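(* Let $F$ be a hyperbolic surface and let $\alpha$ and $\beta$ be two closed oriented curves on $F$ which intersect each other transversally in double points and which intersect each other minimally in their free homotopy classes. Let $P_1$ and $P_2$ be two distinct intersection points between $\alpha$ and $\beta$ such that $\langle\alpha*_{P_1}\beta\rangle=\langle\alpha*_{P_2}\beta\rangle$ (that is, the terms corresponding to $P_1$ and $P_2$ in the Goldman bracket $[\langle\alpha\rangle,\langle\beta\rangle]$ are the same, up to sign coefficients). Then there exist $g,h\in\pi_1(F)$ and a positive integer $N$ such that for all integers $n>N$, the conjugacy classes of $\alpha^n\beta^{g}$ and $\alpha^n\beta^{h}$ in $\pi_1(F)$ are length equivalent.
   Context: A hyperbolic surface is an orientable surface $F$ of finite type with negative Euler characteristic (genus $k$, $b$ boundary components, $m$ punctures, with $2-2k-b-m<0$) endowed with a given hyperbolic metric. Non-trivial free homotopy classes of oriented closed curves in $F$ correspond bijectively to non-trivial conjugacy classes of $\pi_1(F)$, and the two notions are used interchangeably; for an oriented closed curve $\beta$ (or an element of $\pi_1(F)$), $\langle\beta\rangle$ denotes both its free homotopy class and its conjugacy class. When $\alpha,\beta$ are treated as elements of $\pi_1(F)$, one takes elements of $\pi_1(F)$ representing the conjugacy classes $\langle\alpha\rangle,\langle\beta\rangle$. For $x,g\in\pi_1(F)$, $x^g:=gxg^{-1}$. Every non-trivial, non-peripheral free homotopy class contains a unique closed geodesic for a given hyperbolic metric. Length equivalence: two distinct conjugacy classes $\langle x\rangle\neq\langle y\rangle$ in $\pi_1(F)$ are length equivalent if $\langle y\rangle\neq\langle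 x^{-1}\rangle$ and for every hyperbolic metric on $F$ the length of the unique geodesic representative of the free homotopy class $\langle x\rangle$ equals the length of the unique geodesic representative of $\langle y\rangle$. For oriented closed curves $\alpha,\beta$ intersecting transversally in double points, the Goldman bracket is $[\langle\alpha\rangle,\langle\beta\rangle]=\sum_{P\in\alpha\cap\beta}\epsilon_P\langle\alpha*_P\beta\rangle$, where $\alpha\cap\beta$ is the set of intersection points, $\epsilon_P\in\{\pm1\}$ is the sign of the intersection between $\alpha$ and $\beta$ at $P$, and $\alpha*_P\beta$ is the loop product of $\alpha$ and $\beta$ based at $P$. "Intersect minimally" means that the number of intersection points is the minimum over all pairs of transversally intersecting curves freely homotopic to $\alpha$ and $\beta$ respectively. *)

theory Defs
  imports
    "HOL-Complex_Analysis.Complex_Analysis"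
    "HOL-Algebra.Group"
begin

section \<open>Surfaces of finite type\<close>

text \<open>
  A surface is a subset \<open>F\<close> of an arbitrary topological space, with the subspace topology.
  Charts take values in the closed half plane \<open>Re z \<ge> 0\<close>, so that boundary is allowed.
\<close>

definition surface_chart :: "'a::topological_space set \<Rightarrow> 'a set \<Rightarrow> ('a \<Rightarrow> complex) \<Rightarrow> bool" where
  "surface_chart F U \<phi> \<longleftrightarrow>
     openin (top_of_set F) U \<and>
     openin (top_of_set {z. 0 \<le> Re z}) (\<phi> ` U) \<and>
     (\<exists>\<psi>. homeomorphism U (\<phi> ` U) \<phi> \<psi>)"

definition interior_chart :: "'a::topological_space set \<Rightarrow> 'a set \<Rightarrow> ('a \<Rightarrow> complex) \<Rightarrow> bool" where
  "interior_chart F U \<phi> \<longleftrightarrow>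
     openin (top_of_set F) U \<and> open (\<phi> ` U) \<and> (\<exists>\<psi>. homeomorphism U (\<phi> ` U) \<phi> \<psi>)"

definition surface_interior :: "'a::topological_space set \<Rightarrow> 'a set" where
  "surface_interior F = \<Union>{U. \<exists>\<phi>. interior_chart F U \<phi>}"

definition surface_boundary :: "'a::topological_space set \<Rightarrow> 'a set" where
  "surface_boundary F = F - surface_interior F"

definition surface :: "'a::topological_space set \<Rightarrow> bool" where
  "surface F \<longleftrightarrow>
     F \<noteq> {} \<and> connected F \<and>
     Hausdorff_space (top_of_set F) \<and> second_countable (top_of_set F) \<and>
     (\<forall>x\<in>F. \<exists>U \<phi>. x \<in> U \<and> surface_chart F U \<phi>)"

text \<open>
  A transition map preserves orientation if the image of every small positively oriented circle
  winds once, positively, around the image of its centre.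
\<close>

definition orientation_compatible ::
    "'a::topological_space set \<Rightarrow> ('a \<Rightarrow> complex) \<Rightarrow> 'a set \<Rightarrow> ('a \<Rightarrow> complex) \<Rightarrow> bool" where
  "orientation_compatible U \<phi> V \<psi> \<longleftrightarrow>
     (\<forall>z r. 0 < r \<and> cball z r \<subseteq> \<phi> ` (U \<inter> V) \<longrightarrow>
        winding_number ((\<psi> \<circ> inv_into U \<phi>) \<circ> circlepath z r) (\<psi> (inv_into U \<phi> z)) = 1)"

definition orientable :: "'a::topological_space set \<Rightarrow> bool" where
  "orientable F \<longleftrightarrow>
     (\<exists>\<A>. (\<forall>(U, \<phi>)\<in>\<A>. interior_chart F U \<phi>) \<and>
          (\<Union>(U, \<phi>)\<in>\<A>. U) = surface_interior F \<and>
          (\<forall>(U, \<phi>)\<in>\<A>. \<forall>(V, \<psi>)\<in>\<A>. orientation_compatible U \<phi> V \<psi>))"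

text \<open>
  The genus of an orientable surface is the largest number of pairwise disjoint simple closed
  curves in its interior that together do not separate it.
\<close>

definition nonseparating_curves :: "'a::topological_space set \<Rightarrow> nat \<Rightarrow> bool" where
  "nonseparating_curves F n \<longleftrightarrow>
     (\<exists>c :: nat \<Rightarrow> real \<Rightarrow> 'a.
        (\<forall>i<n. simple_path (c i) \<and> pathfinish (c i) = pathstart (c i) \<and>
               path_image (c i) \<subseteq> surface_interior F) \<and>
        (\<forall>i<n. \<forall>j<n. i \<noteq> j \<longrightarrow> path_image (c i) \<inter> path_image (c j) = {}) \<and>
        connected (F - (\<Union>i<n. path_image (c i))))"

definition has_genus :: "'a::topological_space set \<Rightarrow> nat \<Rightarrow> bool" where
  "has_genus F k \<longleftrightarrow> nonseparating_curves F k \<and> (\<forall>n. nonseparating_curves F n \<longrightarrow> n \<le> k)"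

definition has_boundary_components :: "'a::topological_space set \<Rightarrow> nat \<Rightarrow> bool" where
  "has_boundary_components F b \<longleftrightarrow>
     finite (components (surface_boundary F)) \<and> card (components (surface_boundary F)) = b"

text \<open>
  \<open>F\<close> is a compact surface with \<open>m\<close> interior points removed: outside a compact set it consists of
  \<open>m\<close> disjoint punctured discs, closed in \<open>F\<close> because the missing centre is not in \<open>F\<close>.
\<close>

definition has_punctures :: "'a::topological_space set \<Rightarrow> nat \<Rightarrow> bool" where
  "has_punctures F m \<longleftrightarrow>
     (\<exists>\<phi> :: nat \<Rightarrow> complex \<Rightarrow> 'a.
        (\<forall>i<m. closedin (top_of_set F) (\<phi> i ` (cball 0 1 - {0})) \<and>
               openin (top_of_set F) (\<phi> i ` (ball 0 1 - {0})) \<and>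
               (\<exists>\<psi>. homeomorphism (cball 0 1 - {0}) (\<phi> i ` (cball 0 1 - {0})) (\<phi> i) \<psi>)) \<and>
        (\<forall>i<m. \<forall>j<m. i \<noteq> j \<longrightarrow>
               \<phi> i ` (cball 0 1 - {0}) \<inter> \<phi> j ` (cball 0 1 - {0}) = {}) \<and>
        compact (F - (\<Union>i<m. \<phi> i ` (ball 0 1 - {0}))))"

definition finite_type_surface ::
    "'a::topological_space set \<Rightarrow> nat \<Rightarrow> nat \<Rightarrow> nat \<Rightarrow> bool" where
  "finite_type_surface F k b m \<longleftrightarrow>
     surface F \<and> orientable F \<and>
     has_genus F k \<and> has_boundary_components F b \<and> has_punctures F m"


section \<open>Hyperbolic metrics\<close>

text \<open>The distance of the upper half plane model.\<close>

definition hyp_dist :: "complex \<Rightarrow> complex \<Rightarrow> real" where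
  "hyp_dist z w = arcosh (1 + (cmod (z - w))\<^sup>2 / (2 * Im z * Im w))"

definition hyp_area :: "complex set \<Rightarrow> ennreal" where
  "hyp_area S = (\<integral>\<^sup>+z\<in>S. ennreal (1 / (Im z)\<^sup>2) \<partial>lborel)"

text \<open>
  Isometric charts take values in the half of the upper half plane bounded by the geodesic
  \<open>Re z = 0\<close>, which makes the boundary of the surface geodesic.
\<close>

definition hyp_chart ::
    "'a::topological_space set \<Rightarrow> ('a \<Rightarrow> 'a \<Rightarrow> real) \<Rightarrow> 'a set \<Rightarrow> ('a \<Rightarrow> complex) \<Rightarrow> bool" where
  "hyp_chart F d U f \<longleftrightarrow>
     openin (top_of_set F) U \<and>
     openin (top_of_set {z. 0 < Im z \<and> 0 \<le> Re z}) (f ` U) \<and>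
     (\<forall>u\<in>U. \<forall>v\<in>U. d u v = hyp_dist (f u) (f v))"

text \<open>Curves are parametrised on \<open>{0..1}\<close>; lengths may be infinite.\<close>

definition curve_length :: "('a \<Rightarrow> 'a \<Rightarrow> real) \<Rightarrow> (real \<Rightarrow> 'a) \<Rightarrow> ereal" where
  "curve_length d \<gamma> =
     (SUP (n, t) \<in> {(n :: nat, t :: nat \<Rightarrow> real). t 0 = 0 \<and> t n = 1 \<and> (\<forall>i<n. t i \<le> t (Suc i))}.
        ereal (\<Sum>i<n. d (\<gamma> (t i)) (\<gamma> (t (Suc i)))))"

definition length_metric :: "'a::topological_space set \<Rightarrow> ('a \<Rightarrow> 'a \<Rightarrow> real) \<Rightarrow> bool" where
  "length_metric F d \<longleftrightarrow>
     (\<forall>x\<in>F. \<forall>y\<in>F. ereal (d x y) =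
        (INF \<gamma> \<in> {\<gamma>. path \<gamma> \<and> path_image \<gamma> \<subseteq> F \<and> pathstart \<gamma> = x \<and> pathfinish \<gamma> = y}.
           curve_length d \<gamma>))"

text \<open>The area of \<open>F\<close>, exhausted by finite disjoint families of isometric charts.\<close>

definition surface_area :: "'a::topological_space set \<Rightarrow> ('a \<Rightarrow> 'a \<Rightarrow> real) \<Rightarrow> ennreal" where
  "surface_area F d =
     (SUP \<C> \<in> {\<C>. finite \<C> \<and> (\<forall>(U, f)\<in>\<C>. hyp_chart F d U f) \<and>
                  pairwise (\<lambda>(U, f) (V, g). U \<inter> V = {}) \<C>}.
        \<Sum>(U, f)\<in>\<C>. hyp_area (f ` U))"

text \<open>
  A hyperbolic metric is given by its distance function: complete, of finite area (so that the
  punctures are cusps), with geodesic boundary.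
\<close>

definition hyperbolic_metric :: "'a::topological_space set \<Rightarrow> ('a \<Rightarrow> 'a \<Rightarrow> real) \<Rightarrow> bool" where
  "hyperbolic_metric F d \<longleftrightarrow>
     Metric_space F d \<and>
     Metric_space.mtopology F d = top_of_set F \<and>
     Metric_space.mcomplete F d \<and>
     length_metric F d \<and>
     (\<forall>x\<in>F. \<exists>U f. x \<in> U \<and> hyp_chart F d U f) \<and>
     surface_area F d < \<infinity>"

definition hyperbolic_surface :: "'a::topological_space set \<Rightarrow> ('a \<Rightarrow> 'a \<Rightarrow> real) \<Rightarrow> bool" where
  "hyperbolic_surface F d \<longleftrightarrow>
     (\<exists>k b m. finite_type_surface F k b m \<and> 2 - 2 * int k - int b - int m < 0) \<and>
     hyperbolic_metric F d"


section \<open>Closed curves and their intersections\<close>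

definition closed_curve :: "'a::topological_space set \<Rightarrow> (real \<Rightarrow> 'a) \<Rightarrow> bool" where
  "closed_curve F \<gamma> \<longleftrightarrow> path \<gamma> \<and> path_image \<gamma> \<subseteq> F \<and> pathfinish \<gamma> = pathstart \<gamma>"

definition free_homotopy_class ::
    "'a::topological_space set \<Rightarrow> (real \<Rightarrow> 'a) \<Rightarrow> (real \<Rightarrow> 'a) set" where
  "free_homotopy_class F \<gamma> = {\<delta>. homotopic_loops F \<gamma> \<delta>}"

text \<open>
  At a transversal intersection point some chart of \<open>F\<close> carries the two curves to the coordinate
  axes, each with its direction. The point is a double point if each curve visits it only once.
  \<open>\<gamma> \<circ> frac\<close> is the periodic extension of a loop \<open>\<gamma>\<close>.
\<close>

definition transversal_at ::
    "'a::topological_space set \<Rightarrow> (real \<Rightarrow> 'a) \<Rightarrow> real \<Rightarrow> (real \<Rightarrow> 'a) \<Rightarrow> real \<Rightarrow> bool" where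
  "transversal_at F \<alpha> s \<beta> t \<longleftrightarrow>
     (\<exists>U \<phi> \<epsilon>. interior_chart F U \<phi> \<and> 0 < \<epsilon> \<and>
        (\<forall>u. \<bar>u\<bar> < \<epsilon> \<longrightarrow>
           \<alpha> (frac (s + u)) \<in> U \<and> \<phi> (\<alpha> (frac (s + u))) = of_real u \<and>
           \<beta> (frac (t + u)) \<in> U \<and> \<phi> (\<beta> (frac (t + u))) = \<i> * of_real u))"

definition transversal_double_points ::
    "'a::topological_space set \<Rightarrow> (real \<Rightarrow> 'a) \<Rightarrow> (real \<Rightarrow> 'a) \<Rightarrow> bool" where
  "transversal_double_points F \<alpha> \<beta> \<longleftrightarrow>
     (\<forall>s\<in>{0..<1}. \<forall>t\<in>{0..<1}. \<alpha> s = \<beta> t \<longrightarrow>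
        transversal_at F \<alpha> s \<beta> t \<and>
        (\<forall>s'\<in>{0..<1}. \<alpha> s' = \<alpha> s \<longrightarrow> s' = s) \<and>
        (\<forall>t'\<in>{0..<1}. \<beta> t' = \<beta> t \<longrightarrow> t' = t))"

definition intersection_points ::
    "(real \<Rightarrow> 'a::topological_space) \<Rightarrow> (real \<Rightarrow> 'a) \<Rightarrow> 'a set" where
  "intersection_points \<alpha> \<beta> = path_image \<alpha> \<inter> path_image \<beta>"

text \<open>
  For transversal closed curves the intersection is discrete and compact, hence finite, so
  \<^const>\<open>card\<close> is the number of intersection points.
\<close>

definition intersect_minimally ::
    "'a::topological_space set \<Rightarrow> (real \<Rightarrow> 'a) \<Rightarrow> (real \<Rightarrow> 'a) \<Rightarrow> bool" where
  "intersect_minimally F \<alpha> \<beta> \<longleftrightarrow>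
     (\<forall>\<alpha>' \<beta>'. closed_curve F \<alpha>' \<and> closed_curve F \<beta>' \<and> transversal_double_points F \<alpha>' \<beta>' \<and>
        homotopic_loops F \<alpha> \<alpha>' \<and> homotopic_loops F \<beta> \<beta>' \<longrightarrow>
        card (intersection_points \<alpha> \<beta>) \<le> card (intersection_points \<alpha>' \<beta>'))"

definition based_at :: "(real \<Rightarrow> 'a::topological_space) \<Rightarrow> 'a \<Rightarrow> real \<Rightarrow> 'a" where
  "based_at \<gamma> P = shiftpath (THE s. s \<in> {0..<1} \<and> \<gamma> s = P) \<gamma>"

definition loop_product ::
    "(real \<Rightarrow> 'a::topological_space) \<Rightarrow> 'a \<Rightarrow> (real \<Rightarrow> 'a) \<Rightarrow> real \<Rightarrow> 'a" where
  "loop_product \<alpha> P \<beta> = based_at \<alpha> P +++ based_at \<beta> P"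


section \<open>The fundamental group\<close>

definition path_class :: "'a::topological_space set \<Rightarrow> (real \<Rightarrow> 'a) \<Rightarrow> (real \<Rightarrow> 'a) set" where
  "path_class F \<gamma> = {\<delta>. homotopic_paths F \<gamma> \<delta>}"

definition fundamental_group ::
    "'a::topological_space set \<Rightarrow> 'a \<Rightarrow> (real \<Rightarrow> 'a) set monoid" where
  "fundamental_group F p =
     \<lparr>carrier = path_class F ` {\<gamma>. closed_curve F \<gamma> \<and> pathstart \<gamma> = p},
      mult = (\<lambda>X Y. \<Union>\<gamma>\<in>X. \<Union>\<delta>\<in>Y. path_class F (\<gamma> +++ \<delta>)),
      one = path_class F (\<lambda>_. p)\<rparr>"

definition conjugate_by :: "('g, 'b) monoid_scheme \<Rightarrow> 'g \<Rightarrow> 'g \<Rightarrow> 'g" where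
  "conjugate_by G x g = g \<otimes>\<^bsub>G\<^esub> x \<otimes>\<^bsub>G\<^esub> inv\<^bsub>G\<^esub> g"

definition conjugacy_class :: "('g, 'b) monoid_scheme \<Rightarrow> 'g \<Rightarrow> 'g set" where
  "conjugacy_class G x = conjugate_by G x ` carrier G"

text \<open>\<open>x\<close>, an element of the fundamental group, represents the free homotopy class of \<open>\<gamma>\<close>.\<close>

definition represents ::
    "'a::topological_space set \<Rightarrow> (real \<Rightarrow> 'a) set \<Rightarrow> (real \<Rightarrow> 'a) \<Rightarrow> bool" where
  "represents F x \<gamma> \<longleftrightarrow> (\<exists>\<delta>\<in>x. free_homotopy_class F \<delta> = free_homotopy_class F \<gamma>)"


section \<open>Closed geodesics and length equivalence\<close>

text \<open>A closed geodesic has constant speed and is locally distance realizing.\<close>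

definition closed_geodesic ::
    "'a::topological_space set \<Rightarrow> ('a \<Rightarrow> 'a \<Rightarrow> real) \<Rightarrow> (real \<Rightarrow> 'a) \<Rightarrow> bool" where
  "closed_geodesic F d \<gamma> \<longleftrightarrow>
     closed_curve F \<gamma> \<and>
     (\<exists>v>0. \<forall>t. \<exists>\<epsilon>>0. \<forall>s s'. \<bar>s - t\<bar> < \<epsilon> \<and> \<bar>s' - t\<bar> < \<epsilon> \<longrightarrow>
        d (\<gamma> (frac s)) (\<gamma> (frac s')) = v * \<bar>s - s'\<bar>)"

text \<open>
  The classes of \<open>x\<close> and \<open>y\<close> are required to contain closed geodesics (they exist, and are unique
  up to parametrisation, for non-trivial non-peripheral classes), so that length equivalence
  does not hold vacuously for classes without one.
\<close>

definition length_equivalent ::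
    "'a::topological_space set \<Rightarrow> 'a \<Rightarrow> (real \<Rightarrow> 'a) set \<Rightarrow> (real \<Rightarrow> 'a) set \<Rightarrow> bool" where
  "length_equivalent F p x y \<longleftrightarrow>
     conjugacy_class (fundamental_group F p) x \<noteq> conjugacy_class (fundamental_group F p) y \<and>
     conjugacy_class (fundamental_group F p) y \<noteq>
       conjugacy_class (fundamental_group F p) (inv\<^bsub>fundamental_group F p\<^esub> x) \<and>
     (\<forall>d. hyperbolic_metric F d \<longrightarrow>
        (\<exists>\<gamma> \<delta>. closed_geodesic F d \<gamma> \<and> represents F x \<gamma> \<and>
               closed_geodesic F d \<delta> \<and> represents F y \<delta> \<and>
               curve_length d \<gamma> = curve_length d \<delta>))"

end

(*
  The developing map identifies the universal cover of F with a closed convex subset of the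
  hyperbolic plane on which the fundamental group acts by matrices of determinant one. Both curves are
  essential and the first one is not peripheral, as otherwise they could be made disjoint; hence a acts
  by a hyperbolic matrix A. Let b' be a conjugate of b and u = b' a^l b' a^-l b'^-1. Reading u
  backwards gives v = b'^-1 a^-l b' a^l b', and both u and v are conjugates of b. Whatever two matrices
  represent a and b', the words a^n u and a^n v have equal trace, since a cyclic word in two letters of
  SL(2) has the same trace as its reversal. So the two classes have equal length for every metric.
  If b' does not fix an end of the axis of a, then for suitable l and large n a conjugator between
  a^n u and (a^n v)^(+-1) of minimal size would, after multiplication by powers of A, come so close to
  a triangular matrix that discreteness makes it diagonal, which is impossible. Similarly a^n u commutes
  with no element of bounded trace, so it is not peripheral and has a geodesic for every metric.
*)
theory Submission
 imports Defs
begin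

section \<open>The hyperbolic plane\<close>

text \<open>Length equivalence ranges over all hyperbolic metrics, but the bound on \<open>n\<close>
  must not depend on the metric. Equality of traces is an identity in two matrices, so it holds in
  every metric. Non-conjugacy concerns the group alone and is proved in the representation of the
  one metric \<open>d\<close>. The existence of geodesics is the delicate point: an element
  hyperbolic for \<open>d\<close> might be parabolic for another metric. A parabolic class, however,
  can be pushed out of every compact set, hence into one of the finitely many punctured discs, where
  it is a multiple of a fixed loop. This no longer mentions a metric, and read in \<open>d\<close>
  it makes the element commute with a conjugate of one of finitely many matrices; that is where the
  bounded trace comes from. For \<open>l = 0\<close> both words equal \<open>b'\<close>; a larger
  \<open>l\<close> separates them. Isometric charts may reverse orientation, so isometries of
  determinant 1 and -1 both occur. That deck transformations have determinant 1 is extracted from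
  the winding numbers in \<open>orientable\<close>.\<close>

datatype mat2 = Mat (m11: real) (m12: real) (m21: real) (m22: real)

instantiation mat2 :: ring_1
begin
definition "0 = Mat 0 0 0 0"
definition "1 = Mat 1 0 0 1"
definition "A + B = Mat (m11 A + m11 B) (m12 A + m12 B) (m21 A + m21 B) (m22 A + m22 B)"
definition "A - B = Mat (m11 A - m11 B) (m12 A - m12 B) (m21 A - m21 B) (m22 A - m22 B)"
definition "- A = Mat (- m11 A) (- m12 A) (- m21 A) (- m22 A)"
definition "A * B = Mat (m11 A * m11 B + m12 A * m21 B) (m11 A * m12 B + m12 A * m22 B)
            (m21 A * m11 B + m22 A * m21 B) (m21 A * m12 B + m22 A * m22 B)"
instance by standard
  (auto simp: zero_mat2_def one_mat2_def plus_mat2_def minus_mat2_def uminus_mat2_def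
   times_mat2_def algebra_simps mat2.expand)
end

lemma mat2_sel [simp]:
 "m11 0 = 0" "m12 0 = 0" "m21 0 = 0" "m22 0 = 0"
 "m11 1 = 1" "m12 1 = 0" "m21 1 = 0" "m22 1 = 1"
 "m11 (- A) = - m11 A" "m12 (- A) = - m12 A" "m21 (- A) = - m21 A" "m22 (- A) = - m22 A"
 "m11 (A * B) = m11 A * m11 B + m12 A * m21 B" "m12 (A * B) = m11 A * m12 B + m12 A * m22 B"
 "m21 (A * B) = m21 A * m11 B + m22 A * m21 B" "m22 (A * B) = m21 A * m12 B + m22 A * m22 B" by (simp_all add: zero_mat2_def one_mat2_def uminus_mat2_def times_mat2_def)

lemma mat2_eq_iff: "A = B \<longleftrightarrow> m11 A = m11 B \<and> m12 A = m12 B \<and> m21 A = m21 B \<and> m22 A = m22 B" using mat2.expand by blast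

definition det2 :: "mat2 \<Rightarrow> real" where
 "det2 A = m11 A * m22 A - m12 A * m21 A"

definition tr2 :: "mat2 \<Rightarrow> real" where
 "tr2 A = m11 A + m22 A"

definition inv2 :: "mat2 \<Rightarrow> mat2" where
 "inv2 A = Mat (m22 A / det2 A) (- m12 A / det2 A) (- m21 A / det2 A) (m11 A / det2 A)"

lemma det2_mult [simp]: "det2 (A * B) = det2 A * det2 B" by (simp add: det2_def algebra_simps)

lemma det2_one [simp]: "det2 1 = 1" by (simp add: det2_def)

lemma det2_minus [simp]: "det2 (- A) = det2 A" by (simp add: det2_def)

lemma tr2_minus [simp]: "tr2 (- A) = - tr2 A" by (simp add: tr2_def)

lemma tr2_comm: "tr2 (A * B) = tr2 (B * A)" by (simp add: tr2_def algebra_simps)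

lemma inv2_left: "det2 A \<noteq> 0 \<Longrightarrow> inv2 A * A = 1" by (simp add: inv2_def mat2_eq_iff field_simps) (simp add: det2_def)

lemma inv2_right: "det2 A \<noteq> 0 \<Longrightarrow> A * inv2 A = 1" by (simp add: inv2_def mat2_eq_iff field_simps) (simp add: det2_def)

lemma det2_inv2: "det2 A \<noteq> 0 \<Longrightarrow> det2 (inv2 A) = 1 / det2 A" using det2_mult[of "inv2 A" A] by (simp add: inv2_left field_simps)

lemma tr2_conj: "det2 N \<noteq> 0 \<Longrightarrow> tr2 (N * A * inv2 N) = tr2 A" by (metis inv2_left mult.assoc mult_1 tr2_comm)

section \<open>Hyperboloid coordinates on the upper half plane and the action of matrices of
  determinant 1 or -1\<close>

definition upper :: "complex set" where
 "upper = {z. 0 < Im z}"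

text \<open>
 A point \<open>z = x + i y\<close> is encoded by the positive definite symmetric matrix of determinant one
 with entries \<open>hr z, hq z, hq z, hp z\<close>, on which a matrix \<open>M\<close> acts by \<open>P \<mapsto> M P M\<^sup>T\<close>. This is
 the usual Moebius action, preceded by complex conjugation if the determinant is \<open>-1\<close>.
\<close>

definition hp :: "complex \<Rightarrow> real" where "hp z = 1 / Im z"
definition hq :: "complex \<Rightarrow> real" where "hq z = Re z / Im z"
definition hr :: "complex \<Rightarrow> real" where "hr z = ((Re z)\<^sup>2 + (Im z)\<^sup>2) / Im z"

definition hpoint :: "real \<Rightarrow> real \<Rightarrow> complex" where
 "hpoint p q = Complex (q / p) (1 / p)"

text \<open>Points outside \<open>upper\<close> are kept fixed so that, for determinant 1 or -1, the
  map is a bijection of the whole type and \<open>finv\<close> is its true inverse.\<close>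

definition act :: "mat2 \<Rightarrow> complex \<Rightarrow> complex" where
 "act M z = (if z \<in> upper then
   hpoint ((m21 M)\<^sup>2 * hr z + 2 * m21 M * m22 M * hq z + (m22 M)\<^sup>2 * hp z)
    (m11 M * m21 M * hr z + (m11 M * m22 M + m12 M * m21 M) * hq z + m12 M * m22 M * hp z)
  else z)"

text \<open>The hyperbolic cosine of the distance. It is rational in the coordinates, so identities
  are proved for it and transferred to \<open>hyp_dist\<close> by monotonicity of cosh.\<close>

definition hyp_ch :: "complex \<Rightarrow> complex \<Rightarrow> real" where
 "hyp_ch z w = 1 + (cmod (z - w))\<^sup>2 / (2 * Im z * Im w)"

lemma hyp_dist_ch: "hyp_dist z w = arcosh (hyp_ch z w)" by (simp add: hyp_dist_def hyp_ch_def)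

lemma upper_Im [simp]: "z \<in> upper \<longleftrightarrow> 0 < Im z" by (simp add: upper_def)

lemma open_upper: "open upper" unfolding upper_def by (rule open_halfspace_Im_gt)

lemma hp_pos: "0 < Im z \<Longrightarrow> 0 < hp z" by (simp add: hp_def)

lemma h_det: "0 < Im z \<Longrightarrow> hp z * hr z - (hq z)\<^sup>2 = 1" by (simp add: hp_def hq_def hr_def field_simps power2_eq_square)

lemma hp_hpoint [simp]: "p \<noteq> 0 \<Longrightarrow> hp (hpoint p q) = p" by (simp add: hp_def hpoint_def)

lemma hq_hpoint [simp]: "p \<noteq> 0 \<Longrightarrow> hq (hpoint p q) = q" by (simp add: hq_def hpoint_def)

lemma Im_hpoint [simp]: "Im (hpoint p q) = 1 / p" by (simp add: hpoint_def)

lemma h_eqI: "0 < Im z \<Longrightarrow> 0 < Im w \<Longrightarrow> hp z = hp w \<Longrightarrow> hq z = hq w \<Longrightarrow> z = w" by (simp add: hp_def hq_def complex_eq_iff)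

lemma hr_eq: "0 < Im z \<Longrightarrow> hr z = (1 + (hq z)\<^sup>2) / hp z" using h_det[of z] hp_pos[of z] by (simp add: field_simps)

text \<open>The form is \<open>|c z + d|^2 / Im z\<close>, and \<open>c z + d\<close> vanishes only
  for \<open>c = d = 0\<close> because \<open>z\<close> is not real.\<close>

lemma qform_pos:
 assumes "0 < Im z" "c \<noteq> 0 \<or> d \<noteq> 0"
 shows "0 < c\<^sup>2 * hr z + 2 * c * d * hq z + d\<^sup>2 * hp z"
proof -
 have "c\<^sup>2 * hr z + 2 * c * d * hq z + d\<^sup>2 * hp z = ((c * Re z + d)\<^sup>2 + (c * Im z)\<^sup>2) / Im z"
  using assms by (simp add: hp_def hq_def hr_def field_simps power2_eq_square)
 moreover have "0 < (c * Re z + d)\<^sup>2 + (c * Im z)\<^sup>2" using assms by (cases "c = 0") (auto simp: sum_power2_gt_zero_iff)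
 ultimately show ?thesis using assms by simp
qed

lemma det2_row2: "det2 M \<noteq> 0 \<Longrightarrow> m21 M \<noteq> 0 \<or> m22 M \<noteq> 0" by (auto simp: det2_def)

text \<open>By \<open>h_det\<close> the coordinates describe one sheet of the hyperboloid
  \<open>hp * hr - hq^2 = 1\<close>, and cosh of the distance is the polarization of this quadratic
  form. Its linearity in each argument is what makes segments and balls computable later.\<close>

lemma hyp_ch_h:
 assumes "0 < Im z" "0 < Im w"
 shows "hyp_ch z w = (hp z * hr w + hr z * hp w) / 2 - hq z * hq w" using assms unfolding hyp_ch_def cmod_power2 by (simp add: hp_def hq_def hr_def field_simps power2_eq_square)

lemma act_h:
 assumes "0 < Im z" "abs (det2 M) = 1"
 shows "Im (act M z) > 0"
  "hp (act M z) = (m21 M)\<^sup>2 * hr z + 2 * m21 M * m22 M * hq z + (m22 M)\<^sup>2 * hp z"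
  "hq (act M z) = m11 M * m21 M * hr z + (m11 M * m22 M + m12 M * m21 M) * hq z + m12 M * m22 M * hp z"
  "hr (act M z) = (m11 M)\<^sup>2 * hr z + 2 * m11 M * m12 M * hq z + (m12 M)\<^sup>2 * hp z"
proof -
 have p: "0 < (m21 M)\<^sup>2 * hr z + 2 * m21 M * m22 M * hq z + (m22 M)\<^sup>2 * hp z" (is "0 < ?p") using assms det2_row2[of M] by (intro qform_pos) auto
 show "Im (act M z) > 0" using p assms by (simp add: act_def)
 show hp: "hp (act M z) = ?p" using p assms by (simp add: act_def)
 show hq: "hq (act M z) = m11 M * m21 M * hr z + (m11 M * m22 M + m12 M * m21 M) * hq z + m12 M * m22 M * hp z" (is "_ = ?q") using p assms by (simp add: act_def)
 have d: "(det2 M)\<^sup>2 = 1" using assms by (metis abs_1 power2_abs power_one)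
 \<comment> \<open>The determinant of \<open>M P M^T\<close> is \<open>det(M)^2 det(P)\<close>;
   together with \<open>hr_eq\<close> it recovers the third coordinate from the first two.\<close>
 have "?p * ((m11 M)\<^sup>2 * hr z + 2 * m11 M * m12 M * hq z + (m12 M)\<^sup>2 * hp z) - ?q\<^sup>2
   = (det2 M)\<^sup>2 * (hp z * hr z - (hq z)\<^sup>2)" unfolding det2_def by algebra
 also have "\<dots> = 1" using d h_det[OF assms(1)] by simp
 finally have e: "?p * ((m11 M)\<^sup>2 * hr z + 2 * m11 M * m12 M * hq z + (m12 M)\<^sup>2 * hp z) = 1 + ?q\<^sup>2" by simp
 have "hr (act M z) = (1 + ?q\<^sup>2) / ?p" using hr_eq[OF \<open>Im (act M z) > 0\<close>] hp hq by simp
 then show "hr (act M z) = (m11 M)\<^sup>2 * hr z + 2 * m11 M * m12 M * hq z + (m12 M)\<^sup>2 * hp z"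
  unfolding e[symmetric] using p by (metis less_irrefl nonzero_mult_div_cancel_left)
qed

lemma act_outside: "z \<notin> upper \<Longrightarrow> act M z = z" by (simp add: act_def)

lemma hyp_ch_act:
 assumes "0 < Im z" "0 < Im w" "abs (det2 M) = 1"
 shows "hyp_ch (act M z) (act M w) = hyp_ch z w"
proof -
 have d: "(det2 M)\<^sup>2 = 1" using assms by (metis abs_1 power2_abs power_one)
 have "hyp_ch (act M z) (act M w) = (det2 M)\<^sup>2 * hyp_ch z w" unfolding hyp_ch_h[OF act_h(1)[OF assms(1,3)] act_h(1)[OF assms(2,3)]] hyp_ch_h[OF assms(1,2)]
   act_h[OF assms(1,3)] act_h[OF assms(2,3)] det2_def by (simp add: field_simps power2_eq_square)
 then show ?thesis using d by simp
qed

lemma hyp_dist_act: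
 "0 < Im z \<Longrightarrow> 0 < Im w \<Longrightarrow> abs (det2 M) = 1 \<Longrightarrow> hyp_dist (act M z) (act M w) = hyp_dist z w" by (simp add: hyp_dist_ch hyp_ch_act)

lemma act_mult:
 assumes "abs (det2 M) = 1" "abs (det2 N) = 1"
 shows "act (M * N) z = act M (act N z)"
proof (cases "z \<in> upper")
 case True
 then have z: "0 < Im z" by simp
 have MN: "abs (det2 (M * N)) = 1" using assms by (simp add: abs_mult)
 show ?thesis by (rule h_eqI) (use z MN assms in \<open>auto simp: act_h algebra_simps power2_eq_square\<close>)
qed (simp add: act_outside)

lemma act_one [simp]: "act 1 = id"
proof
 fix z show "act 1 z = id z" by (cases "z \<in> upper") (auto simp: act_def hpoint_def hp_def hq_def complex_eq_iff)
qed

lemma act_minus [simp]: "act (- M) = act M" by (auto simp: act_def fun_eq_iff)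

lemma abs_det2_inv2 [simp]: "abs (det2 M) = 1 \<Longrightarrow> abs (det2 (inv2 M)) = 1" by (subst det2_inv2) auto

lemma act_inv2 [simp]:
 assumes "abs (det2 M) = 1"
 shows "act (inv2 M) (act M z) = z" "act M (act (inv2 M) z) = z"
proof -
 have d: "det2 M \<noteq> 0" using assms by auto
 show "act (inv2 M) (act M z) = z" using act_mult[of "inv2 M" M z] assms inv2_left[OF d] by simp
 show "act M (act (inv2 M) z) = z" using act_mult[of M "inv2 M" z] assms inv2_right[OF d] by simp
qed

lemma hyp_ch_ge1: "0 < Im z \<Longrightarrow> 0 < Im w \<Longrightarrow> 1 \<le> hyp_ch z w" by (simp add: hyp_ch_def)

lemma hyp_dist_nonneg [simp]: "0 < Im z \<Longrightarrow> 0 < Im w \<Longrightarrow> 0 \<le> hyp_dist z w" by (simp add: hyp_dist_ch arcosh_nonneg_real hyp_ch_ge1)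

lemma hyp_dist_commute: "hyp_dist z w = hyp_dist w z" by (simp add: hyp_dist_def norm_minus_commute mult.commute mult.left_commute)

lemma cosh_hyp_dist: "0 < Im z \<Longrightarrow> 0 < Im w \<Longrightarrow> cosh (hyp_dist z w) = hyp_ch z w" by (simp add: hyp_dist_ch hyp_ch_ge1)

lemma hyp_dist_eq_iff:
 assumes "0 < Im z" "0 < Im w" "0 < Im z'" "0 < Im w'"
 shows "hyp_dist z w = hyp_dist z' w' \<longleftrightarrow> hyp_ch z w = hyp_ch z' w'" using assms by (metis cosh_hyp_dist hyp_dist_ch)

lemma hyp_dist_le_iff:
 assumes "0 < Im z" "0 < Im w" "0 < Im z'" "0 < Im w'"
 shows "hyp_dist z w \<le> hyp_dist z' w' \<longleftrightarrow> hyp_ch z w \<le> hyp_ch z' w'"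
 using assms cosh_real_nonneg_le_iff[of "hyp_dist z w" "hyp_dist z' w'"] by (simp add: cosh_hyp_dist)

lemma hyp_dist_le_iff':
 assumes "0 < Im z" "0 < Im w" "0 \<le> r"
 shows "hyp_dist z w \<le> r \<longleftrightarrow> hyp_ch z w \<le> cosh r" using assms cosh_real_nonneg_le_iff[of "hyp_dist z w" r] by (simp add: cosh_hyp_dist)

lemma hyp_dist_self [simp]: "hyp_dist z z = 0" by (simp add: hyp_dist_def)

lemma hyp_dist_0_iff: "0 < Im z \<Longrightarrow> 0 < Im w \<Longrightarrow> hyp_dist z w = 0 \<longleftrightarrow> z = w"
 using hyp_dist_eq_iff[of z w z z] by (simp add: hyp_ch_def)

lemma hyp_dist_axis:
 assumes "0 < a" "0 < b"
 shows "hyp_dist (Complex 0 a) (Complex 0 b) = abs (ln (b / a))"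
proof -
 have "hyp_ch (Complex 0 a) (Complex 0 b) = cosh (ln (b / a))" using assms by (simp add: hyp_ch_h hp_def hq_def hr_def cosh_ln_real field_simps power2_eq_square)
 then have "cosh (hyp_dist (Complex 0 a) (Complex 0 b)) = cosh (abs (ln (b / a)))" using assms by (simp add: cosh_hyp_dist)
 then have "abs (hyp_dist (Complex 0 a) (Complex 0 b)) = abs (ln (b / a))" by (simp only: cosh_real_eq_iff)
 then show ?thesis using assms by simp
qed

lemma hyp_dist_ge_ln:
 assumes "0 < Im z" "0 < Im w"
 shows "abs (ln (Im w / Im z)) \<le> hyp_dist z w"
  and "abs (ln (Im w / Im z)) = hyp_dist z w \<longleftrightarrow> Re z = Re w"
proof -
 have e: "hyp_ch z w = hyp_ch (Complex 0 (Im z)) (Complex 0 (Im w)) + (Re z - Re w)\<^sup>2 / (2 * Im z * Im w)"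
  using assms by (simp add: hyp_ch_h hp_def hq_def hr_def field_simps power2_eq_square)
 show "abs (ln (Im w / Im z)) \<le> hyp_dist z w" unfolding hyp_dist_axis[OF assms, symmetric] using assms by (subst hyp_dist_le_iff) (auto simp: e)
 show "abs (ln (Im w / Im z)) = hyp_dist z w \<longleftrightarrow> Re z = Re w" unfolding hyp_dist_axis[OF assms, symmetric] using assms by (subst hyp_dist_eq_iff) (auto simp: e)
qed

lemma i_Complex: "\<i> = Complex 0 1" by (simp add: complex_eq_iff)

section \<open>Normal position of pairs of points and the triangle inequality\<close>

lemma move_to_i:
 assumes "0 < Im z"
 obtains M where "det2 M = 1" "act M z = \<i>"
proof
 let ?s = "sqrt (Im z)"
 let ?M = "Mat (1 / ?s) (- Re z / ?s) 0 ?s"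
 show "det2 ?M = 1" using assms by (simp add: det2_def)
 show "act ?M z = \<i>" using assms by (simp add: act_def hpoint_def hp_def hq_def hr_def complex_eq_iff field_simps)
qed

text \<open>A rotation by \<open>theta\<close> turns the traceless part of the symmetric matrix of
  \<open>w\<close>, encoded in \<open>u\<close>, by twice the angle. Half the argument of
  \<open>u\<close> therefore diagonalizes the matrix, with the larger eigenvalue in the place of
  \<open>hr\<close>.\<close>

lemma rotate_to_axis:
 assumes "0 < Im w"
 obtains M where "det2 M = 1" "act M \<i> = \<i>" "Re (act M w) = 0" "1 \<le> Im (act M w)"
proof -
 define u where "u = Complex ((hr w - hp w) / 2) (hq w)"
 define \<theta> where "\<theta> = Arg u / 2"
 define c s where "c = cos \<theta>" and "s = sin \<theta>"
 define M where "M = Mat c s (- s) c"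
 have cs: "c\<^sup>2 + s\<^sup>2 = 1" by (simp add: c_def s_def)
 have d: "det2 M = 1" using cs by (simp add: det2_def M_def power2_eq_square)
 have c2: "cos (Arg u) = c\<^sup>2 - s\<^sup>2" "sin (Arg u) = 2 * s * c" using cos_double[of \<theta>] sin_double[of \<theta>] by (simp_all add: c_def s_def \<theta>_def)
 have u: "Re u = cmod u * (c\<^sup>2 - s\<^sup>2)" "Im u = cmod u * (2 * s * c)" using rcis_cmod_Arg[of u] c2 by (metis Re_rcis, metis Im_rcis c2(2) rcis_cmod_Arg)
 have i: "act M \<i> = \<i>" using cs by (auto simp: act_def hpoint_def hp_def hq_def hr_def M_def complex_eq_iff add.commute)
 have ad: "abs (det2 M) = 1" using d by simp
 note h = act_h[OF assms ad]
 have q: "hq (act M w) = hq w * (c\<^sup>2 - s\<^sup>2) - (hr w - hp w) / 2 * (2 * s * c)" unfolding h by (simp add: M_def field_simps power2_eq_square)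
 have "hq (act M w) = Im u * (c\<^sup>2 - s\<^sup>2) - Re u * (2 * s * c)" by (simp add: q u_def)
 also have "\<dots> = 0" by (simp add: u)
 finally have q0: "hq (act M w) = 0" .
 have "hr (act M w) - hp (act M w) = 2 * (Re u * (c\<^sup>2 - s\<^sup>2) + Im u * (2 * s * c))" unfolding h by (simp add: M_def u_def field_simps power2_eq_square)
 also have "\<dots> = 2 * cmod u * ((c\<^sup>2 - s\<^sup>2)\<^sup>2 + (2 * s * c)\<^sup>2)" by (simp add: u field_simps power2_eq_square)
 also have "\<dots> \<ge> 0" by simp
 finally have rp: "hr (act M w) \<ge> hp (act M w)" by simp
 have re: "Re (act M w) = 0" using q0 h(1) by (simp add: hq_def)
 have "(Im (act M w))\<^sup>2 \<ge> 1" using rp h(1) re by (simp add: hr_def hp_def field_simps power2_eq_square)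
 then have "1 \<le> Im (act M w)" using h(1) by (smt (verit) one_power2 power2_le_imp_le)
 with that d i re show ?thesis by blast
qed

text \<open>The workhorse of this section: it reduces statements about two points to the imaginary
  axis, where the distance is a difference of logarithms.\<close>

lemma normalise_pair:
 assumes "0 < Im z" "0 < Im w"
 obtains M c where "det2 M = 1" "1 \<le> c" "act M z = \<i>" "act M w = Complex 0 c"
proof -
 obtain M where M: "det2 M = 1" "act M z = \<i>" using move_to_i assms by blast
 have "0 < Im (act M w)" using act_h assms M by simp
 then obtain N where N: "det2 N = 1" "act N \<i> = \<i>" "Re (act N (act M w)) = 0" "1 \<le> Im (act N (act M w))" using rotate_to_axis by blast
 show ?thesis
 proof (rule that)
  show "det2 (N * M) = 1" using M N by simp
  have e: "act (N * M) u = act N (act M u)" for u using M N by (intro act_mult) auto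
  show "1 \<le> Im (act (N * M) w)" "act (N * M) z = \<i>" using M N by (simp_all add: e)
  show "act (N * M) w = Complex 0 (Im (act (N * M) w))" using N by (simp add: e complex_eq_iff)
 qed
qed

text \<open>In normal position the outer points lie on the imaginary axis, and the distances to the
  middle point are at least the logarithmic differences of the heights, which add up.\<close>

lemma hyp_dist_triangle:
 assumes "0 < Im z" "0 < Im u" "0 < Im w"
 shows "hyp_dist z w \<le> hyp_dist z u + hyp_dist u w"
proof -
 obtain M c where M: "det2 M = 1" "1 \<le> c" "act M z = \<i>" "act M w = Complex 0 c" using normalise_pair assms by blast
 let ?u = "act M u"
 have u: "0 < Im ?u" using act_h assms M by simp
 have "hyp_dist z w = ln c" using hyp_dist_act[of z w M] assms M hyp_dist_axis[of 1 c] by (simp add: i_Complex)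
 also have "\<dots> = ln (Im ?u / 1) + ln (c / Im ?u)" using u M by (simp add: ln_div)
 also have "\<dots> \<le> hyp_dist \<i> ?u + hyp_dist ?u (Complex 0 c)" using hyp_dist_ge_ln(1)[of \<i> ?u] hyp_dist_ge_ln(1)[of ?u "Complex 0 c"] u M by auto
 also have "\<dots> = hyp_dist z u + hyp_dist u w" using hyp_dist_act[of z u M] hyp_dist_act[of u w M] assms M by simp
 finally show ?thesis .
qed

lemma two_point_homogeneous:
 assumes "0 < Im z" "0 < Im w" "0 < Im z'" "0 < Im w'" "hyp_dist z w = hyp_dist z' w'"
 obtains M where "det2 M = 1" "act M z = z'" "act M w = w'"
proof -
 obtain M c where M: "det2 M = 1" "1 \<le> c" "act M z = \<i>" "act M w = Complex 0 c" using normalise_pair assms by blast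
 obtain N e where N: "det2 N = 1" "1 \<le> e" "act N z' = \<i>" "act N w' = Complex 0 e" using normalise_pair assms by blast
 have "ln c = hyp_dist z w" using hyp_dist_act[of z w M] assms M hyp_dist_axis[of 1 c] by (simp add: i_Complex)
 moreover have "ln e = hyp_dist z' w'" using hyp_dist_act[of z' w' N] assms N hyp_dist_axis[of 1 e] by (simp add: i_Complex)
 ultimately have "c = e" using assms(5) M N by (metis exp_ln less_le_trans zero_less_one)
 show ?thesis
 proof (rule that)
  show "det2 (inv2 N * M) = 1" using M N by (simp add: det2_inv2)
  have "act (inv2 N * M) u = act (inv2 N) (act M u)" for u using M N by (intro act_mult) auto
  then show "act (inv2 N * M) z = z'" "act (inv2 N * M) w = w'" using M N \<open>c = e\<close> by (metis abs_1 act_inv2(1))+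
 qed
qed


lemma det2_abs: "det2 M = 1 \<Longrightarrow> abs (det2 M) = 1" by simp

lemma act_eq_iff: "abs (det2 M) = 1 \<Longrightarrow> act M z = act M w \<longleftrightarrow> z = w" by (metis act_inv2(1))

lemma Im_act_pos [simp]: "0 < Im z \<Longrightarrow> abs (det2 M) = 1 \<Longrightarrow> 0 < Im (act M z)" by (rule act_h(1))

section \<open>Geodesic segments and chains of points along a geodesic\<close>

lemma axis_between:
 assumes v: "0 < Im v" and c: "1 \<le> c"
 shows "hyp_dist \<i> v + hyp_dist v (Complex 0 c) = hyp_dist \<i> (Complex 0 c) \<longleftrightarrow>
   Re v = 0 \<and> 1 \<le> Im v \<and> Im v \<le> c" (is "?l \<longleftrightarrow> ?r")
proof
 have d: "hyp_dist \<i> (Complex 0 c) = ln c" using hyp_dist_axis[of 1 c] c by (simp add: i_Complex)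
 have l: "abs (ln (Im v)) \<le> hyp_dist \<i> v" "abs (ln (Im v)) = hyp_dist \<i> v \<longleftrightarrow> 0 = Re v"
  "abs (ln (c / Im v)) \<le> hyp_dist v (Complex 0 c)" using hyp_dist_ge_ln[of \<i> v] hyp_dist_ge_ln[of v "Complex 0 c"] v c by auto
 have e: "ln (c / Im v) = ln c - ln (Im v)" using v c by (simp add: ln_div)
 show "?l \<Longrightarrow> ?r"
 proof -
  assume ?l
  with d l e have "abs (ln (Im v)) = hyp_dist \<i> v" "0 \<le> ln (Im v)" "ln (Im v) \<le> ln c" by linarith+
  moreover have "1 \<le> Im v" "Im v \<le> c" using \<open>0 \<le> ln (Im v)\<close> \<open>ln (Im v) \<le> ln c\<close> v c by simp_all
  ultimately show ?r using l(2) by auto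
 qed
 assume r: ?r
 then have "v = Complex 0 (Im v)" by (simp add: complex_eq_iff)
 then have "hyp_dist \<i> v = ln (Im v)" "hyp_dist v (Complex 0 c) = ln (c / Im v)" using hyp_dist_axis[of 1 "Im v"] hyp_dist_axis[of "Im v" c] r v c by (simp_all add: i_Complex)
 then show ?l using d e by simp
qed

text \<open>The geodesic segment from \<open>z\<close> to \<open>w\<close>, with a projective parameter.\<close>

definition cvx_norm :: "complex \<Rightarrow> complex \<Rightarrow> real \<Rightarrow> real" where
 "cvx_norm z w s = sqrt ((1 - s)\<^sup>2 + s\<^sup>2 + 2 * s * (1 - s) * hyp_ch z w)"

definition cvx :: "complex \<Rightarrow> complex \<Rightarrow> real \<Rightarrow> complex" where
 "cvx z w s = hpoint (((1 - s) * hp z + s * hp w) / cvx_norm z w s)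
           (((1 - s) * hq z + s * hq w) / cvx_norm z w s)"

lemma cvx_norm_ge1:
 assumes "0 < Im z" "0 < Im w" "s \<in> {0..1}"
 shows "1 \<le> cvx_norm z w s"
proof -
 have "1 = (1 - s)\<^sup>2 + s\<^sup>2 + 2 * s * (1 - s) * 1" by (simp add: power2_eq_square algebra_simps)
 also have "\<dots> \<le> (1 - s)\<^sup>2 + s\<^sup>2 + 2 * s * (1 - s) * hyp_ch z w" using assms hyp_ch_ge1[of z w] by (intro add_left_mono mult_left_mono) auto
 finally show ?thesis by (simp add: cvx_norm_def)
qed

text \<open>\<open>cvx\<close> interpolates affinely in hyperboloid coordinates and divides by
  \<open>cvx_norm\<close> to return to the hyperboloid. The factor is determined by the polarized
  form, so \<open>hr\<close> obeys the same formula as the two defining coordinates.\<close>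

lemma cvx_h:
 assumes "0 < Im z" "0 < Im w" "s \<in> {0..1}"
 shows "0 < Im (cvx z w s)"
  "hp (cvx z w s) = ((1 - s) * hp z + s * hp w) / cvx_norm z w s"
  "hq (cvx z w s) = ((1 - s) * hq z + s * hq w) / cvx_norm z w s"
  "hr (cvx z w s) = ((1 - s) * hr z + s * hr w) / cvx_norm z w s"
proof -
 let ?n = "cvx_norm z w s"
 have n: "?n > 0" using cvx_norm_ge1[OF assms] by simp
 have p: "0 < (1 - s) * hp z + s * hp w" using assms hp_pos[of z] hp_pos[of w] by (cases "s = 0") (auto intro: add_nonneg_pos)
 show I: "0 < Im (cvx z w s)" using p n by (simp add: cvx_def)
 show hp: "hp (cvx z w s) = ((1 - s) * hp z + s * hp w) / ?n"
  and hq: "hq (cvx z w s) = ((1 - s) * hq z + s * hq w) / ?n" using p n by (simp_all add: cvx_def)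
 have n2: "?n\<^sup>2 = (1 - s)\<^sup>2 + s\<^sup>2 + 2 * s * (1 - s) * hyp_ch z w" using cvx_norm_ge1[OF assms] by (simp add: cvx_norm_def)
 have "((1 - s) * hp z + s * hp w) * ((1 - s) * hr z + s * hr w) - ((1 - s) * hq z + s * hq w)\<^sup>2
   = (1 - s)\<^sup>2 * (hp z * hr z - (hq z)\<^sup>2) + s\<^sup>2 * (hp w * hr w - (hq w)\<^sup>2)
    + 2 * s * (1 - s) * ((hp z * hr w + hr z * hp w) / 2 - hq z * hq w)" by (simp add: field_simps power2_eq_square)
 also have "\<dots> = ?n\<^sup>2" unfolding n2 h_det[OF assms(1)] h_det[OF assms(2)] hyp_ch_h[OF assms(1,2)] by simp
 finally have e: "((1 - s) * hp z + s * hp w) * ((1 - s) * hr z + s * hr w)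
   = ?n\<^sup>2 + ((1 - s) * hq z + s * hq w)\<^sup>2" by simp
 have aux: "(1 + (Q / n)\<^sup>2) / (P / n) = R / n" if "P * R = n\<^sup>2 + Q\<^sup>2" "P > 0" "n > 0" for P Q R n :: real
 proof -
  have "1 + (Q / n)\<^sup>2 = P * R / n\<^sup>2" using that by (simp add: field_simps)
  moreover have "P * R / n\<^sup>2 / (P / n) = R / n" using that(2,3) by (simp add: power2_eq_square)
  ultimately show ?thesis by simp
 qed
 have "hr (cvx z w s) = ((1 - s) * hr z + s * hr w) / ?n" unfolding hr_eq[OF I] hp hq by (rule aux[OF e p n])
 then show "hr (cvx z w s) = ((1 - s) * hr z + s * hr w) / ?n" .
qed

lemma cvx_act:
 assumes "0 < Im z" "0 < Im w" "s \<in> {0..1}" "abs (det2 M) = 1"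
 shows "act M (cvx z w s) = cvx (act M z) (act M w) s"
proof -
 have n: "cvx_norm (act M z) (act M w) s = cvx_norm z w s" using assms by (simp add: cvx_norm_def hyp_ch_act)
 have z: "0 < Im (act M z)" "0 < Im (act M w)" using assms by auto
 have v: "0 < Im (cvx z w s)" using cvx_h assms by blast
 note h = cvx_h[OF z assms(3)] act_h[OF v assms(4)] act_h[OF assms(1,4)] act_h[OF assms(2,4)] cvx_h[OF assms(1-3)] n
 show ?thesis
 proof (rule h_eqI)
  show "0 < Im (act M (cvx z w s))" "0 < Im (cvx (act M z) (act M w) s)" using h by blast+
  show "hp (act M (cvx z w s)) = hp (cvx (act M z) (act M w) s)" unfolding h by (simp add: algebra_simps add_divide_distrib diff_divide_distrib)
  show "hq (act M (cvx z w s)) = hq (cvx (act M z) (act M w) s)" unfolding h by (simp add: algebra_simps add_divide_distrib diff_divide_distrib)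
 qed
qed

lemma hyp_ch_cvx:
 assumes "0 < Im z" "0 < Im w" "s \<in> {0..1}" "0 < Im u"
 shows "hyp_ch u (cvx z w s) = ((1 - s) * hyp_ch u z + s * hyp_ch u w) / cvx_norm z w s"
 unfolding hyp_ch_h[OF assms(4) cvx_h(1)[OF assms(1-3)]] hyp_ch_h[OF assms(4,1)] hyp_ch_h[OF assms(4,2)]
  cvx_h[OF assms(1-3)] by (simp add: add_divide_distrib diff_divide_distrib algebra_simps)

text \<open>Before rescaling, cosh of the distance to \<open>u\<close> is affine along the segment,
  and the rescaling divides by a number that is at least 1.\<close>

lemma cvx_ball:
 assumes "0 < Im z" "0 < Im w" "s \<in> {0..1}" "0 < Im u" "hyp_dist u z \<le> r" "hyp_dist u w \<le> r"
 shows "hyp_dist u (cvx z w s) \<le> r"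
proof -
 have r: "0 \<le> r" using assms hyp_dist_nonneg[of u z] by linarith
 have c: "hyp_ch u z \<le> cosh r" "hyp_ch u w \<le> cosh r" using assms r by (simp_all flip: hyp_dist_le_iff')
 have "(1 - s) * hyp_ch u z + s * hyp_ch u w \<le> cosh r" using c assms(3) by (intro convex_bound_le) auto
 then have "(1 - s) * hyp_ch u z + s * hyp_ch u w \<le> cosh r * cvx_norm z w s"
  using mult_left_mono[OF cvx_norm_ge1[OF assms(1-3)], of "cosh r"] cosh_real_nonneg[of r] by linarith
 then have "hyp_ch u (cvx z w s) \<le> cosh r" using cvx_norm_ge1[OF assms(1-3)] assms by (simp add: hyp_ch_cvx divide_simps)
 then show ?thesis using assms r cvx_h by (simp add: hyp_dist_le_iff')
qed

lemma cvx_halfplane: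
 assumes "0 < Im z" "0 < Im w" "s \<in> {0..1}" "0 \<le> Re z" "0 \<le> Re w"
 shows "0 \<le> Re (cvx z w s)"
proof -
 have "0 \<le> hq (cvx z w s)" unfolding cvx_h[OF assms(1-3)] using assms cvx_norm_ge1[OF assms(1-3)] by (simp add: hq_def)
 then show ?thesis using cvx_h[OF assms(1-3)] by (simp add: hq_def zero_le_divide_iff)
qed

lemma cvx_0 [simp]: "0 < Im z \<Longrightarrow> 0 < Im w \<Longrightarrow> cvx z w 0 = z" using cvx_h[of z w 0] by (intro h_eqI) (auto simp: cvx_norm_def)

lemma cvx_1 [simp]: "0 < Im z \<Longrightarrow> 0 < Im w \<Longrightarrow> cvx z w 1 = w" using cvx_h[of z w 1] by (intro h_eqI) (auto simp: cvx_norm_def)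

lemma cvx_axis_ex:
 assumes "1 \<le> c"
 shows "s \<in> {0..1} \<Longrightarrow> Re (cvx \<i> (Complex 0 c) s) = 0 \<and> 1 \<le> Im (cvx \<i> (Complex 0 c) s) \<and> Im (cvx \<i> (Complex 0 c) s) \<le> c"
  and "1 \<le> y \<Longrightarrow> y \<le> c \<Longrightarrow> \<exists>s\<in>{0..1}. cvx \<i> (Complex 0 c) s = Complex 0 y"
proof -
 have main: "Re (cvx \<i> (Complex 0 c) s) = 0 \<and> ((1 - s) + s / c > 0 \<and> (Im (cvx \<i> (Complex 0 c) s))\<^sup>2 = ((1 - s) + s * c) / ((1 - s) + s / c))" if s: "s \<in> {0..1}" for s
 proof -
  let ?v = "cvx \<i> (Complex 0 c) s" let ?n = "cvx_norm \<i> (Complex 0 c) s"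
  have n: "?n \<ge> 1" using cvx_norm_ge1[of \<i> "Complex 0 c" s] s assms by simp
  have I: "0 < Im \<i>" "0 < Im (Complex 0 c)" using assms by auto
  note h = cvx_h[OF I s]
  have "hq ?v = 0" unfolding h by (simp add: hq_def)
  then have r: "Re ?v = 0" using h(1) by (simp add: hq_def)
  have "hp ?v = ((1 - s) + s / c) / ?n" "hr ?v = ((1 - s) + s * c) / ?n" unfolding h using assms by (simp_all add: hp_def hr_def power2_eq_square)
  moreover have "hr ?v / hp ?v = (Im ?v)\<^sup>2" using r h(1) by (simp add: hr_def hp_def power2_eq_square)
  moreover have "(1 - s) + s / c > 0" using s assms by (cases "s = 0") (auto intro: add_nonneg_pos)
  ultimately show ?thesis using r n by simp
 qed
 { assume s: "s \<in> {0..1}"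
  let ?y = "Im (cvx \<i> (Complex 0 c) s)"
  have y: "0 < ?y" using cvx_h[of \<i> "Complex 0 c" s] s assms by simp
  have p: "(1 - s) + s / c > 0" using main[OF s] by simp
  have "1 / c \<le> c" using assms by (smt (verit) divide_le_eq_1)
  then have "s * (1 / c) \<le> s * c" using s by (intro mult_left_mono) auto
  then have "(1 - s) + s / c \<le> (1 - s) + s * c" by simp
  then have "1 \<le> ?y\<^sup>2" using main[OF s] p by (metis pos_le_divide_eq mult_1)
  moreover have "(1 - s) + s * c \<le> c\<^sup>2 * ((1 - s) + s / c)"
  proof -
   have "1 * (1 - s) \<le> c\<^sup>2 * (1 - s)" using s assms by (intro mult_right_mono) auto
   then show ?thesis using assms by (simp add: algebra_simps power2_eq_square)
  qed
  then have "?y\<^sup>2 \<le> c\<^sup>2" using main[OF s] p by (metis pos_divide_le_eq)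
  ultimately have "1 \<le> ?y" "?y \<le> c" using power2_le_imp_le[of 1 ?y] power2_le_imp_le[of ?y c] y assms by auto
  then show "Re (cvx \<i> (Complex 0 c) s) = 0 \<and> 1 \<le> ?y \<and> ?y \<le> c" using main[OF s] by blast
 }
 { assume y: "1 \<le> y" "y \<le> c"
  show "\<exists>s\<in>{0..1}. cvx \<i> (Complex 0 c) s = Complex 0 y"
  proof (cases "c = 1")
   case True
   then have "cvx \<i> (Complex 0 c) 0 = Complex 0 y" using y by (simp add: i_Complex)
   then show ?thesis by (intro bexI[of _ 0]) auto
  next
   case False
   then have c: "c > 1" using assms by simp
   \<comment> \<open>The condition \<open>(1 - s) + s * c = y^2 * ((1 - s) + s / c)\<close> on the
     parameter is linear in \<open>s\<close>; its solution is \<open>?u / (?u + ?w)\<close>.\<close>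
   let ?u = "y\<^sup>2 - 1" let ?w = "c - y\<^sup>2 / c"
   have u: "?u \<ge> 0" using y by simp
   have w: "?w \<ge> 0" using y c by (simp add: field_simps power2_eq_square mult_mono)
   have uw: "?u + ?w > 0"
   proof (cases "y = 1")
    case True
    have "1 / c < 1" using c by simp
    then have "1 / c < c" using c by linarith
    then show ?thesis using True by simp
   next
    case False
    then have "y\<^sup>2 > 1" using y by simp
    then show ?thesis using w by simp
   qed
   define U W where "U = ?u" and "W = ?w"
   define D where "D = U + W"
   define s where "s = U / D"
   have UW: "U \<ge> 0" "W \<ge> 0" "D > 0" using u w uw by (auto simp: U_def W_def D_def)
   have s: "s \<in> {0..1}" using UW by (simp add: s_def D_def)
   have s1: "1 - s = W / D" using UW(3) unfolding s_def D_def by (simp add: field_simps)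
   have e: "W + U * c = y\<^sup>2 * (W + U / c)" using c by (simp add: U_def W_def field_simps)
   have "(1 - s) + s * c = (W + U * c) / D" unfolding s1 unfolding s_def by (simp add: add_divide_distrib)
   moreover have "(1 - s) + s / c = (W + U / c) / D" unfolding s1 unfolding s_def by (simp add: add_divide_distrib)
   ultimately have "(1 - s) + s * c = y\<^sup>2 * ((1 - s) + s / c)" unfolding e by simp
   then have "(Im (cvx \<i> (Complex 0 c) s))\<^sup>2 = y\<^sup>2" using main[OF s] by (metis less_irrefl nonzero_mult_div_cancel_right)
   moreover have "0 < Im (cvx \<i> (Complex 0 c) s)" using cvx_h[of \<i> "Complex 0 c" s] s assms by simp
   ultimately have "Im (cvx \<i> (Complex 0 c) s) = y" using y by (simp add: power2_eq_iff)
   then have "cvx \<i> (Complex 0 c) s = Complex 0 y" using main[OF s] by (simp add: complex_eq_iff)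
   then show ?thesis using s by blast
  qed
 }
qed

text \<open>Connects the metric notion of betweenness, which is all that an abstract length space
  provides, with the algebraic segment.\<close>

lemma between_iff_cvx:
 assumes "0 < Im z" "0 < Im w" "0 < Im v"
 shows "hyp_dist z v + hyp_dist v w = hyp_dist z w \<longleftrightarrow> (\<exists>s\<in>{0..1}. v = cvx z w s)"
proof -
 obtain M c where M: "det2 M = 1" "1 \<le> c" "act M z = \<i>" "act M w = Complex 0 c" using normalise_pair assms by blast
 have ad: "abs (det2 M) = 1" using M by simp
 have v: "0 < Im (act M v)" using assms ad by simp
 have "hyp_dist z v + hyp_dist v w = hyp_dist z w \<longleftrightarrow>
   hyp_dist \<i> (act M v) + hyp_dist (act M v) (Complex 0 c) = hyp_dist \<i> (Complex 0 c)" using hyp_dist_act[OF _ _ ad] assms M by metis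
 also have "\<dots> \<longleftrightarrow> Re (act M v) = 0 \<and> 1 \<le> Im (act M v) \<and> Im (act M v) \<le> c" by (rule axis_between[OF v M(2)])
 also have "\<dots> \<longleftrightarrow> (\<exists>s\<in>{0..1}. act M v = cvx \<i> (Complex 0 c) s)" using cvx_axis_ex[OF M(2)] by (metis complex_surj)
 also have "\<dots> \<longleftrightarrow> (\<exists>s\<in>{0..1}. act M v = act M (cvx z w s))" using cvx_act[OF assms(1,2) _ ad] M by simp
 also have "\<dots> \<longleftrightarrow> (\<exists>s\<in>{0..1}. v = cvx z w s)" by (simp add: act_eq_iff[OF ad])
 finally show ?thesis .
qed

lemma between_unique:
 assumes "0 < Im z" "0 < Im w" "0 < Im v" "0 < Im v'"
  and "hyp_dist z v + hyp_dist v w = hyp_dist z w" "hyp_dist z v' + hyp_dist v' w = hyp_dist z w"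
  and "hyp_dist z v = hyp_dist z v'"
 shows "v = v'"
proof -
 obtain M c where M: "det2 M = 1" "1 \<le> c" "act M z = \<i>" "act M w = Complex 0 c" using normalise_pair assms by blast
 have ad: "abs (det2 M) = 1" using M by simp
 have *: "Re (act M u) = 0 \<and> 1 \<le> Im (act M u) \<and> Im (act M u) \<le> c" "hyp_dist z u = ln (Im (act M u))"
  if "0 < Im u" "hyp_dist z u + hyp_dist u w = hyp_dist z w" for u
 proof -
  show 1: "Re (act M u) = 0 \<and> 1 \<le> Im (act M u) \<and> Im (act M u) \<le> c"
   using axis_between[of "act M u" c] hyp_dist_act[OF _ _ ad] assms M that ad by (metis Im_act_pos)
  then have e: "act M u = Complex 0 (Im (act M u))" by (simp add: complex_eq_iff)
  have "hyp_dist z u = hyp_dist \<i> (act M u)" using hyp_dist_act[of z u M] that assms M by simp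
  also have "\<dots> = ln (Im (act M u))" using 1 by (subst e) (simp add: hyp_dist_axis i_Complex)
  finally show "hyp_dist z u = ln (Im (act M u))" .
 qed
 have "Im (act M v) = Im (act M v')" using *[OF assms(3,5)] *[OF assms(4,6)] assms(7) by (metis exp_ln less_le_trans zero_less_one)
 then have "act M v = act M v'" using *(1)[OF assms(3,5)] *(1)[OF assms(4,6)] by (simp add: complex_eq_iff)
 then show ?thesis by (simp add: act_eq_iff[OF ad])
qed

lemma between_exists:
 assumes "0 < Im z" "0 < Im w" "0 \<le> t" "t \<le> hyp_dist z w"
 obtains s where "s \<in> {0..1}" "hyp_dist z (cvx z w s) = t" "hyp_dist (cvx z w s) w = hyp_dist z w - t"
proof -
 obtain M c where M: "det2 M = 1" "1 \<le> c" "act M z = \<i>" "act M w = Complex 0 c" using normalise_pair assms by blast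
 have ad: "abs (det2 M) = 1" using M by simp
 have l: "hyp_dist z w = ln c" using hyp_dist_act[of z w M] assms M hyp_dist_axis[of 1 c] by (simp add: i_Complex)
 then have "exp t \<le> c" using assms M by (metis exp_le_cancel_iff exp_ln less_le_trans zero_less_one)
 then obtain s where s: "s \<in> {0..1}" "cvx \<i> (Complex 0 c) s = Complex 0 (exp t)" using cvx_axis_ex(2)[OF M(2), of "exp t"] assms by auto
 have e: "act M (cvx z w s) = Complex 0 (exp t)" using cvx_act[OF assms(1,2) s(1) ad] M s by simp
 have v: "0 < Im (cvx z w s)" using cvx_h assms s by blast
 have t: "hyp_dist z (cvx z w s) = t" using hyp_dist_act[OF assms(1) v ad] e M assms hyp_dist_axis[of 1 "exp t"] by (simp add: i_Complex)
 have "hyp_dist z (cvx z w s) + hyp_dist (cvx z w s) w = hyp_dist z w" using between_iff_cvx[OF assms(1,2) v] s by blast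
 then show ?thesis using that[OF s(1) t] t by simp
qed

text \<open>The two circles, around \<open>a i\<close> and around \<open>a e i\<close>, touch in a
  single point: the difference of their equations gives the height, and then the real part must
  vanish.\<close>

lemma geodesic_extend:
 assumes "0 < a" "1 < e" "0 < Im w" "hyp_ch (Complex 0 a) w = (e\<^sup>2 + 1 / e\<^sup>2) / 2"
  "hyp_ch (Complex 0 (a * e)) w = (e + 1 / e) / 2"
 shows "w = Complex 0 (a * e\<^sup>2)"
proof -
 let ?n = "(Re w)\<^sup>2 + (Im w)\<^sup>2"
 have 1: "a\<^sup>2 + ?n = a * Im w * (e\<^sup>2 + 1 / e\<^sup>2)" using assms by (simp add: hyp_ch_h hp_def hq_def hr_def field_simps power2_eq_square)
 have ae: "(a * e)\<^sup>2 + ?n = (a * e) * Im w * (2 * hyp_ch (Complex 0 (a * e)) w)" using assms by (simp add: hyp_ch_h hp_def hq_def hr_def field_simps power2_eq_square)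
 have 2: "(a * e)\<^sup>2 + ?n = a * Im w * (e\<^sup>2 + 1)" unfolding ae assms(5) using assms(2) by (simp add: field_simps power2_eq_square)
 have "a\<^sup>2 * (e\<^sup>2 - 1) = a * Im w * (1 - 1 / e\<^sup>2)" using 1 2 by (simp add: algebra_simps)
 also have "\<dots> = a * Im w * ((e\<^sup>2 - 1) / e\<^sup>2)" using assms by (simp add: field_simps)
 finally have "a * (a * (e\<^sup>2 - 1)) = a * (Im w / e\<^sup>2 * (e\<^sup>2 - 1))" by (simp add: power2_eq_square)
 moreover have "e\<^sup>2 - 1 \<noteq> 0" using assms by (simp add: power2_eq_1_iff)
 ultimately have "a = Im w / e\<^sup>2" using assms(1) by (metis less_irrefl mult_left_cancel mult_right_cancel)
 then have y: "Im w = a * e\<^sup>2" using assms by (simp add: field_simps)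
 then have "(Re w)\<^sup>2 = 0" using 2 by (simp add: algebra_simps power2_eq_square)
 then show ?thesis using y by (simp add: complex_eq_iff)
qed

text \<open>Passage from local to global: if every three consecutive points are aligned, the whole
  chain lies on one geodesic, since two points already determine the next one.\<close>

lemma geodesic_chain:
 assumes "\<And>i. i \<le> n \<Longrightarrow> 0 < Im (y i)" "0 < s"
  and "\<And>i. i < n \<Longrightarrow> hyp_dist (y i) (y (Suc i)) = s"
  and "\<And>i. Suc i < n \<Longrightarrow> hyp_dist (y i) (y (Suc (Suc i))) = 2 * s"
 shows "hyp_dist (y 0) (y n) = n * s"
proof (cases "n = 0")
 case False
 then have y01: "0 < Im (y 0)" "0 < Im (y 1)" using assms by auto
 obtain M c where M: "det2 M = 1" "1 \<le> c" "act M (y 0) = \<i>" "act M (y 1) = Complex 0 c" using normalise_pair[OF y01] by blast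
 have ad: "abs (det2 M) = 1" using M by simp
 have "s = ln c" using hyp_dist_act[OF y01 ad] M hyp_dist_axis[of 1 c] assms(3)[of 0] False by (simp add: i_Complex)
 then have c: "c = exp s" using M by simp
 define e where "e = exp s"
 have e: "1 < e" using assms by (simp add: e_def)
 have pw: "e ^ k = exp (k * s)" for k by (simp add: e_def exp_of_nat_mult)
 have ch: "cosh s = (e + 1 / e) / 2" "cosh (2 * s) = (e\<^sup>2 + 1 / e\<^sup>2) / 2" by (simp_all add: cosh_def e_def exp_minus field_simps power2_eq_square flip: exp_add)
 have "Suc k \<le> n \<Longrightarrow> act M (y k) = Complex 0 (e ^ k) \<and> act M (y (Suc k)) = Complex 0 (e ^ Suc k)" for k
 proof (induction k)
  case 0 then show ?case using M c by (simp add: i_Complex e_def)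
 next
  case (Suc k)
  let ?w = "act M (y (Suc (Suc k)))"
  have w: "0 < Im ?w" using assms(1)[of "Suc (Suc k)"] Suc ad by simp
  have yk: "0 < Im (y k)" "0 < Im (y (Suc k))" "0 < Im (y (Suc (Suc k)))" using assms(1) Suc.prems by simp_all
  have "hyp_dist (act M (y k)) ?w = 2 * s" "hyp_dist (act M (y (Suc k))) ?w = s" using hyp_dist_act[OF yk(1,3) ad] hyp_dist_act[OF yk(2,3) ad] assms(3,4) Suc.prems by simp_all
  then have "hyp_ch (act M (y k)) ?w = (e\<^sup>2 + 1 / e\<^sup>2) / 2" "hyp_ch (act M (y (Suc k))) ?w = (e + 1 / e) / 2" using yk ad ch by (metis Im_act_pos cosh_hyp_dist)+
  then have "?w = Complex 0 (e ^ k * e\<^sup>2)" using Suc e w by (intro geodesic_extend) (auto simp: mult.commute)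
  then show ?case using Suc by (simp add: power2_eq_square mult_ac)
 qed
 from this[of "n - 1"] have "act M (y n) = Complex 0 (e ^ n)" using False by simp
 moreover have yn: "0 < Im (y n)" using assms by simp
 ultimately have "hyp_dist (y 0) (y n) = abs (ln (e ^ n))" using hyp_dist_act[OF y01(1) _ ad, of "y n"] M hyp_dist_axis[of 1 "e ^ n"] e
   hyp_dist_nonneg[OF y01(1) yn] by (simp add: i_Complex)
 also have "\<dots> = n * s" using assms by (simp add: pw)
 finally show ?thesis .
qed simp

section \<open>The group of isometries and its rigidity\<close>

abbreviation finv :: "('a \<Rightarrow> 'b) \<Rightarrow> 'b \<Rightarrow> 'a" where
 "finv \<equiv> inv_into UNIV"

definition isoms :: "(complex \<Rightarrow> complex) set" where
 "isoms = act ` {M. abs (det2 M) = 1}"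

lemma act_isoms [intro]: "abs (det2 M) = 1 \<Longrightarrow> act M \<in> isoms" by (simp add: isoms_def)

lemma id_isoms [simp]: "id \<in> isoms" using act_isoms[of 1] by simp

lemma isoms_comp:
 assumes "S \<in> isoms" "T \<in> isoms"
 shows "S o T \<in> isoms"
proof -
 obtain M N where "S = act M" "T = act N" and d: "abs (det2 M) = 1" "abs (det2 N) = 1" using assms by (auto simp: isoms_def)
 then have "S o T = act (M * N)" by (auto simp: act_mult)
 then show ?thesis using d by (auto simp: abs_mult)
qed

lemma act_inv: "abs (det2 M) = 1 \<Longrightarrow> finv (act M) = act (inv2 M)" by (intro Hilbert_Choice.inv_equality) auto

lemma isoms_inv:
 assumes "T \<in> isoms"
 shows "finv T \<in> isoms" "T (finv T z) = z" "finv T (T z) = z" "finv T o T = id" "T o finv T = id"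
proof -
 obtain M where T: "T = act M" and d: "abs (det2 M) = 1" using assms by (auto simp: isoms_def)
 show 0: "finv T \<in> isoms" unfolding T act_inv[OF d] using d by auto
 show 1: "T (finv T z) = z" "finv T (T z) = z" for z unfolding T act_inv[OF d] using d by auto
 show "finv T o T = id" "T o finv T = id" using 1 by auto
qed

lemma isoms_upper [simp]: "T \<in> isoms \<Longrightarrow> 0 < Im z \<Longrightarrow> 0 < Im (T z)" by (auto simp: isoms_def)

lemma isoms_dist: "T \<in> isoms \<Longrightarrow> 0 < Im z \<Longrightarrow> 0 < Im w \<Longrightarrow> hyp_dist (T z) (T w) = hyp_dist z w" by (auto simp: isoms_def hyp_dist_act)

lemma isoms_cvx:
 "T \<in> isoms \<Longrightarrow> 0 < Im z \<Longrightarrow> 0 < Im w \<Longrightarrow> s \<in> {0..1} \<Longrightarrow> T (cvx z w s) = cvx (T z) (T w) s"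
 using cvx_act by (auto simp: isoms_def)

lemma continuous_on_h:
 "continuous_on upper hp" "continuous_on upper hq" "continuous_on upper hr" unfolding hp_def[abs_def] hq_def[abs_def] hr_def[abs_def] by (auto intro!: continuous_intros)

lemma continuous_on_hpoint:
 assumes "continuous_on T p" "continuous_on T q" "\<And>t. t \<in> T \<Longrightarrow> p t \<noteq> 0"
 shows "continuous_on T (\<lambda>t. hpoint (p t) (q t))" unfolding hpoint_def Complex_eq using assms by (auto intro!: continuous_intros)

lemma continuous_on_act:
 assumes "abs (det2 M) = 1"
 shows "continuous_on upper (act M)"
proof -
 have "continuous_on upper (\<lambda>z. hpoint ((m21 M)\<^sup>2 * hr z + 2 * m21 M * m22 M * hq z + (m22 M)\<^sup>2 * hp z)
    (m11 M * m21 M * hr z + (m11 M * m22 M + m12 M * m21 M) * hq z + m12 M * m22 M * hp z))"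
 proof (intro continuous_on_hpoint continuous_intros continuous_on_h)
  fix z assume "z \<in> upper"
  then have "0 < (m21 M)\<^sup>2 * hr z + 2 * m21 M * m22 M * hq z + (m22 M)\<^sup>2 * hp z" using assms det2_row2[of M] by (intro qform_pos) auto
  then show "(m21 M)\<^sup>2 * hr z + 2 * m21 M * m22 M * hq z + (m22 M)\<^sup>2 * hp z \<noteq> 0" by simp
 qed
 then show ?thesis by (rule continuous_on_eq) (simp add: act_def)
qed

lemma continuous_on_isom: "T \<in> isoms \<Longrightarrow> continuous_on upper T" by (auto simp: isoms_def continuous_on_act)

lemma open_isom_image:
 assumes "T \<in> isoms" "open U" "U \<subseteq> upper"
 shows "open (T ` U)"
proof -
 have "T ` U = upper \<inter> finv T -` U"
 proof (intro Set.set_eqI iffI)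
  fix x assume "x \<in> T ` U"
  then show "x \<in> upper \<inter> finv T -` U" using assms isoms_inv(3)[OF assms(1)] by auto
 next
  fix x assume "x \<in> upper \<inter> finv T -` U"
  then have "finv T x \<in> U" by simp
  then show "x \<in> T ` U" using isoms_inv(2)[OF assms(1)] by (metis imageI)
 qed
 then show ?thesis using continuous_on_isom[OF isoms_inv(1)[OF assms(1)]] assms open_upper by (metis continuous_on_open_vimage Int_commute)
qed

lemma fix_axis:
 assumes "act M \<i> = \<i>" "act M (Complex 0 e) = Complex 0 e" "1 < e" "abs (det2 M) = 1"
 shows "act M = id \<or> act M = act (Mat 1 0 0 (- 1))"
proof -
 have 1: "(m21 M)\<^sup>2 + (m22 M)\<^sup>2 = 1" "m11 M * m21 M + m12 M * m22 M = 0" using act_h(2,3)[of \<i> M] assms by (simp_all add: hp_def hq_def hr_def)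
 have "(m21 M)\<^sup>2 * e + (m22 M)\<^sup>2 / e = 1 / e" using act_h(2)[of "Complex 0 e" M] assms by (simp add: hp_def hq_def hr_def power2_eq_square)
 then have "(m21 M)\<^sup>2 * e\<^sup>2 + (m22 M)\<^sup>2 = 1" using assms(3) by (simp add: field_simps power2_eq_square)
 then have "(m21 M)\<^sup>2 * (e\<^sup>2 - 1) = 0" using 1(1) unfolding right_diff_distrib by linarith
 moreover have "e\<^sup>2 - 1 \<noteq> 0" using assms by (simp add: power2_eq_1_iff)
 ultimately have c: "m21 M = 0" by simp
 then have d: "abs (m22 M) = 1" using 1 by (simp add: abs_square_eq_1)
 then have b: "m12 M = 0" using 1 c by auto
 have a: "abs (m11 M) = 1" using assms(4) b c d by (simp add: det2_def abs_mult)
 have "M = 1 \<or> M = - 1 \<or> M = Mat 1 0 0 (- 1) \<or> M = - Mat 1 0 0 (- 1)" using a b c d by (auto simp: mat2_eq_iff abs_if split: if_splits)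
 then show ?thesis by (metis act_minus act_one)
qed

lemma act_reflect: "0 < Im z \<Longrightarrow> act (Mat 1 0 0 (- 1)) z = Complex (- Re z) (Im z)" by (simp add: act_def hpoint_def hp_def hq_def hr_def complex_eq_iff)

lemma open_off_axis:
 assumes "open U" "U \<noteq> {}"
 obtains u where "u \<in> U" "Re u \<noteq> 0"
proof -
 obtain u where u: "u \<in> U" using assms by blast
 then obtain e where e: "e > 0" "ball u e \<subseteq> U" using assms openE by blast
 then have "u + of_real (e / 2) \<in> U" by (intro subsetD[OF e(2)]) (simp add: dist_norm)
 moreover have "Re u \<noteq> 0 \<or> Re (u + of_real (e / 2)) \<noteq> 0" using e by auto
 ultimately show ?thesis using u that by blast
qed

text \<open>The distances to the two fixed points determine the height and the absolute value of the
  real part of the image. Comparison with one point \<open>u0\<close> off the axis shows that the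
  sign of the real part is the same choice everywhere.\<close>

lemma isom_rigid_axis:
 assumes U: "open U" "U \<noteq> {}" "U \<subseteq> S" and S: "S \<subseteq> upper" "\<phi> ` S \<subseteq> upper"
  and iso: "\<And>u v. u \<in> S \<Longrightarrow> v \<in> S \<Longrightarrow> hyp_dist (\<phi> u) (\<phi> v) = hyp_dist u v"
  and fixed: "\<i> \<in> S" "Complex 0 e \<in> S" "1 < e" "\<phi> \<i> = \<i>" "\<phi> (Complex 0 e) = Complex 0 e"
 shows "(\<forall>u\<in>S. \<phi> u = u) \<or> (\<forall>u\<in>S. \<phi> u = act (Mat 1 0 0 (- 1)) u)"
proof -
 have up: "0 < Im u" "0 < Im (\<phi> u)" if "u \<in> S" for u using S that by auto
 have ch: "hyp_ch (\<phi> u) (\<phi> v) = hyp_ch u v" if "u \<in> S" "v \<in> S" for u v using iso[OF that] hyp_dist_eq_iff up that by simp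
 have 1: "Im (\<phi> u) = Im u \<and> (Re (\<phi> u))\<^sup>2 = (Re u)\<^sup>2" if u: "u \<in> S" for u
 proof -
  let ?n = "\<lambda>u. (Re u)\<^sup>2 + (Im u)\<^sup>2"
  have *: "(a\<^sup>2 + ?n (\<phi> u)) / Im (\<phi> u) = (a\<^sup>2 + ?n u) / Im u" if "a > 0" "Complex 0 a \<in> S" "\<phi> (Complex 0 a) = Complex 0 a" for a
  proof -
   have h: "hyp_ch w (Complex 0 a) = (a\<^sup>2 + ?n w) / Im w / (2 * a)" if "0 < Im w" for w
    using that \<open>a > 0\<close> by (simp add: hyp_ch_h hp_def hr_def hq_def field_simps power2_eq_square)
   have "(a\<^sup>2 + ?n (\<phi> u)) / Im (\<phi> u) / (2 * a) = (a\<^sup>2 + ?n u) / Im u / (2 * a)" using ch[OF u that(2)] that(3) h[OF up(1)[OF u]] h[OF up(2)[OF u]] by metis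
   then show ?thesis using that(1) by (subst (asm) divide_cancel_right) simp
  qed
  from *[of 1] *[of e] have A: "(1 + ?n (\<phi> u)) / Im (\<phi> u) = (1 + ?n u) / Im u"
   and B: "(e\<^sup>2 + ?n (\<phi> u)) / Im (\<phi> u) = (e\<^sup>2 + ?n u) / Im u" using fixed by (simp_all add: i_Complex)
  have "(e\<^sup>2 - 1) / Im w = (e\<^sup>2 + m) / Im w - (1 + m) / Im w" for w m by (simp flip: diff_divide_distrib)
  with A B have "(e\<^sup>2 - 1) / Im (\<phi> u) = (e\<^sup>2 - 1) / Im u" by metis
  moreover have "e\<^sup>2 - 1 \<noteq> 0" using fixed by (simp add: power2_eq_1_iff)
  ultimately have "Im (\<phi> u) = Im u" using up[OF u] by simp
  with A up[OF u] show ?thesis by simp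
 qed
 obtain u0 where u0: "u0 \<in> S" "Re u0 \<noteq> 0" using open_off_axis[OF U(1,2)] U(3) by blast
 have "Re (\<phi> u) * Re (\<phi> u0) = Re u * Re u0" if u: "u \<in> S" for u
 proof -
  have h: "2 * Im z * Im w * hyp_ch z w = (Re z)\<^sup>2 + (Im z)\<^sup>2 + (Re w)\<^sup>2 + (Im w)\<^sup>2 - 2 * (Re z * Re w)"
   if "0 < Im z" "0 < Im w" for z w using that by (simp add: hyp_ch_h hp_def hq_def hr_def field_simps power2_eq_square)
  show ?thesis using h[OF up(1)[OF u] up(1)[OF u0(1)]] h[OF up(2)[OF u] up(2)[OF u0(1)]] unfolding ch[OF u u0(1)] conjunct1[OF 1[OF u]] conjunct2[OF 1[OF u]]
    conjunct1[OF 1[OF u0(1)]] conjunct2[OF 1[OF u0(1)]] by linarith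
 qed
 moreover have "Re (\<phi> u0) = Re u0 \<or> Re (\<phi> u0) = - Re u0" using 1[OF u0(1)] by (simp add: power2_eq_iff)
 ultimately have "(\<forall>u\<in>S. Re (\<phi> u) = Re u) \<or> (\<forall>u\<in>S. Re (\<phi> u) = - Re u)"
 proof (elim disjE)
  assume p: "\<And>u. u \<in> S \<Longrightarrow> Re (\<phi> u) * Re (\<phi> u0) = Re u * Re u0"
  { assume "Re (\<phi> u0) = Re u0"
   then show ?thesis using p u0(2) by simp }
  { assume "Re (\<phi> u0) = - Re u0"
   then have "Re (\<phi> u) = - Re u" if "u \<in> S" for u
   proof -
    have "(- Re (\<phi> u)) * Re u0 = Re u * Re u0" using p[OF that] \<open>Re (\<phi> u0) = - Re u0\<close> by simp
    then have "- Re (\<phi> u) = Re u" using u0(2) mult_right_cancel by blast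
    then show ?thesis by simp
   qed
   then show ?thesis by blast }
 qed
 then show ?thesis
 proof
  assume "\<forall>u\<in>S. Re (\<phi> u) = Re u"
  then show ?thesis using 1 by (simp add: complex_eq_iff)
 next
  assume "\<forall>u\<in>S. Re (\<phi> u) = - Re u"
  then have "\<forall>u\<in>S. \<phi> u = act (Mat 1 0 0 (- 1)) u" using 1 up by (simp add: act_reflect complex_eq_iff)
  then show ?thesis by blast
 qed
qed

lemma open_two_points:
 assumes "open U" "U \<noteq> {}"
 obtains z w :: complex where "z \<in> U" "w \<in> U" "z \<noteq> w"
proof -
 obtain z where z: "z \<in> U" using assms by blast
 then obtain e where e: "e > 0" "ball z e \<subseteq> U" using assms openE by blast
 have "z + of_real (e / 2) \<in> U" using e by (intro subsetD[OF e(2)]) (simp add: dist_norm)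
 then show ?thesis using that[of z "z + of_real (e / 2)"] z e by simp
qed

text \<open>Made for images of charts: \<open>S\<close> may be relatively open in a half plane only,
  and the open set \<open>U\<close> inside it keeps it from being contained in one geodesic.
  Composition with isometries brings \<open>phi\<close> into the situation with two fixed points on
  the axis.\<close>

lemma isom_rigid:
 assumes U: "open U" "U \<noteq> {}" "U \<subseteq> S" and S: "S \<subseteq> upper" "\<phi> ` S \<subseteq> upper"
  and iso: "\<And>u v. u \<in> S \<Longrightarrow> v \<in> S \<Longrightarrow> hyp_dist (\<phi> u) (\<phi> v) = hyp_dist u v"
 obtains T where "T \<in> isoms" "\<And>u. u \<in> S \<Longrightarrow> \<phi> u = T u"
proof -
 obtain z w where zw: "z \<in> U" "w \<in> U" "z \<noteq> w" using open_two_points U by blast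
 have zS: "z \<in> S" "w \<in> S" using zw U by auto
 have up: "0 < Im u" "0 < Im (\<phi> u)" if "u \<in> S" for u using S that by auto
 obtain M e where M: "det2 M = 1" "1 \<le> e" "act M z = \<i>" "act M w = Complex 0 e" using normalise_pair up zS by blast
 have "e \<noteq> 1" using M zw act_eq_iff[of M z w] by (auto simp: i_Complex)
 then have e: "1 < e" using M by simp
 obtain N where N: "det2 N = 1" "act N (\<phi> z) = z" "act N (\<phi> w) = w" using two_point_homogeneous[of "\<phi> z" "\<phi> w" z w] up zS iso by metis
 have ad: "abs (det2 M) = 1" "abs (det2 N) = 1" using M N by auto
 define \<psi> where "\<psi> u = act M (act N (\<phi> (act (inv2 M) u)))" for u
 have "(\<forall>u\<in>act M ` S. \<psi> u = u) \<or> (\<forall>u\<in>act M ` S. \<psi> u = act (Mat 1 0 0 (- 1)) u)"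
 proof (rule isom_rigid_axis)
  show "open (act M ` U)" using U S ad by (intro open_isom_image) auto
  show "act M ` U \<noteq> {}" "act M ` U \<subseteq> act M ` S" using U by auto
  show "act M ` S \<subseteq> upper" "\<psi> ` act M ` S \<subseteq> upper" using up ad by (auto simp: \<psi>_def)
  show "\<i> \<in> act M ` S" "Complex 0 e \<in> act M ` S" using M zS by (metis image_eqI)+
  show "1 < e" by (rule e)
  have "\<psi> (act M u) = act M (act N (\<phi> u))" for u by (simp add: \<psi>_def ad)
  then show "\<psi> \<i> = \<i>" "\<psi> (Complex 0 e) = Complex 0 e" using M N by metis+
  fix u v assume "u \<in> act M ` S" "v \<in> act M ` S"
  then show "hyp_dist (\<psi> u) (\<psi> v) = hyp_dist u v" using ad up iso by (auto simp: \<psi>_def hyp_dist_act)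
 qed
 then obtain R where R: "abs (det2 R) = 1" "\<And>u. u \<in> act M ` S \<Longrightarrow> \<psi> u = act R u"
 proof
  assume "\<forall>u\<in>act M ` S. \<psi> u = u"
  then have "\<And>u. u \<in> act M ` S \<Longrightarrow> \<psi> u = act 1 u" unfolding act_one id_apply by blast
  then show ?thesis using that[of 1] det2_one abs_1 by metis
 next
  assume "\<forall>u\<in>act M ` S. \<psi> u = act (Mat 1 0 0 (- 1)) u"
  then have "\<And>u. u \<in> act M ` S \<Longrightarrow> \<psi> u = act (Mat 1 0 0 (- 1)) u" by blast
  moreover have "abs (det2 (Mat 1 0 0 (- 1))) = 1" by (simp add: det2_def)
  ultimately show ?thesis using that by metis
 qed
 show ?thesis
 proof (rule that)
  let ?T = "act (inv2 N) o (act (inv2 M) o (act R o act M))"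
  show "?T \<in> isoms" using ad R by (intro isoms_comp act_isoms) auto
  fix u assume u: "u \<in> S"
  then have "act R (act M u) = \<psi> (act M u)" using R by simp
  also have "\<dots> = act M (act N (\<phi> u))" by (simp add: \<psi>_def ad)
  finally show "\<phi> u = ?T u" by (simp add: ad)
 qed
qed

lemma isom_eq_id:
 assumes U: "open U" "U \<noteq> {}" "U \<subseteq> upper" and T: "T \<in> isoms" "\<And>u. u \<in> U \<Longrightarrow> T u = u"
 shows "T = id"
proof -
 obtain z w where zw: "z \<in> U" "w \<in> U" "z \<noteq> w" using open_two_points U by blast
 have up: "0 < Im u" if "u \<in> U" for u using U that by auto
 obtain M e where M: "det2 M = 1" "1 \<le> e" "act M z = \<i>" "act M w = Complex 0 e" using normalise_pair up zw by blast
 have ad: "abs (det2 M) = 1" using M by simp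
 have "e \<noteq> 1" using M zw act_eq_iff[of M z w] by (auto simp: i_Complex)
 then have e: "1 < e" using M by simp
 obtain N where N: "T = act N" "abs (det2 N) = 1" using T by (auto simp: isoms_def)
 define R where "R = M * N * inv2 M"
 have R: "act R u = act M (T (act (inv2 M) u))" "abs (det2 R) = 1" for u using ad N by (simp_all add: R_def act_mult abs_mult)
 have fixU: "act R u = u" if "u \<in> act M ` U" for u using that T(2) ad by (auto simp: R)
 have "\<i> \<in> act M ` U" "Complex 0 e \<in> act M ` U" using M(3,4) zw(1,2) by (metis image_eqI)+
 then have "act R = id \<or> act R = act (Mat 1 0 0 (- 1))" using fixU e R(2) by (intro fix_axis) blast+
 moreover have "act R \<noteq> act (Mat 1 0 0 (- 1))"
 proof
  assume a: "act R = act (Mat 1 0 0 (- 1))"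
  have "open (act M ` U)" by (rule open_isom_image[OF act_isoms[OF ad] U(1,3)])
  then obtain u where u: "u \<in> act M ` U" "Re u \<noteq> 0" using open_off_axis[of "act M ` U"] U(2) by blast
  then have "0 < Im u" using up ad by auto
  then show False using fixU[OF u(1)] u(2) by (simp add: a act_reflect complex_eq_iff)
 qed
 ultimately have R1: "act R = id" by blast
 show ?thesis
 proof
  fix u
  have "act M (T u) = act M u" using R(1)[of "act M u"] R1 ad by simp
  then show "T u = id u" by (simp add: act_eq_iff ad)
 qed
qed

lemma isom_unique:
 assumes U: "open U" "U \<noteq> {}" "U \<subseteq> upper" and T: "T \<in> isoms" "S \<in> isoms" "\<And>u. u \<in> U \<Longrightarrow> T u = S u"
 shows "T = S"
proof -
 have "finv S o T = id" using U T isoms_inv by (intro isom_eq_id[of U]) (auto intro: isoms_comp)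
 then have "S o (finv S o T) = S" by simp
 then show ?thesis using isoms_inv(5)[OF T(2)] by (metis comp_assoc id_comp)
qed

section \<open>Comparison of the hyperbolic with the Euclidean topology\<close>

lemma continuous_on_hyp_dist:
 assumes "continuous_on T f" "continuous_on T g" "f ` T \<subseteq> upper" "g ` T \<subseteq> upper"
 shows "continuous_on T (\<lambda>t. hyp_dist (f t) (g t))" unfolding hyp_dist_ch hyp_ch_def
proof (rule continuous_on_compose2[OF continuous_on_arcosh[OF order.refl]])
 show "continuous_on T (\<lambda>t. 1 + (cmod (f t - g t))\<^sup>2 / (2 * Im (f t) * Im (g t)))" using assms by (intro continuous_intros) fastforce+
 show "(\<lambda>t. 1 + (cmod (f t - g t))\<^sup>2 / (2 * Im (f t) * Im (g t))) ` T \<subseteq> {1..}"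
 proof safe
  fix x assume "x \<in> T"
  then have "0 < Im (f x)" "0 < Im (g x)" using assms by auto
  then show "1 \<le> 1 + (cmod (f x - g x))\<^sup>2 / (2 * Im (f x) * Im (g x))" by simp
 qed
qed

lemma continuous_on_cvx:
 assumes c: "continuous_on T f" "continuous_on T g" "continuous_on T h"
  and "f ` T \<subseteq> upper" "g ` T \<subseteq> upper" "h ` T \<subseteq> {0..1}"
 shows "continuous_on T (\<lambda>t. cvx (f t) (g t) (h t))"
proof -
 have up: "0 < Im (f t)" "0 < Im (g t)" "h t \<in> {0..1}" if "t \<in> T" for t using assms that by auto
 have hh: "continuous_on T (\<lambda>t. hp (f t))" "continuous_on T (\<lambda>t. hq (f t))" "continuous_on T (\<lambda>t. hp (g t))" "continuous_on T (\<lambda>t. hq (g t))"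
  using assms by (auto intro!: continuous_on_compose2[OF continuous_on_h(1)] continuous_on_compose2[OF continuous_on_h(2)])
 have n: "continuous_on T (\<lambda>t. cvx_norm (f t) (g t) (h t))" unfolding cvx_norm_def hyp_ch_def using c up by (intro continuous_intros) fastforce+
 have n0: "cvx_norm (f t) (g t) (h t) \<noteq> 0" if "t \<in> T" for t using cvx_norm_ge1[OF up[OF that]] by linarith
 show ?thesis unfolding cvx_def
 proof (intro continuous_on_hpoint continuous_intros hh n c)
  show "((1 - h t) * hp (f t) + h t * hp (g t)) / cvx_norm (f t) (g t) (h t) \<noteq> 0" if "t \<in> T" for t using cvx_h(1,2)[OF up[OF that]] hp_pos by (metis less_irrefl)
 qed (use n0 in auto)
qed

lemma hyp_dist_small:
 assumes z: "0 < Im z" "0 < e"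
 obtains r where "0 < r" "\<And>w. 0 < Im w \<Longrightarrow> hyp_dist z w < r \<Longrightarrow> dist z w < e"
proof -
 \<comment> \<open>Distance below 1 gives \<open>Im w < exp 1 * Im z\<close>; with this bound,
   \<open>hyp_ch z w < c\<close> is just strong enough for \<open>cmod (z - w) < e\<close>.\<close>
 define c where "c = 1 + e\<^sup>2 / (2 * (Im z)\<^sup>2 * exp 1)"
 have c: "1 < c" using assms by (simp add: c_def)
 show ?thesis
 proof (rule that)
  show "0 < min 1 (arcosh c)" using c by simp
  fix w assume w: "0 < Im w" "hyp_dist z w < min 1 (arcosh c)"
  have "abs (ln (Im w / Im z)) < 1" using hyp_dist_ge_ln(1)[OF z(1) w(1)] w(2) by linarith
  then have "Im w / Im z < exp 1" using z w by (metis abs_less_iff divide_pos_pos exp_less_cancel_iff exp_ln)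
  then have wz: "Im w < Im z * exp 1" using z by (simp add: field_simps)
  have "\<not> cosh (arcosh c) \<le> cosh (hyp_dist z w)" using w z c cosh_real_nonneg_le_iff[of "arcosh c" "hyp_dist z w"] by simp
  then have "hyp_ch z w < c" using c z w by (simp add: cosh_hyp_dist)
  then have "(cmod (z - w))\<^sup>2 / (2 * Im z * Im w) < e\<^sup>2 / (2 * (Im z)\<^sup>2 * exp 1)" by (simp add: c_def hyp_ch_def)
  then have "(cmod (z - w))\<^sup>2 < e\<^sup>2 / (2 * (Im z)\<^sup>2 * exp 1) * (2 * Im z * Im w)" using z w by (simp add: pos_divide_less_eq)
  also have "\<dots> = e\<^sup>2 * (Im w / (Im z * exp 1))" using z by (simp add: power2_eq_square)
  also have "\<dots> \<le> e\<^sup>2 * 1" using wz z by (intro mult_left_mono) auto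
  finally show "dist z w < e" using z by (simp add: dist_norm power_less_imp_less_base)
 qed
qed

lemma hyp_dist_near:
 assumes z: "0 < Im z" "0 < e"
 obtains r where "0 < r" "\<And>w. dist z w < r \<Longrightarrow> 0 < Im w \<and> hyp_dist z w < e"
proof -
 have "continuous_on upper (\<lambda>w. hyp_dist z w)" using z by (intro continuous_on_hyp_dist continuous_intros) auto
 then have "open (upper \<inter> (\<lambda>w. hyp_dist z w) -` {..<e})" by (metis Int_commute continuous_on_open_vimage open_lessThan open_upper)
 moreover have "z \<in> upper \<inter> (\<lambda>w. hyp_dist z w) -` {..<e}" using z by simp
 ultimately obtain r where "0 < r" "ball z r \<subseteq> upper \<inter> (\<lambda>w. hyp_dist z w) -` {..<e}" using openE by blast
 then show ?thesis using that[of r] by (auto simp: subset_iff)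
qed

lemma hyp_cball_bounds:
 assumes z: "0 < Im z" and w: "0 < Im w" "hyp_dist z w \<le> R"
 shows "Im z * exp (- R) \<le> Im w" "Im w \<le> Im z * exp R" "(cmod (z - w))\<^sup>2 \<le> 2 * (Im z)\<^sup>2 * exp R * cosh R"
proof -
 have "abs (ln (Im w / Im z)) \<le> R" using hyp_dist_ge_ln(1)[OF z w(1)] w(2) by linarith
 then have "exp (- R) \<le> exp (ln (Im w / Im z))" "exp (ln (Im w / Im z)) \<le> exp R" by auto
 then show "Im z * exp (- R) \<le> Im w" and 1: "Im w \<le> Im z * exp R" using z w by (simp_all add: field_simps)
 have R: "0 \<le> R" using hyp_dist_nonneg[OF z w(1)] w(2) by linarith
 have "hyp_ch z w \<le> cosh R" using hyp_dist_le_iff'[OF z w(1) R] w(2) by simp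
 then have "(cmod (z - w))\<^sup>2 / (2 * Im z * Im w) \<le> cosh R" by (simp add: hyp_ch_def)
 then have "(cmod (z - w))\<^sup>2 \<le> cosh R * (2 * Im z * Im w)" using z w by (simp add: pos_divide_le_eq)
 also have "\<dots> \<le> cosh R * (2 * Im z * (Im z * exp R))" using 1 z by (intro mult_left_mono) auto
 finally show "(cmod (z - w))\<^sup>2 \<le> 2 * (Im z)\<^sup>2 * exp R * cosh R" by (simp add: power2_eq_square algebra_simps)
qed

lemma compact_hyp_cball:
 assumes z: "0 < Im z"
 shows "compact {w. 0 < Im w \<and> hyp_dist z w \<le> R}" (is "compact ?B")
proof -
 let ?A = "{w. Im z * exp (- R) \<le> Im w}"
 have A: "?A \<subseteq> upper" using z by (auto intro: less_le_trans[OF mult_pos_pos[OF z exp_gt_zero]])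
 have "?B = ?A \<inter> (\<lambda>w. hyp_dist z w) -` {..R}" using hyp_cball_bounds(1)[OF z] A by auto
 moreover have "continuous_on ?A (\<lambda>w. hyp_dist z w)" using z A by (intro continuous_on_hyp_dist continuous_intros) auto
 moreover have "closed ?A" by (rule closed_halfspace_Im_ge)
 ultimately have "closed ?B" using continuous_closed_preimage by (metis closed_atMost)
 moreover have "bounded ?B"
 proof (rule boundedI)
  fix w assume "w \<in> ?B"
  then have "(cmod (z - w))\<^sup>2 \<le> 2 * (Im z)\<^sup>2 * exp R * cosh R" using hyp_cball_bounds(3)[OF z] by blast
  then have "cmod (z - w) \<le> sqrt (2 * (Im z)\<^sup>2 * exp R * cosh R)" by (rule real_le_rsqrt)
  then show "cmod w \<le> cmod z + sqrt (2 * (Im z)\<^sup>2 * exp R * cosh R)" using norm_triangle_ineq4[of z "z - w"] by simp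
 qed
 ultimately show ?thesis by (simp add: compact_eq_bounded_closed)
qed

section \<open>The bundle of germs of isometric charts\<close>

locale hyp_metric =
 fixes F :: "'a::topological_space set" and d :: "'a \<Rightarrow> 'a \<Rightarrow> real"
 assumes hyperbolic: "hyperbolic_metric F d" and connected_F: "connected F" and F_ne: "F \<noteq> {}"
begin

sublocale Metric_space F d using hyperbolic by (simp add: hyperbolic_metric_def)

lemma mtopology_F: "mtopology = top_of_set F"
 and complete_F: "mcomplete"
 and hyp_chart_ex: "x \<in> F \<Longrightarrow> \<exists>U f. x \<in> U \<and> hyp_chart F d U f" using hyperbolic by (auto simp: hyperbolic_metric_def)

text \<open>Isometric charts up to an isometry of the plane. Their images need not lie in the
  standard half \<open>Re z >= 0\<close>, so they can be continued along one another.\<close>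

definition gchart :: "'a set \<Rightarrow> ('a \<Rightarrow> complex) \<Rightarrow> bool" where
 "gchart U e \<longleftrightarrow> (\<exists>f. \<exists>T\<in>isoms. hyp_chart F d U f \<and> (\<forall>u\<in>U. e u = T (f u)))"

text \<open>Convexity of the image lets a geodesic segment between two image points be pulled back
  to \<open>F\<close>.\<close>

definition cchart :: "'a set \<Rightarrow> ('a \<Rightarrow> complex) \<Rightarrow> bool" where
 "cchart U e \<longleftrightarrow> gchart U e \<and> (\<forall>z\<in>e ` U. \<forall>w\<in>e ` U. \<forall>s\<in>{0..1}. cvx z w s \<in> e ` U)"

lemma hyp_chartD:
 assumes "hyp_chart F d U f"
 shows "openin mtopology U" "U \<subseteq> F" "u \<in> U \<Longrightarrow> 0 < Im (f u) \<and> 0 \<le> Re (f u)"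
  "u \<in> U \<Longrightarrow> v \<in> U \<Longrightarrow> d u v = hyp_dist (f u) (f v)"
  "\<exists>O'. open O' \<and> f ` U = {z. 0 < Im z \<and> 0 \<le> Re z} \<inter> O'" using assms unfolding hyp_chart_def mtopology_F
 by (auto simp: openin_open dest: openin_imp_subset)

lemma gchartD:
 assumes "gchart U e"
 shows "openin mtopology U" "U \<subseteq> F" "u \<in> U \<Longrightarrow> 0 < Im (e u)"
  "u \<in> U \<Longrightarrow> v \<in> U \<Longrightarrow> d u v = hyp_dist (e u) (e v)" "inj_on e U"
proof -
 obtain f T where T: "T \<in> isoms" and f: "hyp_chart F d U f" "\<And>u. u \<in> U \<Longrightarrow> e u = T (f u)" using assms by (auto simp: gchart_def)
 note h = hyp_chartD[OF f(1)]
 show "openin mtopology U" "U \<subseteq> F" using h by auto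
 show 1: "u \<in> U \<Longrightarrow> 0 < Im (e u)" for u using h f T by auto
 show 2: "u \<in> U \<Longrightarrow> v \<in> U \<Longrightarrow> d u v = hyp_dist (e u) (e v)" for u v using h f T isoms_dist[OF T] by auto
 show "inj_on e U"
 proof (rule inj_onI)
  fix u v assume uv: "u \<in> U" "v \<in> U" "e u = e v"
  then have "d u v = 0" using 2 by simp
  then show "u = v" using uv \<open>U \<subseteq> F\<close> by (metis subsetD zero)
 qed
qed

lemma gchart_comp:
 assumes "gchart U e" "S \<in> isoms"
 shows "gchart U (S o e)"
proof -
 obtain f T where "T \<in> isoms" "hyp_chart F d U f" "\<And>u. u \<in> U \<Longrightarrow> e u = T (f u)" using assms by (auto simp: gchart_def)
 then show ?thesis unfolding gchart_def using assms by (intro exI[of _ f] bexI[of _ "S o T"]) (auto intro: isoms_comp)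
qed

lemma cchart_comp:
 assumes "cchart U e" "S \<in> isoms"
 shows "cchart U (S o e)" unfolding cchart_def
proof (intro conjI ballI)
 show "gchart U (S o e)" using assms gchart_comp by (auto simp: cchart_def)
 fix z w s assume "z \<in> (S o e) ` U" "w \<in> (S o e) ` U" and s: "s \<in> {0..1::real}"
 then obtain u v where uv: "u \<in> U" "v \<in> U" "z = S (e u)" "w = S (e v)" by auto
 then have "cvx (e u) (e v) s \<in> e ` U" using assms s by (auto simp: cchart_def)
 moreover have "cvx z w s = S (cvx (e u) (e v) s)" using isoms_cvx[OF assms(2)] gchartD(3) assms uv s by (auto simp: cchart_def)
 ultimately show "cvx z w s \<in> (S o e) ` U" by auto
qed

text \<open>Around a boundary point the image is open only relative to a half plane. Its part with
  \<open>Re z > 0\<close> is genuinely open, and a small shift to the right shows that it is not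
  empty.\<close>

lemma gchart_image_open:
 assumes "gchart U e" "W \<subseteq> U" "openin mtopology W" "W \<noteq> {}"
 obtains O' where "open O'" "O' \<noteq> {}" "O' \<subseteq> e ` W" "O' \<subseteq> upper"
proof -
 obtain f T where T: "T \<in> isoms" and f: "hyp_chart F d U f" "\<And>u. u \<in> U \<Longrightarrow> e u = T (f u)" using assms by (auto simp: gchart_def)
 note h = hyp_chartD[OF f(1)]
 obtain O1 where O1: "open O1" "f ` U = {z. 0 < Im z \<and> 0 \<le> Re z} \<inter> O1" using h(5) by blast
 obtain x where x: "x \<in> W" using assms by blast
 obtain q where q: "0 < q" "mball x q \<subseteq> W" using assms(3) x by (auto simp: openin_mtopology)
 have fx: "0 < Im (f x)" "0 \<le> Re (f x)" "f x \<in> O1" using h x assms(2) O1 by blast+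
 obtain s where s: "0 < s" "\<And>w. dist (f x) w < s \<Longrightarrow> 0 < Im w \<and> hyp_dist (f x) w < q" using hyp_dist_near[OF fx(1) q(1)] by blast
 define O2 where "O2 = ball (f x) s \<inter> O1 \<inter> {z. Re z > 0}"
 obtain r where r: "0 < r" "ball (f x) r \<subseteq> O1" using O1 fx openE by blast
 have "f x + of_real (min s r / 2) \<in> O2" using s(1) r fx unfolding O2_def by (auto simp: dist_norm intro!: subsetD[OF r(2)])
 then have ne: "O2 \<noteq> {}" by blast
 have op: "open O2" unfolding O2_def using O1 by (intro open_Int open_halfspace_Re_gt) auto
 have sub: "O2 \<subseteq> f ` W"
 proof
  fix w assume w: "w \<in> O2"
  then have w': "0 < Im w" "hyp_dist (f x) w < q" using s by (auto simp: O2_def)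
  have "w \<in> {z. 0 < Im z \<and> 0 \<le> Re z} \<inter> O1" using w w' by (auto simp: O2_def)
  then obtain u where u: "u \<in> U" "w = f u" unfolding O1(2)[symmetric] by blast
  then have "d x u < q" using h(4) x assms(2) w' by auto
  then have "u \<in> W" using q x u assms(2) h(2) by (auto simp: subset_iff)
  then show "w \<in> f ` W" using u by blast
 qed
 have up: "O2 \<subseteq> upper" using s by (auto simp: O2_def)
 show ?thesis
 proof
  show "open (T ` O2)" using open_isom_image[OF T op up] .
  show "T ` O2 \<noteq> {}" using ne by blast
  show "T ` O2 \<subseteq> e ` W"
  proof
   fix w assume "w \<in> T ` O2"
   then obtain u where "u \<in> W" "w = T (f u)" using sub by blast
   then show "w \<in> e ` W" using f(2)[of u] assms(2) by (metis imageI subsetD)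
  qed
  show "T ` O2 \<subseteq> upper" using up T by auto
 qed
qed

text \<open>A single isometry works on the whole overlap, connected or not, because charts preserve
  the distance \<open>d\<close> itself and not merely the lengths of short curves.\<close>

lemma gchart_transition:
 assumes "gchart U e" "gchart V g" "U \<inter> V \<noteq> {}"
 obtains T where "T \<in> isoms" "\<And>u. u \<in> U \<inter> V \<Longrightarrow> g u = T (e u)"
proof -
 note e = gchartD[OF assms(1)] and g = gchartD[OF assms(2)]
 have op: "openin mtopology (U \<inter> V)" using e(1) g(1) by blast
 obtain O' where O': "open O'" "O' \<noteq> {}" "O' \<subseteq> e ` (U \<inter> V)" "O' \<subseteq> upper" using gchart_image_open[OF assms(1) _ op assms(3)] by blast
 define \<phi> where "\<phi> = g o inv_into (U \<inter> V) e"
 have inj: "inj_on e (U \<inter> V)" using e(5) by (rule inj_on_subset) blast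
 have \<phi>: "\<phi> (e u) = g u" if "u \<in> U \<inter> V" for u using that inj by (simp add: \<phi>_def inv_into_f_f)
 obtain T where "T \<in> isoms" "\<And>w. w \<in> e ` (U \<inter> V) \<Longrightarrow> \<phi> w = T w"
 proof (rule isom_rigid[OF O'(1-3)])
  show "e ` (U \<inter> V) \<subseteq> upper" using e(3) by auto
  show "\<phi> ` e ` (U \<inter> V) \<subseteq> upper" using g(3) \<phi> by auto
  fix u v assume "u \<in> e ` (U \<inter> V)" "v \<in> e ` (U \<inter> V)"
  then obtain a b where ab: "a \<in> U \<inter> V" "b \<in> U \<inter> V" "u = e a" "v = e b" by blast
  then show "hyp_dist (\<phi> u) (\<phi> v) = hyp_dist u v" using \<phi> e(4)[of a b] g(4)[of a b] by auto
 qed blast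
 then show ?thesis using that \<phi> by (metis imageI)
qed

lemma gchart_agree_isom:
 assumes "gchart U e" "W \<subseteq> U" "openin mtopology W" "W \<noteq> {}" "S \<in> isoms" "T \<in> isoms"
  and "\<And>u. u \<in> W \<Longrightarrow> S (e u) = T (e u)"
 shows "S = T"
proof -
 obtain O' where O': "open O'" "O' \<noteq> {}" "O' \<subseteq> e ` W" "O' \<subseteq> upper" using gchart_image_open[OF assms(1-4)] by blast
 show ?thesis using O' assms by (intro isom_unique[OF O'(1,2,4)]) auto
qed

lemma gchart_agree:
 assumes "gchart U e" "gchart V g" "W \<subseteq> U \<inter> V" "openin mtopology W" "W \<noteq> {}"
  "\<And>u. u \<in> W \<Longrightarrow> e u = g u" "u \<in> U \<inter> V"
 shows "e u = g u"
proof -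
 obtain T where T: "T \<in> isoms" "\<And>u. u \<in> U \<inter> V \<Longrightarrow> g u = T (e u)" using gchart_transition[OF assms(1,2)] assms(7) by blast
 have "T = id" using assms T by (intro gchart_agree_isom[OF assms(1) _ assms(4,5)]) (auto simp: subset_iff)
 then show ?thesis using T(2)[OF assms(7)] by simp
qed

text \<open>A chart restricted to a small metric ball has as image a hyperbolic ball cut by the half
  plane, an intersection of convex sets. Half the radius leaves a closed ball whose image is
  compact.\<close>

lemma cchart_ball_ex:
 assumes x: "x \<in> F"
 obtains r U e where "0 < r" "cchart U e" "mcball x r \<subseteq> U" "compact (e ` mcball x r)"
proof -
 obtain U f where U: "x \<in> U" "hyp_chart F d U f" using hyp_chart_ex[OF x] by blast
 note h = hyp_chartD[OF U(2)]
 let ?H = "{z. 0 < Im z \<and> 0 \<le> Re z}"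
 obtain O1 where O1: "open O1" "f ` U = ?H \<inter> O1" using h(5) by blast
 have fx: "0 < Im (f x)" "0 \<le> Re (f x)" "f x \<in> O1" using h U O1 by blast+
 obtain q where q: "0 < q" "ball (f x) q \<subseteq> O1" using O1 fx openE by blast
 obtain \<rho>1 where \<rho>1: "0 < \<rho>1" "\<And>w. 0 < Im w \<Longrightarrow> hyp_dist (f x) w < \<rho>1 \<Longrightarrow> dist (f x) w < q"
  using hyp_dist_small[OF fx(1) q(1)] by blast
 obtain \<rho>2 where \<rho>2: "0 < \<rho>2" "mball x \<rho>2 \<subseteq> U" using h(1) U(1) by (auto simp: openin_mtopology)
 define \<rho> where "\<rho> = min \<rho>1 \<rho>2"
 have \<rho>: "0 < \<rho>" "mball x \<rho> \<subseteq> U" using \<rho>1 \<rho>2 mball_subset_concentric[of \<rho> \<rho>2 x] by (auto simp: \<rho>_def)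
 define V where "V = mball x \<rho>"
 \<comment> \<open>Stated for a predicate on the distance, so that the open ball and the smaller
   closed ball are both covered.\<close>
 have img: "f ` {u \<in> U. P (d x u)} = {w \<in> ?H. P (hyp_dist (f x) w)}" if "\<And>t. P t \<Longrightarrow> t < \<rho>" for P
 proof (intro Set.equalityI subsetI)
  fix w assume "w \<in> f ` {u \<in> U. P (d x u)}"
  then show "w \<in> {w \<in> ?H. P (hyp_dist (f x) w)}" using h U by auto
 next
  fix w assume w: "w \<in> {w \<in> ?H. P (hyp_dist (f x) w)}"
  then have "hyp_dist (f x) w < \<rho>1" using that by (auto simp: \<rho>_def)
  then have "w \<in> f ` U" using w \<rho>1(2)[of w] q O1 by (auto simp: subset_iff)
  then obtain u where "u \<in> U" "w = f u" by blast
  then show "w \<in> f ` {u \<in> U. P (d x u)}" using w h(4) U(1) by auto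
 qed
 have V: "V = {u \<in> U. d x u < \<rho>}" using \<rho>(2) h(2) x unfolding V_def by (auto simp: in_mball)
 have fV: "f ` V = {w \<in> ?H. hyp_dist (f x) w < \<rho>}" unfolding V by (rule img)
 have B: "mcball x (\<rho> / 2) = {u \<in> U. d x u \<le> \<rho> / 2}"
 proof -
  have "mcball x (\<rho> / 2) \<subseteq> U" using \<rho> by (auto simp: subset_iff)
  then show ?thesis using h(2) x by (auto simp: in_mcball)
 qed
 have fB: "f ` mcball x (\<rho> / 2) = {w \<in> ?H. hyp_dist (f x) w \<le> \<rho> / 2}" unfolding B using \<rho>(1) by (intro img) auto
 have chV: "hyp_chart F d V f" unfolding hyp_chart_def
 proof (intro conjI ballI)
  show "openin (top_of_set F) V" unfolding V_def mtopology_F[symmetric] by (rule openin_mball)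
  have "open (upper \<inter> (\<lambda>w. hyp_dist (f x) w) -` {..<\<rho>})"
  proof -
   have "continuous_on upper (\<lambda>w. hyp_dist (f x) w)" using fx by (intro continuous_on_hyp_dist continuous_intros) auto
   then show ?thesis by (metis Int_commute continuous_on_open_vimage open_lessThan open_upper)
  qed
  moreover have "f ` V = ?H \<inter> (upper \<inter> (\<lambda>w. hyp_dist (f x) w) -` {..<\<rho>})" unfolding fV by auto
  ultimately show "openin (top_of_set ?H) (f ` V)" by (auto simp: openin_open)
  show "d u v = hyp_dist (f u) (f v)" if "u \<in> V" "v \<in> V" for u v using that h(4) \<rho>(2) unfolding V_def by blast
 qed
 have gV: "gchart V f" unfolding gchart_def using chV id_isoms by (metis id_apply)
 have "cchart V f" unfolding cchart_def
 proof (intro conjI ballI gV)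
  fix z w s assume zw: "z \<in> f ` V" "w \<in> f ` V" and s: "s \<in> {0..1::real}"
  let ?r = "max (hyp_dist (f x) z) (hyp_dist (f x) w)"
  have zw': "0 < Im z" "0 < Im w" "0 \<le> Re z" "0 \<le> Re w" "?r < \<rho>" using zw unfolding fV by auto
  have "hyp_dist (f x) (cvx z w s) \<le> ?r" using zw' s fx by (intro cvx_ball) auto
  then show "cvx z w s \<in> f ` V" unfolding fV using zw' s cvx_halfplane[of z w s] cvx_h(1)[of z w s] by auto
 qed
 moreover have "mcball x (\<rho> / 2) \<subseteq> V" using \<rho> x unfolding B V by auto
 moreover have "compact (f ` mcball x (\<rho> / 2))"
 proof -
  have "f ` mcball x (\<rho> / 2) = {w. 0 < Im w \<and> hyp_dist (f x) w \<le> \<rho> / 2} \<inter> {w. Re w \<ge> 0}" unfolding fB by auto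
  then show ?thesis using compact_hyp_cball[OF fx(1)] closed_halfspace_Re_ge by (metis compact_Int_closed)
 qed
 ultimately show ?thesis using that[of "\<rho> / 2" V f] \<rho> by simp
qed

text \<open>A germ of an isometric chart at \<open>x\<close> is written \<open>T o base_chart x\<close> with \<open>T\<close> an isometry.\<close>

definition base_pair :: "'a \<Rightarrow> 'a set \<times> ('a \<Rightarrow> complex)" where
 "base_pair x = (SOME c. x \<in> fst c \<and> cchart (fst c) (snd c))"

definition base_dom :: "'a \<Rightarrow> 'a set" where "base_dom x = fst (base_pair x)"
definition base_chart :: "'a \<Rightarrow> 'a \<Rightarrow> complex" where "base_chart x = snd (base_pair x)"

lemma base_chart: assumes "x \<in> F" shows "x \<in> base_dom x" "cchart (base_dom x) (base_chart x)" "gchart (base_dom x) (base_chart x)"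
proof -
 obtain r U e where "0 < r" "cchart U e" "mcball x r \<subseteq> U" using cchart_ball_ex[OF assms] by metis
 then have "x \<in> fst (U, e) \<and> cchart (fst (U, e)) (snd (U, e))" using assms by auto
 then have "x \<in> fst (base_pair x) \<and> cchart (fst (base_pair x)) (snd (base_pair x))" unfolding base_pair_def by (rule someI)
 then show "x \<in> base_dom x" "cchart (base_dom x) (base_chart x)" "gchart (base_dom x) (base_chart x)" by (auto simp: base_dom_def base_chart_def cchart_def)
qed

text \<open>The germs of one chart \<open>e\<close> at all points of its domain: the local section
  of the bundle of germs along which charts are continued.\<close>

definition sheet :: "'a set \<Rightarrow> ('a \<Rightarrow> complex) \<Rightarrow> ('a \<times> (complex \<Rightarrow> complex)) set" where
 "sheet U e = {(x, T). x \<in> U \<and> T \<in> isoms \<and> (\<forall>u\<in>U \<inter> base_dom x. e u = T (base_chart x u))}"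

text \<open>The developing map: a germ is sent to its value at its own base point.\<close>

definition dev :: "'a \<times> (complex \<Rightarrow> complex) \<Rightarrow> complex" where
 "dev m = snd m (base_chart (fst m) (fst m))"

lemma sheet_fst: "m \<in> sheet U e \<Longrightarrow> fst m \<in> U" by (auto simp: sheet_def)

lemma dev_sheet: "gchart U e \<Longrightarrow> m \<in> sheet U e \<Longrightarrow> dev m = e (fst m)" using gchartD(2)[of U e] base_chart(1) by (auto simp: sheet_def dev_def)

lemma sheet_ex:
 assumes "gchart U e" "x \<in> U"
 obtains T where "(x, T) \<in> sheet U e"
proof -
 have x: "x \<in> F" using gchartD assms by blast
 obtain T where "T \<in> isoms" "\<And>u. u \<in> base_dom x \<inter> U \<Longrightarrow> e u = T (base_chart x u)"
  using gchart_transition[OF base_chart(3)[OF x] assms(1)] base_chart(1)[OF x] assms(2) by blast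
 then show ?thesis using that[of T] assms by (auto simp: sheet_def)
qed

lemma open_overlap:
 assumes "gchart U e" "x \<in> U"
 shows "openin mtopology (U \<inter> base_dom x)" "U \<inter> base_dom x \<noteq> {}" using assms gchartD(1,2) base_chart[of x] by blast+

lemma sheet_unique:
 assumes "gchart U e" "m \<in> sheet U e" "m' \<in> sheet U e" "fst m = fst m'"
 shows "m = m'"
proof -
 obtain x T T' where m: "m = (x, T)" "m' = (x, T')" using assms(4) by (metis prod.collapse)
 have x: "x \<in> U" "x \<in> F" using assms m sheet_fst gchartD(2) by (metis fst_conv, metis fst_conv subsetD)
 have "T = T'" using assms m open_overlap[OF assms(1) x(1)] by (intro gchart_agree_isom[OF base_chart(3)[OF x(2)] _ open_overlap[OF assms(1) x(1)]])
   (auto simp: sheet_def)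
 then show ?thesis using m by simp
qed

lemma sheet_agree:
 assumes "gchart U e" "gchart V g" "m \<in> sheet U e" "m \<in> sheet V g" "u \<in> U \<inter> V"
 shows "e u = g u"
proof -
 obtain x T where m: "m = (x, T)" by (metis prod.collapse)
 have x: "x \<in> U" "x \<in> V" "x \<in> F" using assms m sheet_fst gchartD(2) by (metis fst_conv, metis fst_conv, metis fst_conv subsetD)
 have W: "openin mtopology (U \<inter> V \<inter> base_dom x)" "U \<inter> V \<inter> base_dom x \<noteq> {}" using x gchartD(1) assms(1,2) base_chart[OF x(3)] by blast+
 show ?thesis using assms m by (intro gchart_agree[OF assms(1,2) _ W _ assms(5)]) (auto simp: sheet_def)
qed

text \<open>Uniqueness of continuation: two charts with one common germ agree on their whole
  overlap, so their sheets share every germ above it.\<close>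

lemma sheet_transfer:
 assumes "gchart U e" "gchart V g" "m \<in> sheet U e" "m \<in> sheet V g" "m' \<in> sheet V g" "fst m' \<in> U"
 shows "m' \<in> sheet U e"
proof -
 obtain x T where m': "m' = (x, T)" by (metis prod.collapse)
 have x: "x \<in> U" "x \<in> V" "x \<in> F" using assms m' sheet_fst gchartD(2) by (metis fst_conv, metis fst_conv, metis fst_conv subsetD)
 have W: "openin mtopology (U \<inter> V \<inter> base_dom x)" "U \<inter> V \<inter> base_dom x \<noteq> {}" using x gchartD(1) assms(1,2) base_chart[OF x(3)] by blast+
 have T: "T \<in> isoms" "\<And>u. u \<in> V \<inter> base_dom x \<Longrightarrow> g u = T (base_chart x u)" using assms(5) m' by (auto simp: sheet_def)
 have "e u = (T o base_chart x) u" if "u \<in> U \<inter> base_dom x" for u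
 proof (rule gchart_agree[OF assms(1) gchart_comp[OF base_chart(3)[OF x(3)] T(1)] _ W _ that])
  fix v assume "v \<in> U \<inter> V \<inter> base_dom x"
  then show "e v = (T o base_chart x) v" using T(2) sheet_agree[OF assms(1-4), of v] by auto
 qed blast
 then show ?thesis using T x m' by (auto simp: sheet_def)
qed

lemma sheet_comp: "(x, T) \<in> sheet U e \<Longrightarrow> S \<in> isoms \<Longrightarrow> (x, S o T) \<in> sheet U (S o e)" by (auto simp: sheet_def isoms_comp)

lemma sheet_ex_chart:
 assumes "x \<in> F" "T \<in> isoms" "gchart U e" "x \<in> U"
 obtains S where "S \<in> isoms" "(x, T) \<in> sheet U (S o e)"
proof -
 obtain T0 where T0: "(x, T0) \<in> sheet U e" using sheet_ex[OF assms(3,4)] by blast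
 then have i: "T0 \<in> isoms" by (simp add: sheet_def)
 let ?S = "T o finv T0"
 have S: "?S \<in> isoms" using i assms isoms_inv(1) isoms_comp by blast
 have "?S o T0 = T" using isoms_inv(4)[OF i] by (simp add: comp_assoc)
 then show ?thesis using that[OF S] sheet_comp[OF T0 S] by simp
qed

text \<open>Broken geodesics of total length \<open>L\<close> in the bundle. Every edge stays in the
  sheet of a convex chart, so its length is the distance of the base points.\<close>

inductive reach :: "real \<Rightarrow> 'a \<times> (complex \<Rightarrow> complex) \<Rightarrow> 'a \<times> (complex \<Rightarrow> complex) \<Rightarrow> bool" where
 refl: "fst m \<in> F \<Longrightarrow> snd m \<in> isoms \<Longrightarrow> reach 0 m m"
| step: "reach L m m' \<Longrightarrow> cchart U e \<Longrightarrow> m' \<in> sheet U e \<Longrightarrow> m'' \<in> sheet U e \<Longrightarrow>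
     reach (L + d (fst m') (fst m'')) m m''"

lemma cchartD: "cchart U e \<Longrightarrow> gchart U e" by (simp add: cchart_def)

lemma reach_germs:
 assumes "reach L m m'"
 shows "fst m \<in> F" "snd m \<in> isoms" "fst m' \<in> F" "snd m' \<in> isoms" using assms by (induction) (auto simp: sheet_def dest!: cchartD dest: subsetD[OF gchartD(2)])

lemma dev_upper: "fst m \<in> F \<Longrightarrow> snd m \<in> isoms \<Longrightarrow> 0 < Im (dev m)" using gchartD(3)[OF base_chart(3)] base_chart(1) by (auto simp: dev_def)

lemma reach_bounds:
 assumes "reach L m m'"
 shows "0 \<le> L" "hyp_dist (dev m) (dev m') \<le> L" "d (fst m) (fst m') \<le> L"
proof -
 have "0 \<le> L \<and> hyp_dist (dev m) (dev m') \<le> L \<and> d (fst m) (fst m') \<le> L" using assms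
 proof induction
  case (step L m m' U e m'')
  note g = gchartD[OF cchartD[OF step(2)]]
  have f: "fst m \<in> F" "fst m' \<in> F" "fst m'' \<in> F" "snd m \<in> isoms" "snd m' \<in> isoms" "snd m'' \<in> isoms"
   using step reach_germs[OF step(1)] sheet_fst g(2) by (auto simp: sheet_def)
  have "hyp_dist (dev m') (dev m'') = d (fst m') (fst m'')" using dev_sheet[OF cchartD[OF step(2)]] step(3,4) g(4) sheet_fst by auto
  moreover have "hyp_dist (dev m) (dev m'') \<le> hyp_dist (dev m) (dev m') + hyp_dist (dev m') (dev m'')" using f by (intro hyp_dist_triangle dev_upper)
  moreover have "d (fst m) (fst m'') \<le> d (fst m) (fst m') + d (fst m') (fst m'')" using f triangle by blast
  ultimately show ?case using step.IH nonneg[of "fst m'" "fst m''"] by linarith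
 qed (auto simp: )
 then show "0 \<le> L" "hyp_dist (dev m) (dev m') \<le> L" "d (fst m) (fst m') \<le> L" by auto
qed

lemma reach_trans:
 assumes "reach L m m'" "reach K m' m''"
 shows "reach (L + K) m m''" using assms(2,1)
proof (induction arbitrary: )
 case (step K m' n U e n')
 then show ?case using reach.step[of "L + K" m n U e n'] by (simp add: add.assoc)
qed simp

lemma reach_edge:
 assumes "cchart U e" "m \<in> sheet U e" "m' \<in> sheet U e"
 shows "reach (d (fst m) (fst m')) m m'"
proof -
 have "reach 0 m m" using assms gchartD(2)[OF cchartD[OF assms(1)]] by (intro reach.refl) (auto simp: sheet_def)
 from reach.step[OF this assms] show ?thesis by simp
qed

lemma reach_sym:
 assumes "reach L m m'"
 shows "reach L m' m" using assms
proof induction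
 case (refl m)
 then show ?case by (rule reach.refl)
next
 case (step L m m' U e m'')
 then show ?case using reach_trans[OF reach_edge[OF step(2,4,3)] step.IH] commute by (simp add: add.commute)
qed

text \<open>A chain no longer than \<open>r\<close> cannot leave the ball above which the chart is
  defined, so continuation along it never leaves the sheet.\<close>

lemma reach_local:
 assumes "reach L m m'" "L \<le> r" "gchart U e" "m \<in> sheet U e" "mcball (fst m) r \<subseteq> U"
 shows "m' \<in> sheet U e" using assms
proof induction
 case (step L m m' V g m'')
 have "0 \<le> d (fst m') (fst m'')" by simp
 then have m': "m' \<in> sheet U e" using step by linarith
 have "reach (L + d (fst m') (fst m'')) m m''" using reach.step[OF step(1-4)] .
 then have "d (fst m) (fst m'') \<le> r" "fst m \<in> F" "fst m'' \<in> F" using reach_bounds(3) reach_germs step.prems(1) by (meson order_trans)+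
 then have "fst m'' \<in> U" using step.prems by auto
 then show ?case using sheet_transfer[OF step.prems(2) cchartD[OF step(2)] m' step(3,4)] by blast
qed

text \<open>An edge can be cut at any length because the chart image is convex. This provides the
  intermediate points that make the bundle a length space.\<close>

lemma reach_split:
 assumes "reach L m m'" "0 \<le> t" "t \<le> L"
 obtains m'' where "reach t m m''" "reach (L - t) m'' m'"
proof -
 have "\<exists>m''. reach t m m'' \<and> reach (L - t) m'' m'" using assms
 proof induction
  case (refl m)
  then show ?case using reach.refl[OF refl(1,2)] by (intro exI[of _ m]) auto
 next
  case (step L m m' U e m'')
  let ?r = "d (fst m') (fst m'')"
  show ?case
  proof (cases "t \<le> L")
   case True
   then obtain n where n: "reach t m n" "reach (L - t) n m'" using step by blast
   have "reach (L - t + ?r) n m''" using reach.step[OF n(2) step(2-4)] .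
   then show ?thesis using n(1) by (intro exI[of _ n]) (simp add: algebra_simps)
  next
   case False
   note g = gchartD[OF cchartD[OF step(2)]]
   have U: "fst m' \<in> U" "fst m'' \<in> U" using step sheet_fst by auto
   have dd: "?r = hyp_dist (e (fst m')) (e (fst m''))" using g(4) U by blast
   obtain s where s: "s \<in> {0..1}" "hyp_dist (e (fst m')) (cvx (e (fst m')) (e (fst m'')) s) = t - L"
    "hyp_dist (cvx (e (fst m')) (e (fst m'')) s) (e (fst m'')) = ?r - (t - L)" using between_exists[OF g(3)[OF U(1)] g(3)[OF U(2)], of "t - L"] False step.prems dd by auto
   have "cvx (e (fst m')) (e (fst m'')) s \<in> e ` U" using step(2) U s(1) by (auto simp: cchart_def)
   then obtain y where y: "y \<in> U" "e y = cvx (e (fst m')) (e (fst m'')) s" by auto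
   obtain T where T: "(y, T) \<in> sheet U e" using sheet_ex[OF cchartD[OF step(2)] y(1)] .
   have "d (fst m') y = t - L" "d y (fst m'') = ?r - (t - L)" using s y g(4) U by auto
   then have e: "t = L + d (fst m') y" "L + ?r - t = d y (fst m'')" by auto
   have "reach t m (y, T)" "reach (L + ?r - t) (y, T) m''" using reach.step[OF step(1-3) T] reach_edge[OF step(2) T step(4)] unfolding e(2) unfolding e(1) by simp_all
   then show ?thesis by blast
  qed
 qed
 then show ?thesis using that by blast
qed

text \<open>Isometries of the plane act on germs from the left and preserve chains; deck
  transformations arise from this action.\<close>

lemma reach_comp:
 assumes "reach L m m'" "S \<in> isoms"
 shows "reach L (fst m, S o snd m) (fst m', S o snd m')" using assms(1)
proof induction
 case (refl m)
 then show ?case by (intro reach.refl) (use isoms_comp[OF assms(2)] in \<open>auto simp only: fst_conv snd_conv\<close>)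
next
 case (step L m m' U e m'')
 have "(fst m', S o snd m') \<in> sheet U (S o e)" "(fst m'', S o snd m'') \<in> sheet U (S o e)" using step(3,4) sheet_comp assms(2) by (metis prod.collapse)+
 from reach.step[OF step.IH cchart_comp[OF step(2) assms(2)] this] show ?case unfolding fst_conv .
qed

end

section \<open>Complete locally compact length spaces\<close>

context Metric_space
begin

text \<open>The length space property in the form of approximate intermediate points, which is the
  only form used below.\<close>

definition length_space :: bool where
 "length_space \<longleftrightarrow> (\<forall>x\<in>M. \<forall>y\<in>M. \<forall>a b. 0 \<le> a \<and> 0 < b \<and> d x y < a + b \<longrightarrow> (\<exists>z\<in>M. d x z \<le> a \<and> d z y < b))"

definition loc_compact :: bool where
 "loc_compact \<longleftrightarrow> (\<forall>x\<in>M. \<exists>r>0. compactin mtopology (mcball x r))"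

lemma length_spaceD:
 assumes "length_space" "x \<in> M" "y \<in> M" "0 \<le> a" "0 < b" "d x y < a + b"
 obtains z where "z \<in> M" "d x z \<le> a" "d z y < b" using assms unfolding length_space_def by blast

text \<open>The open half of the Hopf-Rinow argument: finitely many small compact balls cover the
  given ball with a Lebesgue number \<open>e\<close>, and a point slightly outside is within
  \<open>e\<close> of the given ball.\<close>

lemma compact_cball_extend:
 assumes "length_space" "loc_compact" "x \<in> M" "0 \<le> R" "compactin mtopology (mcball x R)"
 obtains h where "0 < h" "compactin mtopology (mcball x (R + h))"
proof -
 let ?K = "mcball x R"
 define r where "r y = (SOME r. 0 < r \<and> compactin mtopology (mcball y r))" for y
 have r: "0 < r y \<and> compactin mtopology (mcball y (r y))" if y: "y \<in> M" for y
 proof -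
  have "\<exists>h. 0 < h \<and> compactin mtopology (mcball y h)" using assms(2) y unfolding loc_compact_def by blast
  then obtain h where "0 < h \<and> compactin mtopology (mcball y h)" ..
  then show ?thesis unfolding r_def by (rule someI)
 qed
 have cov: "?K \<subseteq> \<Union> ((\<lambda>y. mball y (r y)) ` ?K)"
 proof
  fix y assume "y \<in> ?K"
  moreover then have "y \<in> mball y (r y)" using r by auto
  ultimately show "y \<in> \<Union> ((\<lambda>y. mball y (r y)) ` ?K)" by blast
 qed
 have "\<And>U. U \<in> (\<lambda>y. mball y (r y)) ` ?K \<Longrightarrow> openin mtopology U" by blast
 then obtain \<F> where \<F>: "finite \<F>" "\<F> \<subseteq> (\<lambda>y. mball y (r y)) ` ?K" "?K \<subseteq> \<Union>\<F>" using compactinD[OF assms(5) _ cov] by blast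
 then obtain K' where K': "finite K'" "K' \<subseteq> ?K" "?K \<subseteq> \<Union> ((\<lambda>y. mball y (r y)) ` K')" using finite_subset_image[OF \<F>(1,2)] by blast
 have "\<And>U. U \<in> (\<lambda>y. mball y (r y)) ` K' \<Longrightarrow> openin mtopology U" by blast
 then obtain e where e: "0 < e" "\<And>y. y \<in> ?K \<Longrightarrow> \<exists>U\<in>(\<lambda>y. mball y (r y)) ` K'. mball y e \<subseteq> U"
  using lebesgue_number[OF assms(5) K'(3)] by meson
 let ?B = "\<Union> ((\<lambda>y. mcball y (r y)) ` K')"
 have "compactin mtopology ?B" using K' r by (intro compactin_Union) auto
 moreover have "mcball x (R + e / 2) \<subseteq> ?B"
 proof
  fix y assume y: "y \<in> mcball x (R + e / 2)"
  then have "d x y < R + e" "y \<in> M" using e(1) by auto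
  then obtain z where z: "z \<in> M" "d x z \<le> R" "d z y < e" using length_spaceD[OF assms(1,3) _ assms(4) e(1)] by blast
  then obtain k where "k \<in> K'" "mball z e \<subseteq> mball k (r k)" using e(2)[of z] assms(3) by auto
  moreover have "y \<in> mball z e" using z \<open>y \<in> M\<close> by simp
  ultimately have "y \<in> mball k (r k)" "k \<in> K'" by auto
  then show "y \<in> ?B" by (metis UN_iff mball_subset_mcball subsetD)
 qed
 ultimately have "compactin mtopology (mcball x (R + e / 2))" by (rule closed_compactin) auto
 then show ?thesis using that[of "e / 2"] e by simp
qed

text \<open>The closed half: a finite net of a slightly smaller ball is a coarser net of the whole
  ball, so the ball is totally bounded, and completeness makes it compact.\<close>

lemma compact_cball_limit:
 assumes "length_space" "mcomplete" "x \<in> M" "0 < R"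
  and "\<And>R'. 0 \<le> R' \<Longrightarrow> R' < R \<Longrightarrow> compactin mtopology (mcball x R')"
 shows "compactin mtopology (mcball x R)"
proof -
 have "mtotally_bounded (mcball x R)" unfolding mtotally_bounded_def
 proof (intro allI impI)
  fix h :: real assume e: "0 < h"
  define R' where "R' = max 0 (R - h / 4)"
  have R': "0 \<le> R'" "R' < R" "R < R' + h / 2" using assms(4) e by (auto simp: R'_def)
  obtain K where K: "finite K" "K \<subseteq> mcball x R'" "mcball x R' \<subseteq> (\<Union>z\<in>K. mball z (h / 2))"
   using compactin_imp_mtotally_bounded[OF assms(5)[OF R'(1,2)]] e unfolding mtotally_bounded_def by (meson half_gt_zero)
  have "mcball x R \<subseteq> (\<Union>z\<in>K. mball z h)"
  proof
   fix y assume y: "y \<in> mcball x R"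
   then have "y \<in> M" "d x y < R' + h / 2" using R' by auto
   then obtain z where z: "z \<in> M" "d x z \<le> R'" "d z y < h / 2" using length_spaceD[OF assms(1,3) _ R'(1), of y "h / 2"] e by auto
   then obtain k where "k \<in> K" "z \<in> mball k (h / 2)" using K(3) assms(3) by (auto simp: subset_iff)
   then have "d k y < h" "k \<in> M" using z triangle[of k z y] \<open>y \<in> M\<close> by auto
   then show "y \<in> (\<Union>z\<in>K. mball z h)" using \<open>k \<in> K\<close> \<open>y \<in> M\<close> by auto
  qed
  moreover have "K \<subseteq> mcball x R" using K(2) R'(2) by (meson dual_order.trans less_imp_le mcball_subset_concentric)
  ultimately show "\<exists>K. finite K \<and> K \<subseteq> mcball x R \<and> mcball x R \<subseteq> (\<Union>z\<in>K. mball z h)" using K(1) by blast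
 qed
 then have "compactin mtopology (mtopology closure_of mcball x R)" using mtotally_bounded_eq_compact_closure_of[OF assms(2)] by blast
 then show ?thesis by (simp add: closure_of_closedin)
qed

text \<open>The supremum of the radii with compact ball is attained by the limit step and then
  exceeded by the extension step, unless every radius occurs.\<close>

proposition hopf_rinow:
 assumes "length_space" "loc_compact" "mcomplete" "x \<in> M"
 shows "compactin mtopology (mcball x R)"
proof (rule ccontr)
 assume R: "\<not> compactin mtopology (mcball x R)"
 define S where "S = {r. 0 \<le> r \<and> compactin mtopology (mcball x r)}"
 have down: "compactin mtopology (mcball x r)" if "r' \<in> S" "r \<le> r'" for r r'
  using that closed_compactin[OF _ mcball_subset_concentric[OF that(2), of x]] by (auto simp: S_def)
 have "mcball x 0 = {x}" using assms(4) by (auto simp: in_mcball intro: antisym) (metis antisym nonneg zero)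
 then have 0: "0 \<in> S" by (simp add: S_def assms(4))
 have bdd: "r \<le> R" if "r \<in> S" for r using down[OF that, of R] R by force
 then have bd: "bdd_above S" by (rule bdd_aboveI)
 define s where "s = Sup S"
 have s0: "0 \<le> s" unfolding s_def by (rule cSup_upper[OF 0 bd])
 have "compactin mtopology (mcball x s)"
 proof (cases "s = 0")
  case True then show ?thesis using 0 by (simp add: S_def)
 next
  case False
  show ?thesis
  proof (rule compact_cball_limit[OF assms(1,3,4)])
   fix R' assume "0 \<le> R'" "R' < s"
   then obtain r where "r \<in> S" "R' < r" unfolding s_def using less_cSup_iff[OF _ bd] 0 by blast
   then show "compactin mtopology (mcball x R')" using down by (meson less_imp_le)
  qed (use False s0 in simp)
 qed
 then obtain q where "0 < q" "compactin mtopology (mcball x (s + q))" using compact_cball_extend[OF assms(1,2,4) s0] by blast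
 then have "s + q \<in> S" using s0 by (simp add: S_def)
 then have "s + q \<le> s" unfolding s_def by (rule cSup_upper[OF _ bd])
 then show False using \<open>0 < q\<close> by simp
qed

lemma between_point:
 assumes "length_space" "\<And>R. compactin mtopology (mcball x R)" "x \<in> M" "y \<in> M" "0 \<le> t" "t \<le> d x y"
 obtains z where "z \<in> M" "d x z = t" "d z y = d x y - t"
proof -
 have "\<exists>z\<in>M. d x z \<le> t \<and> d z y < d x y - t + 1 / Suc n" for n
 proof -
  have "0 < d x y - t + 1 / Suc n" using assms(6) by (intro add_nonneg_pos) auto
  then show ?thesis using length_spaceD[OF assms(1,3,4,5), of "d x y - t + 1 / Suc n"] by auto
 qed
 then obtain q where q: "\<And>n. q n \<in> M" "\<And>n. d x (q n) \<le> t" "\<And>n. d (q n) y < d x y - t + 1 / Suc n" by metis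
 have "range q \<subseteq> mcball x t" using q assms(3) by auto
 then obtain z r where z: "z \<in> mcball x t" "strict_mono r" "limitin mtopology (q o r) z sequentially" using assms(2)[of t] unfolding compactin_sequentially by blast
 have zM: "z \<in> M" "d x z \<le> t" using z(1) by auto
 have l0: "(\<lambda>n. d (q (r n)) z) \<longlonglongrightarrow> 0" using z(3) by (simp add: limitin_metric_dist_null o_def)
 have l1: "(\<lambda>n. d x y - t + 1 / Suc (r n)) \<longlonglongrightarrow> d x y - t + 0" using LIMSEQ_subseq_LIMSEQ[OF LIMSEQ_inverse_real_of_nat z(2)]
  by (intro tendsto_add tendsto_const) (simp add: o_def inverse_eq_divide)
 have "d z y \<le> d x y - t + 0 + 0"
 proof (rule LIMSEQ_le_const[OF tendsto_add[OF l1 l0]], intro exI allI impI)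
  fix n
  show "d z y \<le> d x y - t + 1 / Suc (r n) + d (q (r n)) z" using triangle[of z "q (r n)" y] q(1,3)[of "r n"] zM assms(4) commute[of z "q (r n)"] by fastforce
 qed
 then have "d x z = t" "d z y = d x y - t" using zM triangle[of x z y] assms(3,4) by auto
 then show ?thesis using that zM by blast
qed

lemma equidistant_chain:
 assumes "length_space" "\<And>x R. x \<in> M \<Longrightarrow> compactin mtopology (mcball x R)" "x \<in> M" "y \<in> M" "0 \<le> s" "d x y = n * s"
 shows "\<exists>p. p 0 = x \<and> p n = y \<and> (\<forall>i\<le>n. p i \<in> M) \<and> (\<forall>i<n. d (p i) (p (Suc i)) = s)" using assms(3,6)
proof (induction n arbitrary: x)
 case 0
 then show ?case using assms(4) by (intro exI[of _ "\<lambda>i. x"]) auto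
next
 case (Suc n)
 have "s \<le> d x y" using Suc.prems assms(5) by (simp add: algebra_simps)
 then obtain z where z: "z \<in> M" "d x z = s" "d z y = d x y - s" using between_point[OF assms(1) assms(2)[OF Suc.prems(1)] Suc.prems(1) assms(4,5)] by blast
 then have "d z y = n * s" using Suc.prems by (simp add: algebra_simps)
 then obtain p where p: "p 0 = z" "p n = y" "\<forall>i\<le>n. p i \<in> M" "\<forall>i<n. d (p i) (p (Suc i)) = s" using Suc.IH[OF z(1)] by blast
 let ?q = "\<lambda>i. if i = 0 then x else p (i - 1)"
 show ?case
 proof (intro exI[of _ ?q] conjI allI impI)
  fix i assume i: "i < Suc n"
  show "d (?q i) (?q (Suc i)) = s"
  proof (cases i)
   case (Suc j)
   then show ?thesis using p(4) i by simp
  qed (use p z in simp)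
 qed (use p Suc.prems in auto)
qed

text \<open>A shortest connection is divided into equal steps below a Lebesgue number. Consecutive
  triples are then mapped isometrically, so their images are aligned, and
  \<open>geodesic_chain\<close> shows that no length is lost. In particular such a map is
  injective.\<close>

proposition local_isometry_hyp:
 assumes "length_space" "loc_compact" "mcomplete"
  and D: "\<And>x. x \<in> M \<Longrightarrow> 0 < Im (D x)"
  and loc: "\<And>x. x \<in> M \<Longrightarrow> \<exists>r>0. \<forall>y\<in>mball x r. \<forall>z\<in>mball x r. hyp_dist (D y) (D z) = d y z"
  and xy: "x \<in> M" "y \<in> M"
 shows "hyp_dist (D x) (D y) = d x y"
proof (cases "x = y")
 case True
 then show ?thesis using xy by simp
next
 case False
 let ?L = "d x y"
 have L: "0 < ?L" using False xy by simp
 note cpt = hopf_rinow[OF assms(1-3)]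
 define C where "C = {U. openin mtopology U \<and> (\<forall>y\<in>U. \<forall>z\<in>U. hyp_dist (D y) (D z) = d y z)}"
 have cov: "mcball y ?L \<subseteq> \<Union>C"
 proof
  fix u assume "u \<in> mcball y ?L"
  then have u: "u \<in> M" by auto
  then obtain r where "r > 0" "\<forall>y\<in>mball u r. \<forall>z\<in>mball u r. hyp_dist (D y) (D z) = d y z" using loc by blast
  then show "u \<in> \<Union>C" unfolding C_def using u by (intro UnionI[of "mball u r"]) auto
 qed
 have "\<And>U. U \<in> C \<Longrightarrow> openin mtopology U" by (simp add: C_def)
 then obtain e where e: "0 < e" "\<And>u. u \<in> mcball y ?L \<Longrightarrow> \<exists>U\<in>C. mball u e \<subseteq> U" using lebesgue_number[OF cpt[OF xy(2)] cov] by meson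
 obtain n where n: "?L / e < real n" using reals_Archimedean2 by blast
 have n0: "0 < n" using n divide_pos_pos[OF L e(1)] by (cases n) auto
 define s where "s = ?L / n"
 have s: "0 < s" "s < e" "?L = n * s" using n n0 L e(1) by (auto simp: s_def pos_divide_less_eq mult.commute)
 obtain p where p: "p 0 = x" "p n = y" "\<And>i. i \<le> n \<Longrightarrow> p i \<in> M" "\<And>i. i < n \<Longrightarrow> d (p i) (p (Suc i)) = s"
  using equidistant_chain[OF assms(1) cpt xy less_imp_le[OF s(1)] s(3)] by blast
 have le: "d (p i) (p (i + k)) \<le> k * s" if "i + k \<le> n" for i k using that
 proof (induction k)
  case (Suc k)
  have "d (p i) (p (i + Suc k)) \<le> d (p i) (p (i + k)) + d (p (i + k)) (p (i + Suc k))" using Suc.prems p(3) by (intro triangle) auto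
  then show ?case using Suc p(4)[of "i + k"] by (simp add: algebra_simps)
 qed (use p(3) in simp)
 have eq: "d (p i) (p (i + k)) = k * s" if "i + k \<le> n" for i k
 proof -
  have "n * s \<le> d (p 0) (p i) + d (p i) (p (i + k)) + d (p (i + k)) (p n)"
   using triangle[of "p 0" "p i" "p n"] triangle[of "p i" "p (i + k)" "p n"] p(3)[of 0] p(3)[of i] p(3)[of "i + k"] p(3)[of n] that s(3) p(1,2) by fastforce
  moreover have "d (p 0) (p i) \<le> i * s" using le[of 0 i] that by simp
  moreover have "d (p (i + k)) (p n) \<le> (real n - i - k) * s" using le[of "i + k" "n - i - k"] that by (simp add: of_nat_diff diff_diff_eq)
  ultimately have "k * s \<le> d (p i) (p (i + k))" by (simp add: algebra_simps)
  then show ?thesis using le[OF that] by simp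
 qed
 have near: "hyp_dist (D (p a)) (D (p b)) = d (p a) (p b)"
  if "c \<le> n" "a \<le> n" "b \<le> n" "d (p c) (p a) < e" "d (p c) (p b) < e" for a b c
 proof -
  have "d y (p c) = real (n - c) * s" using eq[of c "n - c"] that p(2) commute[of y "p c"] by simp
  also have "\<dots> \<le> real n * s" using s by (intro mult_right_mono) auto
  finally have "d y (p c) \<le> ?L" using s by simp
  then have "p c \<in> mcball y ?L" using xy p(3)[OF that(1)] by simp
  then obtain U where "U \<in> C" "mball (p c) e \<subseteq> U" using e(2) by blast
  moreover have "p a \<in> mball (p c) e" "p b \<in> mball (p c) e" using that p(3) by auto
  ultimately show ?thesis unfolding C_def by blast
 qed
 have "hyp_dist (D (p 0)) (D (p n)) = n * s"
 proof (rule geodesic_chain[of n "\<lambda>i. D (p i)"])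
  show "0 < Im (D (p i))" if "i \<le> n" for i using D p(3) that by blast
  show "hyp_dist (D (p i)) (D (p (Suc i))) = s" if "i < n" for i using near[of i i "Suc i"] p(3)[of i] p(4)[OF that] that s e(1) by simp
  show "hyp_dist (D (p i)) (D (p (Suc (Suc i)))) = 2 * s" if "Suc i < n" for i using near[of "Suc i" i "Suc (Suc i)"] p(4)[of i] p(4)[of "Suc i"] eq[of i 2] that s commute by simp
 qed (rule s)
 then show ?thesis using p s by simp
qed

end

section \<open>Uniformization\<close>

context hyp_metric
begin

definition germ0 :: "'a \<times> (complex \<Rightarrow> complex)" where
 "germ0 = (SOME x. x \<in> F, id)"

text \<open>The component of one germ. It serves as the universal cover of \<open>F\<close>:
  \<open>dev\<close> will identify it isometrically with a convex set.\<close>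

definition bun :: "('a \<times> (complex \<Rightarrow> complex)) set" where
 "bun = {m. \<exists>L. reach L germ0 m}"

text \<open>The value 0 outside \<open>bun\<close> is a convention: \<open>Metric_space\<close> asks
  for symmetry and non-negativity at all arguments.\<close>

definition bdist :: "'a \<times> (complex \<Rightarrow> complex) \<Rightarrow> 'a \<times> (complex \<Rightarrow> complex) \<Rightarrow> real" where
 "bdist m m' = (if m \<in> bun \<and> m' \<in> bun then Inf {L. reach L m m'} else 0)"

lemma germ0_bundle: "germ0 \<in> bun"
proof -
 have "(SOME x. x \<in> F) \<in> F" using F_ne by (meson someI_ex ex_in_conv)
 then have "reach 0 germ0 germ0" by (intro reach.refl) (auto simp: germ0_def)
 then show ?thesis by (auto simp: bun_def)
qed

lemma bundle_germs:
 assumes "m \<in> bun"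
 shows "fst m \<in> F" "snd m \<in> isoms" "0 < Im (dev m)"
proof -
 obtain L where "reach L germ0 m" using assms by (auto simp: bun_def)
 then show "fst m \<in> F" "snd m \<in> isoms" by (rule reach_germs)+
 then show "0 < Im (dev m)" by (rule dev_upper)
qed

lemma bundle_reach: "m \<in> bun \<Longrightarrow> m' \<in> bun \<Longrightarrow> \<exists>L. reach L m m'" using reach_trans reach_sym unfolding bun_def by blast

lemma bundle_closed: "m \<in> bun \<Longrightarrow> reach L m m' \<Longrightarrow> m' \<in> bun" using reach_trans unfolding bun_def by blast

lemma bdist_le:
 assumes "m \<in> bun" "reach L m m'"
 shows "bdist m m' \<le> L"
proof -
 have "bdd_below {L. reach L m m'}" using reach_bounds(1) by (intro bdd_belowI[of _ 0]) auto
 then show ?thesis using assms bundle_closed[OF assms] by (auto simp: bdist_def intro: cInf_lower)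
qed

lemma bdist_less:
 assumes "m \<in> bun" "m' \<in> bun" "bdist m m' < c"
 obtains L where "L < c" "reach L m m'"
proof -
 have "{L. reach L m m'} \<noteq> {}" using bundle_reach assms by blast
 then show ?thesis using cInf_lessD[of "{L. reach L m m'}" c] assms that by (auto simp: bdist_def)
qed

lemma bdist_ge:
 assumes "m \<in> bun" "m' \<in> bun"
 shows "hyp_dist (dev m) (dev m') \<le> bdist m m'" "d (fst m) (fst m') \<le> bdist m m'"
proof -
 have ne: "{L. reach L m m'} \<noteq> {}" using bundle_reach assms by blast
 have e: "bdist m m' = Inf {L. reach L m m'}" using assms by (simp add: bdist_def)
 show "hyp_dist (dev m) (dev m') \<le> bdist m m'" "d (fst m) (fst m') \<le> bdist m m'" unfolding e by (rule cInf_greatest[OF ne], use reach_bounds in blast)+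
qed

lemma bdist_nonneg: "0 \<le> bdist m m'"
proof (cases "m \<in> bun \<and> m' \<in> bun")
 case True
 then show ?thesis using bdist_ge(2)[of m m'] nonneg[of "fst m" "fst m'"] by linarith
next
 case False
 then show ?thesis by (auto simp: bdist_def)
qed

lemma ball_sheet:
 assumes "m \<in> bun" "m' \<in> bun" "bdist m m' < r" "gchart U e" "m \<in> sheet U e" "mcball (fst m) r \<subseteq> U"
 shows "m' \<in> sheet U e"
proof -
 obtain L where "L < r" "reach L m m'" using bdist_less[OF assms(1-3)] .
 then show ?thesis using reach_local[of L m m' r U e] assms by simp
qed

lemma sheet_bdist:
 assumes "cchart U e" "m \<in> bun" "m \<in> sheet U e" "m' \<in> sheet U e"
 shows "m' \<in> bun" "bdist m m' = d (fst m) (fst m')" "hyp_dist (dev m) (dev m') = d (fst m) (fst m')"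
proof -
 have r: "reach (d (fst m) (fst m')) m m'" using reach_edge assms by blast
 then show m': "m' \<in> bun" using bundle_closed assms by blast
 have "bdist m m' \<le> d (fst m) (fst m')" using bdist_le assms r by blast
 then show "bdist m m' = d (fst m) (fst m')" using bdist_ge(2)[OF assms(2) m'] by simp
 show "hyp_dist (dev m) (dev m') = d (fst m) (fst m')" using dev_sheet[OF cchartD[OF assms(1)]] assms gchartD(4)[OF cchartD[OF assms(1)]] sheet_fst by auto
qed

definition fine_chart :: "'a \<Rightarrow> real \<Rightarrow> 'a set \<Rightarrow> ('a \<Rightarrow> complex) \<Rightarrow> bool" where
 "fine_chart x r U e \<longleftrightarrow> 0 < r \<and> cchart U e \<and> mcball x r \<subseteq> U \<and> compact (e ` mcball x r)"

text \<open>The radius depends on the base point only and serves all germs above it at once. This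
  uniformity is what later yields evenly covered neighbourhoods.\<close>

lemma fine_chart_sheet:
 assumes "x \<in> F"
 obtains r U where "0 < r" "\<And>T. T \<in> isoms \<Longrightarrow> \<exists>e. fine_chart x r U e \<and> (x, T) \<in> sheet U e"
proof -
 obtain r U e where r: "0 < r" "cchart U e" "mcball x r \<subseteq> U" "compact (e ` mcball x r)" using cchart_ball_ex[OF assms] .
 have x: "x \<in> U" using r assms by auto
 have "\<exists>e. fine_chart x r U e \<and> (x, T) \<in> sheet U e" if T: "T \<in> isoms" for T
 proof -
  obtain S where S: "S \<in> isoms" "(x, T) \<in> sheet U (S o e)" using sheet_ex_chart[OF assms T cchartD[OF r(2)] x] .
  have "e ` mcball x r \<subseteq> upper" using gchartD(3)[OF cchartD[OF r(2)]] r(3) by auto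
  then have "compact (S ` e ` mcball x r)" using continuous_on_isom[OF S(1)] r(4) by (meson compact_continuous_image continuous_on_subset)
  then have "fine_chart x r U (S o e)" using r cchart_comp[OF r(2) S(1)] by (auto simp: fine_chart_def image_comp)
  then show ?thesis using S by blast
 qed
 then show ?thesis using that r by blast
qed

lemma fine_chart_ex:
 assumes "m \<in> bun"
 obtains r U e where "fine_chart (fst m) r U e" "m \<in> sheet U e" using fine_chart_sheet[OF bundle_germs(1)[OF assms]] bundle_germs(2)[OF assms] by (metis prod.collapse)

lemma bundle_metric: "Metric_space bun bdist"
proof
 fix m m' m''
 show "0 \<le> bdist m m'" by (rule bdist_nonneg)
 show "bdist m m' = bdist m' m"
 proof -
  have "{L. reach L m m'} = {L. reach L m' m}" using reach_sym by blast
  then show ?thesis by (auto simp: bdist_def)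
 qed
 assume m: "m \<in> bun" "m' \<in> bun"
 show "bdist m m' = 0 \<longleftrightarrow> m = m'"
 proof
  assume 0: "bdist m m' = 0"
  obtain r U e where f: "fine_chart (fst m) r U e" "m \<in> sheet U e" using fine_chart_ex[OF m(1)] .
  then have "m' \<in> sheet U e" using 0 by (intro ball_sheet[OF m, of r]) (auto simp: fine_chart_def dest: cchartD)
  moreover have "fst m = fst m'" using bdist_ge(2)[OF m] 0 m bundle_germs(1) nonneg[of "fst m" "fst m'"] by (metis order_antisym zero)
  ultimately show "m = m'" using sheet_unique[of U e m m'] f by (auto simp: fine_chart_def dest: cchartD)
 next
  assume "m = m'"
  moreover have "reach 0 m m" using m bundle_germs by (intro reach.refl)
  ultimately show "bdist m m' = 0" using bdist_le[OF m(1)] bdist_nonneg[of m m'] by fastforce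
 qed
 assume m'': "m'' \<in> bun"
 show "bdist m m'' \<le> bdist m m' + bdist m' m''"
 proof (rule field_le_epsilon)
  fix h :: real assume "0 < h"
  obtain L where L: "L < bdist m m' + h / 2" "reach L m m'" using bdist_less[OF m, of "bdist m m' + h / 2"] \<open>0 < h\<close> by auto
  obtain K where K: "K < bdist m' m'' + h / 2" "reach K m' m''" using bdist_less[OF m(2) m'', of "bdist m' m'' + h / 2"] \<open>0 < h\<close> by auto
  have "bdist m m'' \<le> L + K" using bdist_le[OF m(1) reach_trans[OF L(2) K(2)]] .
  then show "bdist m m'' \<le> bdist m m' + bdist m' m'' + h" using L K by simp
 qed
qed

interpretation B: Metric_space bun bdist by (rule bundle_metric)

lemma fine_chart_ball:
 assumes "fine_chart (fst m) r U e" "m \<in> sheet U e" "m \<in> bun" "m' \<in> B.mball m r"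
 shows "m' \<in> sheet U e" using assms by (intro ball_sheet[of m m' r]) (auto simp: fine_chart_def dest: cchartD)

lemma bundle_length_space: "B.length_space" unfolding B.length_space_def
proof (intro ballI allI impI, elim conjE)
 fix m m' and a b :: real
 assume m: "m \<in> bun" "m' \<in> bun" and ab: "0 \<le> a" "0 < b" "bdist m m' < a + b"
 obtain L where L: "L < a + b" "reach L m m'" using bdist_less[OF m ab(3)] .
 have L0: "0 \<le> L" using reach_bounds(1)[OF L(2)] .
 obtain n where n: "reach (min a L) m n" "reach (L - min a L) n m'" using reach_split[OF L(2), of "min a L"] ab L0 by auto
 have "n \<in> bun" using bundle_closed m n by blast
 moreover have "bdist m n \<le> a" using bdist_le[OF m(1) n(1)] by simp
 moreover have "bdist n m' < b" using bdist_le[OF \<open>n \<in> bun\<close> n(2)] L ab by linarith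
 ultimately show "\<exists>n\<in>bun. bdist m n \<le> a \<and> bdist n m' < b" by blast
qed

lemma bundle_loc_compact: "B.loc_compact" unfolding B.loc_compact_def
proof
 fix m assume m: "m \<in> bun"
 obtain r U e where f: "fine_chart (fst m) r U e" "m \<in> sheet U e" using fine_chart_ex[OF m] .
 then have r: "0 < r" "cchart U e" "mcball (fst m) r \<subseteq> U" "compact (e ` mcball (fst m) r)" by (auto simp: fine_chart_def)
 note g = gchartD[OF cchartD[OF r(2)]]
 have "compactin B.mtopology (B.mcball m (r / 2))" unfolding B.compactin_sequentially
 proof (intro conjI allI impI)
  fix j :: "nat \<Rightarrow> _" assume j: "range j \<subseteq> B.mcball m (r / 2)"
  have jb: "j n \<in> bun" "bdist m (j n) \<le> r / 2" for n using subsetD[OF j, of "j n"] by auto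
  have js: "j n \<in> sheet U e" for n using fine_chart_ball[OF f m, of "j n"] jb[of n] r(1) m by auto
  have "fst (j n) \<in> mcball (fst m) r" for n using bdist_ge(2)[OF m jb(1)[of n]] jb[of n] r(1) m bundle_germs(1) by (auto intro: order_trans)
  then have "\<forall>n. e (fst (j n)) \<in> e ` mcball (fst m) r" by blast
  then obtain l s where l: "l \<in> e ` mcball (fst m) r" "strict_mono s" "((\<lambda>n. e (fst (j n))) o s) \<longlonglongrightarrow> l" using r(4) unfolding compact_def by meson
  then obtain y where y: "y \<in> mcball (fst m) r" "l = e y" by blast
  have yU: "y \<in> U" using y r by blast
  obtain T where T: "(y, T) \<in> sheet U e" using sheet_ex[OF cchartD[OF r(2)] yU] .
  have Tb: "(y, T) \<in> bun" using sheet_bdist(1)[OF r(2) m f(2) T] .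
  have bd: "bdist (j n) (y, T) = hyp_dist (e (fst (j n))) (e y)" for n using sheet_bdist(2)[OF r(2) jb(1) js T, of n] g(4)[OF sheet_fst[OF js] yU] by simp
  have lim: "limitin B.mtopology (j o s) (y, T) sequentially" unfolding B.limitin_metric
  proof (intro conjI Tb allI impI)
   fix h :: real assume "0 < h"
   obtain q where q: "0 < q" "\<And>w. dist (e y) w < q \<Longrightarrow> 0 < Im w \<and> hyp_dist (e y) w < h" using hyp_dist_near[OF g(3)[OF yU] \<open>0 < h\<close>] by blast
   have "\<forall>\<^sub>F n in sequentially. dist (e (fst (j (s n)))) (e y) < q" using tendstoD[OF l(3) q(1)] y by simp
   then show "\<forall>\<^sub>F n in sequentially. (j o s) n \<in> bun \<and> bdist ((j o s) n) (y, T) < h"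
   proof eventually_elim
    case (elim n)
    then show ?case using q(2)[of "e (fst (j (s n)))"] jb(1) by (simp add: bd dist_commute hyp_dist_commute)
   qed
  qed
  then have "(y, T) \<in> B.mcball m (r / 2)"
  proof -
   have "\<forall>\<^sub>F n in sequentially. (j o s) n \<in> B.mcball m (r / 2)" using subsetD[OF j rangeI] by (simp del: B.in_mcball)
   then show ?thesis by (rule limitin_closedin[OF lim B.closedin_mcball]) simp
  qed
  then show "\<exists>l s. l \<in> B.mcball m (r / 2) \<and> strict_mono s \<and> limitin B.mtopology (j o s) l sequentially" using l(2) lim by blast
 qed (rule B.mcball_subset_mspace)
 then show "\<exists>r>0. compactin B.mtopology (B.mcball m r)" using r(1) by (intro exI[of _ "r / 2"] conjI) simp_all
qed

text \<open>The base points of a Cauchy sequence converge in \<open>F\<close>. From some index on,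
  all germs lie in one sheet over a ball around the limit, and the germ of that sheet at the limit
  point is the limit.\<close>

lemma bundle_mcomplete: "B.mcomplete" unfolding B.mcomplete_def
proof (intro allI impI)
 fix q assume c: "B.MCauchy q"
 then have qb: "q n \<in> bun" for n unfolding B.MCauchy_def by blast
 have c': "\<exists>N. \<forall>n n'. N \<le> n \<longrightarrow> N \<le> n' \<longrightarrow> bdist (q n) (q n') < h" if "0 < h" for h
  using c that unfolding B.MCauchy_def by blast
 have "MCauchy (\<lambda>n. fst (q n))" unfolding MCauchy_def
 proof (intro conjI allI impI)
  show "range (\<lambda>n. fst (q n)) \<subseteq> F" using bundle_germs(1)[OF qb] by blast
  fix h :: real assume "0 < h"
  then obtain N where "\<forall>n n'. N \<le> n \<longrightarrow> N \<le> n' \<longrightarrow> bdist (q n) (q n') < h" using c' by blast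
  then show "\<exists>N. \<forall>n n'. N \<le> n \<longrightarrow> N \<le> n' \<longrightarrow> d (fst (q n)) (fst (q n')) < h"
   using bdist_ge(2)[OF qb qb] by (meson order_le_less_trans)
 qed
 then obtain x where "limitin mtopology (\<lambda>n. fst (q n)) x sequentially" using complete_F by (auto simp: mcomplete_def)
 then have x: "x \<in> F" "\<And>h. 0 < h \<Longrightarrow> \<forall>\<^sub>F n in sequentially. d (fst (q n)) x < h" by (auto simp: limitin_metric eventually_conj_iff)
 obtain r U e where r: "0 < r" "cchart U e" "mcball x r \<subseteq> U" using cchart_ball_ex[OF x(1)] by metis
 have xU: "x \<in> U" using r x by auto
 obtain N1 where N1: "\<And>n n'. N1 \<le> n \<Longrightarrow> N1 \<le> n' \<Longrightarrow> bdist (q n) (q n') < r / 4" using c'[of "r / 4"] r(1) by auto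
 obtain N2 where N2: "\<And>n. N2 \<le> n \<Longrightarrow> d (fst (q n)) x < r / 4" using x(2)[of "r / 4"] r(1) by (auto simp: eventually_sequentially)
 define N where "N = max N1 N2"
 have N: "d (fst (q N)) x < r / 4" "\<And>n. N \<le> n \<Longrightarrow> bdist (q N) (q n) < r / 4" using N1 N2 by (auto simp: N_def)
 have xN: "fst (q N) \<in> F" using bundle_germs qb by blast
 have "fst (q N) \<in> mcball x r" using N(1) xN x(1) r(1) commute[of x] by auto
 then have xNU: "fst (q N) \<in> U" using r(3) by blast
 obtain S where S: "S \<in> isoms" "(fst (q N), snd (q N)) \<in> sheet U (S o e)" using sheet_ex_chart[OF xN bundle_germs(2)[OF qb] cchartD[OF r(2)] xNU] .
 let ?e = "S o e"
 have e: "cchart U ?e" "gchart U ?e" using cchart_comp r S cchartD by blast+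
 have sN: "q N \<in> sheet U ?e" using S by simp
 obtain T where T: "(x, T) \<in> sheet U ?e" using sheet_ex[OF e(2) xU] .
 note bT = sheet_bdist[OF e(1) qb sN T]
 have "q n \<in> sheet U ?e \<and> bdist (q n) (x, T) = d (fst (q n)) x" if "N \<le> n" for n
 proof -
  have "bdist (x, T) (q n) \<le> bdist (x, T) (q N) + bdist (q N) (q n)" using bT(1) qb B.triangle by blast
  also have "\<dots> < r" using bT(2) N(1) N(2)[OF that] B.commute[of "(x, T)"] r(1) by simp
  finally have "q n \<in> sheet U ?e" using ball_sheet[OF bT(1) qb _ e(2) T] r(3) by simp
  then show ?thesis using sheet_bdist(2)[OF e(1) qb _ T] by simp
 qed
 then have "limitin B.mtopology q (x, T) sequentially" unfolding B.limitin_metric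
 proof (intro conjI bT(1) allI impI)
  fix h :: real assume "0 < h"
  assume *: "\<And>n. N \<le> n \<Longrightarrow> q n \<in> sheet U ?e \<and> bdist (q n) (x, T) = d (fst (q n)) x"
  show "\<forall>\<^sub>F n in sequentially. q n \<in> bun \<and> bdist (q n) (x, T) < h" using x(2)[OF \<open>0 < h\<close>] eventually_ge_at_top[of N]
   by eventually_elim (use * qb in auto)
 qed
 then show "\<exists>l. limitin B.mtopology q l sequentially" by blast
qed

text \<open>The bundle satisfies the hypotheses of the local-to-global result, and on each sheet
  \<open>dev\<close> is the chart itself.\<close>

lemma dev_isometry:
 assumes "m \<in> bun" "m' \<in> bun"
 shows "hyp_dist (dev m) (dev m') = bdist m m'"
proof (rule B.local_isometry_hyp[where D = dev, OF bundle_length_space bundle_loc_compact bundle_mcomplete bundle_germs(3) _ assms])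
 fix m assume m: "m \<in> bun"
 obtain r U e where f: "fine_chart (fst m) r U e" "m \<in> sheet U e" using fine_chart_ex[OF m] .
 then have r: "0 < r" "cchart U e" unfolding fine_chart_def by blast+
 show "\<exists>r>0. \<forall>y\<in>B.mball m r. \<forall>z\<in>B.mball m r. hyp_dist (dev y) (dev z) = bdist y z"
 proof (intro exI[of _ r] conjI r(1) ballI)
  fix y z assume yz: "y \<in> B.mball m r" "z \<in> B.mball m r"
  then have "y \<in> sheet U e" "z \<in> sheet U e" "y \<in> bun" using fine_chart_ball[OF f m] by auto
  then show "hyp_dist (dev y) (dev z) = bdist y z" using sheet_bdist(2,3)[OF r(2), of y z] by simp
 qed
qed

lemma dev_inj: "inj_on dev bun" using dev_isometry by (intro inj_onI) (metis B.zero hyp_dist_self)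

text \<open>The universal cover realized as a closed convex set with covering map \<open>pr\<close>;
  it is a proper subset of the half plane when \<open>F\<close> has boundary.\<close>

definition X :: "complex set" where "X = dev ` bun"

definition pr :: "complex \<Rightarrow> 'a" where "pr z = fst (inv_into bun dev z)"

definition deck :: "(complex \<Rightarrow> complex) set" where
 "deck = {T \<in> isoms. T ` X = X \<and> (\<forall>z\<in>X. pr (T z) = pr z)}"

lemma pr_dev: "m \<in> bun \<Longrightarrow> pr (dev m) = fst m" by (simp add: pr_def inv_into_f_f[OF dev_inj])

lemma X_upper: "z \<in> X \<Longrightarrow> 0 < Im z" using bundle_germs(3) by (auto simp: X_def)

lemma X_closed:
 assumes z: "0 < Im z" and lim: "\<And>e. 0 < e \<Longrightarrow> \<exists>w\<in>X. hyp_dist z w < e"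
 shows "z \<in> X"
proof -
 have "\<exists>m\<in>bun. hyp_dist z (dev m) < 1 / Suc n" for n using lim[of "1 / Suc n"] unfolding X_def by simp
 then obtain q where q: "\<And>n. q n \<in> bun" "\<And>n. hyp_dist z (dev (q n)) < 1 / Suc n" by metis
 have up: "0 < Im (dev (q n))" for n using q bundle_germs(3) by blast
 have small: "hyp_dist z (dev (q n)) < e" if "1 / Suc N < e" "N \<le> n" for n N e
 proof -
  have "1 / real (Suc n) \<le> 1 / Suc N" using that by (simp add: field_simps)
  then show ?thesis using q(2)[of n] that by linarith
 qed
 have "B.MCauchy q" unfolding B.MCauchy_def
 proof (intro conjI allI impI)
  fix e :: real assume "0 < e"
  then obtain N where N: "1 / Suc N < e / 2" using nat_approx_posE[of "e / 2"] by auto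
  show "\<exists>N. \<forall>n n'. N \<le> n \<longrightarrow> N \<le> n' \<longrightarrow> bdist (q n) (q n') < e"
  proof (intro exI allI impI)
   fix n n' assume "N \<le> n" "N \<le> n'"
   then have "hyp_dist z (dev (q n)) < e / 2" "hyp_dist z (dev (q n')) < e / 2" using small N by blast+
   then show "bdist (q n) (q n') < e" using hyp_dist_triangle[OF up[of n] z up[of n']] dev_isometry[OF q(1) q(1), of n n'] by (simp add: hyp_dist_commute)
  qed
 qed (use q in auto)
 then obtain m where m: "limitin B.mtopology q m sequentially" using bundle_mcomplete by (auto simp: B.mcomplete_def)
 then have mb: "m \<in> bun" "(\<lambda>n. bdist (q n) m) \<longlonglongrightarrow> 0" by (auto simp: B.limitin_metric_dist_null)
 have "hyp_dist z (dev m) \<le> 0 + 0"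
 proof (rule LIMSEQ_le_const[OF tendsto_add[OF LIMSEQ_inverse_real_of_nat mb(2)]], intro exI allI impI)
  fix n
  have "hyp_dist z (dev m) \<le> hyp_dist z (dev (q n)) + hyp_dist (dev (q n)) (dev m)" using z up[of n] bundle_germs(3)[OF mb(1)] by (rule hyp_dist_triangle)
  then show "hyp_dist z (dev m) \<le> inverse (real (Suc n)) + bdist (q n) m" using q(2)[of n] dev_isometry[OF q(1)[of n] mb(1)] by (simp add: inverse_eq_divide)
 qed
 then have "z = dev m" using z bundle_germs(3)[OF mb(1)] hyp_dist_nonneg[of z "dev m"] hyp_dist_0_iff[of z "dev m"] by linarith
 then show ?thesis using mb by (simp add: X_def)
qed

text \<open>The bundle contains a point at the right distances from both ends, by the Hopf-Rinow
  theorem. Its image under the isometry \<open>dev\<close> is the point of the segment, since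
  betweenness points in the plane are unique.\<close>

lemma X_convex:
 assumes "z \<in> X" "w \<in> X" "s \<in> {0..1}"
 shows "cvx z w s \<in> X"
proof -
 obtain m m' where m: "m \<in> bun" "m' \<in> bun" "z = dev m" "w = dev m'" using assms by (auto simp: X_def)
 have zw: "0 < Im z" "0 < Im w" using X_upper assms by auto
 let ?v = "cvx z w s"
 have v: "0 < Im ?v" using cvx_h(1) zw assms by blast
 have bt: "hyp_dist z ?v + hyp_dist ?v w = hyp_dist z w" using between_iff_cvx[OF zw v] assms by blast
 then have t: "hyp_dist z ?v \<le> bdist m m'" using hyp_dist_nonneg[OF v zw(2)] dev_isometry m by simp
 obtain n where n: "n \<in> bun" "bdist m n = hyp_dist z ?v" "bdist n m' = bdist m m' - hyp_dist z ?v"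
  using B.between_point[OF bundle_length_space B.hopf_rinow[OF bundle_length_space bundle_loc_compact bundle_mcomplete m(1)] m(1,2) hyp_dist_nonneg[OF zw(1) v] t] .
 have "dev n = ?v" using n m dev_isometry[OF m(1) n(1)] dev_isometry[OF n(1) m(2)] dev_isometry[OF m(1,2)] bt by (intro between_unique[OF zw bundle_germs(3)[OF n(1)] v]) simp_all
 then show ?thesis using n(1) unfolding X_def by (metis imageI)
qed

lemma pr_surj: "pr ` X = F"
proof -
 let ?A = "fst ` bun"
 have AF: "?A \<subseteq> F" using bundle_germs by auto
 have nb: "U \<subseteq> ?A" if "cchart U e" "x \<in> U" "x \<in> ?A" for U e x
 proof
  fix y assume y: "y \<in> U"
  obtain m where m: "m \<in> bun" "x = fst m" using \<open>x \<in> ?A\<close> by blast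
  obtain S where S: "S \<in> isoms" "m \<in> sheet U (S o e)"
   using sheet_ex_chart[OF bundle_germs(1,2)[OF m(1)] cchartD[OF \<open>cchart U e\<close>]] \<open>x \<in> U\<close> m(2) by auto
  have c: "cchart U (S o e)" using cchart_comp that S by blast
  obtain T where "(y, T) \<in> sheet U (S o e)" using sheet_ex[OF cchartD[OF c] y] .
  then show "y \<in> ?A" using sheet_bdist(1)[OF c m(1) S(2)] by force
 qed
 have ch: "\<exists>U e. cchart U e \<and> x \<in> U \<and> openin mtopology U" if "x \<in> F" for x using base_chart[OF that] gchartD(1) by blast
 have "openin mtopology ?A"
 proof (subst openin_subopen, intro ballI)
  fix x assume x: "x \<in> ?A"
  then obtain U e where U: "cchart U e" "x \<in> U" "openin mtopology U" using ch AF by blast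
  then have "U \<subseteq> ?A" using nb[OF U(1,2) x] by blast
  then show "\<exists>T. openin mtopology T \<and> x \<in> T \<and> T \<subseteq> ?A" using U by blast
 qed
 moreover have "openin mtopology (F - ?A)"
 proof (subst openin_subopen, intro ballI)
  fix x assume x: "x \<in> F - ?A"
  then obtain U e where U: "cchart U e" "x \<in> U" "openin mtopology U" using ch by blast
  have "U \<inter> ?A = {}"
  proof (rule ccontr)
   assume "U \<inter> ?A \<noteq> {}"
   then obtain y where "y \<in> U" "y \<in> ?A" by blast
   then have "U \<subseteq> ?A" using nb U(1) by blast
   then show False using x U(2) by blast
  qed
  moreover have "U \<subseteq> F" using openin_subset[OF U(3)] by simp
  ultimately show "\<exists>T. openin mtopology T \<and> x \<in> T \<and> T \<subseteq> F - ?A" using U by blast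
 qed
 ultimately have "openin (top_of_set F) ?A" "closedin (top_of_set F) ?A" using AF by (auto simp: closedin_def mtopology_F)
 then have "?A = {} \<or> ?A = F" using connected_F unfolding connected_clopen by blast
 then have "?A = F" using germ0_bundle by blast
 moreover have "pr ` X = ?A" unfolding X_def image_image using pr_dev by (intro image_cong) auto
 ultimately show ?thesis by simp
qed

lemma pr_F: "z \<in> X \<Longrightarrow> pr z \<in> F" using pr_surj by blast

lemma pr_lipschitz:
 assumes "z \<in> X" "w \<in> X"
 shows "d (pr z) (pr w) \<le> hyp_dist z w"
proof -
 obtain m m' where m: "m \<in> bun" "m' \<in> bun" "z = dev m" "w = dev m'" using assms by (auto simp: X_def)
 then show ?thesis using bdist_ge(2)[OF m(1,2)] dev_isometry by (simp add: pr_dev)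
qed

text \<open>The radius on which \<open>pr\<close> is isometric depends on the point of \<open>F\<close> only, hence \<open>pr\<close> is a covering map.\<close>

lemma pr_local:
 assumes "x \<in> F"
 obtains r where "0 < r"
  "\<And>z u v. z \<in> X \<Longrightarrow> pr z = x \<Longrightarrow> u \<in> X \<Longrightarrow> v \<in> X \<Longrightarrow> hyp_dist z u < r \<Longrightarrow> hyp_dist z v < r \<Longrightarrow> d (pr u) (pr v) = hyp_dist u v"
  "\<And>z y. z \<in> X \<Longrightarrow> pr z = x \<Longrightarrow> y \<in> F \<Longrightarrow> d x y < r \<Longrightarrow> \<exists>u\<in>X. hyp_dist z u = d x y \<and> pr u = y"
proof -
 obtain r U where r: "0 < r" "\<And>T. T \<in> isoms \<Longrightarrow> \<exists>e. fine_chart x r U e \<and> (x, T) \<in> sheet U e" using fine_chart_sheet[OF assms] by blast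
 have get: "\<exists>m e. m \<in> bun \<and> z = dev m \<and> fst m = x \<and> fine_chart x r U e \<and> m \<in> sheet U e" if "z \<in> X" "pr z = x" for z
 proof -
  obtain m where m: "m \<in> bun" "z = dev m" using \<open>z \<in> X\<close> by (auto simp: X_def)
  then have "m = (x, snd m)" using that pr_dev by (metis prod.collapse)
  then show ?thesis using r(2)[OF bundle_germs(2)[OF m(1)]] m by (metis fst_conv)
 qed
 show ?thesis
 proof (rule that[OF r(1)])
  fix z u v assume a: "z \<in> X" "pr z = x" "u \<in> X" "v \<in> X" "hyp_dist z u < r" "hyp_dist z v < r"
  obtain m e where m: "m \<in> bun" "z = dev m" "fst m = x" "fine_chart x r U e" "m \<in> sheet U e" using get a by blast
  obtain n k where nk: "n \<in> bun" "k \<in> bun" "u = dev n" "v = dev k" using a by (auto simp: X_def)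
  have "n \<in> sheet U e" "k \<in> sheet U e" using fine_chart_ball[of m r U e] m nk a dev_isometry by auto
  then show "d (pr u) (pr v) = hyp_dist u v" using sheet_bdist(3)[of U e n k] m nk by (simp add: fine_chart_def pr_dev)
 next
  fix z y assume a: "z \<in> X" "pr z = x" "y \<in> F" "d x y < r"
  obtain m e where m: "m \<in> bun" "z = dev m" "fst m = x" "fine_chart x r U e" "m \<in> sheet U e" using get a by blast
  have c: "cchart U e" "y \<in> U" using m a assms by (auto simp: fine_chart_def)
  obtain T where T: "(y, T) \<in> sheet U e" using sheet_ex[OF cchartD[OF c(1)] c(2)] .
  have "(y, T) \<in> bun" "hyp_dist z (dev (y, T)) = d x y" using sheet_bdist[OF c(1) m(1,5) T] m by auto
  then show "\<exists>u\<in>X. hyp_dist z u = d x y \<and> pr u = y" by (intro bexI[of _ "dev (y, T)"]) (auto simp: X_def pr_dev)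
 qed
qed

lemma X_interior:
 assumes "x \<in> F"
 shows "\<exists>O'. open O' \<and> O' \<noteq> {} \<and> O' \<subseteq> X"
proof -
 obtain r U e where f: "fine_chart (fst germ0) r U e" "germ0 \<in> sheet U e" using fine_chart_ex[OF germ0_bundle] .
 then have c: "cchart U e" by (simp add: fine_chart_def)
 have U: "fst germ0 \<in> U" using f sheet_fst by blast
 obtain O' where O': "open O'" "O' \<noteq> {}" "O' \<subseteq> e ` U"
 proof (rule gchart_image_open[OF cchartD[OF c] subset_refl gchartD(1)[OF cchartD[OF c]]])
  show "U \<noteq> {}" using U by blast
 qed
 have "e ` U \<subseteq> X"
 proof
  fix w assume "w \<in> e ` U"
  then obtain u where u: "u \<in> U" "w = e u" by blast
  obtain T where T: "(u, T) \<in> sheet U e" using sheet_ex[OF cchartD[OF c] u(1)] .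
  have "(u, T) \<in> bun" "dev (u, T) = w" using sheet_bdist(1)[OF c germ0_bundle f(2) T] dev_sheet[OF cchartD[OF c] T] u by auto
  then show "w \<in> X" unfolding X_def by force
 qed
 then have "O' \<subseteq> X" using O'(3) by (rule order_trans[rotated])
 then show ?thesis using O'(1,2) by blast
qed

text \<open>Two germs at the same point differ by an isometry of the plane. It acts on chains of
  germs and moves one element of \<open>bun\<close> to another, so it preserves this component and
  leaves base points unchanged.\<close>

lemma deck_transitive:
 assumes "z \<in> X" "w \<in> X" "pr z = pr w"
 shows "\<exists>T\<in>deck. T z = w"
proof -
 obtain m m' where m: "m \<in> bun" "m' \<in> bun" "z = dev m" "w = dev m'" using assms by (auto simp: X_def)
 have f: "fst m = fst m'" using assms m pr_dev by simp
 have T: "snd m \<in> isoms" "snd m' \<in> isoms" using bundle_germs m by auto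
 let ?S = "snd m' o finv (snd m)"
 have S: "?S \<in> isoms" using T isoms_comp isoms_inv(1) by blast
 have Sm: "(fst m, ?S o snd m) = m'" using isoms_inv(4)[OF T(1)] f by (simp add: comp_assoc)
 have Sn: "(fst n, ?S o snd n) \<in> bun" if "n \<in> bun" for n
 proof -
  obtain L where "reach L m n" using bundle_reach[OF m(1) \<open>n \<in> bun\<close>] by blast
  then have "reach L m' (fst n, ?S o snd n)" using reach_comp[OF _ S] Sm by metis
  then show ?thesis using bundle_closed m by blast
 qed
 have S'n: "(fst n, finv ?S o snd n) \<in> bun" if "n \<in> bun" for n
 proof -
  obtain L where "reach L m' n" using bundle_reach[OF m(2) \<open>n \<in> bun\<close>] by blast
  then have "reach L (fst m', finv ?S o snd m') (fst n, finv ?S o snd n)" using reach_comp isoms_inv(1)[OF S] by blast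
  moreover have "(fst m', finv ?S o snd m') = m" using Sm f isoms_inv(4)[OF S] by (metis comp_assoc id_comp prod.collapse snd_conv)
  ultimately show ?thesis using bundle_closed m by metis
 qed
 have devS: "dev (fst n, R o snd n) = R (dev n)" for n R by (simp add: dev_def)
 have 1: "?S u \<in> X \<and> pr (?S u) = pr u" if "u \<in> X" for u
 proof -
  obtain n where n: "n \<in> bun" "u = dev n" using \<open>u \<in> X\<close> by (auto simp: X_def)
  have "?S u = dev (fst n, ?S o snd n)" using devS n by metis
  then show ?thesis using Sn[OF n(1)] n pr_dev[OF Sn[OF n(1)]] pr_dev[OF n(1)] by (auto simp: X_def)
 qed
 have 2: "finv ?S u \<in> X" if "u \<in> X" for u
 proof -
  obtain n where n: "n \<in> bun" "u = dev n" using \<open>u \<in> X\<close> by (auto simp: X_def)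
  have "finv ?S u = dev (fst n, finv ?S o snd n)" using devS n by metis
  then show ?thesis using S'n[OF n(1)] by (auto simp: X_def)
 qed
 have "?S ` X = X"
 proof (intro Set.equalityI subsetI)
  fix u assume "u \<in> X"
  then show "u \<in> ?S ` X" using 2[of u] isoms_inv(2)[OF S, of u] by (metis imageI)
 qed (use 1 in auto)
 then have "?S \<in> deck" using S 1 by (auto simp: deck_def)
 moreover have "?S z = w" using devS[of m ?S] Sm m by metis
 ultimately show ?thesis by blast
qed

text \<open>Near \<open>z\<close> the projection is isometric, so a deck transformation that fixes
  \<open>z\<close> cannot move nearby points. The image of a chart supplies an open set of fixed
  points even when \<open>z\<close> lies on the boundary of \<open>X\<close>.\<close>

lemma deck_free:
 assumes "T \<in> deck" "z \<in> X" "T z = z"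
 shows "T = id"
proof -
 have T: "T \<in> isoms" "\<And>u. u \<in> X \<Longrightarrow> T u \<in> X" "\<And>u. u \<in> X \<Longrightarrow> pr (T u) = pr u" using assms by (auto simp: deck_def)
 obtain r where r: "0 < r" "\<And>u v. u \<in> X \<Longrightarrow> v \<in> X \<Longrightarrow> hyp_dist z u < r \<Longrightarrow> hyp_dist z v < r \<Longrightarrow> d (pr u) (pr v) = hyp_dist u v"
  using pr_local[OF pr_F[OF assms(2)]] assms(2) by metis
 have z: "0 < Im z" using X_upper assms by blast
 have fx: "T u = u" if "u \<in> X" "hyp_dist z u < r" for u
 proof -
  have u: "0 < Im u" "0 < Im (T u)" using that T X_upper by auto
  have "hyp_dist z (T u) < r" using isoms_dist[OF T(1) z u(1)] assms that by simp
  then have "hyp_dist (T u) u = d (pr (T u)) (pr u)" using r(2)[of "T u" u] that T(2) by simp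
  also have "\<dots> = 0" using T(3) that pr_F by simp
  finally show ?thesis using u hyp_dist_0_iff by blast
 qed
 obtain O' where O': "open O'" "O' \<noteq> {}" "O' \<subseteq> X" using X_interior pr_F[OF assms(2)] by blast
 then obtain w where w: "w \<in> O'" by blast
 have wX: "w \<in> X" "0 < Im w" using w O' X_upper by auto
 obtain m m' where m: "m \<in> bun" "z = dev m" using assms(2) by (auto simp: X_def)
 obtain h U e where f: "fine_chart (fst m) h U e" "m \<in> sheet U e" using fine_chart_ex[OF m(1)] .
 then have c: "cchart U e" "0 < h" "mcball (fst m) h \<subseteq> U" by (auto simp: fine_chart_def)
 define W where "W = mball (fst m) (min r h)"
 have "fst m \<in> W" using c r(1) bundle_germs(1)[OF m(1)] by (simp add: W_def)
 then have ne: "W \<noteq> {}" by blast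
 have "W \<subseteq> U"
 proof
  fix u assume "u \<in> W"
  then have "u \<in> mcball (fst m) h" by (auto simp: W_def)
  then show "u \<in> U" using c(3) by blast
 qed
 then have W: "openin mtopology W" "W \<noteq> {}" "W \<subseteq> U" using ne by (simp_all add: W_def)
 obtain O1 where O1: "open O1" "O1 \<noteq> {}" "O1 \<subseteq> e ` W" "O1 \<subseteq> upper" using gchart_image_open[OF cchartD[OF c(1)] W(3,1,2)] .
 show ?thesis
 proof (rule isom_eq_id[OF O1(1,2,4) T(1)])
  fix v assume "v \<in> O1"
  then obtain u where u: "u \<in> W" "v = e u" using O1 by blast
  obtain T' where T': "(u, T') \<in> sheet U e" using sheet_ex[OF cchartD[OF c(1)], of u] W u by blast
  have b: "(u, T') \<in> bun" "dev (u, T') = v" "hyp_dist z v = d (fst m) u" using sheet_bdist(1,3)[OF c(1) m(1) f(2) T'] dev_sheet[OF cchartD[OF c(1)] T'] u m by auto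
  have "v \<in> X" unfolding X_def using b(1,2) by (metis imageI)
  moreover have "hyp_dist z v < r" using b(3) u by (simp add: W_def)
  ultimately show "T v = v" by (rule fx)
 qed
qed

lemma deck_isoms: "T \<in> deck \<Longrightarrow> T \<in> isoms"
 and deck_X: "T \<in> deck \<Longrightarrow> z \<in> X \<Longrightarrow> T z \<in> X"
 and deck_pr: "T \<in> deck \<Longrightarrow> z \<in> X \<Longrightarrow> pr (T z) = pr z" by (auto simp: deck_def)

lemma deck_comp: "S \<in> deck \<Longrightarrow> T \<in> deck \<Longrightarrow> S o T \<in> deck"
proof -
 assume a: "S \<in> deck" "T \<in> deck"
 then have ST: "S ` X = X" "T ` X = X" by (auto simp: deck_def)
 have "(S o T) ` X = X" using ST by (simp only: image_comp[symmetric])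
 moreover have "pr ((S o T) z) = pr z" if "z \<in> X" for z using deck_pr[OF a(1) deck_X[OF a(2) that]] deck_pr[OF a(2) that] by simp
 ultimately show ?thesis unfolding deck_def using isoms_comp a deck_isoms by blast
qed

lemma deck_inv:
 assumes "T \<in> deck"
 shows "finv T \<in> deck"
proof -
 have T: "T \<in> isoms" "T ` X = X" using assms by (auto simp: deck_def)
 have i: "finv T z \<in> X \<and> pr (finv T z) = pr z" if "z \<in> X" for z
 proof -
  obtain w where w: "w \<in> X" "z = T w" using T(2) \<open>z \<in> X\<close> by blast
  then show ?thesis using isoms_inv(3)[OF T(1)] deck_pr[OF assms w(1)] by simp
 qed
 have "finv T ` X = X"
 proof (intro Set.equalityI subsetI)
  fix u assume "u \<in> X"
  then have "T u \<in> X" using deck_X assms by blast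
  then show "u \<in> finv T ` X" using isoms_inv(3)[OF T(1), of u] by (metis imageI)
 qed (use i in auto)
 then show ?thesis using i isoms_inv(1)[OF T(1)] by (auto simp: deck_def)
qed

lemma deck_id: "id \<in> deck" by (simp add: deck_def)

lemma deck_eq: "S \<in> deck \<Longrightarrow> T \<in> deck \<Longrightarrow> z \<in> X \<Longrightarrow> S z = T z \<Longrightarrow> S = T"
proof -
 assume a: "S \<in> deck" "T \<in> deck" "z \<in> X" "S z = T z"
 have T: "T \<in> isoms" using a deck_isoms by blast
 have "finv T o S = id" using a isoms_inv(3)[OF T] by (intro deck_free[of _ z] deck_comp deck_inv) auto
 then have "T o (finv T o S) = T" by simp
 then show "S = T" using isoms_inv(5)[OF T] by (metis comp_assoc id_comp)
qed

end

section \<open>Continuity of the projection and the covering property\<close>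

context hyp_metric
begin

lemma continuous_on_from_F:
 fixes f :: "'a \<Rightarrow> 'b::metric_space"
 assumes "\<And>x e. x \<in> F \<Longrightarrow> 0 < e \<Longrightarrow> \<exists>h>0. \<forall>y\<in>F. d x y < h \<longrightarrow> dist (f x) (f y) < e"
 shows "continuous_on F f"
proof (subst continuous_on_open_gen[of f F UNIV])
 show "\<forall>U. openin (top_of_set UNIV) U \<longrightarrow> openin (top_of_set F) (F \<inter> f -` U)"
 proof (intro allI impI)
  fix U :: "'b set" assume "openin (top_of_set UNIV) U"
  then have U: "open U" by simp
  have "\<exists>r>0. mball x r \<subseteq> F \<inter> f -` U" if x: "x \<in> F \<inter> f -` U" for x
  proof -
   have "f x \<in> U" using x by simp
   then obtain e where e: "0 < e" "ball (f x) e \<subseteq> U" using U openE by blast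
   obtain h where "0 < h" "\<forall>y\<in>F. d x y < h \<longrightarrow> dist (f x) (f y) < e" using assms[of x e] e x by auto
   then show ?thesis using e(2) by (intro exI[of _ h]) (auto simp: subset_iff)
  qed
  then show "openin (top_of_set F) (F \<inter> f -` U)" unfolding mtopology_F[symmetric] openin_mtopology by auto
 qed
qed auto

lemma continuous_on_to_F:
 fixes g :: "'b::metric_space \<Rightarrow> 'a"
 assumes "g ` T \<subseteq> F" and "\<And>t h. t \<in> T \<Longrightarrow> 0 < h \<Longrightarrow> \<exists>q>0. \<forall>s\<in>T. dist t s < q \<longrightarrow> d (g t) (g s) < h"
 shows "continuous_on T g"
proof (subst continuous_on_open_gen[of g T F])
 show "g \<in> T \<rightarrow> F" using assms(1) by auto
 show "\<forall>U. openin (top_of_set F) U \<longrightarrow> openin (top_of_set T) (T \<inter> g -` U)"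
 proof (intro allI impI)
  fix U assume "openin (top_of_set F) U"
  then have U: "openin mtopology U" by (simp add: mtopology_F)
  show "openin (top_of_set T) (T \<inter> g -` U)" unfolding openin_euclidean_subtopology_iff
  proof (intro conjI ballI)
   fix t assume t: "t \<in> T \<inter> g -` U"
   then obtain r where r: "0 < r" "mball (g t) r \<subseteq> U" using U by (auto simp: openin_mtopology)
   obtain q where "0 < q" "\<forall>s\<in>T. dist t s < q \<longrightarrow> d (g t) (g s) < r" using assms(2)[of t r] t r by auto
   then show "\<exists>e>0. \<forall>s\<in>T. dist s t < e \<longrightarrow> s \<in> T \<inter> g -` U"
    using r(2) assms(1) t by (intro exI[of _ q]) (auto simp: subset_iff dist_commute)
  qed auto
 qed
qed

lemma X_sub_upper: "X \<subseteq> upper" using X_upper by auto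

lemma continuous_on_pr: "continuous_on X pr"
proof (rule continuous_on_to_F)
 show "pr ` X \<subseteq> F" using pr_surj by blast
 fix z e assume z: "z \<in> X" and "(0::real) < e"
 obtain r where "0 < r" "\<And>w. dist z w < r \<Longrightarrow> 0 < Im w \<and> hyp_dist z w < e" using hyp_dist_near[OF X_upper[OF z] \<open>0 < e\<close>] by blast
 then show "\<exists>r>0. \<forall>w\<in>X. dist z w < r \<longrightarrow> d (pr z) (pr w) < e" using pr_lipschitz[OF z] by (meson order_le_less_trans)
qed

lemma F_separable: "\<exists>q :: nat \<Rightarrow> 'a. \<forall>x\<in>F. \<forall>e>0. \<exists>n. q n \<in> F \<and> d x (q n) < e"
proof -
 obtain C where C: "countable C" "C \<subseteq> X" "X \<subseteq> closure C" using separable by blast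
 have Xne: "X \<noteq> {}" using pr_surj F_ne by auto
 then have "C \<noteq> {}" using C by auto
 then have r: "range (from_nat_into C) = C" using C by (simp add: range_from_nat_into)
 show ?thesis
 proof (intro exI[of _ "pr o from_nat_into C"] ballI allI impI)
  fix x and e :: real assume x: "x \<in> F" and "0 < e"
  then obtain z where z: "z \<in> X" "x = pr z" using pr_surj by blast
  obtain h where h: "0 < h" "\<And>w. dist z w < h \<Longrightarrow> 0 < Im w \<and> hyp_dist z w < e" using hyp_dist_near[OF X_upper[OF z(1)] \<open>0 < e\<close>] by blast
  obtain w where w: "w \<in> C" "dist w z < h" using C(3) z(1) h(1) by (meson closure_approachable subsetD)
  then obtain n where n: "w = from_nat_into C n" using r by blast
  have "d x (pr w) < e" using pr_lipschitz[OF z(1), of w] h(2)[of w] w C(2) z(2) by (auto simp: dist_commute)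
  moreover have "pr w \<in> F" using w C(2) pr_F by blast
  ultimately show "\<exists>n. (pr o from_nat_into C) n \<in> F \<and> d x ((pr o from_nat_into C) n) < e" using n by auto
 qed
qed

text \<open>
 The lifting theorems of the library require the base of a covering to lie in a normed space, so
 \<open>F\<close> is embedded isometrically in the bounded sequences.
\<close>

lemma isometric_embedding: "\<exists>\<iota> :: 'a \<Rightarrow> (nat \<Rightarrow>\<^sub>C real). \<forall>x\<in>F. \<forall>y\<in>F. dist (\<iota> x) (\<iota> y) = d x y"
proof -
 obtain q :: "nat \<Rightarrow> 'a" where q: "\<And>x e. x \<in> F \<Longrightarrow> 0 < e \<Longrightarrow> \<exists>n. q n \<in> F \<and> d x (q n) < e"
  using F_separable by blast
 obtain x0 where x0: "x0 \<in> F" using F_ne by blast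
 define f where "f x n = (if q n \<in> F then d x (q n) - d x0 (q n) else 0)" for x n
 have f: "f x \<in> bcontfun" if "x \<in> F" for x
 proof -
  have "abs (f x n) \<le> d x x0" for n using mdist_reverse_triangle[of x "q n" x0] that x0 commute[of x0] by (auto simp: f_def)
  then have "bounded (range (f x))" by (auto simp: bounded_real)
  then show ?thesis by (simp add: bcontfun_def)
 qed
 define \<iota> where "\<iota> x = (Bcontfun (f x) :: nat \<Rightarrow>\<^sub>C real)" for x
 have ap: "apply_bcontfun (\<iota> x) = f x" if "x \<in> F" for x using f[OF that] by (simp add: \<iota>_def Bcontfun_inverse)
 have "dist (\<iota> x) (\<iota> y) = d x y" if x: "x \<in> F" and y: "y \<in> F" for x y
 proof (rule antisym)
  show "dist (\<iota> x) (\<iota> y) \<le> d x y"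
  proof (rule dist_bound)
   fix n show "dist (apply_bcontfun (\<iota> x) n) (apply_bcontfun (\<iota> y) n) \<le> d x y"
    using mdist_reverse_triangle[of x "q n" y] x y commute[of y] by (auto simp: ap f_def dist_real_def)
  qed
  show "d x y \<le> dist (\<iota> x) (\<iota> y)"
  proof (rule field_le_epsilon)
   fix e :: real assume "0 < e"
   then obtain n where n: "q n \<in> F" "d y (q n) < e / 2" using q[OF y, of "e / 2"] by auto
   have "d x y \<le> d x (q n) + d y (q n)" using triangle[OF x n(1) y] commute by simp
   moreover have "dist (f x n) (f y n) \<le> dist (\<iota> x) (\<iota> y)" using dist_bounded[of "\<iota> x" n "\<iota> y"] by (simp add: ap x y)
   ultimately show "d x y \<le> dist (\<iota> x) (\<iota> y) + e" using n by (simp add: f_def dist_real_def)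
  qed
 qed
 then show ?thesis by blast
qed

definition emb :: "'a \<Rightarrow> (nat \<Rightarrow>\<^sub>C real)" where
 "emb = (SOME \<iota>. \<forall>x\<in>F. \<forall>y\<in>F. dist (\<iota> x) (\<iota> y) = d x y)"

lemma emb_dist: "x \<in> F \<Longrightarrow> y \<in> F \<Longrightarrow> dist (emb x) (emb y) = d x y" using someI_ex[OF isometric_embedding] unfolding emb_def by blast

lemma emb_inj: "x \<in> F \<Longrightarrow> y \<in> F \<Longrightarrow> emb x = emb y \<longleftrightarrow> x = y" using emb_dist[of x y] zero by (metis dist_eq_0_iff)

lemma continuous_on_emb: "continuous_on F emb" using emb_dist by (intro continuous_on_from_F) fastforce

text \<open>The sheets over the ball of radius \<open>r / 2\<close> are the balls \<open>B z\<close>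
  around the preimages of its centre. If two of them met, their centres would be closer than
  \<open>r\<close>, where \<open>pr\<close> is isometric, and hence equal.\<close>

lemma covering_emb: "covering_space X (emb o pr) (emb ` F)"
proof (rule covering_spaceI)
 show cont: "continuous_on X (emb o pr)" using continuous_on_pr continuous_on_emb pr_surj by (intro continuous_on_compose) auto
 show "(emb o pr) ` X = emb ` F" by (simp only: image_comp[symmetric] pr_surj)
 fix y assume "y \<in> emb ` F"
 then obtain x where x: "x \<in> F" "y = emb x" by blast
 obtain r where r: "0 < r"
  "\<And>z u v. z \<in> X \<Longrightarrow> pr z = x \<Longrightarrow> u \<in> X \<Longrightarrow> v \<in> X \<Longrightarrow> hyp_dist z u < r \<Longrightarrow> hyp_dist z v < r \<Longrightarrow> d (pr u) (pr v) = hyp_dist u v"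
  "\<And>z y. z \<in> X \<Longrightarrow> pr z = x \<Longrightarrow> y \<in> F \<Longrightarrow> d x y < r \<Longrightarrow> \<exists>u\<in>X. hyp_dist z u = d x y \<and> pr u = y"
  using pr_local[OF x(1)] by blast
 define T where "T = emb ` mball x (r / 2)"
 define B where "B z = {u \<in> X. hyp_dist z u < r / 2}" for z
 let ?v = "B ` {z \<in> X. pr z = x}"
 have BX: "B z \<subseteq> X" for z by (auto simp: B_def)
 have Bx: "pr u \<in> mball x (r / 2)" if "z \<in> X" "pr z = x" "u \<in> B z" for z u using that pr_lipschitz[of z u] pr_F x(1) by (auto simp: B_def)
 have T: "T = emb ` F \<inter> ball y (r / 2)" using x emb_dist by (auto simp: T_def)
 show "\<exists>T. y \<in> T \<and> openin (top_of_set (emb ` F)) T \<and>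
     (\<exists>v. \<Union>v = X \<inter> (emb o pr) -` T \<and> (\<forall>u\<in>v. openin (top_of_set X) u) \<and>
        pairwise disjnt v \<and> (\<forall>u\<in>v. \<exists>q. homeomorphism u T (emb o pr) q))"
 proof (intro exI[of _ T] conjI exI[of _ ?v] ballI)
  show "y \<in> T" using x r(1) by (auto simp: T_def)
  show "openin (top_of_set (emb ` F)) T" unfolding T by (auto simp: openin_open)
  show "\<Union>?v = X \<inter> (emb o pr) -` T"
  proof (intro Set.equalityI subsetI)
   fix u assume "u \<in> \<Union>?v"
   then show "u \<in> X \<inter> (emb o pr) -` T" using Bx BX by (auto simp: T_def)
  next
   fix u assume u: "u \<in> X \<inter> (emb o pr) -` T"
   then have uX: "u \<in> X" and "emb (pr u) \<in> T" by auto
   then obtain w where "w \<in> mball x (r / 2)" "emb (pr u) = emb w" by (auto simp: T_def)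
   then have du: "pr u \<in> F" "d x (pr u) < r / 2" using emb_inj[of "pr u" w] pr_F[OF uX] by auto
   obtain z where z: "z \<in> X" "pr z = x" using pr_surj x(1) by (metis imageE)
   obtain u' where u': "u' \<in> X" "hyp_dist z u' = d x (pr u)" "pr u' = pr u" using r(3)[OF z du(1)] du(2) r(1) by auto
   obtain S where S: "S \<in> deck" "S u' = u" using deck_transitive[OF u'(1) uX u'(3)] by blast
   have "hyp_dist (S z) u = hyp_dist z u'" using isoms_dist[OF deck_isoms[OF S(1)] X_upper[OF z(1)] X_upper[OF u'(1)]] S by simp
   then have "u \<in> B (S z)" using u' du uX by (simp add: B_def)
   moreover have "S z \<in> {z \<in> X. pr z = x}" using deck_X deck_pr S z by simp
   ultimately show "u \<in> \<Union>?v" by blast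
  qed
  show "openin (top_of_set X) U" if "U \<in> ?v" for U
  proof -
   obtain z where z: "z \<in> X" "U = B z" using \<open>U \<in> ?v\<close> by blast
   have "continuous_on X (\<lambda>u. hyp_dist z u)" using z X_upper by (intro continuous_on_hyp_dist continuous_intros) auto
   then have "openin (top_of_set X) (X \<inter> (\<lambda>u. hyp_dist z u) -` {..<r / 2})" by (intro continuous_openin_preimage_gen) auto
   moreover have "X \<inter> (\<lambda>u. hyp_dist z u) -` {..<r / 2} = U" using z by (auto simp: B_def)
   ultimately show ?thesis by simp
  qed
  show "pairwise disjnt ?v"
  proof (clarsimp simp: pairwise_def disjnt_iff)
   fix z z' u assume z: "z \<in> X" "z' \<in> X" "x = pr z" "pr z' = pr z" and ne: "B z \<noteq> B z'" and u: "u \<in> B z" "u \<in> B z'"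
   have "hyp_dist z z' \<le> hyp_dist z u + hyp_dist u z'" using z u X_upper by (intro hyp_dist_triangle) (auto simp: B_def)
   then have "hyp_dist z z' < r" using u by (simp add: B_def hyp_dist_commute)
   then have "d (pr z) (pr z') = hyp_dist z z'" using r(1) r(2)[of z z z'] z by simp
   then have "hyp_dist z z' = 0" using z pr_F by simp
   then have "z = z'" using z X_upper hyp_dist_0_iff by blast
   then show False using ne by simp
  qed
  show "\<exists>q. homeomorphism U T (emb o pr) q" if "U \<in> ?v" for U
  proof -
   obtain z where z: "z \<in> X" "pr z = x" "U = B z" using \<open>U \<in> ?v\<close> by blast
   have iso: "d (pr u) (pr v) = hyp_dist u v" if "u \<in> U" "v \<in> U" for u v using r(2)[OF z(1,2), of u v] that z(3) r(1) by (auto simp: B_def)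
   have inj: "inj_on (emb o pr) U"
   proof (rule inj_onI)
    fix u v assume uv: "u \<in> U" "v \<in> U" "(emb o pr) u = (emb o pr) v"
    have X': "u \<in> X" "v \<in> X" using uv z(3) BX by auto
    then have "pr u = pr v" using uv(3) emb_inj pr_F by simp
    then have "hyp_dist u v = 0" using iso[OF uv(1,2)] pr_F X' by simp
    then show "u = v" using X' X_upper hyp_dist_0_iff by blast
   qed
   have img: "(emb o pr) ` U = T"
   proof (intro Set.equalityI subsetI)
    fix w assume "w \<in> (emb o pr) ` U"
    then show "w \<in> T" using Bx[OF z(1,2)] z(3) by (auto simp: T_def)
   next
    fix w assume "w \<in> T"
    then obtain y' where y': "y' \<in> F" "d x y' < r / 2" "w = emb y'" by (auto simp: T_def)
    then obtain u where "u \<in> X" "hyp_dist z u = d x y'" "pr u = y'" using r(3)[OF z(1,2) y'(1)] r(1) by auto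
    then show "w \<in> (emb o pr) ` U" using y' z(3) by (auto simp: B_def)
   qed
   let ?q = "inv_into U (emb o pr)"
   have contq: "continuous_on T ?q" unfolding continuous_on_iff
   proof (intro ballI allI impI)
    fix t and e :: real assume t: "t \<in> T" and "0 < e"
    obtain u where u: "u \<in> U" "t = emb (pr u)" using t img by auto
    have uX: "u \<in> X" using u z BX by auto
    have qu: "?q (emb (pr v)) = v" if "v \<in> U" for v using inv_into_f_f[OF inj that] by simp
    obtain h where h: "0 < h" "\<And>w. 0 < Im w \<Longrightarrow> hyp_dist u w < h \<Longrightarrow> dist u w < e"
     using hyp_dist_small[OF X_upper[OF uX] \<open>0 < e\<close>] by blast
    show "\<exists>h>0. \<forall>s\<in>T. dist s t < h \<longrightarrow> dist (?q s) (?q t) < e"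
    proof (intro exI[of _ h] conjI h(1) ballI impI)
     fix s assume s: "s \<in> T" "dist s t < h"
     obtain v where v: "v \<in> U" "s = emb (pr v)" using s img by auto
     have vX: "v \<in> X" using v z BX by auto
     have "hyp_dist u v < h" using s(2) iso[OF u(1) v(1)] emb_dist[OF pr_F[OF uX] pr_F[OF vX]] u v by (simp add: dist_commute)
     then show "dist (?q s) (?q t) < e" using h(2)[OF X_upper[OF vX]] u v qu by (simp add: dist_commute)
    qed
   qed
   have "homeomorphism U T (emb o pr) ?q"
   proof (rule homeomorphismI)
    show "continuous_on U (emb o pr)" using cont z BX by (meson continuous_on_subset)
   qed (use contq inj img in \<open>auto simp del: comp_apply simp: f_inv_into_f inv_into_into\<close>)
   then show ?thesis by blast
  qed
 qed
qed

section \<open>Lifting\<close>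

definition is_lift :: "(real \<Rightarrow> complex) \<Rightarrow> (real \<Rightarrow> 'a) \<Rightarrow> bool" where
 "is_lift h g \<longleftrightarrow> path h \<and> path_image h \<subseteq> X \<and> (\<forall>t\<in>{0..1}. pr (h t) = g t)"

lemma is_liftD:
 assumes "is_lift h g"
 shows "path h" "path_image h \<subseteq> X" "t \<in> {0..1} \<Longrightarrow> pr (h t) = g t" "t \<in> {0..1} \<Longrightarrow> h t \<in> X"
  "pathstart h \<in> X" "pathfinish h \<in> X" "pr (pathstart h) = pathstart g" "pr (pathfinish h) = pathfinish g"
 using assms by (auto simp: is_lift_def path_image_def pathstart_def pathfinish_def)

lemma path_emb: "path g \<Longrightarrow> path_image g \<subseteq> F \<Longrightarrow> path (emb o g)" using continuous_on_emb by (meson continuous_on_subset path_continuous_image)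

lemma lift_path:
 assumes "path g" "path_image g \<subseteq> F" "z \<in> X" "pr z = pathstart g"
 obtains h where "is_lift h g" "pathstart h = z"
proof -
 have im: "path_image (emb o g) \<subseteq> emb ` F" using assms(2) by (auto simp: path_image_compose)
 have st: "pathstart (emb o g) = (emb o pr) z" using assms(4) by (simp add: pathstart_compose)
 obtain h where h: "path h" "path_image h \<subseteq> X" "pathstart h = z" "\<And>t. t \<in> {0..1} \<Longrightarrow> (emb o pr) (h t) = (emb o g) t"
  using covering_space_lift_path_strong[OF covering_emb assms(3) path_emb[OF assms(1,2)] im st] by metis
 have "pr (h t) = g t" if "t \<in> {0..1}" for t
 proof -
  have "h t \<in> X" "g t \<in> F" using h(2) assms(2) that by (auto simp: path_image_def)
  then show ?thesis using h(4)[OF that] emb_inj pr_F by simp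
 qed
 then show ?thesis using that[of h] h by (simp add: is_lift_def)
qed

lemma pr_lift_path: "path h \<Longrightarrow> path_image h \<subseteq> X \<Longrightarrow> path (pr o h) \<and> path_image (pr o h) \<subseteq> F \<and> is_lift h (pr o h)"
 using continuous_on_pr pr_F by (auto simp: is_lift_def path_image_compose intro!: path_continuous_image continuous_on_subset[of X pr])

lemma lift_unique_gen:
 fixes g1 g2 :: "'b::topological_space \<Rightarrow> complex"
 assumes "connected T" "continuous_on T g1" "g1 ` T \<subseteq> X" "continuous_on T g2" "g2 ` T \<subseteq> X"
  "\<And>t. t \<in> T \<Longrightarrow> pr (g1 t) = pr (g2 t)" "a \<in> T" "g1 a = g2 a" "t \<in> T"
 shows "g1 t = g2 t"
proof (rule covering_space_lift_unique[where ?g1.0 = g1 and ?g2.0 = g2 and a = a and T = T and c = X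
   and S = "emb ` F" and p = "emb o pr" and f = "\<lambda>t. emb (pr (g1 t))"])
 show "continuous_on T (\<lambda>t. emb (pr (g1 t)))" using continuous_on_compose2[OF covering_space_imp_continuous[OF covering_emb] assms(2,3)] by simp
qed (use assms pr_F covering_emb in auto)

lemma lift_unique:
 assumes "is_lift h g" "is_lift h' g" "pathstart h = pathstart h'" "t \<in> {0..1}"
 shows "h t = h' t" using is_liftD[OF assms(1)] is_liftD[OF assms(2)] assms(3,4) by (intro lift_unique_gen[of "{0..1}" h h' 0 t]) (auto simp: path_def pathstart_def path_image_def)

lemma is_lift_deck:
 assumes "is_lift h g" "T \<in> deck"
 shows "is_lift (T o h) g"
proof -
 note h = is_liftD[OF assms(1)]
 have "path_image h \<subseteq> upper" using h(2) X_upper by auto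
 then have "path (T o h)" using continuous_on_isom[OF deck_isoms[OF assms(2)]] h(1) by (meson continuous_on_subset path_continuous_image)
 then show ?thesis using h deck_X[OF assms(2)] deck_pr[OF assms(2)] by (auto simp: is_lift_def path_image_compose)
qed

text \<open>Holonomy of a loop with free starting point of the lift. It is determined up to
  conjugation, which is the right precision for free homotopy classes.\<close>

definition hol :: "(real \<Rightarrow> 'a) \<Rightarrow> (complex \<Rightarrow> complex) \<Rightarrow> bool" where
 "hol g T \<longleftrightarrow> T \<in> deck \<and> (\<exists>h. is_lift h g \<and> pathfinish h = T (pathstart h))"

lemma hol_deck: "hol g T \<Longrightarrow> T \<in> deck" by (simp add: hol_def)

lemma hol_at:
 assumes "closed_curve F g" "z \<in> X" "pr z = pathstart g"
 obtains h T where "T \<in> deck" "is_lift h g" "pathstart h = z" "pathfinish h = T z"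
proof -
 obtain h where h: "is_lift h g" "pathstart h = z" using lift_path assms by (auto simp: closed_curve_def)
 note hd = is_liftD[OF h(1)]
 have "pr z = pr (pathfinish h)" using hd(8) assms by (simp add: closed_curve_def)
 then obtain T where "T \<in> deck" "T z = pathfinish h" using deck_transitive assms(2) hd(6) by blast
 then show ?thesis using that h by simp
qed

lemma hol_conj:
 assumes "hol g S" "hol g T"
 shows "\<exists>C\<in>deck. S = C o T o finv C"
proof -
 obtain h where h: "is_lift h g" "pathfinish h = S (pathstart h)" using assms by (auto simp: hol_def)
 obtain k where k: "is_lift k g" "pathfinish k = T (pathstart k)" using assms by (auto simp: hol_def)
 have ST: "S \<in> deck" "T \<in> deck" using assms hol_deck by auto
 note hd = is_liftD[OF h(1)] and kd = is_liftD[OF k(1)]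
 obtain C where C: "C \<in> deck" "C (pathstart k) = pathstart h" using deck_transitive[OF kd(5) hd(5)] hd(7) kd(7) by auto
 have "pathstart (C o k) = pathstart h" using C by (simp add: pathstart_compose)
 then have "(C o k) 1 = h 1" using lift_unique[OF is_lift_deck[OF k(1) C(1)] h(1)] by simp
 then have e: "C (T (pathstart k)) = S (pathstart h)" using h(2) k(2) by (simp add: pathfinish_def)
 have i: "finv C (pathstart h) = pathstart k" using C isoms_inv(3)[OF deck_isoms[OF C(1)]] by metis
 have "S = C o T o finv C" using e i hd(5) ST C by (intro deck_eq[of _ _ "pathstart h"] deck_comp deck_inv) auto
 then show ?thesis using C by blast
qed

text \<open>Lift the homotopy to the square. Its two vertical edges lie over the same curve, so they
  differ by one deck transformation throughout, and this is \<open>T\<close> at the start.\<close>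

lemma hol_homotopic:
 assumes "homotopic_loops F g g'" "hol g T"
 shows "hol g' T"
proof -
 obtain H :: "real \<times> real \<Rightarrow> 'a" where H: "continuous_on ({0..1} \<times> {0..1}) H" "H \<in> ({0..1} \<times> {0..1}) \<rightarrow> F"
  "\<And>x. x \<in> {0..1} \<Longrightarrow> H (0, x) = g x" "\<And>x. x \<in> {0..1} \<Longrightarrow> H (1, x) = g' x"
  "\<And>t. t \<in> {0..1} \<Longrightarrow> H (t, 1) = H (t, 0)"
 proof -
  obtain H :: "real \<times> real \<Rightarrow> 'a" where "continuous_on ({0..1} \<times> {0..1}) H \<and> H \<in> ({0..1} \<times> {0..1}) \<rightarrow> F \<and>
   (\<forall>x\<in>{0..1}. H (0, x) = g x) \<and> (\<forall>x\<in>{0..1}. H (1, x) = g' x) \<and>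
   (\<forall>t\<in>{0..1}. pathfinish (H o Pair t) = pathstart (H o Pair t))" using assms(1) unfolding homotopic_loops ..
  then show ?thesis using that[of H] by (simp add: pathfinish_def pathstart_def)
 qed
 obtain h where h: "is_lift h g" "pathfinish h = T (pathstart h)" and T: "T \<in> deck" using assms by (auto simp: hol_def)
 note hd = is_liftD[OF h(1)]
 obtain k where k: "continuous_on ({0..1} \<times> {0..1}) k" "k \<in> ({0..1} \<times> {0..1}) \<rightarrow> X"
  "\<And>y. y \<in> {0..1} \<Longrightarrow> k (0, y) = h y" "\<And>z. z \<in> {0..1} \<times> {0..1} \<Longrightarrow> (emb o H) z = (emb o pr) (k z)"
 proof (rule covering_space_lift_homotopy[OF covering_emb, of "{0..1}" "emb o H" h])
  show "continuous_on ({0..1} \<times> {0..1}) (emb o H)" using H(1,2) continuous_on_emb by (intro continuous_on_compose continuous_on_subset[OF continuous_on_emb]) auto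
  show "(emb o H) (0, y) = (emb o pr) (h y)" if "y \<in> {0..1}" for y using H(3) hd(3) that by simp
  show "continuous_on {0..1} h" using hd(1) by (simp add: path_def)
  show "h \<in> {0..1} \<rightarrow> X" using hd(4) by auto
 qed (use H in auto)
 have pk: "pr (k z) = H z" if "z \<in> {0..1} \<times> {0..1}" for z using k(4)[OF that] k(2) H(2) that emb_inj[of "H z" "pr (k z)"] pr_F by (auto simp: Pi_iff)
 have up: "k ` ({0..1} \<times> {0..1}) \<subseteq> X" using k(2) by auto
 have kX: "k (s, y) \<in> X" if "s \<in> {0..1}" "y \<in> {0..1}" for s y using up that by blast
 have c: "continuous_on {0..1} (\<lambda>s. k (s, y))" if "y \<in> {0..1}" for y using that by (intro continuous_on_compose2[OF k(1)] continuous_intros) auto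
 have "k (1, 1) = T (k (1, 0))"
 proof (rule lift_unique_gen[of "{0..1::real}" "\<lambda>s. k (s, 1)" "\<lambda>s. T (k (s, 0))" 0 1])
  show "continuous_on {0..1} (\<lambda>s. T (k (s, 0)))"
  proof (rule continuous_on_compose2[OF continuous_on_isom[OF deck_isoms[OF T]]])
   show "continuous_on {0..1} (\<lambda>s. k (s, 0))" using c[of 0] by simp
   show "(\<lambda>s. k (s, 0)) ` {0..1} \<subseteq> upper" using kX[of _ 0] X_sub_upper by auto
  qed
  show "pr (k (t, 1)) = pr (T (k (t, 0)))" if "t \<in> {0..1}" for t using that pk[of "(t, 1)"] pk[of "(t, 0)"] H(5)[OF that] deck_pr[OF T kX[of t 0]] by simp
  show "k (0, 1) = T (k (0, 0))" using k(3)[of 0] k(3)[of 1] h(2) by (simp add: pathstart_def pathfinish_def)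
  show "(\<lambda>s. T (k (s, 0))) ` {0..1} \<subseteq> X" using kX[of _ 0] deck_X[OF T] by auto
  show "(\<lambda>s. k (s, 1)) ` {0..1} \<subseteq> X" using kX[of _ 1] by auto
 qed (use c[of 1] in auto)
 moreover have "is_lift (\<lambda>y. k (1, y)) g'" unfolding is_lift_def path_def path_image_def
 proof (intro conjI ballI)
  show "continuous_on {0..1} (\<lambda>y. k (1, y))" by (intro continuous_on_compose2[OF k(1)] continuous_intros) auto
  show "pr (k (1, t)) = g' t" if "t \<in> {0..1}" for t using pk[of "(1, t)"] H(4) that by simp
 qed (use up in auto)
 moreover from calculation(1) have "pathfinish (\<lambda>y. k (1, y)) = T (pathstart (\<lambda>y. k (1, y)))" by (simp add: pathstart_def pathfinish_def)
 ultimately show ?thesis using T unfolding hol_def by blast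
qed

lemma cvx_homotopy:
 assumes h: "path h" "path_image h \<subseteq> X" and k: "path k" "path_image k \<subseteq> X"
 shows "continuous_on ({0..1} \<times> {0..1}) (\<lambda>z. cvx (h (snd z)) (k (snd z)) (fst z))"
proof (rule continuous_on_cvx)
 have c: "continuous_on ({0..1::real} \<times> {0..1}) (\<lambda>z. g (snd z))" if "path g" for g :: "real \<Rightarrow> complex"
  using that unfolding path_def by (rule continuous_on_compose2) (auto intro: continuous_intros)
 show "continuous_on ({0..1::real} \<times> {0..1}) (\<lambda>z. h (snd z))" "continuous_on ({0..1::real} \<times> {0..1}) (\<lambda>z. k (snd z))" using c h k by auto
 show "(\<lambda>z. h (snd z)) ` ({0..1::real} \<times> {0..1}) \<subseteq> upper" "(\<lambda>z. k (snd z)) ` ({0..1::real} \<times> {0..1}) \<subseteq> upper"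
  using h k X_sub_upper unfolding path_image_def by force+
qed (auto intro: continuous_intros)

text \<open>The homotopy along geodesic segments commutes with isometries, so each intermediate
  curve is again closed up by \<open>T\<close>.\<close>

lemma homotopic_pr:
 assumes h: "path h" "path_image h \<subseteq> X" and k: "path k" "path_image k \<subseteq> X"
  and T: "T \<in> deck" "pathfinish h = T (pathstart h)" "pathfinish k = T (pathstart k)"
 shows "homotopic_loops F (pr o h) (pr o k)"
proof -
 have hkX: "h t \<in> X" "k t \<in> X" if "t \<in> {0..1}" for t using h k that by (auto simp: path_image_def)
 have up: "h t \<in> X" "k t \<in> X" "0 < Im (h t)" "0 < Im (k t)" if "t \<in> {0..1}" for t using hkX[OF that] X_upper by auto
 define H where "H z = cvx (h (snd z)) (k (snd z)) (fst z)" for z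
 have HX: "H z \<in> X" if "z \<in> {0..1} \<times> {0..1}" for z using that up[of "snd z"] X_convex by (auto simp: H_def)
 show ?thesis unfolding homotopic_loops
 proof (intro exI[of _ "pr o H"] conjI ballI)
  have "continuous_on ({0..1} \<times> {0..1}) H" unfolding H_def by (rule cvx_homotopy[OF h k])
  then show "continuous_on ({0..1} \<times> {0..1}) (pr o H)" using HX by (intro continuous_on_compose continuous_on_subset[OF continuous_on_pr]) auto
  show "pr o H \<in> {0..1} \<times> {0..1} \<rightarrow> F" using HX pr_F by auto
  show "(pr o H) (0, x) = (pr o h) x" "(pr o H) (1, x) = (pr o k) x" if "x \<in> {0..1}" for x using up[OF that] by (simp_all add: H_def)
  show "pathfinish ((pr o H) o Pair t) = pathstart ((pr o H) o Pair t)" if t: "t \<in> {0..1}" for t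
  proof -
   have "H (t, 1) = T (H (t, 0))" using T isoms_cvx[OF deck_isoms[OF T(1)] up(3,4)[of 0] t] by (simp add: H_def pathfinish_def pathstart_def)
   then show ?thesis using deck_pr[OF T(1)] HX[of "(t, 0)"] t by (simp add: pathfinish_def pathstart_def)
  qed
 qed
qed

lemma hol_homotopicI:
 assumes "hol g T" "path k" "path_image k \<subseteq> X" "pathfinish k = T (pathstart k)"
 shows "homotopic_loops F g (pr o k)"
proof -
 obtain h where h: "is_lift h g" "pathfinish h = T (pathstart h)" and T: "T \<in> deck" using assms by (auto simp: hol_def)
 note hd = is_liftD[OF h(1)]
 have 1: "homotopic_loops F (pr o h) (pr o k)" using homotopic_pr[OF hd(1,2) assms(2,3) T h(2) assms(4)] .
 have "homotopic_loops F (pr o h) g" using homotopic_loops_imp_path[OF 1] homotopic_loops_imp_subset[OF 1] homotopic_loops_imp_loop[OF 1] hd(3) by (intro homotopic_loops_eq) auto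
 then show ?thesis using 1 homotopic_loops_sym homotopic_loops_trans by blast
qed

lemma homotopic_paths_pr:
 assumes h: "path h" "path_image h \<subseteq> X" and k: "path k" "path_image k \<subseteq> X"
  and e: "pathstart h = pathstart k" "pathfinish h = pathfinish k"
 shows "homotopic_paths F (pr o h) (pr o k)"
proof -
 have hkX: "h t \<in> X" "k t \<in> X" if "t \<in> {0..1}" for t using h k that by (auto simp: path_image_def)
 have up: "h t \<in> X" "k t \<in> X" "0 < Im (h t)" "0 < Im (k t)" if "t \<in> {0..1}" for t using hkX[OF that] X_upper by auto
 define H where "H z = cvx (h (snd z)) (k (snd z)) (fst z)" for z
 have HX: "H z \<in> X" if "z \<in> {0..1} \<times> {0..1}" for z using that up[of "snd z"] X_convex by (auto simp: H_def)
 have self: "cvx z z s = z" if "0 < Im z" "s \<in> {0..1}" for z s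
 proof -
  have v: "0 < Im (cvx z z s)" using cvx_h(1)[OF that(1,1,2)] .
  have "hyp_dist z (cvx z z s) \<le> 0" using cvx_ball[OF that(1,1,2,1), of 0] by simp
  then have "hyp_dist z (cvx z z s) = 0" using hyp_dist_nonneg[OF that(1) v] by linarith
  then show ?thesis using hyp_dist_0_iff[OF that(1) v] by simp
 qed
 show ?thesis unfolding homotopic_paths
 proof (intro exI[of _ "pr o H"] conjI ballI)
  have "continuous_on ({0..1} \<times> {0..1}) H" unfolding H_def by (rule cvx_homotopy[OF h k])
  then show "continuous_on ({0..1} \<times> {0..1}) (pr o H)" using HX by (intro continuous_on_compose continuous_on_subset[OF continuous_on_pr]) auto
  show "pr o H \<in> {0..1} \<times> {0..1} \<rightarrow> F" using HX pr_F by auto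
  show "(pr o H) (0, x) = (pr o h) x" "(pr o H) (1, x) = (pr o k) x" if "x \<in> {0..1}" for x using up[OF that] by (simp_all add: H_def)
  show "pathstart ((pr o H) o Pair t) = pathstart (pr o h)" "pathfinish ((pr o H) o Pair t) = pathfinish (pr o h)"
   if t: "t \<in> {0..1}" for t using e self[OF up(3)[of 0] t] self[OF up(3)[of 1] t] by (simp_all add: H_def pathstart_def pathfinish_def)
 qed
qed

lemma path_cvx:
 assumes "z \<in> X" "w \<in> X"
 shows "path (cvx z w)" "path_image (cvx z w) \<subseteq> X" "pathstart (cvx z w) = z" "pathfinish (cvx z w) = w"
proof -
 have u: "0 < Im z" "0 < Im w" using assms X_upper by auto
 show "path (cvx z w)" unfolding path_def using u by (intro continuous_on_cvx continuous_intros) auto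
 show "path_image (cvx z w) \<subseteq> X" using X_convex assms by (auto simp: path_image_def)
 show "pathstart (cvx z w) = z" "pathfinish (cvx z w) = w" using u by (simp_all add: pathstart_def pathfinish_def)
qed

lemma lift_line:
 fixes E :: "real \<Rightarrow> 'a"
 assumes "continuous_on UNIV E" "range E \<subseteq> F"
 obtains k where "continuous_on UNIV k" "range k \<subseteq> X" "\<And>t. pr (k t) = E t"
proof -
 obtain k where k: "continuous_on UNIV k" "k \<in> UNIV \<rightarrow> X" "\<And>t. t \<in> UNIV \<Longrightarrow> (emb o pr) (k t) = (emb o E) t"
 proof (rule covering_space_lift[OF covering_emb, of "UNIV :: real set" "emb o E"])
  show "simply_connected (UNIV :: real set)" by (simp add: convex_imp_simply_connected)
  show "locally path_connected (UNIV :: real set)" by (simp add: convex_imp_locally_path_connected)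
  show "continuous_on UNIV (emb o E)" using assms continuous_on_emb by (intro continuous_on_compose continuous_on_subset[OF continuous_on_emb]) auto
  show "emb o E \<in> UNIV \<rightarrow> emb ` F" using assms(2) by auto
 qed auto
 have "pr (k t) = E t" for t using k(3)[of t] k(2) assms(2) emb_inj[of "pr (k t)" "E t"] pr_F[of "k t"] by auto
 then show ?thesis using that[of k] k by auto
qed

end

section \<open>The fundamental group as a group of isometries\<close>

lemma homotopic_loops_class:
 assumes "homotopic_loops F g h"
 shows "free_homotopy_class F g = free_homotopy_class F h" using assms homotopic_loops_sym homotopic_loops_trans unfolding free_homotopy_class_def by blast

lemma class_homotopic_loops:
 assumes "free_homotopy_class F g = free_homotopy_class F h" "closed_curve F g"
 shows "homotopic_loops F g h"
proof -
 have "homotopic_loops F g g" using assms(2) by (simp add: homotopic_loops_refl closed_curve_def)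
 then have "g \<in> free_homotopy_class F h" using assms(1) by (simp add: free_homotopy_class_def[of F g, symmetric] flip: assms(1)) (simp add: free_homotopy_class_def)
 then show ?thesis by (simp add: free_homotopy_class_def homotopic_loops_sym)
qed

context hyp_metric
begin

lemma lift_monodromy:
 assumes "homotopic_paths F g g'" "is_lift h g" "is_lift h' g'" "pathstart h = pathstart h'"
 shows "pathfinish h = pathfinish h'"
proof (rule covering_space_monodromy[OF covering_emb, of "emb o g" "emb o g'"])
 have g: "path g" "path_image g \<subseteq> F" "path g'" "path_image g' \<subseteq> F" using homotopic_paths_imp_path[OF assms(1)] homotopic_paths_imp_subset[OF assms(1)] by auto
 show "path (emb o g)" "path (emb o g')" using g path_emb by auto
 show "path_image (emb o g) \<subseteq> emb ` F" "path_image (emb o g') \<subseteq> emb ` F" using g by (auto simp: path_image_compose)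
 show "homotopic_paths (emb ` F) (emb o g) (emb o g')" using assms(1) continuous_on_emb by (rule homotopic_paths_continuous_image) auto
qed (use is_liftD[OF assms(2)] is_liftD[OF assms(3)] assms(4) in auto)

lemma is_lift_join:
 assumes "is_lift h g" "is_lift k g'" "pathfinish h = pathstart k"
 shows "is_lift (h +++ k) (g +++ g')" unfolding is_lift_def
proof (intro conjI ballI)
 note h = is_liftD[OF assms(1)] and k = is_liftD[OF assms(2)]
 show "path (h +++ k)" using h k assms(3) by simp
 show "path_image (h +++ k) \<subseteq> X" using h k assms(3) by (simp add: path_image_join)
 show "pr ((h +++ k) t) = (g +++ g') t" if "t \<in> {0..1}" for t using that h(3)[of "2 * t"] k(3)[of "2 * t - 1"] by (auto simp: joinpaths_def)
qed

end

locale hyp_pointed = hyp_metric +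
 fixes p :: 'a
 assumes p_F: "p \<in> F"
begin

definition z0 :: complex where "z0 = (SOME z. z \<in> X \<and> pr z = p)"

lemma z0: "z0 \<in> X" "pr z0 = p"
proof -
 have "\<exists>z. z \<in> X \<and> pr z = p" using pr_surj p_F by (metis imageE)
 then have "z0 \<in> X \<and> pr z0 = p" unfolding z0_def by (rule someI_ex)
 then show "z0 \<in> X" "pr z0 = p" by auto
qed

abbreviation \<pi>1 :: "(real \<Rightarrow> 'a) set monoid" where
 "\<pi>1 \<equiv> fundamental_group F p"

text \<open>Holonomy with base point: lifts start at \<open>z0\<close>, in contrast to
  \<open>hol\<close>, so that an element is obtained and not only a conjugacy class.\<close>

definition rho :: "(real \<Rightarrow> 'a) set \<Rightarrow> complex \<Rightarrow> complex" where
 "rho x = (THE T. T \<in> deck \<and> (\<forall>g\<in>x. \<exists>h. is_lift h g \<and> pathstart h = z0 \<and> pathfinish h = T z0))"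

lemma carrier_pi1: "x \<in> carrier \<pi>1 \<longleftrightarrow> (\<exists>g. closed_curve F g \<and> pathstart g = p \<and> x = path_class F g)"
 by (auto simp: fundamental_group_def)

lemma path_class_self: "closed_curve F g \<Longrightarrow> g \<in> path_class F g" by (simp add: path_class_def closed_curve_def)

lemma carrier_elem:
 assumes "x \<in> carrier \<pi>1" "g \<in> x"
 shows "closed_curve F g" "pathstart g = p" "path_class F g = x"
proof -
 obtain g0 where g0: "closed_curve F g0" "pathstart g0 = p" "x = path_class F g0" using assms by (auto simp: carrier_pi1)
 then have h: "homotopic_paths F g0 g" using assms by (simp add: path_class_def)
 show "closed_curve F g" "pathstart g = p" using g0 homotopic_paths_imp_path[OF h] homotopic_paths_imp_subset[OF h]
   homotopic_paths_imp_pathstart[OF h] homotopic_paths_imp_pathfinish[OF h] by (auto simp: closed_curve_def)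
 show "path_class F g = x" unfolding g0(3) path_class_def using h homotopic_paths_sym homotopic_paths_trans by blast
qed

lemma carrier_homotopic:
 assumes "x \<in> carrier \<pi>1" "g \<in> x" "h \<in> x"
 shows "homotopic_paths F g h" using carrier_elem(3)[OF assms(1,2)] assms(3) by (auto simp: path_class_def)

lemma carrier_ne: "x \<in> carrier \<pi>1 \<Longrightarrow> \<exists>g. g \<in> x" using path_class_self by (auto simp: carrier_pi1)

lemma rho_ex:
 assumes "x \<in> carrier \<pi>1"
 shows "\<exists>!T. T \<in> deck \<and> (\<forall>g\<in>x. \<exists>h. is_lift h g \<and> pathstart h = z0 \<and> pathfinish h = T z0)"
proof -
 obtain g where g: "g \<in> x" using carrier_ne[OF assms] by blast
 note ge = carrier_elem[OF assms g]
 obtain T h where T: "T \<in> deck" "is_lift h g" "pathstart h = z0" "pathfinish h = T z0" using hol_at[OF ge(1) z0(1)] z0(2) ge(2) by metis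
 have "\<exists>h. is_lift h g' \<and> pathstart h = z0 \<and> pathfinish h = T z0" if g': "g' \<in> x" for g'
 proof -
  note ge' = carrier_elem[OF assms g']
  obtain h' where h': "is_lift h' g'" "pathstart h' = z0" using lift_path[of g' z0] ge' z0 by (auto simp: closed_curve_def)
  then show ?thesis using lift_monodromy[OF carrier_homotopic[OF assms g g'] T(2) h'(1)] T by metis
 qed
 moreover have "S = T" if S: "S \<in> deck" "\<forall>g\<in>x. \<exists>h. is_lift h g \<and> pathstart h = z0 \<and> pathfinish h = S z0" for S
 proof -
  obtain k where k: "is_lift k g" "pathstart k = z0" "pathfinish k = S z0" using S(2) g by blast
  have "k 1 = h 1" using lift_unique[OF k(1) T(2)] k(2) T(3) by simp
  then have "S z0 = T z0" using k(3) T(4) by (simp add: pathfinish_def)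
  then show ?thesis using deck_eq S T z0 by blast
 qed
 ultimately show ?thesis using T(1) by metis
qed

lemma rho:
 assumes "x \<in> carrier \<pi>1"
 shows "rho x \<in> deck" "g \<in> x \<Longrightarrow> \<exists>h. is_lift h g \<and> pathstart h = z0 \<and> pathfinish h = rho x z0"
 using theI'[OF rho_ex[OF assms]] unfolding rho_def[symmetric] by auto

lemma rho_eqI:
 assumes "x \<in> carrier \<pi>1" "g \<in> x" "T \<in> deck" "is_lift h g" "pathstart h = z0" "pathfinish h = T z0"
 shows "rho x = T"
proof -
 obtain k where k: "is_lift k g" "pathstart k = z0" "pathfinish k = rho x z0" using rho[OF assms(1)] assms(2) by blast
 have "k 1 = h 1" using lift_unique[OF k(1) assms(4)] k(2) assms(5) by simp
 then have "rho x z0 = T z0" using k(3) assms(6) by (simp add: pathfinish_def)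
 then show ?thesis using deck_eq rho(1)[OF assms(1)] assms(3) z0 by blast
qed

lemma rho_hol: "x \<in> carrier \<pi>1 \<Longrightarrow> g \<in> x \<Longrightarrow> hol g (rho x)" using rho by (fastforce simp: hol_def)

lemma mult_pi1:
 assumes "x \<in> carrier \<pi>1" "y \<in> carrier \<pi>1" "g \<in> x" "h \<in> y"
 shows "x \<otimes>\<^bsub>\<pi>1\<^esub> y = path_class F (g +++ h)" "closed_curve F (g +++ h)" "pathstart (g +++ h) = p"
proof -
 have "path_class F (g' +++ h') = path_class F (g +++ h)" if "g' \<in> x" "h' \<in> y" for g' h'
 proof -
  have "homotopic_paths F (g' +++ h') (g +++ h)" using carrier_elem[OF assms(1) that(1)] carrier_elem[OF assms(2) that(2)]
   by (intro homotopic_paths_join carrier_homotopic[OF assms(1) that(1) assms(3)] carrier_homotopic[OF assms(2) that(2) assms(4)])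
    (simp add: closed_curve_def)
  then show ?thesis unfolding path_class_def using homotopic_paths_sym homotopic_paths_trans by blast
 qed
 then have "(\<Union>g'\<in>x. \<Union>h'\<in>y. path_class F (g' +++ h')) = path_class F (g +++ h)" using assms(3,4) by blast
 then show "x \<otimes>\<^bsub>\<pi>1\<^esub> y = path_class F (g +++ h)" by (simp add: fundamental_group_def)
 show "closed_curve F (g +++ h)" "pathstart (g +++ h) = p" using carrier_elem[OF assms(1,3)] carrier_elem[OF assms(2,4)] by (auto simp: closed_curve_def path_image_join)
qed

text \<open>The lift of a product is the lift of the first loop followed by the translate by
  \<open>rho x\<close> of the lift of the second one. Hence the order of factors is kept.\<close>

lemma rho_mult:
 assumes "x \<in> carrier \<pi>1" "y \<in> carrier \<pi>1"
 shows "x \<otimes>\<^bsub>\<pi>1\<^esub> y \<in> carrier \<pi>1" "rho (x \<otimes>\<^bsub>\<pi>1\<^esub> y) = rho x o rho y"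
proof -
 obtain g h where gh: "g \<in> x" "h \<in> y" using carrier_ne[OF assms(1)] carrier_ne[OF assms(2)] by blast
 note m = mult_pi1[OF assms gh]
 show c: "x \<otimes>\<^bsub>\<pi>1\<^esub> y \<in> carrier \<pi>1" using m by (auto simp: carrier_pi1)
 obtain a where a: "is_lift a g" "pathstart a = z0" "pathfinish a = rho x z0" using rho(2)[OF assms(1) gh(1)] by blast
 obtain b where b: "is_lift b h" "pathstart b = z0" "pathfinish b = rho y z0" using rho(2)[OF assms(2) gh(2)] by blast
 note rx = rho(1)[OF assms(1)] and ry = rho(1)[OF assms(2)]
 show "rho (x \<otimes>\<^bsub>\<pi>1\<^esub> y) = rho x o rho y"
 proof (rule rho_eqI[OF c])
  show "g +++ h \<in> x \<otimes>\<^bsub>\<pi>1\<^esub> y" unfolding m(1) by (rule path_class_self[OF m(2)])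
  show "rho x o rho y \<in> deck" using rx ry deck_comp by blast
  show "is_lift (a +++ (rho x o b)) (g +++ h)" using a b rx by (intro is_lift_join is_lift_deck) (auto simp: pathstart_compose)
  show "pathstart (a +++ (rho x o b)) = z0" using a by simp
  show "pathfinish (a +++ (rho x o b)) = (rho x o rho y) z0" using b by (simp add: pathfinish_compose)
 qed
qed

lemma rho_one: "\<one>\<^bsub>\<pi>1\<^esub> \<in> carrier \<pi>1" "rho \<one>\<^bsub>\<pi>1\<^esub> = id"
proof -
 have c: "closed_curve F (\<lambda>_. p)" "pathstart (\<lambda>_. p) = p" using p_F by (auto simp: closed_curve_def path_def path_image_def pathstart_def pathfinish_def)
 have o: "\<one>\<^bsub>\<pi>1\<^esub> = path_class F (\<lambda>_. p)" by (simp add: fundamental_group_def)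
 show 1: "\<one>\<^bsub>\<pi>1\<^esub> \<in> carrier \<pi>1" unfolding o carrier_pi1 using c by blast
 show "rho \<one>\<^bsub>\<pi>1\<^esub> = id"
 proof (rule rho_eqI[OF 1])
  show "(\<lambda>_. p) \<in> \<one>\<^bsub>\<pi>1\<^esub>" unfolding o by (rule path_class_self[OF c(1)])
  show "is_lift (\<lambda>_. z0) (\<lambda>_. p)" using z0 by (auto simp: is_lift_def path_def path_image_def)
 qed (auto simp: deck_id pathstart_def pathfinish_def)
qed

lemma rho_inj:
 assumes "x \<in> carrier \<pi>1" "y \<in> carrier \<pi>1" "rho x = rho y"
 shows "x = y"
proof -
 obtain g h where gh: "g \<in> x" "h \<in> y" using carrier_ne[OF assms(1)] carrier_ne[OF assms(2)] by blast
 obtain a where a: "is_lift a g" "pathstart a = z0" "pathfinish a = rho x z0" using rho(2)[OF assms(1) gh(1)] by blast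
 obtain b where b: "is_lift b h" "pathstart b = z0" "pathfinish b = rho y z0" using rho(2)[OF assms(2) gh(2)] by blast
 note ad = is_liftD[OF a(1)] and bd = is_liftD[OF b(1)]
 have ab: "homotopic_paths F (pr o a) (pr o b)" using a b assms(3) by (intro homotopic_paths_pr ad(1,2) bd(1,2)) auto
 have eq: "homotopic_paths F (pr o k) g" if k: "is_lift k g" for k g using is_liftD[OF k] pr_lift_path[of k] by (intro homotopic_paths_eq) auto
 have "homotopic_paths F g h" using ab eq[OF a(1)] eq[OF b(1)] homotopic_paths_sym homotopic_paths_trans by blast
 then have "path_class F g = path_class F h" unfolding path_class_def using homotopic_paths_sym homotopic_paths_trans by blast
 then show ?thesis using carrier_elem(3) assms gh by metis
qed

lemma rho_surj:
 assumes "T \<in> deck"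
 shows "\<exists>x\<in>carrier \<pi>1. rho x = T"
proof -
 have Tz: "T z0 \<in> X" using deck_X assms z0 by blast
 note c = path_cvx[OF z0(1) Tz]
 note l = pr_lift_path[OF c(1,2)]
 have cl: "closed_curve F (pr o cvx z0 (T z0))" "pathstart (pr o cvx z0 (T z0)) = p"
  using l c z0 deck_pr[OF assms z0(1)] by (auto simp: closed_curve_def pathfinish_compose pathstart_compose)
 let ?x = "path_class F (pr o cvx z0 (T z0))"
 have x: "?x \<in> carrier \<pi>1" using cl by (auto simp: carrier_pi1)
 moreover have "rho ?x = T" using rho_eqI[OF x path_class_self[OF cl(1)] assms] l c by blast
 ultimately show ?thesis by blast
qed

text \<open>The group laws are pulled back from composition of deck transformations along the
  injective map \<open>rho\<close>, instead of being proved by reparametrizing paths.\<close>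

lemma group_pi1: "group \<pi>1"
proof (rule groupI)
 fix x y z assume c: "x \<in> carrier \<pi>1" "y \<in> carrier \<pi>1" "z \<in> carrier \<pi>1"
 show "x \<otimes>\<^bsub>\<pi>1\<^esub> y \<in> carrier \<pi>1" using rho_mult c by blast
 show "x \<otimes>\<^bsub>\<pi>1\<^esub> y \<otimes>\<^bsub>\<pi>1\<^esub> z = x \<otimes>\<^bsub>\<pi>1\<^esub> (y \<otimes>\<^bsub>\<pi>1\<^esub> z)"
  using c by (intro rho_inj) (simp_all add: rho_mult comp_assoc)
next
 show "\<one>\<^bsub>\<pi>1\<^esub> \<in> carrier \<pi>1" by (rule rho_one)
 fix x assume x: "x \<in> carrier \<pi>1"
 show "\<one>\<^bsub>\<pi>1\<^esub> \<otimes>\<^bsub>\<pi>1\<^esub> x = x" using x by (intro rho_inj) (simp_all add: rho_mult rho_one)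
 obtain y where y: "y \<in> carrier \<pi>1" "rho y = finv (rho x)" using rho_surj[OF deck_inv[OF rho(1)[OF x]]] by blast
 have "y \<otimes>\<^bsub>\<pi>1\<^esub> x = \<one>\<^bsub>\<pi>1\<^esub>"
  using x y isoms_inv(4)[OF deck_isoms[OF rho(1)[OF x]]] by (intro rho_inj) (simp_all add: rho_mult rho_one)
 then show "\<exists>y\<in>carrier \<pi>1. y \<otimes>\<^bsub>\<pi>1\<^esub> x = \<one>\<^bsub>\<pi>1\<^esub>" using y by blast
qed

lemma rho_inv:
 assumes "x \<in> carrier \<pi>1"
 shows "inv\<^bsub>\<pi>1\<^esub> x \<in> carrier \<pi>1" "rho (inv\<^bsub>\<pi>1\<^esub> x) = finv (rho x)"
proof -
 interpret group \<pi>1 by (rule group_pi1)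
 show i: "inv\<^bsub>\<pi>1\<^esub> x \<in> carrier \<pi>1" using assms by simp
 have "rho (inv\<^bsub>\<pi>1\<^esub> x) o rho x = id" using rho_mult(2)[OF i assms] rho_one assms by simp
 then have "rho (inv\<^bsub>\<pi>1\<^esub> x) o (rho x o finv (rho x)) = finv (rho x)" by (metis comp_assoc id_comp)
 then show "rho (inv\<^bsub>\<pi>1\<^esub> x) = finv (rho x)" using isoms_inv(5)[OF deck_isoms[OF rho(1)[OF assms]]] by simp
qed

lemma rho_conjugate:
 assumes "x \<in> carrier \<pi>1" "g \<in> carrier \<pi>1"
 shows "conjugate_by \<pi>1 x g \<in> carrier \<pi>1" "rho (conjugate_by \<pi>1 x g) = rho g o rho x o finv (rho g)"
 using assms unfolding conjugate_by_def by (simp_all add: rho_mult rho_inv)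

lemma conjugacy_class_rho:
 assumes "x \<in> carrier \<pi>1" "y \<in> carrier \<pi>1" "conjugacy_class \<pi>1 x = conjugacy_class \<pi>1 y"
 shows "\<exists>C\<in>deck. rho y = C o rho x o finv C"
proof -
 interpret group \<pi>1 by (rule group_pi1)
 have "conjugate_by \<pi>1 y \<one>\<^bsub>\<pi>1\<^esub> = y" using assms by (simp add: conjugate_by_def)
 then have "y \<in> conjugacy_class \<pi>1 y" unfolding conjugacy_class_def by (metis imageI one_closed)
 then have "y \<in> conjugacy_class \<pi>1 x" using assms(3) by simp
 then obtain g where "g \<in> carrier \<pi>1" "y = conjugate_by \<pi>1 x g" by (auto simp: conjugacy_class_def)
 then show ?thesis using rho_conjugate(2)[OF assms(1)] rho(1) by metis
qed

lemma represents_hol: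
 assumes "x \<in> carrier \<pi>1" "represents F x g"
 shows "hol g (rho x)"
proof -
 obtain h where h: "h \<in> x" "free_homotopy_class F h = free_homotopy_class F g" using assms by (auto simp: represents_def)
 then have "homotopic_loops F h g" using class_homotopic_loops carrier_elem(1)[OF assms(1)] by blast
 then show ?thesis using hol_homotopic rho_hol[OF assms(1) h(1)] by blast
qed

lemma represents_pr:
 assumes "x \<in> carrier \<pi>1" "path k" "path_image k \<subseteq> X" "pathfinish k = rho x (pathstart k)"
 shows "represents F x (pr o k)"
proof -
 obtain g where g: "g \<in> x" using carrier_ne[OF assms(1)] by blast
 have "homotopic_loops F g (pr o k)" using hol_homotopicI[OF rho_hol[OF assms(1) g] assms(2-4)] .
 then show ?thesis unfolding represents_def using g homotopic_loops_class by blast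
qed

end

section \<open>Classification of isometries\<close>

lemma elliptic_fixed_point:
 assumes d: "det2 M = 1" and t: "abs (tr2 M) < 2"
 obtains z where "0 < Im z" "act M z = z"
proof -
 have main: "\<exists>z. 0 < Im z \<and> act M z = z" if d: "det2 M = 1" and t: "abs (tr2 M) < 2" and c: "0 < m21 M" for M
 proof -
  have "(tr2 M)\<^sup>2 < 2\<^sup>2" using t by (metis abs_le_square_iff abs_numeral not_le)
  then have "sqrt (4 - (tr2 M)\<^sup>2) > 0" "(sqrt (4 - (tr2 M)\<^sup>2))\<^sup>2 = 4 - (tr2 M)\<^sup>2" by auto
  then obtain s where s: "s > 0" "s\<^sup>2 = 4 - (tr2 M)\<^sup>2" by blast
  \<comment> \<open>Coordinates of the root \<open>(m11 - m22 + i s) / (2 m21)\<close> of the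
    quadratic fixed point equation.\<close>
  define p q where "p = 2 * m21 M / s" and "q = (m11 M - m22 M) / s"
  have p: "p > 0" using c s by (simp add: p_def)
  define z where "z = hpoint p q"
  have z: "0 < Im z" "hp z = p" "hq z = q" using p by (simp_all add: z_def)
  have det: "m11 M * m22 M - m12 M * m21 M = 1" using d by (simp add: det2_def)
  have "1 + q\<^sup>2 = (s\<^sup>2 + (m11 M - m22 M)\<^sup>2) / s\<^sup>2" using s(1) by (simp add: q_def power_divide add_divide_distrib)
  also have "s\<^sup>2 + (m11 M - m22 M)\<^sup>2 = - 4 * (m12 M * m21 M)" unfolding s(2) tr2_def using det by (simp add: power2_eq_square algebra_simps)
  finally have "1 + q\<^sup>2 = - 4 * (m12 M * m21 M) / s\<^sup>2" .
  then have r: "hr z = - 2 * m12 M / s" using c s(1) unfolding hr_eq[OF z(1)] z p_def by (simp add: power2_eq_square)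
  have ad: "abs (det2 M) = 1" using d by simp
  have "hp (act M z) = p * (m11 M * m22 M - m12 M * m21 M)" unfolding act_h[OF z(1) ad] z r using s(1) by (simp add: p_def q_def field_simps power2_eq_square)
  moreover have "hq (act M z) = q * (m11 M * m22 M - m12 M * m21 M)" unfolding act_h[OF z(1) ad] z r using s(1) by (simp add: p_def q_def field_simps power2_eq_square)
  ultimately have "act M z = z" using z act_h(1)[OF z(1) ad] by (intro h_eqI) (simp_all add: det)
  then show ?thesis using z by blast
 qed
 have "m21 M \<noteq> 0"
 proof
  assume "m21 M = 0"
  then have "m11 M * m22 M = 1" using d by (simp add: det2_def)
  then have "(tr2 M)\<^sup>2 = (m11 M - m22 M)\<^sup>2 + 4" by (simp add: tr2_def power2_eq_square algebra_simps)
  then have "2\<^sup>2 \<le> (tr2 M)\<^sup>2" by simp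
  then show False using t by (metis abs_le_square_iff abs_numeral not_le)
 qed
 then consider "0 < m21 M" | "0 < m21 (- M)" by fastforce
 then show ?thesis
 proof cases
  case 1 then show ?thesis using main[OF d t] that by blast
 next
  case 2 then show ?thesis using main[of "- M"] d t that by auto
 qed
qed

lemma inv2_mult_conj:
 assumes "det2 V \<noteq> 0" "M * V = V * D"
 shows "inv2 V * M * V = D" using assms inv2_left[OF assms(1)] by (metis mult.assoc mult_1)

lemma inv2_inv2: "det2 V = 1 \<Longrightarrow> inv2 (inv2 V) = V" using det2_inv2[of V] unfolding inv2_def[of "inv2 V"] by (simp add: inv2_def mat2_eq_iff)

lemma conj_formI:
 assumes "det2 V = 1" "M * V = V * D"
 shows "\<exists>N. det2 N = 1 \<and> N * M * inv2 N = D" using assms inv2_mult_conj[of V M D] inv2_inv2[of V] det2_inv2[of V] by (intro exI[of _ "inv2 V"]) simp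

lemma parabolic_form:
 assumes d: "det2 M = 1" and t: "abs (tr2 M) = 2" and ne: "act M \<noteq> id"
 obtains N u where "det2 N = 1" "u \<noteq> 0" "act (N * M * inv2 N) = act (Mat 1 u 0 1)"
proof -
 have main: "\<exists>N u. det2 N = 1 \<and> u \<noteq> 0 \<and> N * M * inv2 N = Mat 1 u 0 1"
  if d: "det2 M = 1" and t: "tr2 M = 2" and ne: "M \<noteq> 1" for M
 proof -
  obtain a b c e where M: "M = Mat a b c e" by (cases M) auto
  have e: "e = 2 - a" using t by (simp add: M tr2_def)
  have bc: "b * c = - ((a - 1)\<^sup>2)" using d by (simp add: M e det2_def power2_eq_square algebra_simps)
  show ?thesis
  proof (cases "c = 0")
   case True
   then have "a = 1" using bc by simp
   then show ?thesis using ne True by (intro exI[of _ 1] exI[of _ b]) (auto simp: M e inv2_def mat2_eq_iff)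
  next
   case False
   \<comment> \<open>The first column is an eigenvector for the eigenvalue 1, the second one is
     chosen to make the determinant 1.\<close>
   let ?V = "Mat (a - 1) (- 1 / c) c 0"
   have "M * ?V = ?V * Mat 1 (- 1 / c) 0 1" using False bc by (simp add: M e mat2_eq_iff power2_eq_square algebra_simps diff_divide_distrib)
   moreover have "det2 ?V = 1" using False by (simp add: det2_def)
   ultimately obtain N where "det2 N = 1" "N * M * inv2 N = Mat 1 (- 1 / c) 0 1" using conj_formI by blast
   moreover have "- 1 / c \<noteq> 0" using False by simp
   ultimately show ?thesis by blast
  qed
 qed
 obtain M' where M': "det2 M' = 1" "tr2 M' = 2" "act M' = act M" "M' = M \<or> M' = - M"
 proof (cases "tr2 M \<ge> 0")
  case True
  then show ?thesis using that[of M] t d by simp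
 next
  case False
  then show ?thesis using that[of "- M"] t d by simp
 qed
 have "M' \<noteq> 1" using M' ne by auto
 then obtain N u where N: "det2 N = 1" "u \<noteq> 0" "N * M' * inv2 N = Mat 1 u 0 1" using main M' by blast
 have "N * (- M) * inv2 N = - (N * M * inv2 N)" by simp
 then have "act (N * M * inv2 N) = act (Mat 1 u 0 1)" using N(3) M'(4) by (metis act_minus)
 then show ?thesis using that N by blast
qed

lemma hyperbolic_form:
 assumes d: "det2 M = 1" and t: "2 < abs (tr2 M)"
 obtains N l where "det2 N = 1" "1 < abs l" "N * M * inv2 N = Mat l 0 0 (1 / l)"
proof -
 obtain a b c e where M: "M = Mat a b c e" by (cases M) auto
 have det: "a * e - b * c = 1" using d by (simp add: M det2_def)
 let ?t = "a + e"
 have t2: "?t\<^sup>2 > 2\<^sup>2" using t by (metis M abs_le_square_iff abs_numeral mat2.sel(1) mat2.sel(4) not_le tr2_def)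
 define s where "s = sqrt (?t\<^sup>2 - 4)"
 have s: "s > 0" "s\<^sup>2 = ?t\<^sup>2 - 4" using t2 by (auto simp: s_def)
 \<comment> \<open>The eigenvalue of larger modulus: the sign of the root follows the sign of the
   trace.\<close>
 define l where "l = (if ?t > 0 then (?t + s) / 2 else (?t - s) / 2)"
 have ll: "l * (?t - l) = 1" using s(2) by (simp add: l_def power2_eq_square field_simps)
 then have l0: "l \<noteq> 0" by auto
 have il: "?t - l = 1 / l" using ll l0 by (simp add: field_simps)
 have l1: "1 < abs l"
 proof (cases "?t > 0")
  case True
  then have "2 < ?t" using power2_less_imp_less[OF t2] by linarith
  then show ?thesis using True s by (simp add: l_def)
 next
  case False
  have "2\<^sup>2 < (- ?t)\<^sup>2" using t2 by (simp only: power2_minus)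
  then have "2 < - ?t" using power2_less_imp_less[of 2 "- ?t"] False by linarith
  then show ?thesis using False s by (simp add: l_def)
 qed
 have lne: "l \<noteq> 1 / l"
 proof
  assume "l = 1 / l"
  then have "l\<^sup>2 = 1" using l0 by (simp add: power2_eq_square field_simps)
  then show False using l1 by (simp add: abs_square_eq_1)
 qed
 have e: "e = l + 1 / l - a" using il by simp
 have bc: "b * c = a * (l + 1 / l) - a * a - 1" using det by (simp add: e algebra_simps)
 have shear: "b + x * (b / (y - x)) = b / (y - x) * y" if "y \<noteq> x" for x y :: real using that by (simp add: field_simps)
 have case_c: "\<exists>N. det2 N = 1 \<and> N * M * inv2 N = Mat l 0 0 (1 / l)"
  if "c \<noteq> 0"
 proof -
  define k where "k = c * (l - 1 / l)"
  have k: "k \<noteq> 0" using \<open>c \<noteq> 0\<close> lne by (simp add: k_def)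
  \<comment> \<open>The columns are eigenvectors for \<open>l\<close> and \<open>1 / l\<close>, the
    first one scaled to give determinant 1.\<close>
  let ?V = "Mat ((l - e) / k) (1 / l - e) (c / k) c"
  have 1: "a * (l - e) + b * c = l * (l - e)" unfolding bc using l0 by (simp add: e field_simps)
  have 2: "a * (1 / l - e) + b * c = (1 / l) * (1 / l - e)" unfolding bc using l0 by (simp add: e field_simps)
  have "det2 ?V = c * (l - 1 / l) / k" by (simp add: det2_def diff_divide_distrib algebra_simps)
  then have "det2 ?V = 1" using k unfolding k_def[symmetric] by simp
  moreover have "M * ?V = ?V * Mat l 0 0 (1 / l)"
  proof -
   have "a * ((l - e) / k) + b * (c / k) = (l - e) / k * l" using 1 k by (simp add: field_simps)
   moreover have "c * ((l - e) / k) + e * (c / k) = c / k * l" using k by (simp add: field_simps)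
   ultimately show ?thesis using 2 by (simp add: M mat2_eq_iff algebra_simps)
  qed
  ultimately show ?thesis by (rule conj_formI)
 qed
 have "\<exists>N. det2 N = 1 \<and> N * M * inv2 N = Mat l 0 0 (1 / l)"
 proof (cases "c = 0")
  case True
  then have ae: "a * e = 1" using det by simp
  then have "(a - l) * (a - 1 / l) = 0" using bc True l0 by (simp add: field_simps)
  then consider "a = l" | "a = 1 / l" by auto
  then show ?thesis
  proof cases
   case 1
   then have "e = 1 / l" using e by simp
   let ?V = "Mat 1 (b / (1 / l - l)) 0 1"
   have "b + l * (b / (1 / l - l)) = b / (1 / l - l) * (1 / l)" using shear[of "1 / l" l] lne by simp
   then have "M * ?V = ?V * Mat l 0 0 (1 / l)" using True 1 \<open>e = 1 / l\<close> by (simp add: M mat2_eq_iff algebra_simps)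
   then show ?thesis using conj_formI[of ?V] by (simp add: det2_def)
  next
   case 2
   then have e': "e = l" using e by simp
   let ?V = "Mat (b / (l - 1 / l)) (- 1) 1 0"
   have "1 / l * (b / (l - 1 / l)) + b = b / (l - 1 / l) * l" using shear[of l "1 / l"] lne by (metis add.commute)
   then have "M * ?V = ?V * Mat l 0 0 (1 / l)" using True 2 e' by (simp add: M mat2_eq_iff algebra_simps)
   then show ?thesis using conj_formI[of ?V] by (simp add: det2_def)
  qed
 qed (use case_c in blast)
 then show ?thesis using that l1 by blast
qed

lemma act_diag:
 assumes "l \<noteq> 0" "0 < Im z"
 shows "act (Mat l 0 0 (1 / l)) z = of_real (l\<^sup>2) * z" using assms by (simp add: act_def hpoint_def hp_def hq_def complex_eq_iff power2_eq_square)

lemma act_translate: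
 assumes "0 < Im z"
 shows "act (Mat 1 u 0 1) z = z + of_real u" using assms by (simp add: act_def hpoint_def hp_def hq_def complex_eq_iff field_simps)

section \<open>Closed convex sets\<close>

definition hconvex :: "complex set \<Rightarrow> bool" where
 "hconvex Y \<longleftrightarrow> Y \<subseteq> upper \<and>
   (\<forall>z\<in>upper. (\<forall>e>0. \<exists>w\<in>Y. hyp_dist z w < e) \<longrightarrow> z \<in> Y) \<and>
   (\<forall>z\<in>Y. \<forall>w\<in>Y. \<forall>s\<in>{0..1}. cvx z w s \<in> Y)"

lemma hconvex_upper: "hconvex Y \<Longrightarrow> z \<in> Y \<Longrightarrow> 0 < Im z"
 and hconvex_cvx: "hconvex Y \<Longrightarrow> z \<in> Y \<Longrightarrow> w \<in> Y \<Longrightarrow> s \<in> {0..1} \<Longrightarrow> cvx z w s \<in> Y"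
 by (auto simp: hconvex_def subset_iff)

lemma hconvex_closed:
 assumes "hconvex Y" "0 < Im z" "\<And>e. 0 < e \<Longrightarrow> \<exists>w\<in>Y. hyp_dist z w < e"
 shows "z \<in> Y"
proof -
 have "\<forall>z\<in>upper. (\<forall>e>0. \<exists>w\<in>Y. hyp_dist z w < e) \<longrightarrow> z \<in> Y" using assms(1) by (simp add: hconvex_def)
 then show ?thesis using assms(2,3) by simp
qed

lemma hconvex_limit:
 assumes Y: "hconvex Y" and z: "0 < Im z" and f: "\<And>n. f n \<in> Y" "f \<longlonglongrightarrow> z"
 shows "z \<in> Y"
proof (rule hconvex_closed[OF Y z])
 fix e :: real assume "0 < e"
 obtain r where r: "0 < r" "\<And>w. dist z w < r \<Longrightarrow> 0 < Im w \<and> hyp_dist z w < e" using hyp_dist_near[OF z \<open>0 < e\<close>] by blast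
 obtain n where "dist (f n) z < r" using tendstoD[OF f(2) r(1)] by (auto simp: eventually_sequentially)
 then show "\<exists>w\<in>Y. hyp_dist z w < e" using r(2)[of "f n"] f(1) by (auto simp: dist_commute)
qed

lemma hconvex_image:
 assumes "hconvex Y" "T \<in> isoms"
 shows "hconvex (T ` Y)" unfolding hconvex_def
proof (intro conjI ballI impI)
 have up: "0 < Im y" if "y \<in> Y" for y using hconvex_upper assms that by blast
 show "T ` Y \<subseteq> upper" using up assms(2) by auto
 fix z assume z: "z \<in> upper" and lim: "\<forall>e>0. \<exists>w\<in>T ` Y. hyp_dist z w < e"
 have iT: "finv T \<in> isoms" using isoms_inv assms by blast
 have "finv T z \<in> Y"
 proof (rule hconvex_closed[OF assms(1)])
  show "0 < Im (finv T z)" using iT z by simp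
  fix e :: real assume "0 < e"
  then obtain y where y: "y \<in> Y" "hyp_dist z (T y) < e" using lim by blast
  have "hyp_dist (T (finv T z)) (T y) = hyp_dist (finv T z) y" using iT z up y assms(2) by (intro isoms_dist) auto
  then show "\<exists>w\<in>Y. hyp_dist (finv T z) w < e" using y isoms_inv(2)[OF assms(2)] by auto
 qed
 then show "z \<in> T ` Y" using isoms_inv(2)[OF assms(2)] by (metis imageI)
next
 fix z w s assume "z \<in> T ` Y" "w \<in> T ` Y" and s: "s \<in> {0..1::real}"
 then obtain y v where y: "y \<in> Y" "v \<in> Y" "z = T y" "w = T v" by blast
 then have "cvx z w s = T (cvx y v s)" using isoms_cvx[OF assms(2)] hconvex_upper[OF assms(1)] s by simp
 then show "cvx z w s \<in> T ` Y" using hconvex_cvx[OF assms(1) y(1,2) s] by blast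
qed

lemma compact_hconvex_ball:
 assumes "hconvex Y" "0 < Im u"
 shows "compact (Y \<inter> {w. 0 < Im w \<and> hyp_dist u w \<le> R})" (is "compact (Y \<inter> ?B)") unfolding compact_def
proof (intro allI impI)
 fix f :: "nat \<Rightarrow> complex" assume f: "\<forall>n. f n \<in> Y \<inter> ?B"
 then obtain l r where l: "l \<in> ?B" "strict_mono r" "(f o r) \<longlonglongrightarrow> l"
  using compact_hyp_cball[OF assms(2), of R] unfolding compact_def by (metis (no_types, lifting) IntD2)
 have "l \<in> Y" using l f by (intro hconvex_limit[OF assms(1), of l "f o r"]) auto
 then show "\<exists>l\<in>Y \<inter> ?B. \<exists>r. strict_mono r \<and> (f o r) \<longlonglongrightarrow> l" using l by blast
qed

lemma hyp_midpoint_closer: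
 assumes "0 < Im z" "0 < Im w" "z \<noteq> w" "0 < Im u" "hyp_dist u z = hyp_dist u w"
 shows "hyp_dist u (cvx z w (1/2)) < hyp_dist u z"
proof -
 have h: "(1/2::real) \<in> {0..1}" by simp
 have "1 < hyp_ch z w" using assms by (simp add: hyp_ch_def)
 then have "1 < (1 - 1/2)\<^sup>2 + (1/2)\<^sup>2 + 2 * (1/2) * (1 - 1/2) * hyp_ch z w" by (simp add: power2_eq_square)
 then have n: "1 < cvx_norm z w (1/2)" unfolding cvx_norm_def by simp
 have e: "hyp_ch u z = hyp_ch u w" using assms hyp_dist_eq_iff by blast
 have "hyp_ch u (cvx z w (1/2)) = hyp_ch u z / cvx_norm z w (1/2)" unfolding hyp_ch_cvx[OF assms(1,2) h assms(4)] using e by simp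
 also have "\<dots> < hyp_ch u z" using n hyp_ch_ge1[OF assms(4,1)] by (simp add: divide_less_eq)
 finally show ?thesis using hyp_dist_le_iff[OF assms(4,1) assms(4) cvx_h(1)[OF assms(1,2) h]] by linarith
qed

text \<open>The point of \<open>Y\<close> nearest to \<open>u\<close> is unique, since the midpoint
  of two nearest points would be nearer; so it is fixed as well.\<close>

lemma hconvex_fixed_point:
 assumes Y: "hconvex Y" "Y \<noteq> {}" and T: "T \<in> isoms" "\<And>z. z \<in> Y \<Longrightarrow> T z \<in> Y" and u: "0 < Im u" "T u = u"
 obtains z where "z \<in> Y" "T z = z"
proof -
 obtain y where y: "y \<in> Y" using Y by blast
 have up: "0 < Im z" if "z \<in> Y" for z using hconvex_upper Y that by blast
 let ?K = "Y \<inter> {w. 0 < Im w \<and> hyp_dist u w \<le> hyp_dist u y}"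
 have K: "compact ?K" "?K \<noteq> {}" using compact_hconvex_ball[OF Y(1) u(1)] y up by auto
 have "continuous_on ?K (\<lambda>w. hyp_dist u w)" using u up by (intro continuous_on_hyp_dist continuous_intros) auto
 from continuous_attains_inf[OF K this]
 obtain z where z: "z \<in> ?K" "\<And>w. w \<in> ?K \<Longrightarrow> hyp_dist u z \<le> hyp_dist u w" by metis
 have zY: "z \<in> Y" "0 < Im z" using z up by auto
 have min: "hyp_dist u z \<le> hyp_dist u w" if "w \<in> Y" for w using z that up[OF that] by (cases "hyp_dist u w \<le> hyp_dist u y") auto
 have Tz: "T z \<in> Y" "0 < Im (T z)" using T zY by auto
 have "T z = z"
 proof (rule ccontr)
  assume ne: "T z \<noteq> z"
  have "hyp_dist u z = hyp_dist u (T z)" using isoms_dist[OF T(1) u(1) zY(2)] u(2) by simp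
  then have "hyp_dist u (cvx z (T z) (1/2)) < hyp_dist u z" using zY Tz ne u by (intro hyp_midpoint_closer) auto
  moreover have "cvx z (T z) (1/2) \<in> Y" using hconvex_cvx[OF Y(1) zY(1) Tz(1)] by simp
  ultimately show False using min by force
 qed
 then show ?thesis using that zY by blast
qed

text \<open>
 The midpoint of \<open>\<mu>\<^sup>n w\<close> and \<open>\<mu>\<^sup>-\<^sup>n w\<close> converges to the point of the imaginary axis
 with the same modulus as \<open>w\<close>.
\<close>

lemma midpoint_dilate:
 assumes "0 < k" "0 < Im w"
 defines "m \<equiv> cvx (of_real (1 / k) * w) (of_real k * w) (1/2)"
 shows "Re m = 2 * Re w / (k + 1 / k)"
  and "(Im m)\<^sup>2 = (cmod w)\<^sup>2 - (2 * Re w / (k + 1 / k))\<^sup>2" and "0 < Im m"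
proof -
 let ?z = "of_real (1 / k) * w" and ?w = "of_real k * w"
 have I: "0 < Im ?z" "0 < Im ?w" "(1/2::real) \<in> {0..1}" using assms by auto
 let ?n = "cvx_norm ?z ?w (1/2)"
 have n: "?n \<ge> 1" by (rule cvx_norm_ge1[OF I])
 note h = cvx_h[OF I, folded m_def]
 show "0 < Im m" by (rule h)
 have p: "hp m = (k + 1 / k) / (2 * Im w * ?n)" unfolding h using assms by (simp add: hp_def field_simps)
 have q: "hq m = (Re w / Im w) / ?n" unfolding h using assms by (simp add: hq_def)
 have hr: "hr (of_real c * w) = c * ((cmod w)\<^sup>2 / Im w)" if "0 < c" for c using that assms(2) unfolding hr_def cmod_power2 by (simp add: power2_eq_square field_simps)
 have "0 < 1 / k" using assms by simp
 then have r: "hr m = (k + 1 / k) * (cmod w)\<^sup>2 / (2 * Im w * ?n)" unfolding h hr[OF assms(1)] hr[OF \<open>0 < 1 / k\<close>] by (simp add: add_divide_distrib algebra_simps)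
 have "Re m = hq m / hp m" using h(1) by (simp add: hp_def hq_def)
 also have "\<dots> = 2 * Re w / (k + 1 / k)" unfolding p q using n assms by (simp add: field_simps)
 finally show re: "Re m = 2 * Re w / (k + 1 / k)" .
 have k: "k + 1 / k > 0" using assms by (simp add: add_pos_pos)
 have "(Re m)\<^sup>2 + (Im m)\<^sup>2 = hr m / hp m" using h(1) by (simp add: hp_def hr_def power2_eq_square)
 also have "\<dots> = (cmod w)\<^sup>2" unfolding p r using n assms(2) k by simp
 finally show "(Im m)\<^sup>2 = (cmod w)\<^sup>2 - (2 * Re w / (k + 1 / k))\<^sup>2" using re by simp
qed

lemma power_bracket:
 assumes "1 < \<mu>" "0 < (y::real)"
 obtains n where "1 / \<mu> ^ n \<le> y" "y \<le> \<mu> ^ n"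
proof -
 obtain n where n: "max y (1 / y) < \<mu> ^ n" using real_arch_pow[OF assms(1)] by blast
 have "0 < \<mu> ^ n" using assms by simp
 then have "1 / \<mu> ^ n \<le> y" using n assms by (simp add: field_simps)
 then show ?thesis using that n by force
qed

text \<open>The midpoints of the two opposite dilates of a point converge to a point of the axis, so
  \<open>Y\<close> contains one. Its own dilates spread along the axis in both directions, and
  convexity fills the gaps.\<close>

lemma hconvex_axis:
 assumes Y: "hconvex Y" "Y \<noteq> {}" and \<mu>: "1 < \<mu>" and inv: "\<And>z. z \<in> Y \<Longrightarrow> of_real \<mu> * z \<in> Y" "\<And>z. z \<in> Y \<Longrightarrow> of_real (1 / \<mu>) * z \<in> Y"
  and y: "0 < y"
 shows "Complex 0 y \<in> Y"
proof -
 obtain w where w: "w \<in> Y" using Y by blast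
 have I: "0 < Im w" using hconvex_upper[OF Y(1) w] .
 have pw: "of_real (\<mu> ^ n) * z \<in> Y \<and> of_real (1 / \<mu> ^ n) * z \<in> Y" if "z \<in> Y" for n z
 proof (induction n)
  case (Suc n)
  have "of_real (\<mu> ^ Suc n) * z = of_real \<mu> * (of_real (\<mu> ^ n) * z)" "of_real (1 / \<mu> ^ Suc n) * z = of_real (1 / \<mu>) * (of_real (1 / \<mu> ^ n) * z)" by simp_all
  then show ?case using inv Suc by metis
 qed (use that in simp)
 define m where "m n = cvx (of_real (1 / \<mu> ^ n) * w) (of_real (\<mu> ^ n) * w) (1/2)" for n
 have mY: "m n \<in> Y" for n unfolding m_def using pw[OF w] by (intro hconvex_cvx[OF Y(1)]) auto
 have pos: "0 < \<mu> ^ n" for n using \<mu> by simp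
 note md = midpoint_dilate[OF pos I, folded m_def]
 have "(\<lambda>n. norm (2 * Re w) * (1 / \<mu> ^ n)) \<longlonglongrightarrow> norm (2 * Re w) * 0" using \<mu> LIMSEQ_divide_realpow_zero by (intro tendsto_intros) auto
 then have lim: "(\<lambda>n. norm (2 * Re w) * (1 / \<mu> ^ n)) \<longlonglongrightarrow> 0" by simp
 have re0: "(\<lambda>n. 2 * Re w / (\<mu> ^ n + 1 / \<mu> ^ n)) \<longlonglongrightarrow> 0"
 proof (rule Lim_null_comparison[OF _ lim], intro always_eventually allI)
  fix n
  define q where "q = \<mu> ^ n"
  have q: "0 < q" using pos unfolding q_def .
  have "1 / (q + 1 / q) \<le> 1 / q" using q by (intro divide_left_mono) (auto simp: add_pos_pos)
  then have "norm (2 * Re w) * (1 / (q + 1 / q)) \<le> norm (2 * Re w) * (1 / q)" by (rule mult_left_mono) simp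
  moreover have "norm (2 * Re w / (q + 1 / q)) = norm (2 * Re w) * (1 / (q + 1 / q))" using q by (simp add: norm_divide add_pos_pos abs_of_pos)
  ultimately show "norm (2 * Re w / (\<mu> ^ n + 1 / \<mu> ^ n)) \<le> norm (2 * Re w) * (1 / \<mu> ^ n)" unfolding q_def by linarith
 qed
 have im: "Im (m n) = sqrt ((cmod w)\<^sup>2 - (2 * Re w / (\<mu> ^ n + 1 / \<mu> ^ n))\<^sup>2)" for n using md(2,3)[of n] by (metis abs_of_pos real_sqrt_abs)
 have "(\<lambda>n. sqrt ((cmod w)\<^sup>2 - (2 * Re w / (\<mu> ^ n + 1 / \<mu> ^ n))\<^sup>2)) \<longlonglongrightarrow> sqrt ((cmod w)\<^sup>2 - 0\<^sup>2)"
  by (intro tendsto_intros re0)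
 then have "m \<longlonglongrightarrow> Complex 0 (cmod w)" using re0 by (intro tendsto_complex_iff[THEN iffD2]) (simp add: md(1) im)
 moreover have cw: "0 < cmod w" using I by (cases "w = 0") auto
 ultimately have iw: "Complex 0 (cmod w) \<in> Y" using hconvex_limit[OF Y(1) _ mY, of "Complex 0 (cmod w)"] by simp
 have yw: "0 < y / cmod w" using y cw by simp
 obtain n where n: "1 / \<mu> ^ n \<le> y / cmod w" "y / cmod w \<le> \<mu> ^ n" using power_bracket[OF \<mu> yw] .
 have e: "Complex 0 (cmod w / \<mu> ^ n) \<in> Y" "Complex 0 (cmod w * \<mu> ^ n) \<in> Y" using pw[OF iw, of n] by (simp_all add: Complex_eq mult_ac)
 have le: "cmod w / \<mu> ^ n \<le> y" "y \<le> cmod w * \<mu> ^ n" using n cw pos[of n] by (simp_all add: field_simps)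
 have p0: "0 < cmod w / \<mu> ^ n" "0 < cmod w * \<mu> ^ n" using cw pos by auto
 have "hyp_dist (Complex 0 (cmod w / \<mu> ^ n)) (Complex 0 y) + hyp_dist (Complex 0 y) (Complex 0 (cmod w * \<mu> ^ n))
   = hyp_dist (Complex 0 (cmod w / \<mu> ^ n)) (Complex 0 (cmod w * \<mu> ^ n))"
 proof -
  have "ln (cmod w / \<mu> ^ n) \<le> ln y" "ln y \<le> ln (cmod w * \<mu> ^ n)" using le p0 y by auto
  then show ?thesis unfolding hyp_dist_axis[OF p0(1) y] hyp_dist_axis[OF y p0(2)] hyp_dist_axis[OF p0]
   unfolding ln_divide_pos[OF y p0(1)] ln_divide_pos[OF p0(2) y] ln_divide_pos[OF p0(2,1)] by linarith
 qed
 then obtain s where "s \<in> {0..1}" "Complex 0 y = cvx (Complex 0 (cmod w / \<mu> ^ n)) (Complex 0 (cmod w * \<mu> ^ n)) s"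
  using between_iff_cvx[of "Complex 0 (cmod w / \<mu> ^ n)" "Complex 0 (cmod w * \<mu> ^ n)" "Complex 0 y"] p0 y by auto
 then show ?thesis using hconvex_cvx[OF Y(1) e] by metis
qed

text \<open>The segment between two widely separated horizontal translates rises high above them, so
  its midpoint is as high as desired.\<close>

lemma hconvex_high:
 assumes Y: "hconvex Y" "Y \<noteq> {}" and u: "u \<noteq> 0" and inv: "\<And>z. z \<in> Y \<Longrightarrow> z + of_real u \<in> Y" "\<And>z. z \<in> Y \<Longrightarrow> z - of_real u \<in> Y"
 obtains z where "z \<in> Y" "H < Im z"
proof -
 obtain w where w: "w \<in> Y" using Y by blast
 have I: "0 < Im w" using hconvex_upper[OF Y(1) w] .
 have pw: "w + of_real (n * u) \<in> Y \<and> w - of_real (n * u) \<in> Y" for n :: nat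
 proof (induction n)
  case (Suc n)
  have "w + of_real (Suc n * u) = (w + of_real (n * u)) + of_real u" "w - of_real (Suc n * u) = (w - of_real (n * u)) - of_real u" by (simp_all add: algebra_simps)
  then show ?case using inv Suc by metis
 qed (use w in simp)
 obtain n :: nat where n: "abs H / abs u < n" using reals_Archimedean2 by blast
 then have nu: "abs H < n * abs u" using u by (simp add: field_simps)
 let ?z = "w - of_real (n * u)" and ?w = "w + of_real (n * u)"
 have J: "0 < Im ?z" "0 < Im ?w" "(1/2::real) \<in> {0..1}" using I by auto
 let ?m = "cvx ?z ?w (1/2)" let ?N = "cvx_norm ?z ?w (1/2)"
 have N: "1 \<le> ?N" by (rule cvx_norm_ge1[OF J])
 note h = cvx_h[OF J]
 have p: "hp ?m = 1 / (Im w * ?N)" unfolding h using I by (simp add: hp_def field_simps)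
 have "hyp_ch ?z ?w = 1 + 2 * (n * u)\<^sup>2 / (Im w)\<^sup>2"
 proof -
  have "?z - ?w = of_real (- 2 * (n * u))" by simp
  then have "(cmod (?z - ?w))\<^sup>2 = 4 * (n * u)\<^sup>2" by (simp only: norm_of_real power2_abs) (simp add: power_mult_distrib)
  then show ?thesis unfolding hyp_ch_def using I by (simp add: power2_eq_square)
 qed
 then have "?N\<^sup>2 = 1 + (n * u)\<^sup>2 / (Im w)\<^sup>2" unfolding cvx_norm_def using I by (simp add: power2_eq_square add_divide_distrib)
 then have "(Im w * ?N)\<^sup>2 = (Im w)\<^sup>2 + (n * u)\<^sup>2" using I by (simp add: power_mult_distrib field_simps)
 also have "\<dots> > (n * u)\<^sup>2" using I by simp
 finally have "(n * abs u)\<^sup>2 < (Im w * ?N)\<^sup>2" by (simp add: power_mult_distrib)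
 then have "n * abs u < Im w * ?N" using I N by (intro power2_less_imp_less[of "n * abs u"]) auto
 moreover have "Im ?m = Im w * ?N" using p h(1) I N by (simp add: hp_def field_simps)
 ultimately have "H < Im ?m" using nu by linarith
 moreover have "?m \<in> Y" using pw[of n] by (intro hconvex_cvx[OF Y(1)]) auto
 ultimately show ?thesis using that by blast
qed

section \<open>Orientation\<close>

lemma winding_number_exp_line:
 "winding_number (\<lambda>t. c + exp (u + of_real t * (2 * of_real pi * \<i> * of_int k))) c = of_int k"
proof -
 define \<kappa> :: complex where "\<kappa> = 2 * of_real pi * \<i> * of_int k"
 let ?g = "\<lambda>t::real. c + exp (u + of_real t * \<kappa>)"
 have d: "(?g has_vector_derivative exp (u + of_real t * \<kappa>) * \<kappa>) (at t within S)" for t S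
 proof -
  have "((\<lambda>t::real. u + of_real t * \<kappa>) has_vector_derivative \<kappa>) (at t within S)"
   by (auto intro!: derivative_eq_intros simp: has_vector_derivative_def scaleR_conv_of_real)
  from field_vector_diff_chain_within[OF this has_field_derivative_at_within[OF DERIV_exp]]
  have "((\<lambda>t::real. exp (u + of_real t * \<kappa>)) has_vector_derivative exp (u + of_real t * \<kappa>) * \<kappa>) (at t within S)" by (simp add: o_def mult.commute)
  from has_vector_derivative_add[OF has_vector_derivative_const this] show ?thesis by simp
 qed
 have cd: "continuous_on S (\<lambda>t::real. exp (u + of_real t * \<kappa>) * \<kappa>)" for S by (intro continuous_intros)
 have C1: "?g C1_differentiable_on {0..1}" unfolding C1_differentiable_on_def by (intro exI[of _ "\<lambda>t. exp (u + of_real t * \<kappa>) * \<kappa>"] conjI ballI d cd)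
 then have v: "valid_path ?g" unfolding valid_path_def by (rule C1_differentiable_imp_piecewise)
 have "((\<lambda>w. 1 / (w - c)) has_contour_integral \<kappa>) ?g" unfolding has_contour_integral_def
 proof (rule has_integral_eq[rotated])
  show "((\<lambda>t::real. \<kappa>) has_integral \<kappa>) {0..1}" using has_integral_const_real[of \<kappa> 0 1] by simp
  fix t :: real assume "t \<in> {0..1}"
  then have "vector_derivative ?g (at t within {0..1}) = exp (u + of_real t * \<kappa>) * \<kappa>" by (intro vector_derivative_at_within_ivl[OF d]) auto
  then show "\<kappa> = 1 / (?g t - c) * vector_derivative ?g (at t within {0..1})" by simp
 qed
 then have "contour_integral ?g (\<lambda>w. 1 / (w - c)) = \<kappa>" by (rule contour_integral_unique)
 moreover have "c \<notin> path_image ?g" by (auto simp: path_image_def)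
 ultimately have "winding_number ?g c = 1 / (2 * of_real pi * \<i>) * \<kappa>" using winding_number_valid_path[OF v] by simp
 then show ?thesis by (simp add: \<kappa>_def)
qed

text \<open>The homotopy exists in the punctured plane. The radial retraction onto the disc of
  radius \<open>s\<close>, which contains both loops, pushes it into the punctured ball without
  moving the loops.\<close>

lemma homotopic_loops_punctured_ball:
 assumes g: "path g" "pathfinish g = pathstart g" "path_image g \<subseteq> ball c r - {c}"
  and h: "path h" "pathfinish h = pathstart h" "path_image h \<subseteq> ball c r - {c}"
  and w: "winding_number g c = winding_number h c"
 shows "homotopic_loops (ball c r - {c}) g h"
proof -
 let ?K = "path_image g \<union> path_image h"
 have K: "compact ?K" "?K \<noteq> {}" using g h by (auto simp: compact_path_image)
 have "continuous_on ?K (dist c)" by (intro continuous_intros)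
 from continuous_attains_sup[OF K this]
 obtain w where w': "w \<in> ?K" "\<And>v. v \<in> ?K \<Longrightarrow> dist c v \<le> dist c w" by metis
 define s where "s = dist c w"
 have s: "0 < s" "s < r" using w'(1) g h by (auto simp: s_def)
 define R where "R v = c + of_real (min 1 (s / dist c v)) * (v - c)" for v
 have R: "continuous_on (- {c}) R" unfolding R_def by (intro continuous_intros) auto
 have "dist c (R v) = min (dist c v) s" if "v \<noteq> c" for v
 proof -
  have "dist c (R v) = norm (of_real (min 1 (s / dist c v)) * (v - c))" by (simp add: R_def dist_norm)
  also have "\<dots> = min 1 (s / dist c v) * dist c v" using s by (simp only: norm_mult norm_of_real) (simp add: dist_norm norm_minus_commute)
  also have "\<dots> = min (dist c v) s" using that by (simp add: min_def field_simps)
  finally show ?thesis .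
 qed
 then have R': "R \<in> - {c} \<rightarrow> ball c r - {c}" using s by (auto simp: Pi_iff) (metis dist_self dist_eq_0_iff less_irrefl min_def)
 have Rid: "R v = v" if "v \<in> ?K" for v
 proof -
  have "0 < dist c v" "dist c v \<le> s" using w'(2)[OF that] that g h by (auto simp: s_def)
  then have "1 \<le> s / dist c v" by simp
  then show ?thesis by (simp add: R_def min_def)
 qed
 have "homotopic_loops (- {c}) g h" using g h w by (subst winding_number_homotopic_loops_eq[symmetric]) auto
 then have "homotopic_loops (ball c r - {c}) (R o g) (R o h)" using R R' by (rule homotopic_loops_continuous_image)
 moreover have "homotopic_loops (ball c r - {c}) g (R o g)" using g Rid by (intro homotopic_loops_eq) (auto simp: path_image_def)
 moreover have "homotopic_loops (ball c r - {c}) h (R o h)" using h Rid by (intro homotopic_loops_eq) (auto simp: path_image_def)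
 ultimately show ?thesis by (metis homotopic_loops_sym homotopic_loops_trans)
qed

text \<open>An embedding carries the homotopy class of a loop around \<open>c\<close> to a class
  around \<open>f c\<close>, and the winding number determines the former.\<close>

lemma embedding_winding:
 assumes f: "continuous_on (ball c r) f" "inj_on f (ball c r)"
  and g: "path g" "pathfinish g = pathstart g" "path_image g \<subseteq> ball c r - {c}"
  and h: "path h" "pathfinish h = pathstart h" "path_image h \<subseteq> ball c r - {c}"
  and w: "winding_number g c = winding_number h c"
 shows "winding_number (f o g) (f c) = winding_number (f o h) (f c)"
proof (rule winding_number_homotopic_loops)
 show "homotopic_loops (- {f c}) (f o g) (f o h)"
 proof (rule homotopic_loops_continuous_image[OF homotopic_loops_punctured_ball[OF g h w]])
  show "continuous_on (ball c r - {c}) f" using f(1) by (rule continuous_on_subset) auto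
  have "f v \<noteq> f c" if "v \<in> ball c r - {c}" for v
  proof
   assume "f v = f c"
   moreover have "v \<in> ball c r" "c \<in> ball c r" using that by (auto intro: le_less_trans[OF zero_le_dist])
   ultimately show False using inj_onD[OF f(2)] that by blast
  qed
  then show "f \<in> ball c r - {c} \<rightarrow> - {f c}" by auto
 qed
qed

text \<open>The local degree at \<open>z\<close>, in the same shape as in
  \<open>orientation_compatible\<close>.\<close>

definition circle_degree :: "(complex \<Rightarrow> complex) \<Rightarrow> complex \<Rightarrow> real \<Rightarrow> complex" where
 "circle_degree f z r = winding_number (f o circlepath z r) (f z)"

lemma circle_degree_radius:
 assumes "continuous_on (ball z s) f" "inj_on f (ball z s)" "0 < r" "r < s" "0 < r'" "r' < s"
 shows "circle_degree f z r = circle_degree f z r'" unfolding circle_degree_def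
 using assms by (intro embedding_winding[OF assms(1,2)]) (auto simp: winding_number_circlepath_centre)

text \<open>The image of the circle is a simple closed curve. By invariance of domain the image of
  the open disc is a bounded component of its complement, so \<open>f z\<close> is inside.\<close>

lemma circle_degree_cases:
 assumes f: "continuous_on (ball z s) f" "inj_on f (ball z s)" and r: "0 < r" "r < s"
 shows "circle_degree f z r = 1 \<or> circle_degree f z r = - 1"
proof -
 let ?S = "f ` sphere z r" and ?B = "f ` ball z r"
 have sub: "cball z r \<subseteq> ball z s" using r by auto
 have fc: "continuous_on (cball z r) f" "inj_on f (cball z r)" using f sub by (blast intro: continuous_on_subset inj_on_subset)+
 have s: "sphere z r \<subseteq> cball z r" "ball z r \<subseteq> cball z r" by auto
 have pi: "path_image (f o circlepath z r) = ?S" using r by (simp add: path_image_compose)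
 have sp: "simple_path (f o circlepath z r)" using r fc s by (intro simple_path_continuous_image) (auto simp: simple_path_circlepath intro: continuous_on_subset inj_on_subset)
 have disj: "?B \<inter> ?S = {}" using fc(2) s by (auto simp: inj_on_def) (metis dist_commute less_irrefl mem_ball mem_cball order_less_imp_le order_refl)
 have op: "open ?B" using fc s by (intro invariance_of_domain) (auto intro: continuous_on_subset inj_on_subset)
 have "cball z r = ball z r \<union> sphere z r" by auto
 then have un: "f ` cball z r = ?B \<union> ?S" by (simp add: image_Un)
 have comp: "compact (f ` cball z r)" using fc(1) compact_continuous_image compact_cball by blast
 have "connected_component_set (- ?S) (f z) = ?B"
 proof (rule Set.equalityI)
  show "?B \<subseteq> connected_component_set (- ?S) (f z)" using disj r fc s by (intro connected_component_maximal connected_continuous_image) (auto intro: continuous_on_subset)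
  show "connected_component_set (- ?S) (f z) \<subseteq> ?B"
  proof (rule ccontr)
   let ?C = "connected_component_set (- ?S) (f z)"
   assume n: "\<not> ?C \<subseteq> ?B"
   have "open (- f ` cball z r)" using comp by (simp add: compact_imp_closed open_Compl)
   moreover have "?C \<subseteq> ?B \<union> - f ` cball z r" using connected_component_subset[of "- ?S" "f z"] un by auto
   moreover have "f z \<notin> ?S" using disj r by (metis IntI centre_in_ball empty_iff imageI)
   then have "f z \<in> ?C" by (simp add: connected_component_refl_eq)
   moreover have "f z \<in> ?B" using r by auto
   ultimately show False using connectedD[OF connected_connected_component[of "- ?S" "f z"] op \<open>open (- f ` cball z r)\<close>] n un by blast
  qed
 qed
 moreover have "bounded ?B" using comp un by (metis bounded_Un compact_imp_bounded)
 moreover have "f z \<notin> ?S" using disj r by (metis IntI centre_in_ball empty_iff imageI)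
 ultimately have "f z \<in> inside (path_image (f o circlepath z r))" by (simp add: inside_def pi)
 then show ?thesis unfolding circle_degree_def using simple_closed_path_winding_number_inside[OF sp] by metis
qed

text \<open>The centre is moved linearly together with its circle; the ball of radius
  \<open>2 * r\<close> contains all the intermediate circles.\<close>

lemma circle_degree_shift:
 assumes f: "continuous_on (ball z (2 * r)) f" "inj_on f (ball z (2 * r))" and r: "0 < r" and w: "dist z w < r"
 shows "circle_degree f w r = circle_degree f z r"
proof -
 define H where "H x = f (z + of_real (fst x) * (w - z) + of_real r * exp (2 * of_real pi * \<i> * of_real (snd x)))
   - f (z + of_real (fst x) * (w - z))" for x :: "real \<times> real"
 have b1: "z + of_real t * (w - z) + of_real r * exp (2 * of_real pi * \<i> * of_real q) \<in> ball z (2 * r)"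
  "z + of_real t * (w - z) \<in> ball z (2 * r)" if "t \<in> {0..1}" for t q :: real
 proof -
  have e: "norm (exp (2 * of_real pi * \<i> * of_real q)) = 1" by (simp add: norm_exp_eq_Re)
  have m: "norm (of_real t * (w - z)) < r" using w that mult_left_le_one_le[of "norm (w - z)" t] by (simp add: norm_mult dist_norm norm_minus_commute)
  have "norm (of_real t * (w - z) + of_real r * exp (2 * of_real pi * \<i> * of_real q)) < 2 * r"
   using norm_triangle_ineq[of "of_real t * (w - z)" "of_real r * exp (2 * of_real pi * \<i> * of_real q)"] m r by (simp add: norm_mult[of "of_real r"] e)
  then show "z + of_real t * (w - z) + of_real r * exp (2 * of_real pi * \<i> * of_real q) \<in> ball z (2 * r)"
   "z + of_real t * (w - z) \<in> ball z (2 * r)" using m r by (auto simp: dist_norm norm_minus_commute algebra_simps)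
 qed
 have cp: "circlepath u r q = u + of_real r * exp (2 * of_real pi * \<i> * of_real q)" for u q by (simp add: circlepath)
 have "homotopic_loops (- {0}) (\<lambda>q. f (circlepath z r q) - f z) (\<lambda>q. f (circlepath w r q) - f w)" unfolding homotopic_loops
 proof (intro exI[of _ H] conjI ballI)
  show "continuous_on ({0..1} \<times> {0..1}) H" unfolding H_def using b1 by (intro continuous_intros continuous_on_compose2[OF f(1)]) auto
  have "H x \<noteq> 0" if "x \<in> {0..1} \<times> {0..1}" for x
  proof
   assume "H x = 0"
   have "fst x \<in> {0..1}" using that by auto
   then have "of_real r * exp (2 * of_real pi * \<i> * of_real (snd x)) = (0::complex)" using inj_onD[OF f(2) _ b1[of "fst x"]] \<open>H x = 0\<close> unfolding H_def by fastforce
   then show False using r by simp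
  qed
  then show "H \<in> {0..1} \<times> {0..1} \<rightarrow> - {0}" by auto
  show "H (0, q) = f (circlepath z r q) - f z" for q by (simp add: H_def cp)
  show "H (1, q) = f (circlepath w r q) - f w" for q by (simp add: H_def cp)
  show "pathfinish (H o Pair t) = pathstart (H o Pair t)" for t by (simp add: pathfinish_def pathstart_def H_def exp_eq_1)
 qed
 from winding_number_homotopic_loops[OF this]
 show ?thesis unfolding circle_degree_def by (subst (1 2) winding_number_offset) (simp add: o_def)
qed

text \<open>The image under \<open>f\<close> of a small circle winds once around \<open>f z\<close>,
  so for the purposes of \<open>h\<close> it may be replaced by a round circle.\<close>

lemma circle_degree_compose:
 assumes f: "continuous_on (ball z s) f" "inj_on f (ball z s)" "0 < r" "r < s" "circle_degree f z r = 1"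
  and h: "continuous_on O' h" "inj_on h O'" "f ` ball z s \<subseteq> O'" "open O'"
  and pos: "\<And>c \<rho>. 0 < \<rho> \<Longrightarrow> cball c \<rho> \<subseteq> O' \<Longrightarrow> circle_degree h c \<rho> = 1"
 shows "circle_degree (h o f) z r = 1"
proof -
 have zs: "z \<in> ball z s" using assms by auto
 then have "f z \<in> O'" using h(3) by blast
 then obtain \<rho> where \<rho>: "0 < \<rho>" "cball (f z) \<rho> \<subseteq> O'" using h(4) open_contains_cball by blast
 have hs: "continuous_on (ball (f z) \<rho>) h" "inj_on h (ball (f z) \<rho>)"
  using h(1,2) \<rho>(2) ball_subset_cball[of "f z" \<rho>] by (meson continuous_on_subset inj_on_subset order_trans)+
 have "isCont f z" using f(1) zs by (simp add: continuous_on_eq_continuous_at)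
 then obtain k where k: "0 < k" "\<And>w. dist w z < k \<Longrightarrow> dist (f w) (f z) < \<rho>" using \<rho>(1) unfolding continuous_at_eps_delta by blast
 define q where "q = min (k / 2) (s / 2)"
 have q: "0 < q" "q < s" "q < k" using k(1) f(3,4) by (auto simp: q_def)
 have sph: "sphere z q \<subseteq> ball z s - {z}" using q by auto
 have cq: "circle_degree f z q = 1" using circle_degree_radius[OF f(1,2), of q r] q f(3-5) by simp
 have pf: "path (f o circlepath z q)" using q sph f(1) by (intro path_continuous_image) (auto intro: continuous_on_subset)
 have ne: "f w \<noteq> f z" if "w \<in> sphere z q" for w using inj_onD[OF f(2), of w z] that sph zs by auto
 have "winding_number (h o (f o circlepath z q)) (h (f z)) = winding_number (h o circlepath (f z) (\<rho> / 2)) (h (f z))"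
 proof (rule embedding_winding[OF hs])
  show "path_image (f o circlepath z q) \<subseteq> ball (f z) \<rho> - {f z}" using q ne k(2) by (auto simp: path_image_compose dist_commute)
  show "winding_number (f o circlepath z q) (f z) = winding_number (circlepath (f z) (\<rho> / 2)) (f z)"
   using cq \<rho> by (simp add: circle_degree_def winding_number_circlepath_centre)
 qed (use pf \<rho> in \<open>auto simp: pathfinish_compose pathstart_compose\<close>)
 also have "\<dots> = 1" using pos[of "\<rho> / 2" "f z"] \<rho> by (simp add: circle_degree_def subset_iff)
 finally have "circle_degree (h o f) z q = 1" by (simp add: circle_degree_def o_assoc)
 moreover have "circle_degree (h o f) z q = circle_degree (h o f) z r"
 proof (rule circle_degree_radius)
  show "continuous_on (ball z s) (h o f)" using f(1) continuous_on_subset[OF h(1,3)] by (rule continuous_on_compose)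
  show "inj_on (h o f) (ball z s)" using f(2) inj_on_subset[OF h(2,3)] by (rule comp_inj_on)
 qed (use q f in auto)
 ultimately show ?thesis by simp
qed

lemma act_moebius:
 assumes z: "0 < Im z" and M: "det2 M = - 1"
 shows "act M z = cnj ((of_real (m11 M) * z + of_real (m12 M)) / (of_real (m21 M) * z + of_real (m22 M)))"
  and "of_real (m21 M) * z + of_real (m22 M) \<noteq> 0"
proof -
 obtain a b c e where Me: "M = Mat a b c e" by (cases M) auto
 have d: "a * e - b * c = - 1" using M by (simp add: Me det2_def)
 have ce: "c \<noteq> 0 \<or> e \<noteq> 0" using d by auto
 show ne: "of_real (m21 M) * z + of_real (m22 M) \<noteq> 0" using z ce by (auto simp: Me complex_eq_iff)
 define x y where "x = Re z" and "y = Im z"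
 have zxy: "z = Complex x y" "0 < y" using z by (auto simp: x_def y_def)
 define n where "n = (c * x + e)\<^sup>2 + (c * y)\<^sup>2"
 have n: "n \<noteq> 0" using ce zxy(2) by (auto simp: n_def sum_power2_eq_zero_iff)
 have P: "c\<^sup>2 * hr z + 2 * c * e * hq z + e\<^sup>2 * hp z = n / y" using zxy(2) by (simp add: zxy(1) hr_def hq_def hp_def n_def field_simps power2_eq_square)
 have Q: "a * c * hr z + (a * e + b * c) * hq z + b * e * hp z = ((a * x + b) * (c * x + e) + a * c * y\<^sup>2) / y"
  using zxy(2) by (simp add: zxy(1) hr_def hq_def hp_def field_simps power2_eq_square)
 have "Re ((of_real a * z + of_real b) / (of_real c * z + of_real e)) = ((a * x + b) * (c * x + e) + a * c * y\<^sup>2) / n"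
  by (simp add: zxy(1) Re_divide n_def power2_eq_square algebra_simps)
 moreover have "Im ((of_real a * z + of_real b) / (of_real c * z + of_real e)) = (a * e - b * c) * y / n" by (simp add: zxy(1) Im_divide n_def power2_eq_square algebra_simps)
 ultimately show "act M z = cnj ((of_real (m11 M) * z + of_real (m12 M)) / (of_real (m21 M) * z + of_real (m22 M)))"
  using z zxy(2) n d by (simp add: Me act_def P Q hpoint_def complex_eq_iff del: complex_cnj_divide)
qed

text \<open>The map is the conjugate of a fractional linear map \<open>S\<close>. Near
  \<open>z\<close> the image of a circle under \<open>S\<close> stays close to the image under the
  derivative, which winds once; conjugation changes the sign.\<close>

lemma reflection_degree:
 assumes z: "0 < Im z" and M: "det2 M = - 1"
 obtains s where "0 < s" "\<And>r. 0 < r \<Longrightarrow> r < s \<Longrightarrow> circle_degree (act M) z r = - 1"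
proof -
 define S where "S w = (of_real (m11 M) * w + of_real (m12 M)) / (of_real (m21 M) * w + of_real (m22 M))" for w :: complex
 define e where "e = of_real (m21 M) * z + of_real (m22 M)"
 have e0: "e \<noteq> 0" using act_moebius(2)[OF z M] by (simp add: e_def)
 \<comment> \<open>The derivative of \<open>S\<close> at \<open>z\<close>, which is the determinant
   divided by the square of the denominator.\<close>
 define \<kappa> where "\<kappa> = - 1 / e\<^sup>2"
 have \<kappa>: "\<kappa> \<noteq> 0" using e0 by (simp add: \<kappa>_def)
 have num: "of_real (m11 M) * e - (of_real (m11 M) * z + of_real (m12 M)) * of_real (m21 M) = complex_of_real (det2 M)" by (simp add: e_def det2_def algebra_simps)
 have "(S has_field_derivative (of_real (m11 M) * e - (of_real (m11 M) * z + of_real (m12 M)) * of_real (m21 M)) / (e * e)) (at z)"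
  unfolding S_def e_def using e0[unfolded e_def] by (auto intro!: derivative_eq_intros)
 then have der: "(S has_field_derivative \<kappa>) (at z)" unfolding num by (simp add: \<kappa>_def M power2_eq_square)
 then have "(S has_derivative (\<lambda>h. h * \<kappa>)) (at z)" by (simp add: has_field_derivative_def mult_commute_abs)
 then obtain s1 where s1: "0 < s1" "\<And>w. norm (w - z) < s1 \<Longrightarrow> norm (S w - S z - (w - z) * \<kappa>) \<le> norm \<kappa> / 2 * norm (w - z)"
  unfolding has_derivative_at_alt using \<kappa> by (metis half_gt_zero zero_less_norm_iff)
 define s where "s = min s1 (Im z)"
 have "circle_degree (act M) z r = - 1" if r: "0 < r" "r < s" for r
 proof -
  let ?C = "circlepath z r"
  have up: "0 < Im (?C t)" for t
  proof -
   have "abs (Im (?C t - z)) \<le> norm (?C t - z)" by (rule abs_Im_le_cmod)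
   also have "\<dots> = r" using r by (simp add: circlepath norm_mult norm_exp_eq_Re)
   finally have "abs (Im (?C t) - Im z) \<le> r" by simp
   then show ?thesis using r unfolding s_def by linarith
  qed
  have nC: "norm (?C t - z) = r" for t using r by (simp add: circlepath norm_mult norm_exp_eq_Re)
  let ?L = "\<lambda>t. S z + exp (Ln (of_real r * \<kappa>) + of_real t * (2 * of_real pi * \<i> * of_int 1))"
  have rk: "of_real r * \<kappa> \<noteq> 0" using r \<kappa> by simp
  have L: "?L t = S z + (?C t - z) * \<kappa>" for t using rk by (simp add: exp_add circlepath mult_ac)
  have pS: "path (S o ?C)"
  proof (rule path_continuous_image)
   show "continuous_on (path_image ?C) S" unfolding S_def using act_moebius(2)[OF up M] by (intro continuous_intros) (auto simp: path_image_def)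
  qed simp
  have w: "winding_number (S o ?C) (S z) = winding_number ?L (S z)"
  proof (rule winding_number_nearby_loops_eq)
   show "path ?L" unfolding path_def by (intro continuous_intros)
   show "pathfinish ?L = pathstart ?L" by (simp add: pathfinish_def pathstart_def exp_add)
   fix t :: real
   have "norm (S (?C t) - S z - (?C t - z) * \<kappa>) \<le> norm \<kappa> / 2 * norm (?C t - z)" using nC r by (intro s1(2)) (simp add: s_def)
   also have "\<dots> < norm ((?C t - z) * \<kappa>)" using nC r \<kappa> by (simp add: norm_mult)
   finally show "norm ((S o ?C) t - ?L t) < norm (?L t - S z)" unfolding L by (simp add: algebra_simps)
  qed (use pS in \<open>simp_all add: pathfinish_compose pathstart_compose\<close>)
  then have w1: "winding_number (S o ?C) (S z) = 1" using winding_number_exp_line[of "S z" _ 1] by simp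
  have am: "act M v = cnj (S v)" if "0 < Im v" for v using act_moebius(1)[OF that M] by (simp add: S_def)
  have "S z \<notin> path_image (S o ?C)"
  proof
   assume "S z \<in> path_image (S o ?C)"
   then obtain t where t: "t \<in> {0..1}" "S z = S (?C t)" by (auto simp: path_image_def)
   then have "act M z = act M (?C t)" using am z up by metis
   then have "?C t = z" using act_eq_iff[of M] M by simp
   then show False using nC[of t] r by simp
  qed
  then have "winding_number (cnj o (S o ?C)) (cnj (S z)) = - 1" using winding_number_cnj[OF pS] w1 by simp
  moreover have "winding_number (act M o ?C) (act M z) = winding_number (cnj o (S o ?C)) (cnj (S z))" unfolding am[OF z] using am up by (intro winding_number_cong) simp
  ultimately show ?thesis by (simp add: circle_degree_def)
 qed
 moreover have "0 < s" using s1(1) z by (simp add: s_def)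
 ultimately show ?thesis using that by blast
qed

text \<open>For \<open>s < 1\<close> the contraction towards \<open>w\<close> is injective, so
  invariance of domain applies. For injectivity, the norm of a preimage is a root of
  \<open>n^2 - 2 s c n = 1 - 2 s\<close>; two different roots have product
  \<open>2 s - 1 < 1\<close> and cannot both be at least 1.\<close>

lemma cvx_interior:
 assumes z: "z \<in> interior Y" and Y: "hconvex Y" and w: "w \<in> Y" and s: "s \<in> {0..<1}"
 shows "cvx z w s \<in> interior Y"
proof -
 have up: "0 < Im v" if "v \<in> Y" for v using hconvex_upper[OF Y that] .
 have iY: "interior Y \<subseteq> Y" by (rule interior_subset)
 have s': "s \<in> {0..1}" "0 \<le> s" "s < 1" using s by auto
 have "inj_on (\<lambda>v. cvx v w s) (interior Y)"
 proof (rule inj_onI)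
  fix u v assume uv: "u \<in> interior Y" "v \<in> interior Y" "cvx u w s = cvx v w s"
  have I: "0 < Im u" "0 < Im v" "0 < Im w" using uv iY up w by auto
  define N K where "N = cvx_norm u w s" and "K = cvx_norm v w s"
  have NK: "1 \<le> N" "1 \<le> K" using cvx_norm_ge1 I s' by (auto simp: N_def K_def)
  have e1: "K * ((1 - s) * hp u + s * hp w) = N * ((1 - s) * hp v + s * hp w)"
   "K * ((1 - s) * hq u + s * hq w) = N * ((1 - s) * hq v + s * hq w)" using cvx_h(2,3)[OF I(1,3) s'(1)] cvx_h(2,3)[OF I(2,3) s'(1)] uv(3) NK
   by (auto simp: N_def[symmetric] K_def[symmetric] field_simps)
  define c where "c = hyp_ch w (cvx u w s)"
  have root: "n * (n - 2 * s * c) = 1 - 2 * s" if "0 < Im v'" "n = cvx_norm v' w s" "cvx v' w s = cvx u w s" for v' n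
  proof -
   have n: "1 \<le> n" using cvx_norm_ge1[OF that(1) I(3) s'(1)] that(2) by simp
   have "c = ((1 - s) * hyp_ch w v' + s * hyp_ch w w) / n" unfolding c_def that(2) that(3)[symmetric] by (rule hyp_ch_cvx[OF that(1) I(3) s'(1) I(3)])
   then have nc: "n * c = (1 - s) * hyp_ch v' w + s" using n by (simp add: hyp_ch_def norm_minus_commute mult.commute)
   have "n\<^sup>2 = (1 - s)\<^sup>2 + s\<^sup>2 + 2 * s * ((1 - s) * hyp_ch v' w)" using n unfolding that(2) cvx_norm_def by (simp add: mult.assoc)
   also have "\<dots> = (1 - s)\<^sup>2 + s\<^sup>2 + 2 * s * (n * c - s)" using nc by simp
   finally show ?thesis by (simp add: power2_eq_square algebra_simps)
  qed
  have N: "N * (N - 2 * s * c) = 1 - 2 * s" and K: "K * (K - 2 * s * c) = 1 - 2 * s" using root[OF I(1) N_def] root[OF I(2) K_def] uv(3) by simp_all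
  have "(N - K) * (N + K - 2 * s * c) = 0" using N K by (simp add: algebra_simps)
  moreover have "N + K - 2 * s * c \<noteq> 0"
  proof
   assume "N + K - 2 * s * c = 0"
   then have "N - 2 * s * c = - K" by simp
   then have "N * K = 2 * s - 1" using N by simp
   moreover have "1 \<le> N * K" using NK mult_mono[of 1 N 1 K] by simp
   ultimately show False using s' by simp
  qed
  ultimately have NK': "N = K" by simp
  have "hp u = hp v" "hq u = hq v" using e1 NK NK' s' by simp_all
  then show "u = v" using h_eqI I by blast
 qed
 moreover have "continuous_on (interior Y) (\<lambda>v. cvx v w s)" using iY up w s' by (intro continuous_on_cvx continuous_intros) auto
 ultimately have "open ((\<lambda>v. cvx v w s) ` interior Y)" by (intro invariance_of_domain) auto
 moreover have "(\<lambda>v. cvx v w s) ` interior Y \<subseteq> Y" using hconvex_cvx[OF Y _ w s'(1)] iY by blast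
 ultimately have "(\<lambda>v. cvx v w s) ` interior Y \<subseteq> interior Y" by (rule interior_maximal[rotated])
 then show ?thesis using z by blast
qed

section \<open>The interior of the cover; deck transformations preserve orientation\<close>

context hyp_metric
begin

lemma hconvex_X: "hconvex X" unfolding hconvex_def using X_sub_upper X_closed X_convex by auto

lemma X_ne: "X \<noteq> {}" using pr_surj F_ne by auto

lemma interior_X_ne: "interior X \<noteq> {}"
proof -
 obtain x where "x \<in> F" using F_ne by blast
 then obtain O' where "open O'" "O' \<noteq> {}" "O' \<subseteq> X" using X_interior by blast
 then show ?thesis using interior_maximal by blast
qed

lemma deck_interior:
 assumes "T \<in> deck" "z \<in> interior X"
 shows "T z \<in> interior X"
proof -
 have "open (T ` interior X)" using deck_isoms[OF assms(1)] interior_subset[of X] X_sub_upper by (intro open_isom_image) auto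
 moreover have "T ` interior X \<subseteq> X" using deck_X[OF assms(1)] interior_subset by blast
 ultimately have "T ` interior X \<subseteq> interior X" by (rule interior_maximal[rotated])
 then show ?thesis using assms(2) by blast
qed

lemma openin_F_iff: "openin (top_of_set F) U \<longleftrightarrow> U \<subseteq> F \<and> (\<forall>x\<in>U. \<exists>r>0. \<forall>y\<in>F. d x y < r \<longrightarrow> y \<in> U)"
proof -
 have "mball x r \<subseteq> U \<longleftrightarrow> (\<forall>y\<in>F. d x y < r \<longrightarrow> y \<in> U)" if "x \<in> F" for x r using that by (auto simp: subset_eq)
 then show ?thesis unfolding mtopology_F[symmetric] openin_mtopology by (meson subsetD)
qed

lemma pr_open:
 assumes V: "open V" "V \<subseteq> X"
 shows "openin (top_of_set F) (pr ` V)" unfolding openin_F_iff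
proof (intro conjI ballI)
 show "pr ` V \<subseteq> F" using V(2) by (auto intro!: pr_F)
 fix x assume "x \<in> pr ` V"
 then obtain z where z: "z \<in> V" "z \<in> X" "x = pr z" using V(2) by blast
 obtain e where e: "0 < e" "ball z e \<subseteq> V" using V(1) z(1) open_contains_ball by blast
 obtain h where h: "0 < h" "\<And>w. 0 < Im w \<Longrightarrow> hyp_dist z w < h \<Longrightarrow> dist z w < e" using hyp_dist_small[OF X_upper[OF z(2)] e(1)] by metis
 have "x \<in> F" using z pr_F by simp
 then obtain r where r: "0 < r" "\<And>z y. z \<in> X \<Longrightarrow> pr z = x \<Longrightarrow> y \<in> F \<Longrightarrow> d x y < r \<Longrightarrow> \<exists>u\<in>X. hyp_dist z u = d x y \<and> pr u = y"
  using pr_local by metis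
 show "\<exists>r>0. \<forall>y\<in>F. d x y < r \<longrightarrow> y \<in> pr ` V"
 proof (intro exI[of _ "min r h"] conjI ballI impI)
  fix y assume y: "y \<in> F" "d x y < min r h"
  then obtain u where u: "u \<in> X" "hyp_dist z u = d x y" "pr u = y" using r(2)[of z y] z by auto
  then have "dist z u < e" using h(2) X_upper y by simp
  then have "u \<in> V" using e(2) by auto
  then show "y \<in> pr ` V" using u(3) by blast
 qed (use r h in auto)
qed

text \<open>Discs that are embedded by \<open>pr\<close> into the domain of a chart, so that the
  local degree of chart after projection makes sense there.\<close>

definition good_ball :: "complex \<Rightarrow> real \<Rightarrow> 'a set \<Rightarrow> bool" where
 "good_ball z s U \<longleftrightarrow> 0 < s \<and> ball z s \<subseteq> X \<and> pr ` ball z s \<subseteq> U \<and> inj_on pr (ball z s)"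

lemma good_ball_sub:
 assumes "good_ball z s U" "0 < r" "dist z w + r \<le> s"
 shows "good_ball w r U"
proof -
 have "ball w r \<subseteq> ball z s"
 proof
  fix v assume "v \<in> ball w r"
  then have "dist w v < r" by simp
  then have "dist z v < s" using dist_triangle[of z v w] assms(3) by linarith
  then show "v \<in> ball z s" by simp
 qed
 moreover from this have "pr ` ball w r \<subseteq> pr ` ball z s" by (rule image_mono)
 ultimately show ?thesis using assms(1,2) inj_on_subset[of pr "ball z s" "ball w r"] unfolding good_ball_def by (metis (no_types, lifting) order_trans)
qed

lemma good_ball_ex:
 assumes "z \<in> interior X" "openin (top_of_set F) U" "pr z \<in> U"
 obtains s where "good_ball z s U"
proof -
 have zX: "z \<in> X" using assms(1) interior_subset by blast
 obtain s1 where s1: "0 < s1" "ball z s1 \<subseteq> X" using assms(1) mem_interior by blast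
 have zF: "pr z \<in> F" using pr_F[OF zX] .
 obtain r1 where r1: "0 < r1" "\<And>y. y \<in> F \<Longrightarrow> d (pr z) y < r1 \<Longrightarrow> y \<in> U" using assms(2,3) unfolding openin_F_iff by blast
 obtain r2 where r2: "0 < r2" "\<And>u v. u \<in> X \<Longrightarrow> v \<in> X \<Longrightarrow> hyp_dist z u < r2 \<Longrightarrow> hyp_dist z v < r2 \<Longrightarrow> d (pr u) (pr v) = hyp_dist u v"
  using pr_local[OF zF] zX by metis
 have "0 < min r1 r2" using r1 r2 by simp
 then obtain h where h: "0 < h" "\<And>w. dist z w < h \<Longrightarrow> 0 < Im w \<and> hyp_dist z w < min r1 r2" using hyp_dist_near[OF X_upper[OF zX]] by metis
 have b: "v \<in> X \<and> hyp_dist z v < r1 \<and> hyp_dist z v < r2" if "v \<in> ball z (min s1 h)" for v using that s1(2) h(2)[of v] by auto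
 have "good_ball z (min s1 h) U" unfolding good_ball_def
 proof (intro conjI)
  show "pr ` ball z (min s1 h) \<subseteq> U"
  proof
   fix y assume "y \<in> pr ` ball z (min s1 h)"
   then obtain v where v: "v \<in> ball z (min s1 h)" "y = pr v" by blast
   have "d (pr z) (pr v) < r1" using pr_lipschitz[OF zX, of v] b[OF v(1)] by linarith
   then show "y \<in> U" using r1(2) pr_F b[OF v(1)] v(2) by simp
  qed
  show "inj_on pr (ball z (min s1 h))"
  proof (rule inj_onI)
   fix u v assume uv: "u \<in> ball z (min s1 h)" "v \<in> ball z (min s1 h)" "pr u = pr v"
   have "hyp_dist u v = d (pr u) (pr v)" using r2(2) b[OF uv(1)] b[OF uv(2)] by simp
   also have "\<dots> = 0" using uv(3) pr_F b[OF uv(2)] by simp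
   finally show "u = v" using hyp_dist_0_iff X_upper b[OF uv(1)] b[OF uv(2)] by blast
  qed
  show "0 < min s1 h" using s1(1) h(1) by simp
  show "ball z (min s1 h) \<subseteq> X" using b by blast
 qed
 then show ?thesis using that by blast
qed

text \<open>The atlas in \<open>orientable\<close> covers \<open>surface_interior F\<close> only;
  this lemma makes it available over \<open>interior X\<close>.\<close>

lemma pr_surface_interior:
 assumes "z \<in> interior X"
 shows "pr z \<in> surface_interior F"
proof -
 have zX: "z \<in> X" using interior_subset[of X] assms by (rule subsetD)
 obtain s where s: "good_ball z s F" using good_ball_ex[OF assms openin_subtopology_self pr_F[OF zX]] .
 let ?B = "ball z s"
 have B: "?B \<subseteq> X" "inj_on pr ?B" "0 < s" using s by (auto simp: good_ball_def)
 have cp: "continuous_on ?B pr" using continuous_on_pr B(1) by (rule continuous_on_subset)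
 have ci: "continuous_on (pr ` ?B) (inv_into ?B pr)"
 proof (rule continuous_on_inverse_open_map[OF cp HOL.refl])
  show "inv_into ?B pr (pr x) = x" if "x \<in> ?B" for x using B(2) that by simp
  fix V assume "openin (top_of_set ?B) V"
  then have V: "open V" "V \<subseteq> ?B" by (auto simp: openin_open_eq)
  then have "openin (top_of_set F) (pr ` V)" using pr_open B(1) by blast
  then show "openin (top_of_set (pr ` ?B)) (pr ` V)" by (rule openin_subset_trans) (use V(2) B(1) in \<open>auto intro!: pr_F\<close>)
 qed
 have "interior_chart F (pr ` ?B) (inv_into ?B pr)" unfolding interior_chart_def
 proof (intro conjI exI[of _ pr])
  show "openin (top_of_set F) (pr ` ?B)" using pr_open B(1) by blast
  have e: "inv_into ?B pr ` pr ` ?B = ?B" using B(2) by (simp add: inv_into_image_cancel)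
  show "open (inv_into ?B pr ` pr ` ?B)" unfolding e by simp
  show "homeomorphism (pr ` ?B) (inv_into ?B pr ` pr ` ?B) (inv_into ?B pr) pr" unfolding e homeomorphism_def using cp ci e B(2) by (auto simp: f_inv_into_f)
 qed
 moreover have "pr z \<in> pr ` ?B" using B(3) by auto
 ultimately show ?thesis unfolding surface_interior_def by blast
qed

text \<open>An oriented atlas splits the interior of \<open>X\<close> into points where the
  projection has degree 1 in the charts and points where it has degree -1. The type of a point is
  locally constant, so it agrees at \<open>z\<close> and at its image. As \<open>pr\<close> is
  invariant, a deck transformation of determinant -1 would change the type.\<close>

lemma deck_orientation:
 assumes ori: "orientable F" and T: "act M \<in> deck" and M: "abs (det2 M) = 1"
 shows "det2 M = 1"
proof (rule ccontr)
 assume "det2 M \<noteq> 1"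
 then have M1: "det2 M = - 1" using M by linarith
 let ?T = "act M"
 obtain A where "(\<forall>(U, \<phi>)\<in>A. interior_chart F U \<phi>) \<and> (\<Union>(U, \<phi>)\<in>A. U) = surface_interior F \<and>
   (\<forall>(U, \<phi>)\<in>A. \<forall>(V, \<psi>)\<in>A. orientation_compatible U \<phi> V \<psi>)" using ori unfolding orientable_def by (rule exE)
 then have A: "\<And>U \<phi>. (U, \<phi>) \<in> A \<Longrightarrow> interior_chart F U \<phi>" "(\<Union>(U, \<phi>)\<in>A. U) = surface_interior F"
  "\<And>U \<phi> V \<psi>. (U, \<phi>) \<in> A \<Longrightarrow> (V, \<psi>) \<in> A \<Longrightarrow> orientation_compatible U \<phi> V \<psi>" by auto
 have ch: "openin (top_of_set F) U" "open (\<phi> ` U)" "continuous_on U \<phi>" "inj_on \<phi> U"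
  "continuous_on (\<phi> ` U) (inv_into U \<phi>)" if UA: "(U, \<phi>) \<in> A" for U \<phi>
 proof -
  obtain \<psi> where h: "homeomorphism U (\<phi> ` U) \<phi> \<psi>" and o: "openin (top_of_set F) U" "open (\<phi> ` U)" using A(1)[OF UA] by (auto simp: interior_chart_def)
  show "openin (top_of_set F) U" "open (\<phi> ` U)" "continuous_on U \<phi>" using h o by (auto simp: homeomorphism_def)
  show i: "inj_on \<phi> U" using h by (metis homeomorphism_apply1 inj_onI)
  have "inv_into U \<phi> v = \<psi> v" if "v \<in> \<phi> ` U" for v using that h i by (auto simp: homeomorphism_apply1)
  then show "continuous_on (\<phi> ` U) (inv_into U \<phi>)" using homeomorphism_cont2[OF h] continuous_on_cong by (metis (no_types, lifting))
 qed
 have emb: "continuous_on (ball z s) (\<phi> o pr)" "inj_on (\<phi> o pr) (ball z s)"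
  if "(U, \<phi>) \<in> A" "good_ball z s U" for U \<phi> z s
 proof -
  have g: "ball z s \<subseteq> X" "pr ` ball z s \<subseteq> U" "inj_on pr (ball z s)" using that(2) by (auto simp: good_ball_def)
  show "continuous_on (ball z s) (\<phi> o pr)" using continuous_on_subset[OF continuous_on_pr g(1)] continuous_on_subset[OF ch(3)[OF that(1)] g(2)] by (rule continuous_on_compose)
  show "inj_on (\<phi> o pr) (ball z s)" using g(3) inj_on_subset[OF ch(4)[OF that(1)] g(2)] by (rule comp_inj_on)
 qed
 define P where "P z \<longleftrightarrow> (\<exists>U \<phi> s r. (U, \<phi>) \<in> A \<and> good_ball z s U \<and> 0 < r \<and> r < s \<and> circle_degree (\<phi> o pr) z r = 1)" for z
 \<comment> \<open>The degree does not depend on the chart: transition maps of the atlas have degree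
   1 on every small circle.\<close>
 have P_all: "circle_degree (\<psi> o pr) z r = 1"
  if Pz: "P z" and V: "(V, \<psi>) \<in> A" "good_ball z s V" "0 < r" "r < s" for z V \<psi> s r
 proof -
  obtain U \<phi> s' r' where U: "(U, \<phi>) \<in> A" "good_ball z s' U" "0 < r'" "r' < s'" "circle_degree (\<phi> o pr) z r' = 1" using Pz unfolding P_def by blast
  define t where "t = min s s'"
  have t: "0 < t" "t \<le> s" "t \<le> s'" using V U by (auto simp: t_def)
  have gt: "good_ball z t V" "good_ball z t U" using t good_ball_sub[OF V(2)] good_ball_sub[OF U(2)] by auto
  then have im: "pr ` ball z t \<subseteq> U \<inter> V" by (auto simp: good_ball_def)
  have U1: "circle_degree (\<phi> o pr) z (t / 2) = 1" using circle_degree_radius[OF emb[OF U(1,2)], of "t / 2" r'] t U by simp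
  let ?h = "\<psi> o inv_into U \<phi>" and ?O = "\<phi> ` (U \<inter> V)"
  have "openin (top_of_set (\<phi> ` U)) (\<phi> ` U \<inter> inv_into U \<phi> -` (U \<inter> V))"
  proof (rule continuous_openin_preimage[OF ch(5)[OF U(1)], of U])
   show "inv_into U \<phi> \<in> \<phi> ` U \<rightarrow> U" by (auto simp: inv_into_into)
   show "openin (top_of_set U) (U \<inter> V)" using ch(1)[OF U(1)] ch(1)[OF V(1)] by (meson Int_lower1 openin_Int openin_imp_subset openin_subset_trans)
  qed
  moreover have "\<phi> ` U \<inter> inv_into U \<phi> -` (U \<inter> V) = ?O" using ch(4)[OF U(1)] by auto
  ultimately have oO: "open ?O" using ch(2)[OF U(1)] openin_open_trans by metis
  have iO: "inv_into U \<phi> ` ?O = U \<inter> V" using ch(4)[OF U(1)] by (simp add: inv_into_image_cancel)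
  have "circle_degree (?h o (\<phi> o pr)) z (t / 2) = 1"
  proof (rule circle_degree_compose[OF emb[OF U(1) gt(2)] _ _ U1, of ?O])
   show "continuous_on ?O ?h" using iO by (intro continuous_on_compose continuous_on_subset[OF ch(5)[OF U(1)]] continuous_on_subset[OF ch(3)[OF V(1)]]) auto
   show "inj_on ?h ?O" using iO by (intro comp_inj_on inj_on_inv_into inj_on_subset[OF ch(4)[OF V(1)]]) auto
   show "(\<phi> o pr) ` ball z t \<subseteq> ?O" using im by (auto simp: image_comp[symmetric])
   show "circle_degree ?h c \<rho> = 1" if "0 < \<rho>" "cball c \<rho> \<subseteq> ?O" for c \<rho>
    using A(3)[OF U(1) V(1)] that unfolding orientation_compatible_def circle_degree_def by simp
  qed (use t oO in auto)
  moreover have "circle_degree (?h o (\<phi> o pr)) z (t / 2) = circle_degree (\<psi> o pr) z (t / 2)"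
  proof -
   have e: "(?h o (\<phi> o pr)) v = (\<psi> o pr) v" if "v \<in> ball z t" for v
   proof -
    have "pr v \<in> U" using im that by blast
    then show ?thesis using ch(4)[OF U(1)] by simp
   qed
   have "circlepath z (t / 2) q \<in> ball z t" for q using t by (simp add: circlepath dist_norm norm_mult norm_exp_eq_Re)
   then show ?thesis unfolding circle_degree_def using e t e[of z] by (auto intro!: winding_number_cong)
  qed
  ultimately show ?thesis using circle_degree_radius[OF emb[OF V(1,2)], of "t / 2" r] t V by simp
 qed
 have chart: "\<exists>U \<phi> s. (U, \<phi>) \<in> A \<and> good_ball z s U" if z: "z \<in> interior X" for z
 proof -
  have "pr z \<in> (\<Union>(U, \<phi>)\<in>A. U)" using pr_surface_interior[OF z] A(2) by simp
  then obtain U \<phi> where U: "(U, \<phi>) \<in> A" "pr z \<in> U" by auto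
  then show ?thesis using good_ball_ex[OF z ch(1)[OF U(1)] U(2)] by metis
 qed
 have loc: "\<exists>e>0. \<forall>w. dist z w < e \<longrightarrow> (P z \<longleftrightarrow> P w)" if z: "z \<in> interior X" for z
 proof -
  obtain U \<phi> s where U: "(U, \<phi>) \<in> A" "good_ball z s U" using chart[OF z] by blast
  have s: "0 < s" using U(2) by (simp add: good_ball_def)
  have "P z \<longleftrightarrow> P w" if w: "dist z w < s / 4" for w
  proof -
   have gw: "good_ball w (3 * s / 4) U" using good_ball_sub[OF U(2), of "3 * s / 4" w] s w by simp
   have "circle_degree (\<phi> o pr) w (s / 2) = circle_degree (\<phi> o pr) z (s / 2)" using emb[OF U] s w by (intro circle_degree_shift) auto
   moreover have "P z \<longleftrightarrow> circle_degree (\<phi> o pr) z (s / 2) = 1"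
    using P_all[OF _ U, of "s / 2"] U s unfolding P_def by (metis field_sum_of_halves half_gt_zero less_add_same_cancel1)
   moreover have "P w \<longleftrightarrow> circle_degree (\<phi> o pr) w (s / 2) = 1"
   proof
    show "P w" if "circle_degree (\<phi> o pr) w (s / 2) = 1"
     unfolding P_def using that U(1) gw s by (intro exI[of _ U] exI[of _ \<phi>] exI[of _ "3 * s / 4"] exI[of _ "s / 2"]) auto
   qed (use P_all[OF _ U(1) gw, of "s / 2"] s in auto)
   ultimately show ?thesis by simp
  qed
  then show ?thesis using s by (intro exI[of _ "s / 4"]) auto
 qed
 obtain z where z: "z \<in> interior X" using interior_X_ne by blast
 have Tz: "?T z \<in> interior X" by (rule deck_interior[OF T z])
 have zX: "z \<in> X" "?T z \<in> X" using z Tz interior_subset by blast+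
 \<comment> \<open>Interior points are connected through interior points, so the locally constant
   type can be transported along the segment.\<close>
 have pc: "path_image (cvx z (?T z)) \<subseteq> interior X"
 proof
  fix v assume "v \<in> path_image (cvx z (?T z))"
  then obtain q where q: "q \<in> {0..1}" "v = cvx z (?T z) q" by (auto simp: path_image_def)
  show "v \<in> interior X"
  proof (cases "q = 1")
   case True
   then show ?thesis using q Tz zX X_upper by simp
  next
   case False
   then show ?thesis using cvx_interior[OF z hconvex_X zX(2), of q] q by auto
  qed
 qed
 have con: "connected (path_image (cvx z (?T z)))" using path_cvx(1)[OF zX] by (rule connected_path_image)
 have PT: "P z \<longleftrightarrow> P (?T z)"
 proof (rule connected_equivalence_relation[OF con, of z "?T z" "\<lambda>v w. P v \<longleftrightarrow> P w"])
  show "z \<in> path_image (cvx z (?T z))" "?T z \<in> path_image (cvx z (?T z))" using path_cvx(3,4)[OF zX] by (metis pathstart_in_path_image pathfinish_in_path_image)+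
  fix v assume v: "v \<in> path_image (cvx z (?T z))"
  then obtain e where e: "0 < e" "\<And>w. dist v w < e \<Longrightarrow> (P v \<longleftrightarrow> P w)" using loc[of v] pc by blast
  show "\<exists>N. openin (top_of_set (path_image (cvx z (?T z)))) N \<and> v \<in> N \<and> (\<forall>w\<in>N. P v \<longleftrightarrow> P w)"
   using v e by (intro exI[of _ "path_image (cvx z (?T z)) \<inter> ball v e"]) (auto simp: openin_open)
 qed auto
 obtain U \<phi> s where U: "(U, \<phi>) \<in> A" "good_ball (?T z) s U" using chart[OF Tz] by blast
 have s: "0 < s" using U(2) by (simp add: good_ball_def)
 obtain s1 where s1: "good_ball z s1 U"
 proof (rule good_ball_ex[OF z ch(1)[OF U(1)]])
  have "pr (?T z) \<in> U" using U(2) s centre_in_ball unfolding good_ball_def by blast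
  then show "pr z \<in> U" using deck_pr[OF T zX(1)] by simp
 qed
 have s1p: "0 < s1" using s1 by (simp add: good_ball_def)
 obtain k where k: "0 < k" "\<And>r. 0 < r \<Longrightarrow> r < k \<Longrightarrow> circle_degree ?T z r = - 1" using reflection_degree[OF X_upper[OF zX(1)] M1] by blast
 have "continuous_on upper ?T" using M by (rule continuous_on_act)
 then have "isCont ?T z" using X_upper[OF zX(1)] open_upper by (simp add: continuous_on_eq_continuous_at)
 then obtain k2 where k2: "0 < k2" "\<And>w. dist w z < k2 \<Longrightarrow> dist (?T w) (?T z) < s" unfolding continuous_at_eps_delta using s by blast
 define r where "r = Min {k, k2, s1} / 2"
 have r: "0 < r" "r < k" "r < k2" "r < s1" using k(1) k2(1) s1p by (auto simp: r_def min_def)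
 let ?C = "circlepath z r"
 have C: "dist (?C q) z = r" for q using r by (simp add: circlepath dist_norm norm_mult norm_exp_eq_Re)
 have CX: "?C q \<in> X" for q using C[of q] r s1 by (auto simp: good_ball_def dist_commute)
 have Ci: "path_image ?C \<subseteq> upper" using CX X_upper by (auto simp: path_image_def)
 have pT: "path (?T o ?C)" using continuous_on_subset[OF continuous_on_act[OF M] Ci] by (intro path_continuous_image) auto
 \<comment> \<open>The image of the circle under the reflection winds -1 times around its centre, so
   an embedding treats it like a reversed circle.\<close>
 have "winding_number ((\<phi> o pr) o (?T o ?C)) ((\<phi> o pr) (?T z)) = winding_number ((\<phi> o pr) o reversepath (circlepath (?T z) (s / 2))) ((\<phi> o pr) (?T z))"
 proof (rule embedding_winding[OF emb[OF U]])
  show "path_image (?T o ?C) \<subseteq> ball (?T z) s - {?T z}" using k2(2)[OF C[THEN eq_refl[THEN le_less_trans], OF r(3)]] act_eq_iff[OF M] C r(1)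
   by (auto simp: path_image_def dist_commute) (metis dist_self less_irrefl)
  show "winding_number (?T o ?C) (?T z) = winding_number (reversepath (circlepath (?T z) (s / 2))) (?T z)" using k(2)[OF r(1,2)] s
   by (subst winding_number_reversepath) (auto simp: circle_degree_def winding_number_circlepath_centre)
 qed (use pT s in \<open>auto simp: pathfinish_compose pathstart_compose\<close>)
 also have "\<dots> = winding_number (reversepath ((\<phi> o pr) o circlepath (?T z) (s / 2))) ((\<phi> o pr) (?T z))" by (simp add: reversepath_o o_assoc)
 also have "\<dots> = - circle_degree (\<phi> o pr) (?T z) (s / 2)" unfolding circle_degree_def
 proof (rule winding_number_reversepath)
  have sub: "sphere (?T z) (s / 2) \<subseteq> ball (?T z) s" using s by auto
  show "path ((\<phi> o pr) o circlepath (?T z) (s / 2))" using s continuous_on_subset[OF emb(1)[OF U] sub] by (intro path_continuous_image) auto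
  show "(\<phi> o pr) (?T z) \<notin> path_image ((\<phi> o pr) o circlepath (?T z) (s / 2))"
  proof
   assume "(\<phi> o pr) (?T z) \<in> path_image ((\<phi> o pr) o circlepath (?T z) (s / 2))"
   then obtain v where v: "v \<in> sphere (?T z) (s / 2)" "(\<phi> o pr) (?T z) = (\<phi> o pr) v" using s by (auto simp: path_image_compose)
   then have "?T z = v" using inj_onD[OF emb(2)[OF U] v(2)] sub s by auto
   then show False using v(1) s by auto
  qed
 qed
 also have "winding_number ((\<phi> o pr) o (?T o ?C)) ((\<phi> o pr) (?T z)) = circle_degree (\<phi> o pr) z r"
  unfolding circle_degree_def using deck_pr[OF T] CX zX(1) by (auto intro!: winding_number_cong)
 finally have flip: "circle_degree (\<phi> o pr) z r = - circle_degree (\<phi> o pr) (?T z) (s / 2)" .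
 have "P z \<longleftrightarrow> circle_degree (\<phi> o pr) z r = 1" using P_all[OF _ U(1) s1 r(1,4)] U(1) s1 r unfolding P_def by blast
 moreover have "P (?T z) \<longleftrightarrow> circle_degree (\<phi> o pr) (?T z) (s / 2) = 1"
  using P_all[OF _ U, of "s / 2"] U s unfolding P_def by (metis field_sum_of_halves half_gt_zero less_add_same_cancel1)
 moreover have "circle_degree (\<phi> o pr) z r = 1 \<or> circle_degree (\<phi> o pr) z r = - 1" using emb[OF U(1) s1] r by (intro circle_degree_cases)
 ultimately show False using PT flip by auto
qed

end

section \<open>Axes and closed geodesics\<close>

locale oriented_hyp = hyp_metric +
 assumes orientable_F: "orientable F"
begin

lemma deck_matrix:
 assumes "T \<in> deck"
 obtains M where "det2 M = 1" "T = act M" using deck_isoms[OF assms] deck_orientation[OF orientable_F] assms unfolding isoms_def by auto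

text \<open>The fixed point may lie outside \<open>X\<close>. The convex set then contains another
  one, and deck transformations act freely on \<open>X\<close>.\<close>

lemma deck_fixed:
 assumes "T \<in> deck" "0 < Im u" "T u = u"
 shows "T = id" using hconvex_fixed_point[OF hconvex_X X_ne deck_isoms[OF assms(1)] deck_X[OF assms(1)] assms(2,3)]
  deck_free[OF assms(1)] by blast

lemma deck_trace:
 assumes "act M \<in> deck" "det2 M = 1" "act M \<noteq> id"
 shows "2 \<le> abs (tr2 M)" using elliptic_fixed_point[OF assms(2)] deck_fixed[OF assms(1)] assms(3) by (metis not_le)

lemma deck_conj_invariant:
 assumes T: "act M \<in> deck" "det2 M = 1" and N: "det2 N = 1" and z: "z \<in> act N ` X"
 shows "act (N * M * inv2 N) z \<in> act N ` X" "act (inv2 (N * M * inv2 N)) z \<in> act N ` X"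
proof -
 obtain w where w: "w \<in> X" "z = act N w" using z by blast
 have d: "det2 (inv2 N) = 1" "det2 (inv2 M) = 1" using det2_inv2 T N by auto
 have "act (N * M * inv2 N) z = act N (act M w)" unfolding w(2) using T N d by (simp add: act_mult)
 then show "act (N * M * inv2 N) z \<in> act N ` X" using deck_X[OF T(1) w(1)] by simp
 have "finv (act M) = act (inv2 M)" using T by (simp add: act_inv)
 then have iX: "act (inv2 M) w \<in> X" using deck_X[OF deck_inv[OF T(1)] w(1)] by simp
 have "act (N * M * inv2 N) (act N (act (inv2 M) w)) = z" unfolding w(2) using T N d by (simp add: act_mult)
 moreover have "abs (det2 (N * M * inv2 N)) = 1" using T N d by simp
 ultimately have "act (inv2 (N * M * inv2 N)) z = act N (act (inv2 M) w)" using act_inv2(1) by metis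
 then show "act (inv2 (N * M * inv2 N)) z \<in> act N ` X" using iX by simp
qed

text \<open>A positive lower bound for the injectivity radius over a compact part of the surface.
  Locally \<open>r / 2\<close> works: a smaller displacement would put both points into a ball on
  which \<open>pr\<close> is injective.\<close>

lemma displacement:
 assumes K: "compact K" "K \<subseteq> F"
 obtains e where "0 < e" "\<And>z T. z \<in> X \<Longrightarrow> pr z \<in> K \<Longrightarrow> T \<in> deck \<Longrightarrow> T \<noteq> id \<Longrightarrow> e \<le> hyp_dist z (T z)"
proof -
 define good where "good V e \<longleftrightarrow> open V \<and> 0 < e \<and>
  (\<forall>z\<in>X. \<forall>T\<in>deck. pr z \<in> V \<longrightarrow> T \<noteq> id \<longrightarrow> e \<le> hyp_dist z (T z))" for V and e :: real
 have loc: "\<exists>V e. good V e \<and> x \<in> V" if xF: "x \<in> F" for x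
 proof -
  obtain r where r: "0 < r"
   "\<And>z u v. z \<in> X \<Longrightarrow> pr z = x \<Longrightarrow> u \<in> X \<Longrightarrow> v \<in> X \<Longrightarrow> hyp_dist z u < r \<Longrightarrow> hyp_dist z v < r \<Longrightarrow> d (pr u) (pr v) = hyp_dist u v"
   "\<And>z y. z \<in> X \<Longrightarrow> pr z = x \<Longrightarrow> y \<in> F \<Longrightarrow> d x y < r \<Longrightarrow> \<exists>u\<in>X. hyp_dist z u = d x y \<and> pr u = y"
   by (rule pr_local[OF xF]) (rule that; assumption)
  have "openin mtopology (mball x (r / 2))" by (rule openin_mball)
  then obtain V where V: "open V" "mball x (r / 2) = F \<inter> V" unfolding mtopology_F openin_open by blast
  have "r / 2 \<le> hyp_dist w (T w)" if w: "w \<in> X" "pr w \<in> V" and T: "T \<in> deck" "T \<noteq> id" for w T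
  proof (rule ccontr)
   assume small: "\<not> r / 2 \<le> hyp_dist w (T w)"
   have wF: "pr w \<in> F" using pr_F[OF w(1)] .
   then have dw: "d x (pr w) < r / 2" using V(2) w(2) by (metis IntI in_mball)
   obtain z0 where z0: "z0 \<in> X" "pr z0 = x" using pr_surj \<open>x \<in> F\<close> by (metis imageE)
   obtain u where u: "u \<in> X" "hyp_dist z0 u = d x (pr w)" "pr u = pr w" using r(3)[OF z0 wF] dw r(1) by auto
   obtain S where S: "S \<in> deck" "S u = w" using deck_transitive[OF u(1) w(1) u(3)] by blast
   define z where "z = S z0"
   have z: "z \<in> X" "pr z = x" using deck_X[OF S(1) z0(1)] deck_pr[OF S(1) z0(1)] z0(2) by (auto simp: z_def)
   have zw: "hyp_dist z w < r / 2" using isoms_dist[OF deck_isoms[OF S(1)] X_upper[OF z0(1)] X_upper[OF u(1)]] S(2) u(2) dw by (simp add: z_def)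
   have Tw: "T w \<in> X" "pr (T w) = pr w" using deck_X[OF T(1) w(1)] deck_pr[OF T(1) w(1)] .
   have "hyp_dist z (T w) < r" using hyp_dist_triangle[OF X_upper[OF z(1)] X_upper[OF w(1)] X_upper[OF Tw(1)]] zw small by linarith
   then have "d (pr w) (pr (T w)) = hyp_dist w (T w)" using r(2)[OF z w(1) Tw(1)] zw r(1) by simp
   then have "hyp_dist w (T w) = 0" using Tw(2) wF by simp
   then have "T w = w" using hyp_dist_0_iff X_upper w(1) Tw(1) by metis
   then show False using deck_free[OF T(1) w(1)] T(2) by simp
  qed
  then have "good V (r / 2)" using V(1) r(1) by (simp add: good_def)
  moreover have "x \<in> V" using V(2) r(1) \<open>x \<in> F\<close> by (metis IntD2 centre_in_mball_iff half_gt_zero)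
  ultimately show ?thesis by blast
 qed
 have "K \<subseteq> \<Union> {V. \<exists>e. good V e}" using loc K(2) by blast
 moreover have "\<forall>B\<in>{V. \<exists>e. good V e}. open B" by (auto simp: good_def)
 ultimately obtain D where D: "D \<subseteq> {V. \<exists>e. good V e}" "finite D" "K \<subseteq> \<Union> D" using compactE[OF K(1)] by metis
 then have "\<forall>V\<in>D. \<exists>e. good V e" by blast
 then obtain e where e: "\<And>V. V \<in> D \<Longrightarrow> good V (e V)" by metis
 show ?thesis
 proof (rule that[of "Min (insert 1 (e ` D))"])
  show "0 < Min (insert 1 (e ` D))" using D(2) e by (auto simp: good_def)
  fix z T assume z: "z \<in> X" "pr z \<in> K" and T: "T \<in> deck" "T \<noteq> id"
  then obtain V where V: "V \<in> D" "pr z \<in> V" using D(3) by blast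
  have "Min (insert 1 (e ` D)) \<le> e V" using D(2) V(1) by (intro Min_le) auto
  also have "\<dots> \<le> hyp_dist z (T z)" using e[OF V(1)] V(2) z(1) T by (simp add: good_def)
  finally show "Min (insert 1 (e ` D)) \<le> hyp_dist z (T z)" .
 qed
qed

text \<open>Infinitely many orbit points in a compact ball would accumulate, so the quotient of two
  group elements would move \<open>z\<close> by less than the minimal displacement above
  \<open>pr z\<close>.\<close>

lemma deck_discrete:
 assumes z: "z \<in> X"
 shows "finite {T \<in> deck. hyp_dist z (T z) \<le> R}" (is "finite ?S")
proof (rule ccontr)
 assume inf: "infinite ?S"
 let ?B = "{w. 0 < Im w \<and> hyp_dist z w \<le> R}"
 have zp: "0 < Im z" using X_upper[OF z] .
 have inj: "inj_on (\<lambda>T. T z) ?S" using deck_eq z by (auto intro: inj_onI)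
 have up: "0 < Im (T z)" if "T \<in> ?S" for T using that X_upper deck_X z by auto
 have "infinite ((\<lambda>T. T z) ` ?S)" using inf inj finite_imageD by blast
 moreover have "(\<lambda>T. T z) ` ?S \<subseteq> ?B" using up by auto
 ultimately have "\<exists>x\<in>?B. x islimpt (\<lambda>T. T z) ` ?S" using compact_hyp_cball[OF zp, of R] unfolding compact_eq_Bolzano_Weierstrass by simp
 then obtain x where x: "x \<in> ?B" "x islimpt (\<lambda>T. T z) ` ?S" by blast
 have K: "compact {pr z}" "{pr z} \<subseteq> F" using pr_F[OF z] by simp_all
 obtain e where e: "0 < e" "\<And>w T. w \<in> X \<Longrightarrow> pr w \<in> {pr z} \<Longrightarrow> T \<in> deck \<Longrightarrow> T \<noteq> id \<Longrightarrow> e \<le> hyp_dist w (T w)"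
  by (rule displacement[OF K]) (rule that; assumption)
 have "0 < e / 2" using e(1) by simp
 then obtain r where r: "0 < r" "\<And>w. dist x w < r \<Longrightarrow> 0 < Im w \<and> hyp_dist x w < e / 2" using hyp_dist_near[of x "e / 2"] x(1) by blast
 obtain S where S: "S \<in> ?S" "S z \<noteq> x" "dist (S z) x < r" using x(2) r(1) unfolding islimpt_approachable by blast
 have "0 < min r (dist (S z) x)" using r(1) S(2) by simp
 then obtain T where T: "T \<in> ?S" "dist (T z) x < min r (dist (S z) x)" using x(2) unfolding islimpt_approachable by blast
 have SD: "S \<in> deck" "T \<in> deck" using S(1) T(1) by auto
 have xp: "0 < Im x" using x(1) by simp
 have "hyp_dist (S z) (T z) \<le> hyp_dist (S z) x + hyp_dist x (T z)" using hyp_dist_triangle up[OF S(1)] up[OF T(1)] xp by blast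
 also have "\<dots> < e" using r(2)[of "S z"] r(2)[of "T z"] S(3) T(2) hyp_dist_commute[of "S z" x] by (simp add: dist_commute)
 finally have lt: "hyp_dist (S z) (T z) < e" .
 let ?R = "finv S o T"
 have R: "?R \<in> deck" using deck_comp deck_inv SD by blast
 have Sis: "S \<in> isoms" using deck_isoms SD by blast
 have "hyp_dist (S z) (T z) = hyp_dist (S z) (S (?R z))" using isoms_inv(2)[OF Sis] by simp
 also have "\<dots> = hyp_dist z (?R z)" using isoms_dist[OF Sis zp X_upper[OF deck_X[OF R z]]] .
 finally have "?R = id" using e(2)[OF z _ R] lt by fastforce
 then have "S z = T z" using isoms_inv(2)[OF Sis] by (metis comp_apply id_apply)
 then show False using T(2) S(2) by simp
qed

text \<open>High horocycles have small displacement, so a curve along one of them leaves every compact set.\<close>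

lemma parabolic_escape:
 assumes T: "act M \<in> deck" "det2 M = 1" "abs (tr2 M) = 2" "act M \<noteq> id" and K: "compact K" "K \<subseteq> F"
 obtains k where "path k" "path_image k \<subseteq> X" "pathfinish k = act M (pathstart k)" "pr ` path_image k \<inter> K = {}"
proof -
 obtain N u where N: "det2 N = 1" and u: "u \<noteq> 0" and NM: "act (N * M * inv2 N) = act (Mat 1 u 0 1)" using parabolic_form[OF T(2-4)] .
 have iN: "det2 (inv2 N) = 1" using det2_inv2 N by simp
 let ?Y = "act N ` X"
 have Y: "hconvex ?Y" "?Y \<noteq> {}" using hconvex_image[OF hconvex_X] act_isoms N X_ne by auto
 have up: "0 < Im z" if "z \<in> ?Y" for z using hconvex_upper[OF Y(1) that] .
 have tr: "act (N * M * inv2 N) z = z + of_real u" if "z \<in> ?Y" for z unfolding NM using act_translate up[OF that] by simp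
 have inv1: "z + of_real u \<in> ?Y" if "z \<in> ?Y" for z using deck_conj_invariant(1)[OF T(1,2) N that] tr[OF that] by simp
 have inv2: "z - of_real u \<in> ?Y" if "z \<in> ?Y" for z
 proof -
  have w: "act (inv2 (N * M * inv2 N)) z \<in> ?Y" by (rule deck_conj_invariant(2)[OF T(1,2) N that])
  have "abs (det2 (N * M * inv2 N)) = 1" using N iN T by simp
  then have "act (N * M * inv2 N) (act (inv2 (N * M * inv2 N)) z) = z" by (rule act_inv2(2))
  then have "act (inv2 (N * M * inv2 N)) z + of_real u = z" using tr[OF w] by simp
  then show ?thesis using w by (metis add_diff_cancel)
 qed
 obtain e where e: "0 < e" "\<And>z T. z \<in> X \<Longrightarrow> pr z \<in> K \<Longrightarrow> T \<in> deck \<Longrightarrow> T \<noteq> id \<Longrightarrow> e \<le> hyp_dist z (T z)"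
  using displacement[OF K] by blast
 have "1 < cosh e" using e(1) cosh_real_strict_mono[of 0 e] by simp
 \<comment> \<open>At height at least \<open>H\<close> the translation by \<open>u\<close> has cosh
   of displacement at most \<open>1 + u^2 / (2 * H^2)\<close>, which is below
   \<open>cosh e\<close>.\<close>
 define H where "H = sqrt (u\<^sup>2 / (cosh e - 1))"
 have H: "0 \<le> H" "u\<^sup>2 / H\<^sup>2 = cosh e - 1" "0 < H" using \<open>1 < cosh e\<close> u by (auto simp: H_def field_simps)
 obtain z where z: "z \<in> ?Y" "H < Im z" using hconvex_high[OF Y u inv1 inv2] by blast
 let ?k = "cvx z (z + of_real u)"
 have zu: "z + of_real u \<in> ?Y" using inv1 z by blast
 \<comment> \<open>A segment between two points of equal height does not descend below that
   height.\<close>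
 have kY: "?k s \<in> ?Y" "H < Im (?k s)" if "s \<in> {0..1}" for s
 proof -
  show "?k s \<in> ?Y" using hconvex_cvx[OF Y(1) z(1) zu that] .
  have n: "1 \<le> cvx_norm z (z + of_real u) s" using cvx_norm_ge1 up z(1) zu that by blast
  have "hp (?k s) = hp z / cvx_norm z (z + of_real u) s" unfolding cvx_h(2)[OF up[OF z(1)] up[OF zu] that] by (simp add: hp_def flip: add_divide_distrib)
  then have "Im (?k s) = Im z * cvx_norm z (z + of_real u) s" using up[OF z(1)] n up[OF \<open>?k s \<in> ?Y\<close>] by (simp add: hp_def field_simps)
  moreover have "Im z * 1 \<le> Im z * cvx_norm z (z + of_real u) s" using n up[OF z(1)] by (intro mult_left_mono) auto
  ultimately show "H < Im (?k s)" using z(2) by linarith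
 qed
 have N': "act (inv2 N) w \<in> X" "act M (act (inv2 N) w) = act (inv2 N) (w + of_real u)" if "w \<in> ?Y" for w
 proof -
  show "act (inv2 N) w \<in> X" using that N by auto
  have "w + of_real u = act N (act M (act (inv2 N) w))" using tr[OF that] N iN T(2) by (simp add: act_mult)
  then show "act M (act (inv2 N) w) = act (inv2 N) (w + of_real u)" using N by simp
 qed
 have far: "pr (act (inv2 N) w) \<notin> K" if w: "w \<in> ?Y" "H < Im w" for w
 proof
  assume "pr (act (inv2 N) w) \<in> K"
  then have "e \<le> hyp_dist (act (inv2 N) w) (act M (act (inv2 N) w))" using e(2)[OF N'(1)[OF w(1)] _ T(1,4)] by blast
  also have "\<dots> = hyp_dist w (w + of_real u)" unfolding N'(2)[OF w(1)] using hyp_dist_act[of w "w + of_real u" "inv2 N"] up[OF w(1)] iN by simp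
  finally have "cosh e \<le> cosh (hyp_dist w (w + of_real u))" using e(1) by (subst cosh_real_nonneg_le_iff) auto
  also have "\<dots> = 1 + u\<^sup>2 / (2 * (Im w)\<^sup>2)" using up[OF w(1)] by (simp add: cosh_hyp_dist hyp_ch_def power2_eq_square)
  also have "\<dots> \<le> 1 + u\<^sup>2 / (2 * H\<^sup>2)" using w(2) H(3) by (intro add_left_mono divide_left_mono mult_left_mono power_mono) auto
  also have "\<dots> < 1 + u\<^sup>2 / H\<^sup>2" using u H(3) by (simp add: field_simps)
  finally show False unfolding H(2) by simp
 qed
 have pk: "path ?k" unfolding path_def using up[OF z(1)] up[OF zu] by (intro continuous_on_cvx continuous_intros) auto
 have ki: "path_image ?k \<subseteq> upper" using kY up by (auto simp: path_image_def)
 show ?thesis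
 proof (rule that[of "act (inv2 N) o ?k"])
  show "path (act (inv2 N) o ?k)" using pk continuous_on_subset[OF continuous_on_act ki] iN by (intro path_continuous_image) auto
  show "path_image (act (inv2 N) o ?k) \<subseteq> X" using kY N'(1) by (auto simp: path_image_def)
  show "pathfinish (act (inv2 N) o ?k) = act M (pathstart (act (inv2 N) o ?k))" using up[OF z(1)] up[OF zu] N'(2)[OF z(1)] by (simp add: pathfinish_def pathstart_def)
  show "pr ` path_image (act (inv2 N) o ?k) \<inter> K = {}" using far kY by (auto simp: path_image_def)
 qed
qed

text \<open>The axis is parametrized so that the transformation is the shift by 1. Its speed is then
  the translation length, a function of the trace alone, and this turns equal traces into equal
  lengths.\<close>

lemma hyperbolic_axis:
 assumes T: "act M \<in> deck" "det2 M = 1" "2 < abs (tr2 M)"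
 obtains c where "continuous_on UNIV c" "range c \<subseteq> X" "\<And>t. act M (c t) = c (t + 1)"
  "\<And>s t. hyp_dist (c s) (c t) = 2 * arcosh (abs (tr2 M) / 2) * abs (s - t)"
proof -
 obtain N l where N: "det2 N = 1" and l: "1 < abs l" and NM: "N * M * inv2 N = Mat l 0 0 (1 / l)" using hyperbolic_form[OF T(2,3)] .
 have iN: "det2 (inv2 N) = 1" using det2_inv2 N by simp
 have l0: "l \<noteq> 0" "1 < l\<^sup>2" using l power_strict_mono[of 1 "abs l" 2] by auto
 have dD: "det2 (Mat l 0 0 (1 / l)) = 1" using l0 by (simp add: det2_def)
 let ?Y = "act N ` X"
 have Y: "hconvex ?Y" "?Y \<noteq> {}" using hconvex_image[OF hconvex_X] act_isoms N X_ne by auto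
 have up: "0 < Im z" if "z \<in> ?Y" for z using hconvex_upper[OF Y(1) that] .
 have inv1: "of_real (l\<^sup>2) * z \<in> ?Y" if "z \<in> ?Y" for z using deck_conj_invariant(1)[OF T(1,2) N that] act_diag[OF l0(1) up[OF that]] unfolding NM by simp
 have inv2: "of_real (1 / l\<^sup>2) * z \<in> ?Y" if "z \<in> ?Y" for z
 proof -
  have "inv2 (Mat l 0 0 (1 / l)) = Mat (1 / l) 0 0 (1 / (1 / l))" using dD l0 by (simp add: inv2_def)
  then show ?thesis using deck_conj_invariant(2)[OF T(1,2) N that] act_diag[of "1 / l", OF _ up[OF that]] l0 unfolding NM by (simp add: power_divide)
 qed
 have axis: "Complex 0 y \<in> ?Y" if "0 < y" for y using hconvex_axis[OF Y l0(2) inv1 inv2 that] by blast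
 define L where "L = ln (l\<^sup>2)"
 have L: "0 < L" "exp L = l\<^sup>2" using l0 by (auto simp: L_def)
 have tr: "abs (tr2 M) = abs l + 1 / abs l"
 proof -
  have "tr2 M = l + 1 / l" using tr2_conj[of N M] N NM by (simp add: tr2_def)
  then show ?thesis using l0 by (cases "0 < l") (auto simp: abs_if not_less le_less add_pos_pos add_neg_neg divide_neg_pos zero_less_divide_iff)
 qed
 have "cosh (ln (abs l)) = (abs l + inverse (abs l)) / 2" using l by (intro cosh_ln_real) linarith
 then have "abs (tr2 M) / 2 = cosh (ln (abs l))" unfolding tr by (simp only: inverse_eq_divide)
 moreover have "0 \<le> ln (abs l)" using l by (intro ln_ge_zero) linarith
 ultimately have "arcosh (abs (tr2 M) / 2) = ln (abs l)" by (simp only: arcosh_cosh_real)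
 moreover have "L = 2 * ln (abs l)" unfolding L_def using l ln_realpow[of "abs l" 2] by simp
 ultimately have L': "2 * arcosh (abs (tr2 M) / 2) = L" by simp
 define c where "c t = act (inv2 N) (Complex 0 (exp (L * t)))" for t
 show ?thesis
 proof (rule that[of c])
  have "continuous_on UNIV (\<lambda>t. Complex 0 (exp (L * t)))" by (intro continuous_intros)
  moreover have "range (\<lambda>t. Complex 0 (exp (L * t))) \<subseteq> upper" by auto
  ultimately show "continuous_on UNIV c" unfolding c_def using continuous_on_compose2[OF continuous_on_act[of "inv2 N"]] iN by simp
  have "c t \<in> X" for t
  proof -
   obtain w where "w \<in> X" "Complex 0 (exp (L * t)) = act N w" using axis[of "exp (L * t)"] by auto
   then show ?thesis unfolding c_def using N by simp
  qed
  then show "range c \<subseteq> X" by blast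
  show "act M (c t) = c (t + 1)" for t
  proof -
   have "act N (act M (c t)) = act (N * M * inv2 N) (Complex 0 (exp (L * t)))" using N iN T(2) by (simp add: act_mult c_def)
   also have "\<dots> = of_real (l\<^sup>2) * Complex 0 (exp (L * t))" unfolding NM using act_diag[OF l0(1), of "Complex 0 (exp (L * t))"] by simp
   also have "\<dots> = Complex 0 (exp (L * (t + 1)))" by (simp add: complex_eq_iff exp_add algebra_simps L)
   finally show ?thesis using N by (metis act_inv2(1) c_def det2_abs)
  qed
  show "hyp_dist (c s) (c t) = 2 * arcosh (abs (tr2 M) / 2) * abs (s - t)" for s t
  proof -
   have "hyp_dist (c s) (c t) = hyp_dist (Complex 0 (exp (L * s))) (Complex 0 (exp (L * t)))" unfolding c_def using iN by (intro hyp_dist_act) auto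
   also have "\<dots> = abs (ln (exp (L * t) / exp (L * s)))" by (intro hyp_dist_axis) auto
   also have "\<dots> = abs (L * (t - s))" by (simp add: exp_diff[symmetric] algebra_simps)
   also have "\<dots> = L * abs (s - t)" using L(1) by (simp add: abs_mult abs_minus_commute)
   finally show ?thesis using L' by simp
  qed
 qed
qed

text \<open>Along the axis \<open>pr\<close> is locally isometric. Since \<open>pr\<close> is
  1-Lipschitz, no subdivision measures more than \<open>v\<close>; a subdivision below the Lebesgue
  number measures exactly \<open>v\<close>.\<close>

lemma axis_geodesic:
 assumes T: "T \<in> deck" and c: "continuous_on UNIV c" "range c \<subseteq> X" "\<And>t. T (c t) = c (t + 1)"
  and dist: "\<And>s t. hyp_dist (c s) (c t) = v * abs (s - t)" and v: "0 < v"
 shows "closed_geodesic F d (pr o c)" "curve_length d (pr o c) = ereal v"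
proof -
 have cX: "c t \<in> X" for t using c(2) by blast
 have pc: "path c" using c(1) unfolding path_def by (rule continuous_on_subset) simp
 have per: "pr (c (t + 1)) = pr (c t)" for t using c(3)[of t] deck_pr[OF T cX[of t]] by simp
 have pern: "pr (c (t + real n)) = pr (c t)" for t n
 proof (induction n)
  case (Suc n)
  then show ?case using per[of "t + real n"] by (simp add: algebra_simps)
 qed simp
 have perf: "pr (c (frac t)) = pr (c t)" for t
 proof (cases "0 \<le> t")
  case True
  then have "t = frac t + real (nat \<lfloor>t\<rfloor>)" by (simp add: frac_def)
  then show ?thesis using pern by metis
 next
  case False
  then have "frac t = t + real (nat (- \<lfloor>t\<rfloor>))" by (simp add: frac_def)
  then show ?thesis using pern by metis
 qed
 have loc: "\<exists>h>0. \<forall>s s'. abs (s - t) < h \<and> abs (s' - t) < h \<longrightarrow> d (pr (c s)) (pr (c s')) = v * abs (s - s')" for t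
 proof -
  obtain r where r: "0 < r" "\<And>u v. u \<in> X \<Longrightarrow> v \<in> X \<Longrightarrow> hyp_dist (c t) u < r \<Longrightarrow> hyp_dist (c t) v < r \<Longrightarrow> d (pr u) (pr v) = hyp_dist u v"
   using pr_local[OF pr_F[OF cX[of t]]] cX[of t] by metis
  show ?thesis
  proof (intro exI[of _ "r / v"] conjI allI impI)
   fix s s' assume s: "abs (s - t) < r / v \<and> abs (s' - t) < r / v"
   then have "hyp_dist (c t) (c s) < r" "hyp_dist (c t) (c s') < r" unfolding dist using v by (auto simp: field_simps abs_minus_commute)
   then show "d (pr (c s)) (pr (c s')) = v * abs (s - s')" using r(2)[OF cX cX] dist by simp
  qed (use r v in simp)
 qed
 have cc: "closed_curve F (pr o c)" using pr_lift_path[OF pc] cX per[of 0] by (auto simp: closed_curve_def path_image_def pathstart_def pathfinish_def)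
 show "closed_geodesic F d (pr o c)" unfolding closed_geodesic_def using cc loc perf v by (intro conjI exI[of _ v]) auto
 show "curve_length d (pr o c) = ereal v" unfolding curve_length_def
 proof (rule antisym)
  have up: "(\<Sum>i<n. d ((pr o c) (t i)) ((pr o c) (t (Suc i)))) \<le> v"
   if t: "t 0 = 0 \<and> t n = 1 \<and> (\<forall>i<n. t i \<le> t (Suc i))" for n t
  proof -
   have "(\<Sum>i<n. d ((pr o c) (t i)) ((pr o c) (t (Suc i)))) \<le> (\<Sum>i<n. v * (t (Suc i) - t i))"
   proof (rule sum_mono)
    fix i assume "i \<in> {..<n}"
    then show "d ((pr o c) (t i)) ((pr o c) (t (Suc i))) \<le> v * (t (Suc i) - t i)" using pr_lipschitz[OF cX[of "t i"] cX[of "t (Suc i)"]] dist[of "t i" "t (Suc i)"] t by simp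
   qed
   also have "\<dots> = v" using t by (simp add: sum_distrib_left[symmetric] sum_lessThan_telescope)
   finally show ?thesis .
  qed
  show "(SUP (n, t) \<in> {(n, t). t 0 = 0 \<and> t n = 1 \<and> (\<forall>i<n. t i \<le> t (Suc i))}.
    ereal (\<Sum>i<n. d ((pr o c) (t i)) ((pr o c) (t (Suc i))))) \<le> ereal v" using up by (intro SUP_least) auto
  define \<E> where "\<E> = {B. \<exists>t h. B = ball t h \<and> 0 < h \<and> (\<forall>s s'. abs (s - t) < h \<and> abs (s' - t) < h \<longrightarrow> d (pr (c s)) (pr (c s')) = v * abs (s - s'))}"
  have "{0..1} \<subseteq> \<Union>\<E>"
  proof
   fix t :: real
   obtain h where "0 < h" "\<forall>s s'. abs (s - t) < h \<and> abs (s' - t) < h \<longrightarrow> d (pr (c s)) (pr (c s')) = v * abs (s - s')" using loc by blast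
   then have "ball t h \<in> \<E>" "t \<in> ball t h" unfolding \<E>_def by auto
   then show "t \<in> \<Union>\<E>" by blast
  qed
  moreover have "B \<in> \<E> \<Longrightarrow> open B" for B by (auto simp: \<E>_def)
  ultimately obtain e where e: "0 < e" "\<And>t. t \<in> {0..1} \<Longrightarrow> \<exists>B\<in>\<E>. ball t e \<subseteq> B"
   using Heine_Borel_lemma[of "{0..1::real}" \<E>] by (metis compact_Icc)
  obtain n where n: "1 / e < real n" using reals_Archimedean2 by blast
  have np: "0 < real n" using n e(1) by (meson less_trans zero_less_divide_1_iff)
  define t where "t i = real i / real n" for i
  have piece: "d ((pr o c) (t i)) ((pr o c) (t (Suc i))) = v / real n" if "i < n" for i
  proof -
   have ti: "t i \<in> {0..1}" using that np by (simp add: t_def)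
   have df: "t (Suc i) - t i = 1 / real n" using np by (simp add: t_def field_simps)
   moreover have "1 / real n < e" using n e(1) np by (simp add: field_simps)
   moreover have "0 < 1 / real n" using np by simp
   ultimately have "abs (t i - t (Suc i)) < e" by linarith
   then have b: "t i \<in> ball (t i) e" "t (Suc i) \<in> ball (t i) e" using e(1) by (auto simp: dist_real_def)
   obtain q h where "ball (t i) e \<subseteq> ball q h" "\<forall>s s'. abs (s - q) < h \<and> abs (s' - q) < h \<longrightarrow> d (pr (c s)) (pr (c s')) = v * abs (s - s')"
    using e(2)[OF ti] unfolding \<E>_def by blast
   moreover from this(1) have "t i \<in> ball q h" "t (Suc i) \<in> ball q h" using b by blast+
   then have "abs (t i - q) < h" "abs (t (Suc i) - q) < h" by (simp_all only: mem_ball dist_real_def abs_minus_commute)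
   ultimately have "d (pr (c (t i))) (pr (c (t (Suc i)))) = v * abs (t i - t (Suc i))" by blast
   then show ?thesis using df np by (simp add: abs_minus_commute[of "t i"])
  qed
  have "(\<Sum>i<n. d ((pr o c) (t i)) ((pr o c) (t (Suc i)))) = v" using piece np by simp
  moreover have "(n, t) \<in> {(n, t). t 0 = 0 \<and> t n = 1 \<and> (\<forall>i<n. t i \<le> t (Suc i))}" using np by (auto simp: t_def divide_right_mono)
  ultimately show "ereal v \<le> (SUP (n, t) \<in> {(n, t). t 0 = 0 \<and> t n = 1 \<and> (\<forall>i<n. t i \<le> t (Suc i))}.
    ereal (\<Sum>i<n. d ((pr o c) (t i)) ((pr o c) (t (Suc i)))))" by (intro SUP_upper2[of "(n, t)"]) auto
 qed
qed

end

section \<open>Discrete groups of matrices containing a hyperbolic diagonal element\<close>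

definition bounded_mat :: "real \<Rightarrow> mat2 \<Rightarrow> bool" where
 "bounded_mat R M \<longleftrightarrow> abs (m11 M) \<le> R \<and> abs (m12 M) \<le> R \<and> abs (m21 M) \<le> R \<and> abs (m22 M) \<le> R"

lemma diag_power: "Mat a 0 0 (1 / a) ^ n = Mat (a ^ n) 0 0 (1 / a ^ n)" by (induction n) (simp_all add: mat2_eq_iff)

lemma inv2_det1: "det2 M = 1 \<Longrightarrow> inv2 M = Mat (m22 M) (- m12 M) (- m21 M) (m11 M)" by (simp add: inv2_def)

text \<open>Abstracts the matrices of the deck group in coordinates where the axis of
  \<open>a\<close> is the imaginary axis. The trace bound says that there are no elliptic
  elements.\<close>

locale discrete_sl2 =
 fixes G :: "mat2 set" and \<mu> :: real
 assumes det: "M \<in> G \<Longrightarrow> det2 M = 1" and trace: "M \<in> G \<Longrightarrow> 2 \<le> abs (tr2 M)"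
  and mult: "M \<in> G \<Longrightarrow> N \<in> G \<Longrightarrow> M * N \<in> G" and inverse: "M \<in> G \<Longrightarrow> inv2 M \<in> G"
  and discrete: "finite {M \<in> G. bounded_mat R M}"
  and \<mu>: "1 < \<mu>" and diag: "Mat \<mu> 0 0 (1 / \<mu>) \<in> G"
begin

lemma one: "1 \<in> G" using mult[OF inverse[OF diag] diag] inv2_left[of "Mat \<mu> 0 0 (1 / \<mu>)"] det[OF diag] by simp

lemma diag_pow: "Mat (\<mu> ^ n) 0 0 (1 / \<mu> ^ n) \<in> G" unfolding diag_power[symmetric] by (induction n) (auto intro: one mult diag)

lemma diag_inv_pow: "Mat (1 / \<mu> ^ n) 0 0 (\<mu> ^ n) \<in> G" using inverse[OF diag_pow[of n]] det[OF diag_pow[of n]] by (simp add: inv2_det1)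

lemma large: "\<exists>N. \<forall>n>N. K \<le> \<mu> ^ n"
proof -
 obtain N where N: "K < \<mu> ^ N" using real_arch_pow[OF \<mu>] by blast
 have "K \<le> \<mu> ^ n" if "N < n" for n using N power_increasing[of N n \<mu>] less_imp_le[OF that] \<mu> by linarith
 then show ?thesis by blast
qed

text \<open>Powers of the diagonal element, with positive or negative exponent, approximate every
  scale up to the factor \<open>mu\<close>. They serve to balance the entries of a matrix within the
  group.\<close>

lemma diag_scale:
 assumes "0 < y"
 obtains r where "0 < r" "r \<le> y" "y < \<mu> * r" "Mat r 0 0 (1 / r) \<in> G" "Mat (1 / r) 0 0 r \<in> G"
proof (cases "1 \<le> y")
 case True
 have "\<exists>n. y < \<mu> ^ n" using real_arch_pow[OF \<mu>] .
 define n where "n = (LEAST n. y < \<mu> ^ n)"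
 have n: "y < \<mu> ^ n" unfolding n_def by (rule LeastI_ex) fact
 then have "n \<noteq> 0" using True by (cases n) auto
 then obtain k where k: "n = Suc k" by (cases n) auto
 have "\<not> y < \<mu> ^ k" using not_less_Least[of k "\<lambda>n. y < \<mu> ^ n"] k n_def by simp
 then show ?thesis using that[of "\<mu> ^ k"] n k \<mu> diag_pow diag_inv_pow by simp
next
 case False
 have "\<exists>n. 1 / y < \<mu> ^ n" using real_arch_pow[OF \<mu>] .
 define n where "n = (LEAST n. 1 / y < \<mu> ^ n)"
 have n: "1 / y < \<mu> ^ n" unfolding n_def by (rule LeastI_ex) fact
 then have "n \<noteq> 0" using False assms by (cases n) (auto simp: field_simps)
 then obtain k where k: "n = Suc k" by (cases n) auto
 have nk: "\<not> 1 / y < \<mu> ^ k" using not_less_Least[of k "\<lambda>n. 1 / y < \<mu> ^ n"] k n_def by simp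
 show ?thesis
 proof (cases "1 / y = \<mu> ^ k")
  case True
  have "y = 1 / (1 / y)" by simp
  then have "y = 1 / \<mu> ^ k" unfolding True .
  moreover have "1 / \<mu> ^ k < \<mu> / \<mu> ^ k" using \<mu> by (intro divide_strict_right_mono) auto
  ultimately show ?thesis using that[of "1 / \<mu> ^ k"] \<mu> diag_pow[of k] diag_inv_pow[of k] by simp
 next
  case False
  then have "\<mu> ^ k < 1 / y" using nk by linarith
  then have "y < 1 / \<mu> ^ k" "1 / \<mu> ^ n < y" using n assms \<mu> by (simp_all add: field_simps)
  then show ?thesis using that[of "1 / \<mu> ^ n"] \<mu> diag_pow[of n] diag_inv_pow[of n] k by simp
 qed
qed

text \<open>Bounded elements are finite in number, so the non-zero values of any function on them
  stay away from zero.\<close>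

lemma gap:
 obtains r where "0 < r" "\<And>M. M \<in> G \<Longrightarrow> bounded_mat R M \<Longrightarrow> abs (f M) < r \<Longrightarrow> f M = (0::real)"
proof
 let ?S = "insert 1 ((\<lambda>M. abs (f M)) ` {M \<in> G. bounded_mat R M} - {0})"
 have fin: "finite ?S" using discrete by simp
 show "0 < Min ?S" using fin by auto
 fix M assume "M \<in> G" "bounded_mat R M" and lt: "abs (f M) < Min ?S"
 then have "abs (f M) \<noteq> 0 \<Longrightarrow> abs (f M) \<in> ?S" by blast
 then show "f M = 0" using Min_le[OF fin, of "abs (f M)"] lt by force
qed

text \<open>A bounded sequence of group elements with an entry that tends to zero must eventually
  have this entry equal to zero.\<close>

lemma shrinking_entry:
 fixes f :: "mat2 \<Rightarrow> real"
 assumes T: "\<And>n. T n \<in> G" "\<And>n. bounded_mat R (T n)" and f: "\<And>n. f (T n) = q / (\<mu> ^ n * \<mu> ^ n)"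
 shows "q = 0"
proof -
 obtain r where r: "0 < r" "\<And>M. M \<in> G \<Longrightarrow> bounded_mat R M \<Longrightarrow> abs (f M) < r \<Longrightarrow> f M = 0" using gap[of R f] by blast
 obtain n where n: "abs q / r < \<mu> ^ n" using real_arch_pow[OF \<mu>] by blast
 have pos: "1 \<le> \<mu> ^ n" using \<mu> by simp
 have "abs q < \<mu> ^ n * r" using n r(1) by (simp add: pos_divide_less_eq)
 also have "\<dots> \<le> \<mu> ^ n * \<mu> ^ n * r" using pos r(1) by (intro mult_right_mono) auto
 finally have "abs (f (T n)) < r" unfolding f using pos by (simp add: abs_mult pos_divide_less_eq mult.commute)
 then have "f (T n) = 0" using r(2) T by simp
 then show ?thesis using \<mu> by (simp add: f)
qed

lemma shrink_le: "abs (q / (\<mu> ^ n * \<mu> ^ n)) \<le> abs q"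
proof -
 have "1 * 1 \<le> \<mu> ^ n * \<mu> ^ n" using \<mu> by (intro mult_mono) auto
 then have "abs q / (\<mu> ^ n * \<mu> ^ n) \<le> abs q / 1" by (intro divide_left_mono) auto
 then show ?thesis by (simp add: abs_mult)
qed

text \<open>An element fixing one end of the axis fixes the other one too: conjugation with powers
  of the diagonal element contracts the remaining entry to zero inside the discrete group.\<close>

lemma lower_left_0:
 assumes S: "S \<in> G" "m21 S = 0"
 shows "m12 S = 0"
proof (rule shrinking_entry)
 let ?T = "\<lambda>n. Mat (1 / \<mu> ^ n) 0 0 (\<mu> ^ n) * S * Mat (\<mu> ^ n) 0 0 (1 / \<mu> ^ n)"
 show "?T n \<in> G" for n using diag_pow diag_inv_pow S(1) mult by blast
 show "m12 (?T n) = m12 S / (\<mu> ^ n * \<mu> ^ n)" for n by simp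
 show "bounded_mat (abs (m11 S) + abs (m12 S) + abs (m22 S)) (?T n)" for n using shrink_le[of "m12 S" n] S(2) \<mu> by (simp add: bounded_mat_def)
qed

lemma upper_right_0:
 assumes S: "S \<in> G" "m12 S = 0"
 shows "m21 S = 0"
proof (rule shrinking_entry)
 let ?T = "\<lambda>n. Mat (\<mu> ^ n) 0 0 (1 / \<mu> ^ n) * S * Mat (1 / \<mu> ^ n) 0 0 (\<mu> ^ n)"
 show "?T n \<in> G" for n using diag_pow diag_inv_pow S(1) mult by blast
 show "m21 (?T n) = m21 S / (\<mu> ^ n * \<mu> ^ n)" for n by simp
 show "bounded_mat (abs (m11 S) + abs (m21 S) + abs (m22 S)) (?T n)" for n using shrink_le[of "m21 S" n] S(2) \<mu> by (simp add: bounded_mat_def)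
qed

text \<open>If \<open>m11 S = 0\<close>, then \<open>S\<close> maps one end of the axis to the
  other, so the conjugate of the diagonal element by \<open>S\<close> fixes an end and therefore
  both. Hence \<open>S\<close> exchanges the ends and has trace 0, which is impossible.\<close>

lemma diagonal_entry_nonzero:
 assumes S: "S \<in> G"
 shows "m11 S \<noteq> 0" "m22 S \<noteq> 0"
proof -
 have main: "m11 S \<noteq> 0" if S: "S \<in> G" for S
 proof
  assume p: "m11 S = 0"
  have d: "m12 S * m21 S = - 1" using det[OF S] p by (simp add: det2_def)
  define T where "T = S * Mat \<mu> 0 0 (1 / \<mu>) * inv2 S"
  have TG: "T \<in> G" unfolding T_def using S mult inverse diag by blast
  have "m12 T = 0" unfolding T_def inv2_det1[OF det[OF S]] using p by simp
  then have "m21 T = 0" using upper_right_0[OF TG] by simp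
  then have "m21 S * m22 S * (\<mu> - 1 / \<mu>) = 0" unfolding T_def inv2_det1[OF det[OF S]] by (simp add: algebra_simps)
  moreover have "\<mu> - 1 / \<mu> \<noteq> 0" using \<mu> by (simp add: field_simps) (metis mult_less_cancel_left1 less_irrefl less_1_mult)
  ultimately have "m22 S = 0" using d by auto
  then show False using trace[OF S] p by (simp add: tr2_def)
 qed
 show "m11 S \<noteq> 0" using main S .
 show "m22 S \<noteq> 0" using main[OF inverse[OF S]] det[OF S] by (simp add: inv2_det1)
qed

lemma nonzero_entries:
 assumes "S \<in> G" "m12 S \<noteq> 0"
 shows "m11 S \<noteq> 0" "m21 S \<noteq> 0" "m22 S \<noteq> 0" using assms diagonal_entry_nonzero lower_left_0 by blast+

text \<open>Commutation with the product forces the lower left entry of \<open>D\<close> to be of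
  order \<open>1 / L^2\<close> relative to the upper right one, where \<open>L\<close> is the power
  of \<open>mu\<close>. Bounded trace bounds all entries of \<open>D\<close>, so by the gap this
  entry vanishes, and then \<open>D\<close> is scalar.\<close>

lemma commuting_trivial:
 assumes W: "W \<in> G" "m12 W \<noteq> 0"
 shows "\<exists>N. \<forall>n>N. \<forall>D\<in>G. abs (tr2 D) \<le> t \<longrightarrow>
  D * (Mat (\<mu> ^ n) 0 0 (1 / \<mu> ^ n) * W) = (Mat (\<mu> ^ n) 0 0 (1 / \<mu> ^ n) * W) * D \<longrightarrow> D = 1 \<or> D = - 1"
proof -
 obtain x y z w where We: "W = Mat x y z w" by (cases W) auto
 have nz: "x \<noteq> 0" "y \<noteq> 0" "z \<noteq> 0" "w \<noteq> 0" using nonzero_entries[OF W] W(2) by (auto simp: We)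
 \<comment> \<open>Gives \<open>abs c2 <= K * abs (c1 - c4)\<close> as soon as
   \<open>abs w / L^2\<close> is at most half of \<open>abs x\<close>.\<close>
 define K where "K = 2 * abs y / abs x"
 define R where "R = (3 + 2 * K + 2 * K * abs z / abs y) * abs t + 1"
 have K: "0 < K" using nz by (simp add: K_def)
 obtain r where r: "0 < r" "\<And>M. M \<in> G \<Longrightarrow> bounded_mat R M \<Longrightarrow> abs (m21 M) < r \<Longrightarrow> m21 M = 0" using gap[of R m21] by blast
 \<comment> \<open>The three middle summands ensure, in this order, the bound on
   \<open>abs w / L^2\<close>, the absorption of the \<open>c2^2\<close> term into half of
   \<open>(c1 - c4)^2\<close>, and a lower left entry below the gap \<open>r\<close>.\<close>
 define L0 where "L0 = 1 + 2 * abs w / abs x + 8 * K\<^sup>2 * abs z / abs y + 2 * K * abs t * abs z / abs y / r + 1"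
 obtain N where N: "\<And>n. N < n \<Longrightarrow> L0 \<le> \<mu> ^ n" using large by blast
 have "D = 1 \<or> D = - 1" if n: "N < n" and D: "D \<in> G" "abs (tr2 D) \<le> t"
  and comm: "D * (Mat (\<mu> ^ n) 0 0 (1 / \<mu> ^ n) * W) = (Mat (\<mu> ^ n) 0 0 (1 / \<mu> ^ n) * W) * D" for n D
 proof -
  define L where "L = \<mu> ^ n"
  have nn: "0 \<le> 2 * abs w / abs x" "0 \<le> 8 * K\<^sup>2 * abs z / abs y" "0 \<le> 2 * K * abs t * abs z / abs y / r" using r(1) K by simp_all
  have L: "1 < L" "2 * abs w / abs x \<le> L" "8 * K\<^sup>2 * abs z / abs y \<le> L" "2 * K * abs t * abs z / abs y / r < L" using N[OF n] nn unfolding L0_def L_def by linarith+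
  have LL: "L \<le> L\<^sup>2" "1 < L\<^sup>2" using L(1) by (auto simp: power2_eq_square less_1_mult)
  obtain c1 c2 c3 c4 where De: "D = Mat c1 c2 c3 c4" by (cases D) auto
  have tr: "abs (c1 + c4) \<le> t" using D(2) by (simp add: De tr2_def)
  have dt: "c1 * c4 - c2 * c3 = 1" using det[OF D(1)] by (simp add: De det2_def)
  have "c1 * (L * x) + c2 * (z / L) = L * x * c1 + L * y * c3" "c1 * (L * y) + c2 * (w / L) = L * x * c2 + L * y * c4"
   using comm by (simp_all add: De We mat2_eq_iff L_def[symmetric])
  then have c3: "c3 = c2 * z / y / L\<^sup>2" and c2: "c2 * (x - w / L\<^sup>2) = y * (c1 - c4)" using L(1) nz by (simp_all add: field_simps power2_eq_square)
  have "2 * abs w \<le> L * abs x" using L(2) nz by (simp add: pos_divide_le_eq)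
  also have "\<dots> \<le> L\<^sup>2 * abs x" using LL by (intro mult_right_mono) auto
  finally have "abs w \<le> abs x / 2 * L\<^sup>2" by (simp add: mult.commute)
  moreover have "0 < L\<^sup>2" using LL by linarith
  ultimately have "abs w / L\<^sup>2 \<le> abs x / 2" by (rule iffD2[OF pos_divide_le_eq, rotated])
  then have "abs (w / L\<^sup>2) \<le> abs x / 2" by (simp add: abs_divide)
  then have "abs x / 2 \<le> abs (x - w / L\<^sup>2)" using abs_triangle_ineq2[of x "w / L\<^sup>2"] by linarith
  then have "abs c2 * (abs x / 2) \<le> abs c2 * abs (x - w / L\<^sup>2)" by (intro mult_left_mono) auto
  also have "\<dots> = abs y * abs (c1 - c4)" using c2 by (metis abs_mult)
  finally have c2b: "abs c2 \<le> K * abs (c1 - c4)" using nz by (simp add: K_def field_simps)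
  have "(c1 - c4)\<^sup>2 = (c1 + c4)\<^sup>2 - 4 - 4 * (z / y / L\<^sup>2 * c2\<^sup>2)"
  proof -
   have "(c1 - c4)\<^sup>2 = (c1 + c4)\<^sup>2 - 4 * (c1 * c4)" by (simp add: power2_eq_square algebra_simps)
   also have "c1 * c4 = 1 + z / y / L\<^sup>2 * c2\<^sup>2" using dt c3 by (simp add: power2_eq_square algebra_simps)
   finally show ?thesis by simp
  qed
  also have "\<dots> \<le> t\<^sup>2 + 4 * (abs z / abs y / L\<^sup>2 * c2\<^sup>2)"
  proof -
   have "(c1 + c4)\<^sup>2 \<le> t\<^sup>2" using tr by (simp add: abs_le_square_iff[symmetric])
   moreover have "- (z / y / L\<^sup>2 * c2\<^sup>2) \<le> abs (z / y / L\<^sup>2 * c2\<^sup>2)" by linarith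
   moreover have "abs (z / y / L\<^sup>2 * c2\<^sup>2) = abs z / abs y / L\<^sup>2 * c2\<^sup>2" by (simp add: abs_mult abs_divide)
   ultimately show ?thesis by linarith
  qed
  also have "4 * (abs z / abs y / L\<^sup>2 * c2\<^sup>2) \<le> 4 * (abs z / abs y / L\<^sup>2 * (K\<^sup>2 * (c1 - c4)\<^sup>2))"
  proof -
   have "c2\<^sup>2 \<le> (K * abs (c1 - c4))\<^sup>2" using c2b by (simp add: power2_le_iff_abs_le)
   then show ?thesis by (intro mult_left_mono) (auto simp: power_mult_distrib)
  qed
  also have "\<dots> = 4 * K\<^sup>2 * abs z / abs y / L\<^sup>2 * (c1 - c4)\<^sup>2" by simp
  also have "\<dots> \<le> 1 / 2 * (c1 - c4)\<^sup>2"
  proof (rule mult_right_mono)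
   have "4 * K\<^sup>2 * abs z / abs y \<le> 1 / 2 * L\<^sup>2" using L(3) LL by simp
   moreover have "0 < L\<^sup>2" using LL by linarith
   ultimately show "4 * K\<^sup>2 * abs z / abs y / L\<^sup>2 \<le> 1 / 2" by (rule iffD2[OF pos_divide_le_eq, rotated])
  qed simp
  finally have "(c1 - c4)\<^sup>2 \<le> 2 * t\<^sup>2" by simp
  also have "\<dots> \<le> (2 * abs t)\<^sup>2" by (simp add: power_mult_distrib)
  finally have df: "abs (c1 - c4) \<le> 2 * abs t" using abs_le_square_iff[of "c1 - c4" "2 * abs t"] by simp
  have c2t: "abs c2 \<le> 2 * K * abs t"
  proof -
   have "K * abs (c1 - c4) \<le> K * (2 * abs t)" using df K by (intro mult_left_mono) auto
   then show ?thesis using c2b by linarith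
  qed
  have "abs c3 = abs c2 * (abs z / abs y) / L\<^sup>2" unfolding c3 by (simp add: abs_mult abs_divide)
  also have "\<dots> \<le> 2 * K * abs t * (abs z / abs y) / L\<^sup>2" using c2t by (intro divide_right_mono mult_right_mono) auto
  finally have c3t: "abs c3 \<le> 2 * K * abs t * abs z / abs y / L\<^sup>2" by simp
  also have "\<dots> \<le> 2 * K * abs t * abs z / abs y / 1" using LL K by (intro divide_left_mono) auto
  finally have c3R: "abs c3 \<le> 2 * K * abs z / abs y * abs t" by (simp add: mult_ac)
  have RR: "R = 3 * abs t + 2 * K * abs t + 2 * K * abs z / abs y * abs t + 1" unfolding R_def by (simp add: algebra_simps)
  have nn': "0 \<le> 2 * K * abs t" "0 \<le> 2 * K * abs z / abs y * abs t" using K by auto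
  have "abs c1 \<le> 3 * abs t" "abs c4 \<le> 3 * abs t" using tr df by linarith+
  then have "bounded_mat R D" unfolding bounded_mat_def De RR mat2.sel using c2t c3R nn' abs_ge_zero[of t] by (intro conjI; linarith)
  moreover have "2 * K * abs t * abs z / abs y / L\<^sup>2 < r"
  proof -
   have "2 * K * abs t * abs z / abs y < L * r" by (rule iffD1[OF pos_divide_less_eq[OF r(1)] L(4)])
   also have "\<dots> \<le> L\<^sup>2 * r" using LL r(1) by (intro mult_right_mono) auto
   also have "\<dots> = r * L\<^sup>2" by (rule mult.commute)
   finally show ?thesis using LL by (subst pos_divide_less_eq) linarith+
  qed
  ultimately have "m21 D = 0" using r(2)[OF D(1)] c3t by (simp add: De)
  then have "c3 = 0" by (simp add: De)
  then have "c2 = 0" using c3 nz LL by auto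
  then have "c1 = c4" using c2 nz by simp
  then have "c1 * c1 = 1" using dt \<open>c2 = 0\<close> by simp
  then have "c1 = 1 \<or> c1 = - 1" by (metis square_eq_1_iff power2_eq_square)
  then show ?thesis using \<open>c1 = c4\<close> \<open>c2 = 0\<close> \<open>c3 = 0\<close> by (auto simp: De mat2_eq_iff)
 qed
 then show ?thesis by blast
qed

text \<open>The row \<open>(c1, c2)\<close> of a conjugator has \<open>c1\<close> and
  \<open>e = c1 * y - c2 * x\<close> as approximate coordinates in the eigenbasis of
  \<open>A^n W\<close>: the first is stretched by \<open>A^n W\<close>, the second by its inverse,
  each by about \<open>L * x\<close>. The last two premises say that neither multiplication shortens
  the row, so both coordinates are at least of order \<open>1 / L\<close> times the size; the
  premise with \<open>v\<close>, a determinant, controls their product. Together they bound the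
  square of the size by a multiple of \<open>L\<close>.\<close>

lemma reduced_row:
 fixes x y z w v :: real
 assumes "x \<noteq> 0" "x * w - y * z = 1"
 obtains C L0 where "0 < C" "\<And>L c1 c2. L0 \<le> L \<Longrightarrow> abs (c1 * (c1 * y - c2 * x) + c2 * (c1 * w - c2 * z) / L\<^sup>2) = abs v \<Longrightarrow>
   abs c1 + abs (c1 * y - c2 * x) \<le> abs (L * x * c1 + c2 * z / L) + abs (c2 / L) \<Longrightarrow>
   abs c1 + abs (c1 * y - c2 * x) \<le> abs ((c1 * w - c2 * z) / L) + abs (L * x * (c1 * y - c2 * x) + y * ((c1 * w - c2 * z) / L)) \<Longrightarrow>
   abs c2 \<le> C * (abs c1 + abs (c1 * y - c2 * x)) \<and> abs (c1 * w - c2 * z) \<le> C * (abs c1 + abs (c1 * y - c2 * x)) \<and>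
   abs (c1 * (c1 * y - c2 * x)) \<le> 2 * abs v \<and> (abs c1 + abs (c1 * y - c2 * x))\<^sup>2 \<le> C * L"
proof -
 \<comment> \<open>\<open>K\<close> and \<open>K2\<close> bound \<open>c2\<close> and
   \<open>c1 * w - c2 * z\<close> by the size \<open>g\<close> of the row; \<open>K3\<close>
   collects the error terms, which contribute at most \<open>g / 2\<close> once
   \<open>2 * K3 <= L\<close>.\<close>
 define K where "K = (1 + abs y) / abs x"
 define K2 where "K2 = abs w + K * abs z"
 define K3 where "K3 = (1 + abs z) * K + (1 + abs y) * K2"
 define C where "C = 1 + K + K2 + 8 * abs x * abs v"
 define L0 where "L0 = 1 + 2 * K3 + 8 * abs x * K * K2"
 have K: "0 \<le> K" "0 \<le> K2" "0 \<le> K3" by (simp_all add: K_def K2_def K3_def)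
 have main: "abs c2 \<le> C * g \<and> abs (c1 * w - c2 * z) \<le> C * g \<and> abs (c1 * e) \<le> 2 * abs v \<and> g\<^sup>2 \<le> C * L"
  if L: "L0 \<le> L" and e: "e = c1 * y - c2 * x" and g: "g = abs c1 + abs e"
   and Q: "abs (c1 * e + c2 * (c1 * w - c2 * z) / L\<^sup>2) = abs v"
   and up: "g \<le> abs (L * x * c1 + c2 * z / L) + abs (c2 / L)"
   and dn: "g \<le> abs ((c1 * w - c2 * z) / L) + abs (L * x * e + y * ((c1 * w - c2 * z) / L))"
  for L c1 c2 e g
 proof -
  have L0: "0 \<le> 8 * abs x * K * K2" using K by simp
  then have L1: "1 \<le> L" "2 * K3 \<le> L" "8 * abs x * K * K2 \<le> L" using L K unfolding L0_def by linarith+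
  have g0: "0 \<le> g" using g by simp
  have "c2 * x = c1 * y - e" using e by simp
  then have "abs c2 * abs x = abs (c1 * y - e)" by (metis abs_mult)
  also have "\<dots> \<le> abs c1 * abs y + abs e" using abs_triangle_ineq4[of "c1 * y" e] by (simp add: abs_mult)
  also have "\<dots> \<le> (1 + abs y) * g"
  proof -
   have "abs c1 * abs y \<le> g * abs y" using g by (intro mult_right_mono) auto
   then show ?thesis using g by (simp add: algebra_simps)
  qed
  finally have c2: "abs c2 \<le> K * g" using assms(1) by (simp add: K_def pos_le_divide_eq)
  have s: "abs (c1 * w - c2 * z) \<le> K2 * g"
  proof -
   have "abs (c1 * w - c2 * z) \<le> abs c1 * abs w + abs c2 * abs z" using abs_triangle_ineq4[of "c1 * w" "c2 * z"] by (simp add: abs_mult)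
   moreover have "abs c1 * abs w \<le> g * abs w" using g by (intro mult_right_mono) auto
   moreover have "abs c2 * abs z \<le> K * g * abs z" using c2 by (intro mult_right_mono) auto
   ultimately show ?thesis unfolding K2_def by (simp add: algebra_simps)
  qed
  have half: "B * g / L \<le> g / 2" if "B \<le> K3" for B
  proof -
   have "B * g \<le> L / 2 * g" using that L1 g0 by (intro mult_right_mono) auto
   then show ?thesis using L1(1) by (simp add: pos_divide_le_eq mult.commute)
  qed
  have K3: "(1 + abs z) * K \<le> K3" "(1 + abs y) * K2 \<le> K3" using K by (simp_all add: K3_def)
  have "abs (L * x * c1 + c2 * z / L) + abs (c2 / L) \<le> L * abs x * abs c1 + (1 + abs z) * abs c2 / L" using abs_triangle_ineq[of "L * x * c1" "c2 * z / L"] L1(1)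
   by (simp add: abs_mult abs_divide algebra_simps add_divide_distrib)
  also have "(1 + abs z) * abs c2 / L \<le> (1 + abs z) * K * g / L" using mult_left_mono[OF c2, of "1 + abs z"] L1(1) by (simp add: divide_right_mono mult.assoc)
  also have "\<dots> \<le> g / 2" by (rule half[OF K3(1)])
  finally have a: "g \<le> 2 * L * abs x * abs c1" using up by simp
  have "abs ((c1 * w - c2 * z) / L) + abs (L * x * e + y * ((c1 * w - c2 * z) / L))
    \<le> L * abs x * abs e + (1 + abs y) * abs (c1 * w - c2 * z) / L" using abs_triangle_ineq[of "L * x * e" "y * ((c1 * w - c2 * z) / L)"] L1(1)
   by (simp add: abs_mult abs_divide distrib_right add_divide_distrib)
  also have "(1 + abs y) * abs (c1 * w - c2 * z) / L \<le> (1 + abs y) * K2 * g / L" using mult_left_mono[OF s, of "1 + abs y"] L1(1) by (simp add: divide_right_mono mult.assoc)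
  also have "\<dots> \<le> g / 2" by (rule half[OF K3(2)])
  finally have b: "g \<le> 2 * L * abs x * abs e" using dn by simp
  \<comment> \<open>The lower bound for the smaller coordinate is multiplied by the trivial bound of
    \<open>g\<close> by twice the larger one.\<close>
  have gg: "g\<^sup>2 \<le> 4 * L * abs x * abs (c1 * e)"
  proof (cases "abs c1 \<le> abs e")
   case True
   then have "g \<le> 2 * abs e" using g by simp
   then have "g * g \<le> (2 * L * abs x * abs c1) * (2 * abs e)" using a g0 L1(1) by (intro mult_mono) auto
   then show ?thesis by (simp add: power2_eq_square abs_mult mult_ac)
  next
   case False
   then have "g \<le> 2 * abs c1" using g by simp
   then have "g * g \<le> (2 * L * abs x * abs e) * (2 * abs c1)" using b g0 L1(1) by (intro mult_mono) auto
   then show ?thesis by (simp add: power2_eq_square abs_mult mult_ac)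
  qed
  have "abs (c2 * (c1 * w - c2 * z) / L\<^sup>2) \<le> K * K2 * g\<^sup>2 / L\<^sup>2"
  proof -
   have "abs c2 * abs (c1 * w - c2 * z) \<le> (K * g) * (K2 * g)" using c2 s g0 K by (intro mult_mono) auto
   then show ?thesis by (simp add: abs_mult abs_divide divide_right_mono power2_eq_square mult_ac)
  qed
  also have "\<dots> \<le> K * K2 * (4 * L * abs x * abs (c1 * e)) / L\<^sup>2" using gg K by (intro divide_right_mono mult_left_mono) auto
  also have "\<dots> = 4 * abs x * K * K2 / L * abs (c1 * e)" using L1(1) by (simp add: power2_eq_square)
  also have "\<dots> \<le> 1 / 2 * abs (c1 * e)" using L1 by (intro mult_right_mono) (auto simp: pos_divide_le_eq)
  finally have q: "abs (c2 * (c1 * w - c2 * z) / L\<^sup>2) \<le> 1 / 2 * abs (c1 * e)" .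
  have "abs A \<le> abs v + 1 / 2 * abs A" if "abs q \<le> 1 / 2 * abs A" "abs (A + q) = abs v" for A q :: real using that by linarith
  from this[OF q Q] have "abs (c1 * e) \<le> abs v + 1 / 2 * abs (c1 * e)" .
  then have ce: "abs (c1 * e) \<le> 2 * abs v" by simp
  have "4 * L * abs x * abs (c1 * e) \<le> 4 * L * abs x * (2 * abs v)" using ce L1(1) by (intro mult_left_mono) auto
  also have "\<dots> = 8 * abs x * abs v * L" by simp
  also have "\<dots> \<le> C * L" using L1(1) K by (intro mult_right_mono) (auto simp: C_def)
  finally have "g\<^sup>2 \<le> C * L" using gg by linarith
  moreover have "K * g \<le> C * g" "K2 * g \<le> C * g" using g0 K by (intro mult_right_mono; simp add: C_def)+
  ultimately show ?thesis using c2 s ce by linarith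
 qed
 have C0: "0 < C" using K by (simp add: C_def add_pos_nonneg)
 show ?thesis by (rule that[OF C0], rule main[OF _ HOL.refl HOL.refl])
qed

end

section \<open>Conjugators of minimal size\<close>

context discrete_sl2
begin

text \<open>Since \<open>X\<close> commutes with \<open>P\<close>, conjugators may be multiplied by
  \<open>X\<close> and by its inverse. Those with first row below a given size are bounded
  altogether, as \<open>B\<close> controls the second row, hence finite in number, and a minimum of
  \<open>f\<close> exists.\<close>

lemma short_solution:
 fixes x y :: real
 assumes X: "X \<in> G" "P * X = X * P" and c0: "c0 \<in> G" "c0 * P = Y * c0" and x: "x \<noteq> 0"
  and B: "\<And>c. c \<in> G \<Longrightarrow> c * P = Y * c \<Longrightarrow> abs (m21 c) \<le> B * (abs (m11 c) + abs (m12 c)) \<and> abs (m22 c) \<le> B * (abs (m11 c) + abs (m12 c))"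
 defines "f \<equiv> \<lambda>c. abs (m11 c) + abs (m11 c * y - m12 c * x)"
 obtains c where "c \<in> G" "c * P = Y * c" "f c \<le> f (c * X)" "f c \<le> f (c * inv2 X)"
proof -
 define S where "S = {c \<in> G. c * P = Y * c \<and> f c \<le> f c0}"
 define b where "b = f c0"
 define R where "R = b + (1 + abs y) * b / abs x + abs B * (b + (1 + abs y) * b / abs x)"
 have b0: "0 \<le> b" by (simp add: b_def f_def)
 have "bounded_mat R c" if "c \<in> S" for c
 proof -
  have c: "c \<in> G" "c * P = Y * c" "f c \<le> b" using that by (auto simp: S_def b_def)
  have c1: "abs (m11 c) \<le> b" using c(3) by (simp add: f_def)
  have "abs (m12 c * x) \<le> abs (m11 c * y) + abs (m11 c * y - m12 c * x)" by linarith
  also have "\<dots> \<le> b * abs y + b" using c(3) mult_right_mono[OF c1, of "abs y"] by (simp add: f_def abs_mult)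
  finally have c2: "abs (m12 c) \<le> (1 + abs y) * b / abs x" using x by (simp add: abs_mult pos_le_divide_eq algebra_simps)
  define k where "k = (1 + abs y) * b / abs x"
  have "B * (abs (m11 c) + abs (m12 c)) \<le> abs B * (b + k)" using c1 c2 by (intro mult_mono) (auto simp: k_def)
  moreover have "0 \<le> k" using b0 by (simp add: k_def)
  ultimately show ?thesis using B[OF c(1,2)] c1 c2 b0 unfolding bounded_mat_def R_def k_def[symmetric] by (smt (verit) mult_nonneg_nonneg abs_ge_zero)
 qed
 then have "S \<subseteq> {M \<in> G. bounded_mat R M}" by (auto simp: S_def)
 then have fin: "finite S" using discrete finite_subset by blast
 have c0S: "c0 \<in> S" using c0 by (simp add: S_def)
 have "Min (f ` S) \<in> f ` S" using fin c0S by (intro Min_in) auto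
 then obtain c where cS: "c \<in> S" and cm: "f c = Min (f ` S)" by (metis imageE)
 have c: "c \<in> G" "c * P = Y * c" using cS by (auto simp: S_def)
 have le: "f c \<le> f c'" if "c' \<in> G" "c' * P = Y * c'" for c'
 proof (cases "f c' \<le> f c0")
  case True
  then show ?thesis using that fin cm by (auto simp: S_def)
 next
  case False
  then show ?thesis using cS by (simp add: S_def)
 qed
 have dX: "det2 X = 1" using det X by blast
 have i: "inv2 X * P = P * inv2 X"
 proof -
  have "inv2 X * (P * X) * inv2 X = inv2 X * (X * P) * inv2 X" using X(2) by simp
  then show ?thesis using inv2_left[of X] inv2_right[of X] dX by (metis mult.assoc mult_1 mult_1_right zero_neq_one)
 qed
 have "c * X * P = Y * (c * X)" "c * inv2 X * P = Y * (c * inv2 X)" using X(2) i c(2) by (metis mult.assoc)+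
 then show ?thesis using that[OF c] le mult inverse X(1) c(1) by blast
qed

text \<open>
 For large \<open>n\<close> the axes of \<open>A\<^sup>n W\<close> and \<open>A\<^sup>n V\<close> are close to each other. A conjugator that is as
 short as possible then becomes almost triangular after multiplication by a power of \<open>A\<close>,
 so by discreteness it is diagonal.
\<close>

lemma not_conjugate:
 assumes W: "W \<in> G" "m12 W \<noteq> 0" and V: "V \<in> G" "m12 V \<noteq> 0" and eq: "m11 V = m11 W" "m22 V = m22 W"
  and nd: "\<And>m. Mat m 0 0 (1 / m) \<in> G \<Longrightarrow> m * m * m12 W \<noteq> m12 V"
 shows "\<exists>N. \<forall>n>N. \<forall>c\<in>G. c * (Mat (\<mu> ^ n) 0 0 (1 / \<mu> ^ n) * W) \<noteq> (Mat (\<mu> ^ n) 0 0 (1 / \<mu> ^ n) * V) * c"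
  and "\<exists>N. \<forall>n>N. \<forall>c\<in>G. c * inv2 (Mat (\<mu> ^ n) 0 0 (1 / \<mu> ^ n) * W) \<noteq> (Mat (\<mu> ^ n) 0 0 (1 / \<mu> ^ n) * V) * c"
proof -
 obtain x y z w where We: "W = Mat x y z w" by (cases W) auto
 obtain u v where Ve: "V = Mat x v u w" using eq by (cases V) (auto simp: We)
 have nz: "x \<noteq> 0" "y \<noteq> 0" "z \<noteq> 0" "w \<noteq> 0" "v \<noteq> 0" using nonzero_entries[OF W] W(2) V(2) by (auto simp: We Ve)
 have dW: "x * w - y * z = 1" using det[OF W(1)] by (simp add: We det2_def)
 obtain C L0 where C: "0 < C" and red: "\<And>L c1 c2. L0 \<le> L \<Longrightarrow> abs (c1 * (c1 * y - c2 * x) + c2 * (c1 * w - c2 * z) / L\<^sup>2) = abs v \<Longrightarrow>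
   abs c1 + abs (c1 * y - c2 * x) \<le> abs (L * x * c1 + c2 * z / L) + abs (c2 / L) \<Longrightarrow>
   abs c1 + abs (c1 * y - c2 * x) \<le> abs ((c1 * w - c2 * z) / L) + abs (L * x * (c1 * y - c2 * x) + y * ((c1 * w - c2 * z) / L)) \<Longrightarrow>
   abs c2 \<le> C * (abs c1 + abs (c1 * y - c2 * x)) \<and> abs (c1 * w - c2 * z) \<le> C * (abs c1 + abs (c1 * y - c2 * x)) \<and>
   abs (c1 * (c1 * y - c2 * x)) \<le> 2 * abs v \<and> (abs c1 + abs (c1 * y - c2 * x))\<^sup>2 \<le> C * L" by (rule reduced_row[OF nz(1) dW, of v]) (rule that; assumption)
 define X where "X L = Mat L 0 0 (1 / L) * W" for L
 define Y where "Y L = Mat L 0 0 (1 / L) * V" for L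
 have X: "X L = Mat (L * x) (L * y) (z / L) (w / L)" and Y: "Y L = Mat (L * x) (L * v) (u / L) (w / L)" for L by (simp_all add: X_def Y_def We Ve mat2_eq_iff)
 have iX: "inv2 (X L) = Mat (w / L) (- (L * y)) (- (z / L)) (L * x)" if "1 \<le> L" for L
 proof -
  have "L * x * (w / L) - L * y * (z / L) = x * w - y * z" using that by simp
  then show ?thesis using dW unfolding X by (subst inv2_det1) (simp_all add: det2_def)
 qed
 have short: "\<exists>c1 c2 c3 c4. Mat c1 c2 c3 c4 \<in> G \<and> Mat c1 c2 c3 c4 * P = Y L * Mat c1 c2 c3 c4 \<and>
   abs c2 \<le> C * (abs c1 + abs (c1 * y - c2 * x)) \<and> abs (c1 * w - c2 * z) \<le> C * (abs c1 + abs (c1 * y - c2 * x)) \<and>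
   abs (c1 * (c1 * y - c2 * x)) \<le> 2 * abs v \<and> (abs c1 + abs (c1 * y - c2 * x))\<^sup>2 \<le> C * L"
  if L: "1 \<le> L" "L0 \<le> L" "X L \<in> G" and P: "P * X L = X L * P" and c0: "c0 \<in> G" "c0 * P = Y L * c0"
   and B: "\<And>c. c \<in> G \<Longrightarrow> c * P = Y L * c \<Longrightarrow> abs (m21 c) \<le> B * (abs (m11 c) + abs (m12 c)) \<and> abs (m22 c) \<le> B * (abs (m11 c) + abs (m12 c))"
   and Q: "\<And>c. c \<in> G \<Longrightarrow> c * P = Y L * c \<Longrightarrow> abs (m11 c * (m11 c * y - m12 c * x) + m12 c * (m11 c * w - m12 c * z) / L\<^sup>2) = abs v"
  for L P c0 B
 proof -
  obtain c where c: "c \<in> G" "c * P = Y L * c"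
   "abs (m11 c) + abs (m11 c * y - m12 c * x) \<le> abs (m11 (c * X L)) + abs (m11 (c * X L) * y - m12 (c * X L) * x)"
   "abs (m11 c) + abs (m11 c * y - m12 c * x) \<le> abs (m11 (c * inv2 (X L))) + abs (m11 (c * inv2 (X L)) * y - m12 (c * inv2 (X L)) * x)"
   using short_solution[OF L(3) P c0 nz(1) B, of y] by blast
  obtain c1 c2 c3 c4 where ce: "c = Mat c1 c2 c3 c4" by (cases c) auto
  have "m11 (c * X L) = L * x * c1 + c2 * z / L" by (simp add: ce X)
  moreover have "m11 (c * X L) * y - m12 (c * X L) * x = - (c2 * (x * w - y * z) / L)" by (simp add: ce X algebra_simps diff_divide_distrib)
  moreover have "m11 (c * inv2 (X L)) = (c1 * w - c2 * z) / L" by (simp add: ce iX[OF L(1)] diff_divide_distrib)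
  moreover have "m11 (c * inv2 (X L)) * y - m12 (c * inv2 (X L)) * x = L * x * (c1 * y - c2 * x) + y * ((c1 * w - c2 * z) / L)"
   by (simp add: ce iX[OF L(1)] algebra_simps diff_divide_distrib)
  ultimately have "abs c2 \<le> C * (abs c1 + abs (c1 * y - c2 * x)) \<and> abs (c1 * w - c2 * z) \<le> C * (abs c1 + abs (c1 * y - c2 * x)) \<and>
   abs (c1 * (c1 * y - c2 * x)) \<le> 2 * abs v \<and> (abs c1 + abs (c1 * y - c2 * x))\<^sup>2 \<le> C * L" using c(3,4) Q[OF c(1,2)] dW by (intro red[OF L(2)]) (simp_all add: ce)
  then show ?thesis using c(1,2) unfolding ce by blast
 qed
 \<comment> \<open>The conjugation equation expresses \<open>v\<close> times the second row through
   the first row with coefficients among \<open>x, y, z, w\<close>.\<close>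
 define B where "B = (abs z + abs y + abs x + abs w) / abs v"
 have entry: "abs a \<le> B * (abs p + abs q)"
  if "abs (a * v) \<le> abs p * k1 + abs q * k2" "k1 \<le> abs z + abs y + abs x + abs w" "k2 \<le> abs z + abs y + abs x + abs w" for a p q k1 k2
 proof -
  define k where "k = abs z + abs y + abs x + abs w"
  have "abs p * k1 + abs q * k2 \<le> abs p * k + abs q * k" using that by (intro add_mono mult_left_mono) (auto simp: k_def)
  then have "abs a * abs v \<le> k * (abs p + abs q)" using that(1) by (simp add: abs_mult algebra_simps)
  then have "abs a \<le> k * (abs p + abs q) / abs v" using nz(5) by (intro iffD2[OF pos_le_divide_eq]) auto
  then show ?thesis by (simp add: B_def k_def)
 qed
 have red_L: "abs (a / L\<^sup>2) \<le> abs a" if "1 \<le> L" for a L :: real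
 proof -
  have "1 \<le> L\<^sup>2" using that by simp
  then have "abs a / L\<^sup>2 \<le> abs a / 1" by (intro divide_left_mono) auto
  then show ?thesis by (simp add: abs_divide)
 qed
 have XG: "X (\<mu> ^ n) \<in> G" for n unfolding X_def using mult diag_pow W by blast
 show "\<exists>N. \<forall>n>N. \<forall>c\<in>G. c * (Mat (\<mu> ^ n) 0 0 (1 / \<mu> ^ n) * W) \<noteq> (Mat (\<mu> ^ n) 0 0 (1 / \<mu> ^ n) * V) * c"
 proof -
  \<comment> \<open>From \<open>T * abs c2 <= (1 + g) * C * g\<close> and
    \<open>g^2 <= C * L\<close> one obtains \<open>T * abs c2 <= D * L\<close>; after division by
    \<open>L^2\<close> this makes the scaled lower left entry small, below the gap by the choice of
    \<open>L1\<close>.\<close>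
  define D where "D = C * (1 + 2 * C)"
  define R where "R = \<mu> + 2 * C * \<mu> + abs z * D / abs v + (1 + 2 * abs v + D * abs w) / abs v + (\<mu> + 2 * C * \<mu> * abs w) / abs v + 1 + 2 * abs v"
  obtain r where r: "0 < r" "\<And>M. M \<in> G \<Longrightarrow> bounded_mat R M \<Longrightarrow> abs (m21 M) < r \<Longrightarrow> m21 M = 0" using gap[of R m21] by blast
  have D: "0 < D" using C by (simp add: D_def)
  define L1 where "L1 = 1 + abs L0 + abs z * D / abs v / r"
  obtain N where N: "\<And>n. N < n \<Longrightarrow> L1 \<le> \<mu> ^ n" using large by blast
  have False if n: "N < n" and c0: "c0 \<in> G" "c0 * X (\<mu> ^ n) = Y (\<mu> ^ n) * c0" for n c0
  proof -
   define L where "L = \<mu> ^ n"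
   have "0 \<le> abs z * D / abs v / r" using D r by simp
   then have L: "1 \<le> L" "L0 \<le> L" "abs z * D / abs v / r < L" using N[OF n] unfolding L1_def L_def by linarith+
   have LL: "L \<le> L\<^sup>2" "1 \<le> L\<^sup>2" using L(1) mult_mono[of 1 L 1 L] by (auto simp: power2_eq_square)
   have XL: "X L \<in> G" using XG L_def by simp
   have eqs: "m21 c * v = m12 c * z / L\<^sup>2" "m22 c * v = m11 c * y - m12 c * x + m12 c * w / L\<^sup>2"
    if "c * X L = Y L * c" for c
   proof -
    have "m11 c * (L * x) + m12 c * (z / L) = L * x * m11 c + L * v * m21 c"
     "m11 c * (L * y) + m12 c * (w / L) = L * x * m12 c + L * v * m22 c" using that by (simp_all add: X Y mat2_eq_iff)
    then show "m21 c * v = m12 c * z / L\<^sup>2" "m22 c * v = m11 c * y - m12 c * x + m12 c * w / L\<^sup>2" using L(1) by (simp_all add: field_simps power2_eq_square)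
   qed
   have Bb: "abs (m21 c) \<le> B * (abs (m11 c) + abs (m12 c)) \<and> abs (m22 c) \<le> B * (abs (m11 c) + abs (m12 c))"
    if "c \<in> G" "c * X L = Y L * c" for c
   proof
    show "abs (m21 c) \<le> B * (abs (m11 c) + abs (m12 c))"
     using red_L[OF L(1), of "m12 c * z"] unfolding eqs[OF that(2), symmetric] by (intro entry[of _ _ 0 _ "abs z"]) (simp_all add: abs_mult)
    show "abs (m22 c) \<le> B * (abs (m11 c) + abs (m12 c))"
    proof (rule entry[of _ _ "abs y" _ "abs x + abs w"])
     show "abs (m22 c * v) \<le> abs (m11 c) * abs y + abs (m12 c) * (abs x + abs w)"
      unfolding eqs[OF that(2)] distrib_left abs_mult[symmetric] using red_L[OF L(1), of "m12 c * w"] by linarith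
    qed auto
   qed
   have Qq: "abs (m11 c * (m11 c * y - m12 c * x) + m12 c * (m11 c * w - m12 c * z) / L\<^sup>2) = abs v"
    if c: "c \<in> G" "c * X L = Y L * c" for c
   proof -
    have "v = (m11 c * m22 c - m12 c * m21 c) * v" using det[OF c(1)] by (simp add: det2_def)
    also have "\<dots> = m11 c * (m22 c * v) - m12 c * (m21 c * v)" by (simp only: left_diff_distrib mult.assoc)
    also have "\<dots> = m11 c * (m11 c * y - m12 c * x) + m12 c * (m11 c * w - m12 c * z) / L\<^sup>2"
     unfolding eqs[OF c(2)] by (simp add: algebra_simps add_divide_distrib diff_divide_distrib)
    finally show ?thesis by simp
   qed
   have c0': "c0 \<in> G" "c0 * X L = Y L * c0" using c0 unfolding L_def by simp_all
   obtain c1 c2 c3 c4 where c: "Mat c1 c2 c3 c4 \<in> G" "Mat c1 c2 c3 c4 * X L = Y L * Mat c1 c2 c3 c4"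
     and s0: "abs c2 \<le> C * (abs c1 + abs (c1 * y - c2 * x))" "abs (c1 * (c1 * y - c2 * x)) \<le> 2 * abs v" "(abs c1 + abs (c1 * y - c2 * x))\<^sup>2 \<le> C * L"
    using short[OF L(1,2) XL HOL.refl c0' Bb Qq] by blast
   define e where "e = c1 * y - c2 * x"
   define g where "g = abs c1 + abs e"
   have s: "abs c2 \<le> C * g" "abs (c1 * e) \<le> 2 * abs v" "g\<^sup>2 \<le> C * L" using s0 by (auto simp: g_def e_def)
   have e34: "c3 * v = c2 * z / L\<^sup>2" "c4 * v = e + c2 * w / L\<^sup>2" using eqs[OF c(2)] by (simp_all add: e_def)
   have g0: "0 \<le> g" by (simp add: g_def)
   \<comment> \<open>The scale to be removed. If \<open>c1\<close> dominates, a diagonal factor on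
     the left divides the first row by about \<open>T\<close>; if \<open>e\<close> dominates, a
     factor on the right divides the second column. Either way the matrix becomes bounded, with a
     tiny lower left entry.\<close>
   define T where "T = max 1 (max (abs c1) (abs e))"
   have T: "1 \<le> T" "T \<le> 1 + g" "abs c1 \<le> T" "abs e \<le> T" by (auto simp: T_def g_def)
   have Tc2: "T * abs c2 / L\<^sup>2 \<le> D / L"
   proof -
    have "T * abs c2 \<le> (1 + g) * (C * g)" using T s g0 by (intro mult_mono) auto
    also have "\<dots> \<le> C * (1 + 2 * g\<^sup>2)"
    proof -
     have "2 * g \<le> 1 + g\<^sup>2" using zero_le_power2[of "g - 1"] by (simp add: power2_diff)
     then have "g + g\<^sup>2 \<le> 1 + 2 * g\<^sup>2" using g0 by linarith
     then show ?thesis using C mult_left_mono[of "g + g\<^sup>2" "1 + 2 * g\<^sup>2" C] by (simp add: power2_eq_square algebra_simps)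
    qed
    also have "\<dots> \<le> C * (L + 2 * (C * L))" using s(3) L(1) C by (intro mult_left_mono add_mono) auto
    also have "\<dots> = D * L" by (simp add: D_def algebra_simps)
    finally show ?thesis using L(1) by (simp add: pos_divide_le_eq power2_eq_square)
   qed
   have DL: "D / L \<le> D" using D L(1) by (simp add: pos_divide_le_eq)
   have Tc3: "T * abs c3 \<le> abs z * D / abs v / L"
   proof -
    have "abs c3 * abs v = abs c2 * abs z / L\<^sup>2" using e34(1) by (metis abs_mult abs_divide abs_power2)
    then have "T * abs c3 * abs v = abs z * (T * abs c2 / L\<^sup>2)" by (simp add: mult_ac)
    also have "\<dots> \<le> abs z * (D / L)" using Tc2 by (intro mult_left_mono) auto
    finally have "T * abs c3 \<le> abs z * (D / L) / abs v" using nz(5) by (intro iffD2[OF pos_le_divide_eq]) auto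
    then show ?thesis by (simp add: mult_ac)
   qed
   have zD: "abs z * D / abs v / L \<le> abs z * D / abs v" "abs z * D / abs v / L < r"
   proof -
    define q where "q = abs z * D / abs v"
    have q: "0 \<le> q" "q / r < L" using D L(3) by (simp_all add: q_def)
    then have "q / L \<le> q / 1" using L(1) by (intro divide_left_mono) auto
    then show "abs z * D / abs v / L \<le> abs z * D / abs v" by (simp add: q_def)
    have "q < L * r" using q(2) r(1) by (simp add: pos_divide_less_eq)
    then have "q / L < r" using L(1) by (simp add: pos_divide_less_eq mult.commute)
    then show "abs z * D / abs v / L < r" by (simp add: q_def)
   qed
   have Rb: "\<mu> \<le> R" "2 * C * \<mu> \<le> R" "abs z * D / abs v \<le> R" "(1 + 2 * abs v + D * abs w) / abs v \<le> R" "(\<mu> + 2 * C * \<mu> * abs w) / abs v \<le> R" "1 + 2 * abs v \<le> R"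
   proof -
    have "0 \<le> 2 * C * \<mu>" "0 \<le> abs z * D / abs v" "0 \<le> (1 + 2 * abs v + D * abs w) / abs v" "0 \<le> (\<mu> + 2 * C * \<mu> * abs w) / abs v"
     using C D \<mu> by simp_all
    then show "\<mu> \<le> R" "2 * C * \<mu> \<le> R" "abs z * D / abs v \<le> R" "(1 + 2 * abs v + D * abs w) / abs v \<le> R" "(\<mu> + 2 * C * \<mu> * abs w) / abs v \<le> R" "1 + 2 * abs v \<le> R"
     using \<mu> unfolding R_def by linarith+
   qed
   obtain h where h: "0 < h" "h \<le> T" "T < \<mu> * h" "Mat h 0 0 (1 / h) \<in> G" "Mat (1 / h) 0 0 h \<in> G" using diag_scale[of T] T(1) by auto
   have "abs (h * c3) \<le> T * abs c3" using h by (simp add: abs_mult mult_right_mono)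
   then have c3b: "abs (h * c3) \<le> R" "abs (h * c3) < r" using Tc3 zD Rb(3) by linarith+
   have small: "abs a \<le> 1 + 2 * abs v" if "abs a \<le> abs b" "abs (b * a) \<le> 2 * abs v" for a b
   proof -
    have "abs a * abs a \<le> abs b * abs a" using that(1) by (intro mult_right_mono) auto
    also have "\<dots> \<le> 2 * abs v" using that(2) by (simp add: abs_mult)
    finally have "abs a * abs a \<le> 2 * abs v" .
    moreover have "2 * abs a \<le> 1 + abs a * abs a" using zero_le_power2[of "abs a - 1"] by (simp only: power2_diff) (simp add: power2_eq_square)
    ultimately show ?thesis using abs_ge_zero[of a] by linarith
   qed
   have "c3 = 0"
   proof (cases "abs e \<le> abs c1")
    case True
    let ?M = "Mat (1 / h) 0 0 h * Mat c1 c2 c3 c4"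
    have "abs (c1 / h) \<le> \<mu>" using T(3) h by (simp add: abs_divide pos_divide_le_eq mult.commute)
    moreover have "abs (c2 / h) \<le> 2 * C * \<mu>"
    proof -
     have "g \<le> 2 * abs c1" using True by (simp add: g_def)
     then have "g \<le> 2 * (\<mu> * h)" using T(3) h(3) by linarith
     then have "C * g \<le> C * (2 * (\<mu> * h))" using C by (intro mult_left_mono) auto
     then have "abs c2 \<le> 2 * C * \<mu> * h" using s(1) by simp
     then show ?thesis using h(1) by (simp add: abs_divide pos_divide_le_eq)
    qed
    moreover have "abs (h * c4) \<le> (1 + 2 * abs v + D * abs w) / abs v"
    proof -
     have TT: "T = max 1 (abs c1)" using True by (auto simp: T_def)
     have Te: "T * abs e \<le> 1 + 2 * abs v" using small[OF True s(2)] s(2) unfolding TT by (cases "abs c1 \<le> 1") (auto simp: max_def abs_mult)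
     have "abs (h * c4) * abs v = h * abs (e + c2 * w / L\<^sup>2)" using e34(2) h(1) by (metis abs_mult abs_of_pos mult.assoc)
     also have "\<dots> \<le> T * (abs e + abs c2 * abs w / L\<^sup>2)"
     proof (rule mult_mono)
      show "abs (e + c2 * w / L\<^sup>2) \<le> abs e + abs c2 * abs w / L\<^sup>2" using abs_triangle_ineq[of e "c2 * w / L\<^sup>2"] by (simp add: abs_divide abs_mult)
     qed (use h T in auto)
     also have "\<dots> = T * abs e + T * abs c2 / L\<^sup>2 * abs w" by (simp add: algebra_simps)
     also have "\<dots> \<le> 1 + 2 * abs v + D * abs w" using Te Tc2 DL by (intro add_mono mult_right_mono) auto
     finally show ?thesis using nz(5) by (simp add: pos_le_divide_eq)
    qed
    ultimately have bM: "bounded_mat R ?M" using c3b(1) Rb unfolding bounded_mat_def by (simp del: abs_divide abs_mult)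
    have "?M \<in> G" using c(1) h(5) mult by blast
    then have "m21 ?M = 0" using bM by (rule r(2)) (use c3b(2) in \<open>simp add: mult.commute\<close>)
    then show ?thesis using h(1) by simp
   next
    case False
    let ?M = "Mat c1 c2 c3 c4 * Mat h 0 0 (1 / h)"
    have g2: "g \<le> 2 * (\<mu> * h)" using False T(4) h(3) unfolding g_def by linarith
    have "abs (c1 * h) \<le> 1 + 2 * abs v"
    proof -
     have TT: "T = max 1 (abs e)" using False by (auto simp: T_def)
     have "abs (c1 * h) \<le> T * abs c1" using h(1,2) by (simp add: abs_mult mult.commute mult_right_mono)
     also have "\<dots> \<le> 1 + 2 * abs v" using small[of c1 e] False s(2) unfolding TT by (cases "abs e \<le> 1") (auto simp: max_def abs_mult mult.commute)
     finally show ?thesis .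
    qed
    moreover have c2d: "abs c2 \<le> 2 * C * \<mu> * h"
    proof -
     have "C * g \<le> C * (2 * (\<mu> * h))" using g2 C by (intro mult_left_mono) auto
     then show ?thesis using s(1) by simp
    qed
    then have "abs (c2 / h) \<le> 2 * C * \<mu>" using h(1) by (simp add: abs_divide pos_divide_le_eq)
    moreover have "abs (c4 / h) \<le> (\<mu> + 2 * C * \<mu> * abs w) / abs v"
    proof -
     have "abs c4 * abs v = abs (e + c2 * w / L\<^sup>2)" using e34(2) by (metis abs_mult)
     also have "\<dots> \<le> abs e + abs (c2 * w)" using abs_triangle_ineq[of e "c2 * w / L\<^sup>2"] red_L[OF L(1), of "c2 * w"] by linarith
     also have "\<dots> \<le> \<mu> * h + 2 * C * \<mu> * h * abs w" using T(4) h(3) mult_right_mono[OF c2d, of "abs w"] by (simp add: abs_mult)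
     also have "\<dots> = (\<mu> + 2 * C * \<mu> * abs w) * h" by (simp add: algebra_simps)
     finally show ?thesis using nz(5) h(1) by (simp add: abs_divide pos_divide_le_eq pos_le_divide_eq mult_ac)
    qed
    ultimately have bM: "bounded_mat R ?M" using c3b(1) Rb unfolding bounded_mat_def by (simp add: mult.commute del: abs_divide abs_mult)
    have "?M \<in> G" using c(1) h(4) mult by blast
    then have "m21 ?M = 0" using bM by (rule r(2)) (use c3b(2) in \<open>simp add: mult.commute\<close>)
    then show ?thesis using h(1) by simp
   qed
   then have "c2 = 0" using lower_left_0[OF c(1)] by simp
   then have c4: "c4 * v = c1 * y" "c1 * c4 = 1" using e34(2) det[OF c(1)] by (simp_all add: e_def det2_def)
   then have "c1 * c1 * y = v" by (metis mult.assoc mult.commute mult.right_neutral)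
   moreover have "c4 = 1 / c1" using c4(2) by (metis mult_zero_left nonzero_eq_divide_eq mult.commute zero_neq_one)
   ultimately show False using nd[of c1] c(1) \<open>c2 = 0\<close> \<open>c3 = 0\<close> by (simp add: We Ve)
  qed
  then show ?thesis unfolding X_def Y_def by blast
 qed
 show "\<exists>N. \<forall>n>N. \<forall>c\<in>G. c * inv2 (Mat (\<mu> ^ n) 0 0 (1 / \<mu> ^ n) * W) \<noteq> (Mat (\<mu> ^ n) 0 0 (1 / \<mu> ^ n) * V) * c"
 proof -
  define R where "R = 2 + \<mu>\<^sup>2 + abs (y / v)"
  obtain r where r: "0 < r" "\<And>M. M \<in> G \<Longrightarrow> bounded_mat R M \<Longrightarrow> abs (m11 M) < r \<Longrightarrow> m11 M = 0" using gap[of R m11] by blast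
  \<comment> \<open>With \<open>a^2 <= C^3 / L\<close> proved below, the last three summands yield
    \<open>abs a <= 1\<close>, \<open>abs (a * b') <= 1 / 2\<close> and
    \<open>abs a < r\<close>.\<close>
  define L1 where "L1 = 1 + abs L0 + C ^ 3 + 2 * C ^ 3 * abs (y / v) + C ^ 3 / r\<^sup>2"
  obtain N where N: "\<And>n. N < n \<Longrightarrow> L1 \<le> \<mu> ^ n" using large by blast
  have False if n: "N < n" and c0: "c0 \<in> G" "c0 * inv2 (X (\<mu> ^ n)) = Y (\<mu> ^ n) * c0" for n c0
  proof -
   define L where "L = \<mu> ^ n"
   have "0 \<le> C ^ 3" "0 \<le> 2 * C ^ 3 * abs (y / v)" "0 \<le> C ^ 3 / r\<^sup>2" using C by simp_all
   then have L: "1 \<le> L" "L0 \<le> L" "C ^ 3 \<le> L" "2 * C ^ 3 * abs (y / v) \<le> L" "C ^ 3 / r\<^sup>2 < L" using N[OF n] unfolding L1_def L_def by linarith+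
   have XL: "X L \<in> G" using XG L_def by simp
   have eqs: "m22 c * v = - (m11 c * y)" "m21 c * v = (m11 c * w - m12 c * z) / L\<^sup>2 - x * m11 c"
    if "c * inv2 (X L) = Y L * c" for c
   proof -
    have "m11 c * (w / L) + m12 c * (- (z / L)) = L * x * m11 c + L * v * m21 c"
     "m11 c * (- (L * y)) + m12 c * (L * x) = L * x * m12 c + L * v * m22 c" using that unfolding iX[OF L(1)] by (simp_all add: Y mat2_eq_iff)
    then have "L * (m22 c * v + m11 c * y) = 0" "m11 c * w - m12 c * z = L\<^sup>2 * (x * m11 c + m21 c * v)" using L(1) by (simp_all add: field_simps power2_eq_square)
    moreover from this(2) have "(m11 c * w - m12 c * z) / L\<^sup>2 = x * m11 c + m21 c * v" using L(1) by simp
    ultimately show "m22 c * v = - (m11 c * y)" "m21 c * v = (m11 c * w - m12 c * z) / L\<^sup>2 - x * m11 c" using L(1) by (simp_all add: add_eq_0_iff2)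
   qed
   have PX: "inv2 (X L) * X L = X L * inv2 (X L)" using inv2_left[of "X L"] inv2_right[of "X L"] det[OF XL] by simp
   have Bb: "abs (m21 c) \<le> B * (abs (m11 c) + abs (m12 c)) \<and> abs (m22 c) \<le> B * (abs (m11 c) + abs (m12 c))"
    if "c \<in> G" "c * inv2 (X L) = Y L * c" for c
   proof
    show "abs (m21 c) \<le> B * (abs (m11 c) + abs (m12 c))"
    proof (rule entry[of _ _ "abs w + abs x" _ "abs z"])
     show "abs (m21 c * v) \<le> abs (m11 c) * (abs w + abs x) + abs (m12 c) * abs z" unfolding eqs[OF that(2)] distrib_left abs_mult[symmetric] mult.commute[of x]
      using red_L[OF L(1), of "m11 c * w - m12 c * z"] by linarith
    qed auto
    show "abs (m22 c) \<le> B * (abs (m11 c) + abs (m12 c))" unfolding abs_minus_cancel using eqs(1)[OF that(2)] by (intro entry[of _ _ "abs y" _ 0]) (simp_all add: abs_mult)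
   qed
   have Qq: "abs (m11 c * (m11 c * y - m12 c * x) + m12 c * (m11 c * w - m12 c * z) / L\<^sup>2) = abs v"
    if c: "c \<in> G" "c * inv2 (X L) = Y L * c" for c
   proof -
    have "v = (m11 c * m22 c - m12 c * m21 c) * v" using det[OF c(1)] by (simp add: det2_def)
    also have "\<dots> = m11 c * (m22 c * v) - m12 c * (m21 c * v)" by (simp only: left_diff_distrib mult.assoc)
    also have "\<dots> = - (m11 c * (m11 c * y - m12 c * x) + m12 c * (m11 c * w - m12 c * z) / L\<^sup>2)" unfolding eqs[OF c(2)] by (simp add: algebra_simps)
    finally show ?thesis by (metis abs_minus_cancel)
   qed
   have c0': "c0 \<in> G" "c0 * inv2 (X L) = Y L * c0" using c0 unfolding L_def by simp_all
   obtain c1 c2 c3 c4 where c: "Mat c1 c2 c3 c4 \<in> G" "Mat c1 c2 c3 c4 * inv2 (X L) = Y L * Mat c1 c2 c3 c4"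
     and s0: "abs (c1 * w - c2 * z) \<le> C * (abs c1 + abs (c1 * y - c2 * x))" "(abs c1 + abs (c1 * y - c2 * x))\<^sup>2 \<le> C * L"
    using short[OF L(1,2) XL PX c0' Bb Qq] by blast
   define e where "e = c1 * y - c2 * x"
   define g where "g = abs c1 + abs e"
   \<comment> \<open>One further multiplication by the inverse keeps the conjugation property and
     makes the upper left entry of order \<open>1 / sqrt L\<close>.\<close>
   define c' where "c' = Mat c1 c2 c3 c4 * inv2 (X L)"
   have c'G: "c' \<in> G" unfolding c'_def using c(1) XL mult inverse by blast
   have "c' * inv2 (X L) = Y L * c'" unfolding c'_def using c(2) by (simp add: mult.assoc)
   note q = eqs(1)[OF this]
   obtain a b a' b' where c'e: "c' = Mat a b a' b'" by (cases c') auto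
   have a: "a = (c1 * w - c2 * z) / L" using c'e unfolding c'_def iX[OF L(1)] by (simp add: mat2_eq_iff diff_divide_distrib)
   have "abs a \<le> C * g / L" using s0(1) L(1) by (simp add: a abs_divide divide_right_mono g_def e_def)
   then have "(abs a)\<^sup>2 \<le> (C * g / L)\<^sup>2" by (rule power_mono) simp
   also have "\<dots> = C\<^sup>2 * g\<^sup>2 / L\<^sup>2" by (simp add: power_divide power_mult_distrib)
   also have "\<dots> \<le> C\<^sup>2 * (C * L) / L\<^sup>2" using s0(2) by (intro divide_right_mono mult_left_mono) (auto simp: g_def e_def)
   also have "\<dots> = C ^ 3 / L" using L(1) by (simp add: power2_eq_square power3_eq_cube)
   finally have a2: "a\<^sup>2 \<le> C ^ 3 / L" by simp
   have "C ^ 3 / L \<le> 1" using L(1,3) by simp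
   then have "a\<^sup>2 \<le> 1" using a2 by linarith
   then have a1: "abs a \<le> 1" by (simp add: abs_square_le_1)
   have ae: "abs a < r"
   proof -
    have "C ^ 3 < L * r\<^sup>2" using L(5) r(1) by (simp only: pos_divide_less_eq zero_less_power)
    then have "C ^ 3 / L < r\<^sup>2" using L(1) by (simp add: pos_divide_less_eq mult.commute)
    then have "(abs a)\<^sup>2 < r\<^sup>2" using a2 by simp
    then show ?thesis using r(1) power2_less_imp_less[of "abs a" r] by simp
   qed
   have b': "b' = - (a * (y / v))" using q nz(5) by (simp add: c'e field_simps)
   have "abs (a * b') = a\<^sup>2 * abs (y / v)" unfolding b' by (simp add: abs_mult power2_eq_square)
   also have "\<dots> \<le> C ^ 3 / L * abs (y / v)" using a2 by (intro mult_right_mono) auto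
   also have "C ^ 3 / L * abs (y / v) = C ^ 3 * abs (y / v) / L" by simp
   also have "\<dots> \<le> 1 / 2" using L(1,4) by (intro iffD2[OF pos_divide_le_eq]) linarith+
   finally have ab: "abs (a * b') \<le> 1 / 2" .
   have dt: "a * b' - b * a' = 1" using det[OF c'G] by (simp add: c'e det2_def)
   then have b0: "b \<noteq> 0" using ab by auto
   have ba: "abs (b * a') \<le> 2" using dt ab by linarith
   have "0 < sqrt (abs b)" using b0 by simp
   then obtain h where h: "0 < h" "h \<le> sqrt (abs b)" "sqrt (abs b) < \<mu> * h" "Mat h 0 0 (1 / h) \<in> G" "Mat (1 / h) 0 0 h \<in> G" using diag_scale by blast
   \<comment> \<open>Conjugation by a diagonal matrix with \<open>h^2\<close> comparable to
     \<open>abs b\<close> bounds the off-diagonal entries and keeps the tiny entry \<open>a\<close>.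
     The gap makes it zero, which no element of the group allows.\<close>
   let ?M = "Mat (1 / h) 0 0 h * c' * Mat h 0 0 (1 / h)"
   have M: "?M = Mat a (b / h\<^sup>2) (h\<^sup>2 * a') b'" using h(1) by (simp add: c'e mat2_eq_iff power2_eq_square)
   have "h\<^sup>2 \<le> (sqrt (abs b))\<^sup>2" "(sqrt (abs b))\<^sup>2 \<le> (\<mu> * h)\<^sup>2" using h(1-3) by (intro power_mono; simp)+
   then have d2: "h\<^sup>2 \<le> abs b" "abs b \<le> \<mu>\<^sup>2 * h\<^sup>2" by (simp_all add: power_mult_distrib)
   have "abs (b / h\<^sup>2) \<le> \<mu>\<^sup>2" using d2(2) h(1) by (simp add: abs_divide pos_divide_le_eq)
   moreover have "abs (h\<^sup>2 * a') \<le> 2" using mult_right_mono[OF d2(1), of "abs a'"] ba by (simp add: abs_mult)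
   moreover have "abs b' \<le> abs (y / v)" using mult_right_mono[OF a1, of "abs (y / v)"] unfolding b' by (simp add: abs_mult)
   ultimately have bM: "bounded_mat R ?M" using a1 zero_le_power2[of \<mu>] unfolding M bounded_mat_def R_def mat2.sel by (smt (verit) abs_ge_zero)
   have MG: "?M \<in> G" using c'G h mult by blast
   then have "m11 ?M = 0" using bM by (rule r(2)) (unfold M, use ae in simp)
   then show False using diagonal_entry_nonzero(1)[OF MG] by simp
  qed
  then show ?thesis unfolding X_def Y_def by blast
 qed
qed

end

definition dg :: "real \<Rightarrow> mat2" where "dg a = Mat a 0 0 (1 / a)"

text \<open>The two words are reversals of each other up to cyclic permutation, so they have the same trace after multiplication by a power of \<open>A\<close>.\<close>

definition word1 :: "mat2 \<Rightarrow> mat2 \<Rightarrow> mat2" where "word1 A B = B * A * B * inv2 A * inv2 B"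
definition word2 :: "mat2 \<Rightarrow> mat2 \<Rightarrow> mat2" where "word2 A B = inv2 B * inv2 A * B * A * B"

lemma word_entries:
 assumes "a \<noteq> 0" "det2 B = 1" "B = Mat p q r s"
 shows "m12 (word1 (dg a) B) = q * (a\<^sup>2 * p\<^sup>2 - q * r / a\<^sup>2 - p * (p - s))"
  and "m12 (word2 (dg a) B) = - q * (a\<^sup>2 * (q * r) - s\<^sup>2 / a\<^sup>2 - s * (p - s))"
  and "m11 (word1 (dg a) B) = m11 (word2 (dg a) B)" and "m22 (word1 (dg a) B) = m22 (word2 (dg a) B)"
proof -
 have d: "det2 (dg a) = 1" using assms(1) by (simp add: dg_def det2_def)
 have i: "inv2 (dg a) = Mat (1 / a) 0 0 a" using d by (simp add: inv2_det1) (simp add: dg_def)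
 have iB: "inv2 B = Mat s (- q) (- r) p" using inv2_det1[OF assms(2)] assms(3) by simp
 show "m12 (word1 (dg a) B) = q * (a\<^sup>2 * p\<^sup>2 - q * r / a\<^sup>2 - p * (p - s))"
  unfolding word1_def i iB unfolding dg_def assms(3) using assms(1) by (simp add: field_simps power2_eq_square)
 show "m12 (word2 (dg a) B) = - q * (a\<^sup>2 * (q * r) - s\<^sup>2 / a\<^sup>2 - s * (p - s))"
  unfolding word2_def i iB unfolding dg_def assms(3) using assms(1) by (simp add: field_simps power2_eq_square)
 show "m11 (word1 (dg a) B) = m11 (word2 (dg a) B)" "m22 (word1 (dg a) B) = m22 (word2 (dg a) B)"
  unfolding word1_def word2_def i iB unfolding dg_def assms(3) using assms(1) by (simp_all add: field_simps power2_eq_square)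
qed

section \<open>A power of the diagonal element that distinguishes the two words\<close>

context discrete_sl2
begin

lemma dg_G: "dg (\<mu> ^ n) \<in> G" unfolding dg_def by (rule diag_pow)

lemma word_G:
 assumes "A \<in> G" "B \<in> G"
 shows "word1 A B \<in> G" "word2 A B \<in> G" using assms mult inverse by (auto simp: word1_def word2_def)

text \<open>Both upper right entries grow like \<open>t = mu^(2 l)\<close>. If for every large
  \<open>l\<close> a diagonal element related them, these elements would be bounded, hence finitely
  many, and one of them would serve infinitely many \<open>l\<close>. A quadratic polynomial in
  \<open>t\<close> would then vanish identically, and its coefficients force the square of the trace
  of \<open>B\<close> to be 2, below the permitted 4.\<close>

lemma words_not_conjugate:
 assumes B: "B \<in> G" "m12 B \<noteq> 0"
 obtains l where "m12 (word1 (dg (\<mu> ^ l)) B) \<noteq> 0" "m12 (word2 (dg (\<mu> ^ l)) B) \<noteq> 0"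
  "\<And>m. Mat m 0 0 (1 / m) \<in> G \<Longrightarrow> m * m * m12 (word1 (dg (\<mu> ^ l)) B) \<noteq> m12 (word2 (dg (\<mu> ^ l)) B)"
proof -
 obtain p q r s where Be: "B = Mat p q r s" by (cases B) auto
 have nz: "p \<noteq> 0" "q \<noteq> 0" "r \<noteq> 0" "s \<noteq> 0" using nonzero_entries[OF B] B(2) by (auto simp: Be)
 have d: "p * s - q * r = 1" using det[OF B(1)] by (simp add: Be det2_def)
 define t where "t l = (\<mu> ^ l)\<^sup>2" for l :: nat
 have t1: "1 \<le> \<mu> ^ l" "\<mu> ^ l \<le> t l" "1 \<le> t l" for l
 proof -
  show 1: "1 \<le> \<mu> ^ l" using \<mu> by simp
  then show "\<mu> ^ l \<le> t l" using mult_mono[of 1 "\<mu> ^ l" "\<mu> ^ l" "\<mu> ^ l"] by (simp add: t_def power2_eq_square)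
  then show "1 \<le> t l" using 1 by linarith
 qed
 define f h where "f l = t l * p\<^sup>2 - q * r / t l - p * (p - s)" and "h l = t l * (q * r) - s\<^sup>2 / t l - s * (p - s)" for l
 have w: "m12 (word1 (dg (\<mu> ^ l)) B) = q * f l" "m12 (word2 (dg (\<mu> ^ l)) B) = - q * h l" for l
 proof -
  have "\<mu> ^ l \<noteq> 0" using \<mu> by simp
  from word_entries(1,2)[OF this det[OF B(1)] Be]
  show "m12 (word1 (dg (\<mu> ^ l)) B) = q * f l" "m12 (word2 (dg (\<mu> ^ l)) B) = - q * h l" by (simp_all add: f_def h_def t_def)
 qed
 define P Q where "P = p\<^sup>2" and "Q = abs (q * r)"
 have PQ: "0 < P" "0 < Q" using nz by (auto simp: P_def Q_def)
 \<comment> \<open>From this size of \<open>t\<close> on, the lower order terms of \<open>f\<close>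
   and \<open>h\<close> are at most half of the leading ones.\<close>
 define T0 where "T0 = 2 * (Q + abs (p * (p - s))) / P + 2 * (s\<^sup>2 + abs (s * (p - s))) / Q"
 obtain l0 where l0: "\<And>l. l0 < l \<Longrightarrow> T0 \<le> \<mu> ^ l" using large by blast
 have bounds: "t l * P / 2 \<le> abs (f l)" "abs (f l) \<le> 2 * (t l * P)" "t l * Q / 2 \<le> abs (h l)" "abs (h l) \<le> 2 * (t l * Q)" if "l0 < l" for l
 proof -
  have "T0 \<le> t l" using l0[OF that] t1(2)[of l] by linarith
  moreover have "0 \<le> 2 * (Q + abs (p * (p - s))) / P" "0 \<le> 2 * (s\<^sup>2 + abs (s * (p - s))) / Q" using PQ by simp_all
  ultimately have "2 * (Q + abs (p * (p - s))) / P \<le> t l" "2 * (s\<^sup>2 + abs (s * (p - s))) / Q \<le> t l" unfolding T0_def by linarith+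
  then have big: "2 * (Q + abs (p * (p - s))) \<le> t l * P" "2 * (s\<^sup>2 + abs (s * (p - s))) \<le> t l * Q" using PQ by (simp_all only: pos_divide_le_eq)
  have dv: "abs (a / t l) \<le> abs a" for a using divide_left_mono[of 1 "t l" "abs a"] t1(3)[of l] by (simp add: abs_divide)
  have near: "b / 2 \<le> abs a \<and> abs a \<le> 2 * b" if "abs (a - e) \<le> c" "abs e = b" "2 * c \<le> b" for a b c e :: real using that by linarith
  have "abs (f l - t l * P) \<le> Q + abs (p * (p - s))" using dv[of "q * r"] unfolding f_def P_def Q_def by linarith
  moreover have "abs (t l * P) = t l * P" using t1(3)[of l] PQ by simp
  ultimately have "t l * P / 2 \<le> abs (f l) \<and> abs (f l) \<le> 2 * (t l * P)" using big(1) by (rule near)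
  then show "t l * P / 2 \<le> abs (f l)" "abs (f l) \<le> 2 * (t l * P)" by simp_all
  have tQ: "abs (t l * (q * r)) = t l * Q" using t1(3)[of l] by (simp add: abs_mult Q_def)
  have "abs (h l - t l * (q * r)) \<le> s\<^sup>2 + abs (s * (p - s))" using dv[of "s\<^sup>2"] zero_le_power2[of s] unfolding h_def by linarith
  then have "t l * Q / 2 \<le> abs (h l) \<and> abs (h l) \<le> 2 * (t l * Q)" using tQ big(2) by (rule near)
  then show "t l * Q / 2 \<le> abs (h l)" "abs (h l) \<le> 2 * (t l * Q)" by simp_all
 qed
 have fh: "f l \<noteq> 0" "h l \<noteq> 0" if "l0 < l" for l
 proof -
  have "0 < t l * P / 2" "0 < t l * Q / 2" using t1(3)[of l] PQ by (intro divide_pos_pos mult_pos_pos; simp)+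
  then show "f l \<noteq> 0" "h l \<noteq> 0" using bounds(1,3)[OF that] by linarith+
 qed
 have "\<exists>l>l0. \<forall>m. Mat m 0 0 (1 / m) \<in> G \<longrightarrow> m * m * f l \<noteq> - h l"
 proof (rule ccontr)
  assume "\<not> ?thesis"
  then have "\<forall>l\<in>{l0<..}. \<exists>m. Mat m 0 0 (1 / m) \<in> G \<and> m * m * f l = - h l" by auto
  then obtain m where m: "\<And>l. l0 < l \<Longrightarrow> Mat (m l) 0 0 (1 / m l) \<in> G" "\<And>l. l0 < l \<Longrightarrow> m l * m l * f l = - h l" by (metis greaterThan_iff)
  \<comment> \<open>The bounds on \<open>f\<close> and \<open>h\<close> place \<open>m^2\<close>
    between \<open>Q / (4 * P)\<close> and \<open>4 * Q / P\<close>; the 1 allows square roots to be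
    bounded by \<open>K\<close> as well.\<close>
  define K where "K = 1 + 4 * Q / P + 4 * P / Q"
  have K1: "1 \<le> K" "4 * Q / P \<le> K" "4 * P / Q \<le> K" using PQ by (simp_all add: K_def add_nonneg_nonneg)
  have sq: "abs a \<le> K" if "a * a \<le> K" for a
  proof (rule ccontr)
   assume "\<not> abs a \<le> K"
   then have "K * 1 < abs a * abs a" using K1 by (intro mult_strict_mono) auto
   then show False using that by simp
  qed
  have bd: "bounded_mat K (Mat (m l) 0 0 (1 / m l))" if l: "l0 < l" for l
  proof -
   have m0: "m l \<noteq> 0" using m(2)[OF l] fh(2)[OF l] by auto
   have e: "m l * m l * abs (f l) = abs (h l)" using m(2)[OF l] by (metis abs_minus_cancel abs_mult abs_mult_self_eq)
   have tp: "0 < t l" using t1(3)[of l] by linarith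
   have "m l * m l * (t l * P / 2) \<le> m l * m l * abs (f l)" using bounds(1)[OF l] by (intro mult_left_mono) auto
   then have "m l * m l * (t l * P) \<le> 4 * (t l * Q)" using e bounds(4)[OF l] by linarith
   then have "m l * m l * P \<le> 4 * Q" using tp by (simp add: mult_ac)
   then have "m l * m l \<le> 4 * Q / P" using PQ by (simp add: pos_le_divide_eq)
   then have 1: "abs (m l) \<le> K" using K1 by (intro sq) linarith
   have "m l * m l * abs (f l) \<le> m l * m l * (2 * (t l * P))" using bounds(2)[OF l] by (intro mult_left_mono) auto
   then have "t l * Q \<le> m l * m l * (4 * (t l * P))" using e bounds(3)[OF l] by linarith
   then have "Q \<le> m l * m l * (4 * P)" using tp by (simp add: mult_ac)
   moreover have "0 < m l * m l" using m0 by (cases "0 < m l") (auto simp: zero_less_mult_iff)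
   ultimately have "1 / m l * (1 / m l) \<le> 4 * P / Q" using PQ by (simp add: field_simps)
   then have "abs (1 / m l) \<le> K" using K1 by (intro sq) linarith
   then show ?thesis using 1 K1 by (simp add: bounded_mat_def)
  qed
  let ?S = "{l0<..}" and ?g = "\<lambda>l. Mat (m l) 0 0 (1 / m l)"
  have "?g ` ?S \<subseteq> {M \<in> G. bounded_mat K M}" using m(1) bd by auto
  then have "finite (?g ` ?S)" using discrete finite_subset by blast
  moreover have "infinite ?S" by (simp add: infinite_Ioi)
  ultimately obtain l' where "infinite {l \<in> ?S. ?g l = ?g l'}" using pigeonhole_infinite[of ?S ?g] by blast
  then have inf: "infinite {l \<in> ?S. m l = m l'}" by (rule contrapos_nn) (auto elim: finite_subset[rotated])
  define M where "M = m l' * m l'"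
  \<comment> \<open>This is \<open>t * (M * f + h)\<close> written out as a polynomial in
    \<open>t\<close>.\<close>
  define pl where "pl = [: - M * (q * r) - s\<^sup>2, - (p - s) * (M * p + s), M * P + q * r :]"
  have root: "poly pl (t l) = 0" if "l \<in> {l \<in> ?S. m l = m l'}" for l
  proof -
   have l: "l0 < l" "M * f l = - h l" using that m(2)[of l] by (auto simp: M_def)
   have tp: "t l \<noteq> 0" using t1(3)[of l] by linarith
   have "poly pl (t l) = t l * (M * f l + h l)" using tp by (simp add: pl_def f_def h_def P_def power2_eq_square field_simps)
   then show ?thesis using l(2) by simp
  qed
  have "inj t"
  proof (rule injI)
   fix a b assume "t a = t b"
   then have "\<mu> ^ a = \<mu> ^ b" using t1(1)[of a] t1(1)[of b] by (simp add: t_def power2_eq_iff_nonneg)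
   then show "a = b" using \<mu> by (simp add: power_inject_exp)
  qed
  then have "infinite (t ` {l \<in> ?S. m l = m l'})" using inf by (meson finite_imageD inj_on_subset subset_UNIV)
  then have "infinite {x. poly pl x = 0}" by (rule contrapos_nn) (rule finite_subset, use root in auto)
  then have "pl = 0" using poly_roots_finite by blast
  then have z: "- M * (q * r) - s\<^sup>2 = 0" "(p - s) * (M * p + s) = 0" "M * P + q * r = 0" by (auto simp: pl_def)
  have qr: "q * r = - (M * p * p)" using z(3) by (simp add: P_def power2_eq_square)
  have one: "p * (s + M * p) = 1" using d qr by (simp add: algebra_simps)
  then have nz': "s + M * p \<noteq> 0" by auto
  then have ps: "p = s" using z(2) by (simp add: add.commute)
  have "(M * p - s) * (s + M * p) = 0" using z(1) qr by (simp add: power2_eq_square algebra_simps)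
  then have "M * p = s" using nz' by simp
  then have "p * (s + s) = 1" using one by simp
  then have "p * (2 * p) = 1" unfolding ps by simp
  then have "(tr2 B)\<^sup>2 = 2" by (simp add: tr2_def Be ps[symmetric] power2_eq_square)
  moreover have "2\<^sup>2 \<le> (tr2 B)\<^sup>2" using trace[OF B(1)] by (metis abs_le_square_iff abs_numeral)
  ultimately show False by simp
 qed
 then obtain l where l: "l0 < l" "\<And>m. Mat m 0 0 (1 / m) \<in> G \<Longrightarrow> m * m * f l \<noteq> - h l" by blast
 show ?thesis
 proof (rule that[of l])
  show "m12 (word1 (dg (\<mu> ^ l)) B) \<noteq> 0" "m12 (word2 (dg (\<mu> ^ l)) B) \<noteq> 0" using w fh[OF l(1)] nz by simp_all
  fix k assume "Mat k 0 0 (1 / k) \<in> G"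
  then have "k * k * f l \<noteq> - h l" by (rule l(2))
  moreover have "k * k * (q * f l) - - q * h l = q * (k * k * f l + h l)" by (simp add: algebra_simps)
  ultimately show "k * k * m12 (word1 (dg (\<mu> ^ l)) B) \<noteq> m12 (word2 (dg (\<mu> ^ l)) B)"
   unfolding w using nz(2) by (metis add.inverse_inverse add_eq_0_iff eq_iff_diff_eq_0 mult_eq_0_iff)
 qed
qed

end

section \<open>Loops around the punctures\<close>

text \<open>The circle of radius 1/2 in a punctured disc, parametrized over the whole line so that
  its multiples are rescalings. The summand 0 matches the form of
  \<open>winding_number_exp_line\<close>.\<close>

definition core_line :: "(complex \<Rightarrow> 'a) \<Rightarrow> real \<Rightarrow> 'a" where
 "core_line \<phi> t = \<phi> (0 + exp (of_real (ln (1 / 2)) + of_real t * (2 * of_real pi * \<i>)))"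

lemma core_line_period: "core_line \<phi> (t + of_int j) = core_line \<phi> t"
proof -
 have "exp (of_int j * (2 * of_real pi * \<i>)) = 1" using exp_integer_2pi[of "of_int j"] by (simp add: mult_ac)
 then show ?thesis by (simp add: core_line_def exp_add distrib_right del: exp_of_real)
qed

lemma core_line_norm: "norm (exp (complex_of_real (ln (1 / 2)) + of_real t * (2 * of_real pi * \<i>))) = 1 / 2" by (simp add: norm_exp_eq_Re)

text \<open>Being connected, the loop stays in one of the disjoint discs, where its winding number
  around the puncture determines its class.\<close>

lemma loop_in_punctured_discs:
 fixes \<phi> :: "nat \<Rightarrow> complex \<Rightarrow> 'a::topological_space"
 assumes o: "\<And>i. i < m \<Longrightarrow> openin (top_of_set F) (\<phi> i ` (ball 0 1 - {0}))"
  and h: "\<And>i. i < m \<Longrightarrow> \<exists>\<psi>. homeomorphism (cball 0 1 - {0}) (\<phi> i ` (cball 0 1 - {0})) (\<phi> i) \<psi>"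
  and disj: "\<And>i j. i < m \<Longrightarrow> j < m \<Longrightarrow> i \<noteq> j \<Longrightarrow> \<phi> i ` (cball 0 1 - {0}) \<inter> \<phi> j ` (cball 0 1 - {0}) = {}"
  and g: "path \<gamma>" "pathfinish \<gamma> = pathstart \<gamma>" "path_image \<gamma> \<subseteq> (\<Union>i<m. \<phi> i ` (ball 0 1 - {0}))"
 obtains i j where "i < m" "homotopic_loops F \<gamma> (\<lambda>t. core_line (\<phi> i) (of_int j * t))"
proof -
 let ?U = "\<lambda>i. \<phi> i ` (ball 0 1 - {0})" and ?P = "path_image \<gamma>"
 have UF: "?U i \<subseteq> F" if "i < m" for i using openin_imp_subset[OF o[OF that]] .
 have sub: "?U i \<subseteq> \<phi> i ` (cball 0 1 - {0})" for i by auto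
 have "pathstart \<gamma> \<in> ?P" by (rule pathstart_in_path_image)
 then obtain i where i: "i < m" "pathstart \<gamma> \<in> ?U i" using g(3) by blast
 have PU: "?P \<subseteq> ?U i"
 proof (rule ccontr)
  assume n: "\<not> ?P \<subseteq> ?U i"
  let ?V = "\<Union>j\<in>{..<m} - {i}. ?U j"
  have PF: "?P \<subseteq> F" using g(3) UF by blast
  have rel: "openin (top_of_set ?P) (?P \<inter> W)" if "openin (top_of_set F) W" for W using that PF unfolding openin_open by (metis inf.absorb_iff1 inf_assoc)
  define E1 E2 where "E1 = ?P \<inter> ?U i" and "E2 = ?P \<inter> ?V"
  have "openin (top_of_set ?P) E1" unfolding E1_def using rel[OF o[OF i(1)]] .
  moreover have "openin (top_of_set ?P) E2" unfolding E2_def using o by (intro rel openin_clauses(3)) auto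
  moreover have cov: "?P \<subseteq> E1 \<union> E2"
  proof
   fix x assume x: "x \<in> ?P"
   then obtain j where "j < m" "x \<in> ?U j" using g(3) by blast
   then show "x \<in> E1 \<union> E2" using x by (cases "j = i") (auto simp: E1_def E2_def)
  qed
  moreover have "E1 \<inter> E2 = {}"
  proof -
   have "?U i \<inter> ?U j = {}" if "j \<in> {..<m} - {i}" for j using disj[OF i(1), of j] that sub[of i] sub[of j] by blast
   then show ?thesis unfolding E1_def E2_def by blast
  qed
  moreover have "E1 \<noteq> {}" unfolding E1_def using i(2) pathstart_in_path_image by blast
  moreover obtain x where "x \<in> ?P" "x \<notin> ?U i" using n by blast
  then have "E2 \<noteq> {}" using cov unfolding E1_def by blast
  ultimately show False using connected_path_image[OF g(1)] unfolding connected_openin by blast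
 qed
 obtain \<psi> where hm: "homeomorphism (cball 0 1 - {0}) (\<phi> i ` (cball 0 1 - {0})) (\<phi> i) \<psi>" using h[OF i(1)] by blast
 have Pc: "?P \<subseteq> \<phi> i ` (cball 0 1 - {0})" using PU sub by blast
 have pd: "path (\<psi> o \<gamma>)" using g(1) continuous_on_subset[OF homeomorphism_cont2[OF hm] Pc] by (rule path_continuous_image)
 have "\<psi> x \<in> ball 0 1 - {0} \<and> \<phi> i (\<psi> x) = x" if x: "x \<in> ?P" for x
 proof -
  obtain v where v: "v \<in> ball 0 1 - {0}" "x = \<phi> i v" using PU x by blast
  then have "\<psi> x = v" using homeomorphism_apply1[OF hm, of v] by auto
  then show ?thesis using v by simp
 qed
 then have \<psi>: "path_image (\<psi> o \<gamma>) \<subseteq> ball 0 1 - {0}" "\<And>t. t \<in> {0..1} \<Longrightarrow> (\<phi> i o (\<psi> o \<gamma>)) t = \<gamma> t"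
  by (auto simp: path_image_def)
 have cl: "pathfinish (\<psi> o \<gamma>) = pathstart (\<psi> o \<gamma>)" using g(2) by (simp add: pathfinish_compose pathstart_compose)
 have "winding_number (\<psi> o \<gamma>) 0 \<in> \<int>" using integer_winding_number[OF pd cl] \<psi>(1) by blast
 then obtain j :: int where j: "winding_number (\<psi> o \<gamma>) 0 = of_int j" by (auto elim: Ints_cases)
 let ?e = "\<lambda>t::real. 0 + exp (of_real (ln (1 / 2)) + of_real t * (2 * of_real pi * \<i> * of_int j))"
 have es: "?e t = exp (of_real (ln (1 / 2)) + of_real (of_int j * t) * (2 * of_real pi * \<i>))" for t by (simp add: mult_ac)
 have "homotopic_loops (ball 0 1 - {0}) (\<psi> o \<gamma>) ?e"
 proof (rule homotopic_loops_punctured_ball[OF pd cl \<psi>(1)])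
  show "path ?e" unfolding path_def by (intro continuous_intros)
  show "pathfinish ?e = pathstart ?e" using exp_integer_2pi[of "of_int j"] by (simp add: pathfinish_def pathstart_def exp_add mult_ac)
  show "path_image ?e \<subseteq> ball 0 1 - {0}"
  proof
   fix v assume "v \<in> path_image ?e"
   then obtain t where "v = ?e t" by (auto simp: path_image_def)
   then have "norm v = 1 / 2" using core_line_norm unfolding es by simp
   then show "v \<in> ball 0 1 - {0}" by auto
  qed
  show "winding_number (\<psi> o \<gamma>) 0 = winding_number ?e 0" unfolding j by (rule winding_number_exp_line[symmetric])
 qed
 then have "homotopic_loops F (\<phi> i o (\<psi> o \<gamma>)) (\<phi> i o ?e)"
 proof (rule homotopic_loops_continuous_image)
  show "continuous_on (ball 0 1 - {0}) (\<phi> i)" using homeomorphism_cont1[OF hm] by (rule continuous_on_subset) auto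
  show "\<phi> i \<in> ball 0 1 - {0} \<rightarrow> F" using UF[OF i(1)] by auto
 qed
 moreover have "\<phi> i o ?e = (\<lambda>t. core_line (\<phi> i) (of_int j * t))" unfolding o_def es core_line_def by simp
 moreover have "homotopic_loops F \<gamma> (\<phi> i o (\<psi> o \<gamma>))" using g PU UF[OF i(1)] \<psi>(2) by (intro homotopic_loops_eq) auto
 ultimately show ?thesis using that i(1) homotopic_loops_trans by metis
qed

section \<open>Holonomy of periodic curves; curves in minimal position\<close>

context hyp_metric
begin

text \<open>All multiples are read off from one lift of the line, on which translation by an integer
  is a deck transformation. \<open>S\<close> belongs to a single period; it commutes with the
  others, and they are trivial if it is. So one matrix per puncture controls all multiples.\<close>

lemma periodic_holonomy:
 assumes E: "continuous_on UNIV E" "range E \<subseteq> F" "\<And>t j. E (t + of_int j) = E t"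
 obtains S where "S \<in> deck" "\<And>j. \<exists>T. hol (\<lambda>t. E (of_int j * t)) T \<and> T o S = S o T \<and> (S = id \<longrightarrow> T = id)"
proof -
 obtain k where k: "continuous_on UNIV k" "range k \<subseteq> X" "\<And>t. pr (k t) = E t" by (rule lift_line[OF E(1,2)]) (rule that; assumption)
 have kX: "k t \<in> X" for t using k(2) by blast
 have tr: "\<exists>T\<in>deck. \<forall>t. T (k t) = k (t + of_int j)" for j
 proof -
  have "pr (k 0) = pr (k (of_int j))" unfolding k(3) using E(3)[of 0 j] by simp
  then obtain T where T: "T \<in> deck" "T (k 0) = k (of_int j)" using deck_transitive kX by blast
  have "T (k t) = k (t + of_int j)" for t
  proof (rule lift_unique_gen[of "UNIV :: real set" "\<lambda>t. T (k t)" "\<lambda>t. k (t + of_int j)" 0 t])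
   show "continuous_on UNIV (\<lambda>t. T (k t))" using k(1,2) X_sub_upper by (intro continuous_on_compose2[OF continuous_on_isom[OF deck_isoms[OF T(1)]]]) auto
   show "continuous_on UNIV (\<lambda>t. k (t + of_int j))" by (intro continuous_on_compose2[OF k(1)] continuous_intros) auto
   show "pr (T (k t)) = pr (k (t + of_int j))" for t using deck_pr[OF T(1) kX] k(3) E(3) by simp
  qed (use T deck_X[OF T(1) kX] kX in auto)
  then show ?thesis using T(1) by blast
 qed
 then obtain T where T: "\<And>j. T j \<in> deck" "\<And>j t. T j (k t) = k (t + of_int j)" by metis
 have "\<exists>T'. hol (\<lambda>t. E (of_int j * t)) T' \<and> T' o T 1 = T 1 o T' \<and> (T 1 = id \<longrightarrow> T' = id)" for j
 proof (intro exI[of _ "T j"] conjI impI)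
  have "is_lift (\<lambda>t. k (of_int j * t)) (\<lambda>t. E (of_int j * t))" unfolding is_lift_def path_def path_image_def using k kX
   by (auto intro!: continuous_on_compose2[OF k(1)] continuous_intros)
  moreover have "pathfinish (\<lambda>t. k (of_int j * t)) = T j (pathstart (\<lambda>t. k (of_int j * t)))" using T(2)[of j 0] by (simp add: pathfinish_def pathstart_def)
  ultimately show "hol (\<lambda>t. E (of_int j * t)) (T j)" using T(1) unfolding hol_def by blast
  have "(T j o T 1) (k 0) = (T 1 o T j) (k 0)" using T(2) by (simp add: add.commute)
  then show "T j o T 1 = T 1 o T j" using deck_eq[OF deck_comp[OF T(1) T(1)] deck_comp[OF T(1) T(1)] kX[of 0]] by blast
  assume "T 1 = id"
  then have p1: "k (t + 1) = k t" for t using T(2)[of 1 t] by simp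
  have "k (of_int j) = k 0"
  proof (induction j rule: int_induct[of _ 0])
   case (step1 i)
   then show ?case using p1[of "of_int i"] by simp
  next
   case (step2 i)
   then show ?case using p1[of "of_int i - 1"] by simp
  qed simp
  then have "T j (k 0) = k 0" using T(2)[of j 0] by simp
  then show "T j = id" using deck_free[OF T(1) kX] by blast
 qed
 then show ?thesis using that[OF T(1)[of 1]] by blast
qed

text \<open>An accumulation point of parameter pairs is again an intersection, and the axes of the
  transversal chart meet only at the origin. Finiteness matters because \<open>card\<close> is 0 for
  infinite sets.\<close>

lemma finite_intersection:
 assumes a: "closed_curve F \<alpha>" and b: "closed_curve F \<beta>" and tr: "transversal_double_points F \<alpha> \<beta>"
 shows "finite (intersection_points \<alpha> \<beta>)"
proof -
 define Z where "Z = {x \<in> {0..1} \<times> {0..1}. \<alpha> (fst x) = \<beta> (snd x)}"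
 have I: "intersection_points \<alpha> \<beta> = (\<lambda>x. \<alpha> (fst x)) ` Z" by (force simp: intersection_points_def path_image_def Z_def)
 have F: "\<alpha> t \<in> F" "\<beta> t \<in> F" if "t \<in> {0..1}" for t using a b that by (auto simp: closed_curve_def path_image_def)
 have pa: "path (emb o \<alpha>)" "path (emb o \<beta>)" using path_emb a b by (auto simp: closed_curve_def)
 have Ze: "Z = {x \<in> {0..1} \<times> {0..1}. (emb o \<alpha>) (fst x) = (emb o \<beta>) (snd x)}" using emb_inj F by (auto simp: Z_def)
 have "finite Z"
 proof (rule ccontr)
  assume "infinite Z"
  moreover have "Z \<subseteq> {0..1} \<times> {0..1}" by (auto simp: Z_def)
  moreover have "compact ({0..1} \<times> {0..1} :: (real \<times> real) set)" by (intro compact_Times compact_Icc)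
  ultimately obtain x where x: "x \<in> {0..1} \<times> {0..1}" "x islimpt Z" unfolding compact_eq_Bolzano_Weierstrass by blast
  have "closed (({0..1} \<times> {0..1}) \<inter> (\<lambda>x. emb (\<alpha> (fst x)) - emb (\<beta> (snd x))) -` {0})"
  proof (rule continuous_closed_preimage)
   show "continuous_on ({0..1} \<times> {0..1}) (\<lambda>x. emb (\<alpha> (fst x)) - emb (\<beta> (snd x)))"
   proof (rule continuous_on_diff)
    have "continuous_on ({0..1} \<times> {0..1}) (\<lambda>x. (emb o \<alpha>) (fst x))"
     by (rule continuous_on_compose2[OF pa(1)[unfolded path_def]]) (auto intro: continuous_intros)
    then show "continuous_on ({0..1} \<times> {0..1}) (\<lambda>x. emb (\<alpha> (fst x)))" by simp
    have "continuous_on ({0..1} \<times> {0..1}) (\<lambda>x. (emb o \<beta>) (snd x))"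
     by (rule continuous_on_compose2[OF pa(2)[unfolded path_def]]) (auto intro: continuous_intros)
    then show "continuous_on ({0..1} \<times> {0..1}) (\<lambda>x. emb (\<beta> (snd x)))" by simp
   qed
  qed (auto intro: closed_Times)
  moreover have "({0..1} \<times> {0..1}) \<inter> (\<lambda>x. emb (\<alpha> (fst x)) - emb (\<beta> (snd x))) -` {0} = Z" unfolding Ze by auto
  ultimately have "closed Z" by simp
  then have xZ: "x \<in> Z" using x(2) closed_limpt by blast
  obtain s t where st: "x = (s, t)" "s \<in> {0..1}" "t \<in> {0..1}" "\<alpha> s = \<beta> t" using xZ by (cases x) (auto simp: Z_def)
  have per: "\<gamma> (frac u) = \<gamma> u" if "u \<in> {0..1}" "closed_curve F \<gamma>" for u and \<gamma> :: "real \<Rightarrow> 'a"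
  proof (cases "u = 1")
   case False
   then have "frac u = u" using that(1) frac_eq[of u] by simp
   then show ?thesis by simp
  qed (use that in \<open>simp add: closed_curve_def pathfinish_def pathstart_def\<close>)
  note fr = per[OF st(2) a] per[OF st(3) b]
  have "frac s \<in> {0..<1}" "frac t \<in> {0..<1}" by (auto simp: frac_lt_1)
  then have "transversal_at F \<alpha> (frac s) \<beta> (frac t)" using tr fr st(4) unfolding transversal_double_points_def by metis
  then obtain U \<phi> r where e: "0 < r" and U: "\<And>u. abs u < r \<Longrightarrow> \<phi> (\<alpha> (frac (frac s + u))) = of_real u \<and> \<phi> (\<beta> (frac (frac t + u))) = \<i> * of_real u"
   unfolding transversal_at_def by blast
  have "0 < min r 1" using e by simp
  then obtain y where y: "y \<in> Z" "y \<noteq> x" "dist y x < min r 1" using x(2) unfolding islimpt_approachable by blast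
  obtain s' t' where st': "y = (s', t')" "s' \<in> {0..1}" "t' \<in> {0..1}" "\<alpha> s' = \<beta> t'" using y(1) by (cases y) (auto simp: Z_def)
  have ds: "abs (s' - s) < r" "abs (t' - t) < r" "abs (s' - s) < 1" "abs (t' - t) < 1" using y(3) dist_fst_le[of y x] dist_snd_le[of y x] by (auto simp: st(1) st'(1) dist_real_def)
  have sh: "\<gamma> (frac (frac u + (u' - u))) = \<gamma> u'"
   if "u \<in> {0..1}" "u' \<in> {0..1}" "abs (u' - u) < 1" "closed_curve F \<gamma>" for u u' :: real and \<gamma> :: "real \<Rightarrow> 'a"
  proof -
   have "frac u + (u' - u) = u' - of_int \<lfloor>u\<rfloor>" by (simp add: frac_def)
   then have "frac (frac u + (u' - u)) = frac u'" by (simp add: frac_def)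
   then show ?thesis using per[OF that(2,4)] by simp
  qed
  have "\<phi> (\<alpha> s') = of_real (s' - s)" "\<phi> (\<beta> t') = \<i> * of_real (t' - t)"
   using U[OF ds(1)] U[OF ds(2)] sh[OF st(2) st'(2) ds(3) a] sh[OF st(3) st'(3) ds(4) b] by simp_all
  then have "complex_of_real (s' - s) = \<i> * of_real (t' - t)" using st'(4) by simp
  then have "s' = s" "t' = t" by (simp_all add: complex_eq_iff)
  then show False using y(2) st(1) st'(1) by simp
 qed
 then show ?thesis unfolding I by simp
qed

text \<open>Disjoint curves are vacuously transversal, so they would compete in the minimality
  condition with 0 intersections against at least one.\<close>

lemma not_disjoint:
 assumes "closed_curve F \<alpha>" "closed_curve F \<beta>" "transversal_double_points F \<alpha> \<beta>" "intersect_minimally F \<alpha> \<beta>"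
  and P: "P \<in> intersection_points \<alpha> \<beta>"
  and h: "homotopic_loops F \<alpha> \<alpha>'" "homotopic_loops F \<beta> \<beta>'"
 shows "path_image \<alpha>' \<inter> path_image \<beta>' \<noteq> {}"
proof
 assume dis: "path_image \<alpha>' \<inter> path_image \<beta>' = {}"
 have "closed_curve F \<alpha>'" "closed_curve F \<beta>'" unfolding closed_curve_def
  using homotopic_loops_imp_path[OF h(1)] homotopic_loops_imp_subset[OF h(1)] homotopic_loops_imp_loop[OF h(1)]
   homotopic_loops_imp_path[OF h(2)] homotopic_loops_imp_subset[OF h(2)] homotopic_loops_imp_loop[OF h(2)] by simp_all
 moreover have "transversal_double_points F \<alpha>' \<beta>'" using dis unfolding transversal_double_points_def path_image_def by fastforce
 ultimately have "card (intersection_points \<alpha> \<beta>) \<le> card (intersection_points \<alpha>' \<beta>')" using assms(4) h unfolding intersect_minimally_def by blast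
 moreover have "intersection_points \<alpha>' \<beta>' = {}" using dis by (simp add: intersection_points_def)
 ultimately show False using finite_intersection[OF assms(1-3)] P by auto
qed

text \<open>If one curve were contained in the other, its image would consist of intersection
  points, hence be finite; but the transversal chart shows it to be infinite. The points found here
  are those to which an inessential curve is contracted.\<close>

lemma off_points:
 assumes "closed_curve F \<alpha>" "closed_curve F \<beta>" "transversal_double_points F \<alpha> \<beta>"
  and P: "P \<in> intersection_points \<alpha> \<beta>"
 shows "\<exists>x\<in>path_image \<alpha>. x \<notin> path_image \<beta>" "\<exists>x\<in>path_image \<beta>. x \<notin> path_image \<alpha>"
proof -
 have pt: "\<exists>s\<in>{0..<1}. \<gamma> s = P" if g: "closed_curve F \<gamma>" "P \<in> path_image \<gamma>" for \<gamma>
 proof -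
  obtain s where s: "s \<in> {0..1}" "\<gamma> s = P" using g(2) by (auto simp: path_image_def)
  then show ?thesis using g(1) by (cases "s = 1") (auto simp: closed_curve_def pathfinish_def pathstart_def intro: bexI[of _ 0] bexI[of _ s])
 qed
 obtain s t where st: "s \<in> {0..<1}" "t \<in> {0..<1}" "\<alpha> s = P" "\<beta> t = P" using pt[OF assms(1)] pt[OF assms(2)] P by (auto simp: intersection_points_def)
 then have "transversal_at F \<alpha> s \<beta> t" using assms(3) unfolding transversal_double_points_def by metis
 then obtain U \<phi> r where e: "0 < r" and U: "\<And>u. abs u < r \<Longrightarrow> \<phi> (\<alpha> (frac (s + u))) = of_real u \<and> \<phi> (\<beta> (frac (t + u))) = \<i> * of_real u"
  unfolding transversal_at_def by blast
 have inf: "infinite (path_image \<gamma>)" if "\<And>u. abs u < r \<Longrightarrow> \<phi> (\<gamma> (frac (q + u))) = c * of_real u" "c \<noteq> 0" for \<gamma> q and c :: complex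
 proof
  assume fin: "finite (path_image \<gamma>)"
  have "frac x \<in> {0..1}" for x :: real using frac_lt_1[of x] by auto
  then have "(\<lambda>u. \<gamma> (frac (q + u))) ` {-r<..<r} \<subseteq> path_image \<gamma>" unfolding path_image_def by blast
  then have "finite ((\<lambda>u. \<gamma> (frac (q + u))) ` {-r<..<r})" using fin finite_subset by blast
  moreover have "inj_on (\<lambda>u. \<gamma> (frac (q + u))) {-r<..<r}"
  proof (rule inj_onI)
   fix u u' assume "u \<in> {-r<..<r}" "u' \<in> {-r<..<r}" "\<gamma> (frac (q + u)) = \<gamma> (frac (q + u'))"
   then have "c * of_real u = c * of_real u'" using that(1)[of u] that(1)[of u'] by (auto simp: abs_less_iff)
   then show "u = u'" using that(2) by simp
  qed
  ultimately have "finite {-r<..<r}" by (rule finite_imageD)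
  then show False using e infinite_Ioo[of "-r" r] by simp
 qed
 note fin = finite_intersection[OF assms(1-3)]
 have "infinite (path_image \<alpha>)" using inf[of \<alpha> s 1] U by simp
 then have "\<not> path_image \<alpha> \<subseteq> path_image \<beta>" using fin unfolding intersection_points_def by (metis inf.absorb1)
 then show "\<exists>x\<in>path_image \<alpha>. x \<notin> path_image \<beta>" by blast
 have "infinite (path_image \<beta>)" using inf[of \<beta> t \<i>] U by simp
 then have "\<not> path_image \<beta> \<subseteq> path_image \<alpha>" using fin unfolding intersection_points_def by (metis inf.absorb2)
 then show "\<exists>x\<in>path_image \<beta>. x \<notin> path_image \<alpha>" by blast
qed

lemma null_loop:
 assumes "hol g id" "x \<in> F"
 shows "\<exists>g'. homotopic_loops F g g' \<and> path_image g' = {x}"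
proof -
 obtain z where z: "z \<in> X" "pr z = x" using pr_surj assms(2) by (metis imageE)
 have "homotopic_loops F g (pr o linepath z z)" using z(1) by (intro hol_homotopicI[OF assms(1)]) auto
 moreover have "path_image (pr o linepath z z) = {x}" using z(2) by (simp add: path_image_compose)
 ultimately show ?thesis by blast
qed

end

text \<open>A curve with trivial holonomy can be contracted to a point off the other curve, and a
  parabolic \<open>alpha\<close> can be pushed along high horocycles off the compact image of
  \<open>beta\<close>.\<close>

lemma (in oriented_hyp) essential:
 assumes c: "closed_curve F \<alpha>" "closed_curve F \<beta>" "transversal_double_points F \<alpha> \<beta>" "intersect_minimally F \<alpha> \<beta>"
  and P: "P \<in> intersection_points \<alpha> \<beta>"
 shows "hol \<beta> T \<Longrightarrow> T \<noteq> id" and "hol \<alpha> (act M) \<Longrightarrow> det2 M = 1 \<Longrightarrow> 2 < abs (tr2 M)"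
proof -
 have refl: "homotopic_loops F \<alpha> \<alpha>" "homotopic_loops F \<beta> \<beta>" using c by (auto simp: closed_curve_def homotopic_loops_refl)
 note nd = not_disjoint[OF c P]
 note off = off_points[OF c(1-3) P]
 show "T \<noteq> id" if T: "hol \<beta> T"
 proof
  assume "T = id"
  obtain x where x: "x \<in> path_image \<alpha>" "x \<notin> path_image \<beta>" using off(1) by blast
  obtain x' where x': "x' \<in> path_image \<beta>" "x' \<notin> path_image \<alpha>" using off(2) by blast
  then have "x' \<in> F" using c(2) by (auto simp: closed_curve_def)
  then obtain \<beta>' where "homotopic_loops F \<beta> \<beta>'" "path_image \<beta>' = {x'}" using null_loop T \<open>T = id\<close> by blast
  then show False using nd[OF refl(1), of \<beta>'] x' by auto
 qed
 assume T: "hol \<alpha> (act M)" "det2 M = 1"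
 have TD: "act M \<in> deck" by (rule hol_deck[OF T(1)])
 have ne: "act M \<noteq> id"
 proof
  assume "act M = id"
  obtain x where x: "x \<in> path_image \<alpha>" "x \<notin> path_image \<beta>" using off(1) by blast
  then have "x \<in> F" using c(1) by (auto simp: closed_curve_def)
  then obtain \<alpha>' where "homotopic_loops F \<alpha> \<alpha>'" "path_image \<alpha>' = {x}" using null_loop T \<open>act M = id\<close> by metis
  then show False using nd[OF _ refl(2), of \<alpha>'] x by auto
 qed
 show "2 < abs (tr2 M)"
 proof (rule ccontr)
  assume "\<not> 2 < abs (tr2 M)"
  then have par: "abs (tr2 M) = 2" using deck_trace[OF TD T(2) ne] by simp
  have K: "compact (path_image \<beta>)" "path_image \<beta> \<subseteq> F" using c(2) by (auto simp: closed_curve_def compact_path_image)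
  obtain k where k: "path k" "path_image k \<subseteq> X" "pathfinish k = act M (pathstart k)" "pr ` path_image k \<inter> path_image \<beta> = {}"
   using parabolic_escape[OF TD T(2) par ne K] by blast
  have "homotopic_loops F \<alpha> (pr o k)" by (rule hol_homotopicI[OF T(1) k(1-3)])
  from nd[OF this refl(2)] show False using k(4) by (simp add: path_image_compose)
 qed
qed

text \<open>The conclusion is purely topological, with discs fixed in advance. It can therefore be
  derived in one metric and exploited in another.\<close>

lemma (in oriented_hyp) parabolic_core:
 fixes \<phi> :: "nat \<Rightarrow> complex \<Rightarrow> 'a"
 assumes o: "\<And>i. i < m \<Longrightarrow> openin (top_of_set F) (\<phi> i ` (ball 0 1 - {0}))"
  and h: "\<And>i. i < m \<Longrightarrow> \<exists>\<psi>. homeomorphism (cball 0 1 - {0}) (\<phi> i ` (cball 0 1 - {0})) (\<phi> i) \<psi>"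
  and disj: "\<And>i j. i < m \<Longrightarrow> j < m \<Longrightarrow> i \<noteq> j \<Longrightarrow> \<phi> i ` (cball 0 1 - {0}) \<inter> \<phi> j ` (cball 0 1 - {0}) = {}"
  and K: "compact (F - (\<Union>i<m. \<phi> i ` (ball 0 1 - {0})))"
  and g: "hol g (act M)" "det2 M = 1" "abs (tr2 M) = 2" "act M \<noteq> id"
 shows "\<exists>i<m. \<exists>j. homotopic_loops F g (\<lambda>t. core_line (\<phi> i) (of_int j * t))"
proof -
 have TD: "act M \<in> deck" by (rule hol_deck[OF g(1)])
 obtain k where k: "path k" "path_image k \<subseteq> X" "pathfinish k = act M (pathstart k)"
   "pr ` path_image k \<inter> (F - (\<Union>i<m. \<phi> i ` (ball 0 1 - {0}))) = {}" using parabolic_escape[OF TD g(2-4) K] by blast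
 have gk: "homotopic_loops F g (pr o k)" by (rule hol_homotopicI[OF g(1) k(1-3)])
 note pk = pr_lift_path[OF k(1,2)]
 have cl: "pathfinish (pr o k) = pathstart (pr o k)" using homotopic_loops_imp_loop[OF gk] by simp
 have p1: "path (pr o k)" using pk by simp
 have p2: "path_image (pr o k) \<subseteq> (\<Union>i<m. \<phi> i ` (ball 0 1 - {0}))" using pk k(4) unfolding path_image_compose by blast
 obtain i j where ij: "i < m" "homotopic_loops F (pr o k) (\<lambda>t. core_line (\<phi> i) (of_int j * t))"
  by (rule loop_in_punctured_discs[OF o h disj p1 cl p2]) (assumption | (rule that; assumption))+
 show ?thesis by (intro exI[of _ i] exI[of _ j] conjI ij(1) homotopic_loops_trans[OF gk ij(2)])
qed

section \<open>Matrices of group elements\<close>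

lemma act_eq_id:
 assumes M: "det2 M = 1" "act M = id"
 shows "M = 1 \<or> M = - 1"
proof -
 obtain a b c e where Me: "M = Mat a b c e" by (cases M) auto
 have h: "hp (Complex 0 y) = 1 / y" "hq (Complex 0 y) = 0" "hr (Complex 0 y) = y" if "0 < y" for y using that by (simp_all add: hp_def hq_def hr_def power2_eq_square)
 have p: "c\<^sup>2 * y + e\<^sup>2 / y = 1 / y" "a * c * y + b * e / y = 0" if "0 < y" for y using act_h(2,3)[of "Complex 0 y" M] M that by (simp_all add: h[OF that] Me)
 have "c\<^sup>2 + e\<^sup>2 = 1" "4 * c\<^sup>2 + e\<^sup>2 = 1" using p(1)[of 1] p(1)[of 2] by simp_all
 then have "c\<^sup>2 = 0" "e\<^sup>2 = 1" by linarith+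
 then have ce: "c = 0" "e = 1 \<or> e = - 1" by (simp_all add: power2_eq_1_iff)
 then have "b = 0" using p(2)[of 1] by auto
 moreover have "a * e = 1" using M(1) ce by (simp add: Me det2_def)
 ultimately show ?thesis using ce by (auto simp: Me mat2_eq_iff)
qed

lemma inv2_mult: "det2 M = 1 \<Longrightarrow> det2 N = 1 \<Longrightarrow> inv2 (M * N) = inv2 N * inv2 M" by (simp add: inv2_det1 mat2_eq_iff)

lemma det2_inv2_1: "det2 M = 1 \<Longrightarrow> det2 (inv2 M) = 1" by (simp add: det2_inv2)

lemma det2_power: "det2 M = 1 \<Longrightarrow> det2 (M ^ n) = 1" by (induction n) simp_all

lemma act_comp: "det2 M = 1 \<Longrightarrow> det2 N = 1 \<Longrightarrow> act (M * N) = act M o act N" by (auto simp: act_mult)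

lemma act_eqD:
 assumes d: "det2 M = 1" "det2 N = 1" and "act M = act N"
 shows "M = N \<or> M = - N"
proof -
 have "act (inv2 N * M) = id" using assms by (simp add: act_comp det2_inv2_1 fun_eq_iff)
 then have "inv2 N * M = 1 \<or> inv2 N * M = - 1" using d by (intro act_eq_id) (simp_all add: det2_inv2_1)
 moreover have "M = N * (inv2 N * M)" using inv2_right[of N] d by (simp add: mult.assoc[symmetric])
 ultimately show ?thesis by (metis mult_1_right mult_minus_right)
qed

text \<open>Cayley-Hamilton: every power is \<open>v + u * A\<close> with numbers \<open>u\<close>
  and \<open>v\<close>.\<close>

lemma power_linear:
 assumes "det2 A = 1"
 shows "\<exists>u v. A ^ n = Mat (v + u * m11 A) (u * m12 A) (u * m21 A) (v + u * m22 A)"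
proof (induction n)
 case 0
 show ?case by (rule exI[of _ 0], rule exI[of _ 1]) (simp add: mat2_eq_iff)
next
 case (Suc n)
 then obtain u v where A: "A ^ n = Mat (v + u * m11 A) (u * m12 A) (u * m21 A) (v + u * m22 A)" by blast
 have "A ^ Suc n = Mat (- u + (v + u * tr2 A) * m11 A) ((v + u * tr2 A) * m12 A) ((v + u * tr2 A) * m21 A) (- u + (v + u * tr2 A) * m22 A)"
  using assms unfolding power_Suc A mat2_eq_iff det2_def tr2_def by (simp add: algebra_simps)
 then show ?case by blast
qed

text \<open>Unless \<open>Q = A^l\<close> is scalar, \<open>A^n\<close> is a linear combination of 1
  and \<open>Q\<close>. So it suffices to compare the traces of the words themselves and of their
  products with \<open>Q\<close>, which is a direct computation.\<close>

lemma trace_words: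
 assumes A: "det2 A = 1" and B: "det2 B = 1"
 shows "tr2 (A ^ n * word1 (A ^ l) B) = tr2 (A ^ n * word2 (A ^ l) B)"
proof -
 obtain u v where P: "A ^ n = Mat (v + u * m11 A) (u * m12 A) (u * m21 A) (v + u * m22 A)" using power_linear[OF A] by blast
 obtain w z where Q: "A ^ l = Mat (z + w * m11 A) (w * m12 A) (w * m21 A) (z + w * m22 A)" using power_linear[OF A] by blast
 define Q where "Q = A ^ l"
 have dQ: "det2 Q = 1" using det2_power[OF A] by (simp add: Q_def)
 obtain a b c e where Qe: "Q = Mat a b c e" by (cases Q) auto
 obtain p q r s where Be: "B = Mat p q r s" by (cases B) auto
 have i: "inv2 Q = Mat e (- b) (- c) a" "inv2 B = Mat s (- q) (- r) p" using inv2_det1[OF dQ] inv2_det1[OF B] by (simp_all add: Qe Be)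
 have t: "tr2 (word1 Q B) = tr2 (word2 Q B)" "tr2 (Q * word1 Q B) = tr2 (Q * word2 Q B)" unfolding word1_def word2_def i unfolding Qe Be tr2_def by (simp_all add: algebra_simps)
 show ?thesis
 proof (cases "w = 0")
  \<comment> \<open>Here \<open>Q\<close> is 1 or -1 and both words collapse to
    \<open>B\<close>.\<close>
  case True
  then have "Q = Mat z 0 0 z" using Q by (simp add: Q_def)
  moreover from this have "z * z = 1" using dQ by (simp add: det2_def)
  then have "z = 1 \<or> z = - 1" by (metis power2_eq_1_iff power2_eq_square)
  ultimately have "Q = 1 \<or> Q = - 1" by (auto simp: mat2_eq_iff)
  moreover have "inv2 1 = 1" "inv2 (- 1) = - 1" by (simp_all add: inv2_det1 mat2_eq_iff)
  moreover have "inv2 B * (B * W) = W" for W using inv2_left[of B] B by (simp add: mult.assoc[symmetric])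
  ultimately have "word1 Q B = B" "word2 Q B = B" using inv2_left[of B] inv2_right[of B] B by (auto simp: word1_def word2_def mult.assoc)
  then show ?thesis by (simp add: Q_def)
 next
  case False
  define y x where "y = u / w" and "x = v - z * (u / w)"
  have Pq: "A ^ n = Mat (x + y * m11 Q) (y * m12 Q) (y * m21 Q) (x + y * m22 Q)" using False unfolding P Q_def Q by (simp add: mat2_eq_iff x_def y_def field_simps)
  have "tr2 (A ^ n * W) = x * tr2 W + y * tr2 (Q * W)" for W unfolding Pq tr2_def by (simp add: algebra_simps)
  then show ?thesis using t by (simp add: Q_def)
 qed
qed

text \<open>Change of coordinates: \<open>N\<close> will move the axis of \<open>a\<close> to the
  imaginary axis, and \<open>cj\<close> leads back to the coordinates of \<open>X\<close>.\<close>

definition cj :: "mat2 \<Rightarrow> mat2 \<Rightarrow> mat2" where "cj N M = inv2 N * M * N"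

lemma cj_simps:
 assumes N: "det2 N = 1"
 shows "det2 (cj N M) = det2 M" "tr2 (cj N M) = tr2 M" "cj N (M * M') = cj N M * cj N M'"
  "cj N 1 = 1" "cj N (- M) = - cj N M" "cj N (N * M * inv2 N) = M" "N * cj N M * inv2 N = M"
proof -
 have i: "inv2 N * N = 1" "N * inv2 N = 1" using inv2_left[of N] inv2_right[of N] N by simp_all
 have i': "N * (inv2 N * W) = W" "inv2 N * (N * W) = W" for W using i by (simp_all add: mult.assoc[symmetric])
 show "det2 (cj N M) = det2 M" using N by (simp add: cj_def det2_inv2_1)
 show "tr2 (cj N M) = tr2 M" unfolding cj_def by (subst tr2_comm) (simp add: i')
 show "cj N (M * M') = cj N M * cj N M'" "cj N 1 = 1" "cj N (- M) = - cj N M"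
  "cj N (N * M * inv2 N) = M" "N * cj N M * inv2 N = M" by (simp_all add: cj_def mult.assoc i i')
qed

lemma cj_inv2: "det2 N = 1 \<Longrightarrow> det2 M = 1 \<Longrightarrow> cj N (inv2 M) = inv2 (cj N M)" by (simp add: cj_def inv2_mult det2_inv2_1 inv2_inv2 mult.assoc)

lemma cj_inj: "det2 N = 1 \<Longrightarrow> cj N M = cj N M' \<Longrightarrow> M = M'" by (metis cj_simps(7))

text \<open>Translates a bound on matrix entries into a bound on the displacement of a point, so
  that metric discreteness gives finiteness of bounded matrices.\<close>

lemma hyp_ch_act_bound:
 assumes u: "0 < Im u" and M: "det2 M = 1" "bounded_mat R M"
 shows "hyp_ch u (act M u) \<le> 4 * R\<^sup>2 * (abs (hp u) + abs (hq u) + abs (hr u))\<^sup>2"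
proof -
 define K where "K = abs (hp u) + abs (hq u) + abs (hr u)"
 obtain a b c e where Me: "M = Mat a b c e" by (cases M) auto
 have e: "abs a \<le> R" "abs b \<le> R" "abs c \<le> R" "abs e \<le> R" using M(2) by (auto simp: bounded_mat_def Me)
 have pr: "abs (x * y * k) \<le> R\<^sup>2 * abs k" if "abs x \<le> R" "abs y \<le> R" for x y k using mult_mono[OF that order_trans[OF abs_ge_zero that(1)] abs_ge_zero]
  by (auto simp: abs_mult power2_eq_square intro!: mult_right_mono)
 have fm: "abs (x * y * hr u + (x * y' + x' * y) * hq u + x' * y' * hp u) \<le> 2 * R\<^sup>2 * K"
  if "abs x \<le> R" "abs y \<le> R" "abs x' \<le> R" "abs y' \<le> R" for x y x' y'
 proof -
  have "x * y * hr u + (x * y' + x' * y) * hq u + x' * y' * hp u = x * y * hr u + x * y' * hq u + x' * y * hq u + x' * y' * hp u" by (simp add: algebra_simps)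
  then have "abs (x * y * hr u + (x * y' + x' * y) * hq u + x' * y' * hp u) \<le> R\<^sup>2 * abs (hr u) + R\<^sup>2 * abs (hq u) + R\<^sup>2 * abs (hq u) + R\<^sup>2 * abs (hp u)"
   using pr[OF that(1,2), of "hr u"] pr[OF that(1,4), of "hq u"] pr[OF that(3,2), of "hq u"] pr[OF that(3,4), of "hp u"] by linarith
  moreover have "0 \<le> R\<^sup>2 * abs (hp u)" "0 \<le> R\<^sup>2 * abs (hr u)" by simp_all
  ultimately show ?thesis unfolding K_def distrib_left by linarith
 qed
 have ad: "abs (det2 M) = 1" using M by simp
 note h = act_h[OF u ad, unfolded Me mat2.sel, folded Me]
 have p: "abs (hp (act M u)) \<le> 2 * R\<^sup>2 * K" "abs (hq (act M u)) \<le> 2 * R\<^sup>2 * K" "abs (hr (act M u)) \<le> 2 * R\<^sup>2 * K"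
  using fm[of c c e e] fm[of a c b e] fm[of a a b b] e unfolding h by (simp_all add: power2_eq_square algebra_simps)
 have m: "abs (x * y) \<le> 2 * (R\<^sup>2 * K * K)" if "abs x \<le> K" "abs y \<le> 2 * R\<^sup>2 * K" for x y using mult_mono[OF that] by (simp add: abs_mult mult_ac K_def)
 have avg: "(P + Q) / 2 - S \<le> 2 * m" if "abs P \<le> m" "abs Q \<le> m" "abs S \<le> m" for P Q S m :: real
  using abs_le_D1[OF that(1)] abs_le_D1[OF that(2)] abs_le_D2[OF that(3)] by (simp add: field_simps)
 have K: "abs (hp u) \<le> K" "abs (hq u) \<le> K" "abs (hr u) \<le> K" by (simp_all add: K_def)
 have "hyp_ch u (act M u) = (hp u * hr (act M u) + hr u * hp (act M u)) / 2 - hq u * hq (act M u)" by (rule hyp_ch_h[OF u h(1)])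
 also have "\<dots> \<le> 2 * (2 * (R\<^sup>2 * K * K))" by (rule avg[OF m[OF K(1) p(3)] m[OF K(3) p(1)] m[OF K(2) p(2)]])
 finally show ?thesis by (simp add: K_def power2_eq_square mult.assoc)
qed

section \<open>The deck group as a discrete group of matrices\<close>

context oriented_hyp
begin

text \<open>The full preimage in SL(2) of the deck group in the coordinates \<open>N\<close>; with
  each matrix it contains the negative one.\<close>

definition deck_group :: "mat2 \<Rightarrow> mat2 set" where
 "deck_group N = {M. det2 M = 1 \<and> act (cj N M) \<in> deck}"

lemma deck_groupI:
 assumes "T \<in> deck" "det2 N = 1"
 obtains M where "M \<in> deck_group N" "T = act (cj N M)"
proof -
 obtain M where M: "det2 M = 1" "T = act M" using deck_matrix[OF assms(1)] .
 have "N * M * inv2 N \<in> deck_group N" "T = act (cj N (N * M * inv2 N))" using assms M by (simp_all add: deck_group_def cj_simps(6) det2_inv2_1)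
 then show ?thesis by (rule that)
qed

lemma deck_group_discrete:
 assumes N: "det2 N = 1" and \<mu>: "1 < \<mu>" "Mat \<mu> 0 0 (1 / \<mu>) \<in> deck_group N"
 shows "discrete_sl2 (deck_group N) \<mu>"
proof
 note cjN = cj_simps[OF N]
 fix M assume M: "M \<in> deck_group N"
 then have d: "det2 M = 1" "det2 (cj N M) = 1" "act (cj N M) \<in> deck" by (simp_all add: deck_group_def cjN)
 show "det2 M = 1" by (rule d)
 show "2 \<le> abs (tr2 M)"
 proof (cases "act (cj N M) = id")
  case True
  then have "cj N M = 1 \<or> cj N M = - 1" by (rule act_eq_id[OF d(2)])
  then have "abs (tr2 (cj N M)) = 2" by (auto simp: tr2_def)
  then show ?thesis by (simp add: cjN)
 qed (use deck_trace[OF d(3,2)] in \<open>simp add: cjN\<close>)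
 have "act (cj N (inv2 M)) = finv (act (cj N M))" using d by (simp add: cj_inv2[OF N] act_inv)
 then show "inv2 M \<in> deck_group N" using d deck_inv by (simp add: deck_group_def det2_inv2_1)
 fix M' assume M': "M' \<in> deck_group N"
 then have "act (cj N (M * M')) = act (cj N M) o act (cj N M')" using d by (simp add: cjN act_comp deck_group_def)
 then show "M * M' \<in> deck_group N" using M' d deck_comp by (simp add: deck_group_def)
next
 note cjN = cj_simps[OF N]
 fix R
 obtain z where z: "z \<in> X" using X_ne by blast
 have zI: "0 < Im z" by (rule X_upper[OF z])
 define u where "u = act N z"
 have u: "0 < Im u" using zI N by (simp add: u_def)
 define B where "B = 4 * R\<^sup>2 * (abs (hp u) + abs (hq u) + abs (hr u))\<^sup>2"
 define r where "r = arcosh (max 1 B)"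
 have r: "0 \<le> r" "B \<le> cosh r" by (simp_all add: r_def)
 let ?D = "{T \<in> deck. hyp_dist z (T z) \<le> r}"
 have "act (cj N M) \<in> ?D" if M: "M \<in> deck_group N" "bounded_mat R M" for M
 proof -
  have d: "det2 M = 1" "act (cj N M) \<in> deck" using M by (simp_all add: deck_group_def)
  have "act N (act (cj N M) z) = act M u" using N d by (simp add: cj_def act_mult det2_inv2_1 u_def)
  then have "hyp_dist z (act (cj N M) z) = hyp_dist u (act M u)" using hyp_dist_act[of z "act (cj N M) z" N] zI N d by (simp add: u_def cjN)
  moreover have "hyp_dist u (act M u) \<le> r" using hyp_ch_act_bound[OF u d(1) M(2)] r u d by (subst hyp_dist_le_iff') (simp_all add: B_def)
  ultimately show ?thesis using d by simp
 qed
 then have "{M \<in> deck_group N. bounded_mat R M} \<subseteq> (\<Union>T\<in>?D. {M. det2 M = 1 \<and> act (cj N M) = T})" by (auto simp: deck_group_def)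
 moreover have "finite {M. det2 M = 1 \<and> act (cj N M) = T}" for T
 proof (cases "\<exists>M. det2 M = 1 \<and> act (cj N M) = T")
  case True
  then obtain M where M: "det2 M = 1" "act (cj N M) = T" by blast
  have "M' = M \<or> M' = - M" if "det2 M' = 1" "act (cj N M') = T" for M' using act_eqD[of "cj N M'" "cj N M"] M that cj_inj[OF N, of M'] by (auto simp: cjN simp flip: cjN(5))
  then have "{M. det2 M = 1 \<and> act (cj N M) = T} \<subseteq> {M, - M}" by blast
  then show ?thesis using finite_subset by blast
 next
  case False
  then have "{M. det2 M = 1 \<and> act (cj N M) = T} = {}" by blast
  then show ?thesis by (metis finite.emptyI)
 qed
 ultimately show "finite {M \<in> deck_group N. bounded_mat R M}" using deck_discrete[OF z] finite_subset by (metis (no_types, lifting) finite_UN)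
qed (use \<mu> in auto)

end

locale marked = oriented_hyp + hyp_pointed
begin

text \<open>The matrix of a group element in the coordinates \<open>N\<close> is determined only up
  to sign, hence a relation and not a function.\<close>

definition rep :: "mat2 \<Rightarrow> (real \<Rightarrow> 'a) set \<Rightarrow> mat2 \<Rightarrow> bool" where
 "rep N x M \<longleftrightarrow> det2 N = 1 \<and> x \<in> carrier \<pi>1 \<and> det2 M = 1 \<and> rho x = act (cj N M)"

lemma rep_ex:
 assumes "x \<in> carrier \<pi>1" "det2 N = 1"
 obtains M where "rep N x M" using deck_groupI[OF rho(1)[OF assms(1)] assms(2)] assms unfolding rep_def deck_group_def by blast

lemma rep_group: "rep N x M \<Longrightarrow> M \<in> deck_group N" using rho(1) by (simp add: rep_def deck_group_def) metis

lemma rep_mult: "rep N x M \<Longrightarrow> rep N y M' \<Longrightarrow> rep N (x \<otimes>\<^bsub>\<pi>1\<^esub> y) (M * M')"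
 using rho_mult by (auto simp: rep_def cj_simps act_comp)

lemma rep_inv: "rep N x M \<Longrightarrow> rep N (inv\<^bsub>\<pi>1\<^esub> x) (inv2 M)" using rho_inv by (auto simp: rep_def cj_simps cj_inv2 act_inv det2_inv2_1)

lemma rep_pow: "rep N x M \<Longrightarrow> rep N (x [^]\<^bsub>\<pi>1\<^esub> (n::nat)) (M ^ n)"
proof (induction n)
 case 0
 interpret group \<pi>1 by (rule group_pi1)
 show ?case using 0 rho_one by (simp add: rep_def cj_simps)
next
 case (Suc n)
 interpret group \<pi>1 by (rule group_pi1)
 show ?case using rep_mult[OF Suc.IH[OF Suc.prems] Suc.prems] by (simp add: power_commutes)
qed

lemma rep_conj: "rep N x M \<Longrightarrow> rep N g S \<Longrightarrow> rep N (conjugate_by \<pi>1 x g) (S * M * inv2 S)" unfolding conjugate_by_def by (intro rep_mult rep_inv)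

text \<open>With \<open>b'\<close> the conjugate of \<open>b\<close> by \<open>g0\<close>,
  \<open>twist1\<close> is \<open>b' a^l g0\<close> and \<open>twist2\<close> is
  \<open>b'^-1 a^-l g0\<close>: conjugating \<open>b\<close> by them produces the two words.\<close>

definition twist1 where
 "twist1 a b g0 l = conjugate_by \<pi>1 b g0 \<otimes>\<^bsub>\<pi>1\<^esub> (a [^]\<^bsub>\<pi>1\<^esub> (l::nat)) \<otimes>\<^bsub>\<pi>1\<^esub> g0"

definition twist2 where
 "twist2 a b g0 l = inv\<^bsub>\<pi>1\<^esub> (conjugate_by \<pi>1 b g0) \<otimes>\<^bsub>\<pi>1\<^esub> inv\<^bsub>\<pi>1\<^esub> (a [^]\<^bsub>\<pi>1\<^esub> (l::nat)) \<otimes>\<^bsub>\<pi>1\<^esub> g0"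

lemma rep_twist:
 assumes a: "rep N a A" and b: "rep N b B" and g: "rep N g0 S"
 defines "B1 \<equiv> S * B * inv2 S"
 shows "rep N (a [^]\<^bsub>\<pi>1\<^esub> (n::nat) \<otimes>\<^bsub>\<pi>1\<^esub> conjugate_by \<pi>1 b (twist1 a b g0 l)) (A ^ n * word1 (A ^ l) B1)"
  and "rep N (a [^]\<^bsub>\<pi>1\<^esub> (n::nat) \<otimes>\<^bsub>\<pi>1\<^esub> conjugate_by \<pi>1 b (twist2 a b g0 l)) (A ^ n * word2 (A ^ l) B1)"
  and "twist1 a b g0 l \<in> carrier \<pi>1" "twist2 a b g0 l \<in> carrier \<pi>1"
proof -
 have d: "det2 A = 1" "det2 B = 1" "det2 S = 1" using a b g by (simp_all add: rep_def)
 have d1: "det2 B1 = 1" "det2 (A ^ l) = 1" using d by (simp_all add: B1_def det2_inv2_1 det2_power)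
 have t1: "rep N (twist1 a b g0 l) (B1 * A ^ l * S)" unfolding twist1_def B1_def by (intro rep_mult rep_conj rep_pow a b g)
 have t2: "rep N (twist2 a b g0 l) (inv2 B1 * inv2 (A ^ l) * S)" unfolding twist2_def B1_def by (intro rep_mult rep_inv rep_conj rep_pow a b g)
 show "twist1 a b g0 l \<in> carrier \<pi>1" "twist2 a b g0 l \<in> carrier \<pi>1" using t1 t2 by (simp_all add: rep_def)
 have "(B1 * A ^ l * S) * B * inv2 (B1 * A ^ l * S) = word1 (A ^ l) B1" using d d1 by (simp add: inv2_mult word1_def mult.assoc) (simp add: B1_def mult.assoc)
 then show "rep N (a [^]\<^bsub>\<pi>1\<^esub> (n::nat) \<otimes>\<^bsub>\<pi>1\<^esub> conjugate_by \<pi>1 b (twist1 a b g0 l)) (A ^ n * word1 (A ^ l) B1)"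
  using rep_mult[OF rep_pow[OF a, of n] rep_conj[OF b t1]] by simp
 have "(inv2 B1 * inv2 (A ^ l) * S) * B * inv2 (inv2 B1 * inv2 (A ^ l) * S) = word2 (A ^ l) B1"
  using d d1 by (simp add: inv2_mult det2_inv2_1 inv2_inv2 word2_def mult.assoc) (simp add: B1_def mult.assoc)
 then show "rep N (a [^]\<^bsub>\<pi>1\<^esub> (n::nat) \<otimes>\<^bsub>\<pi>1\<^esub> conjugate_by \<pi>1 b (twist2 a b g0 l)) (A ^ n * word2 (A ^ l) B1)"
  using rep_mult[OF rep_pow[OF a, of n] rep_conj[OF b t2]] by simp
qed

lemma geodesic_rep:
 assumes x: "rep N x M" and t: "2 < abs (tr2 M)"
 shows "\<exists>\<gamma>. closed_geodesic F d \<gamma> \<and> represents F x \<gamma> \<and> curve_length d \<gamma> = ereal (2 * arcosh (abs (tr2 M) / 2))"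
proof -
 have xc: "x \<in> carrier \<pi>1" "det2 N = 1" "det2 M = 1" "rho x = act (cj N M)" using x by (simp_all add: rep_def)
 have D: "act (cj N M) \<in> deck" "det2 (cj N M) = 1" "2 < abs (tr2 (cj N M))" "tr2 (cj N M) = tr2 M" using rho(1)[OF xc(1)] xc t by (simp_all add: cj_simps)
 obtain c where c: "continuous_on UNIV c" "range c \<subseteq> X" "\<And>t. act (cj N M) (c t) = c (t + 1)"
  "\<And>s t. hyp_dist (c s) (c t) = 2 * arcosh (abs (tr2 (cj N M)) / 2) * abs (s - t)" by (rule hyperbolic_axis[OF D(1-3)]) (rule that; assumption)
 have "0 < 2 * arcosh (abs (tr2 (cj N M)) / 2)" using D(3) arcosh_real_strict_mono[of 1 "abs (tr2 (cj N M)) / 2"] by simp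
 note ax = axis_geodesic[OF D(1) c this]
 have "path c" "path_image c \<subseteq> X" "pathfinish c = rho x (pathstart c)"
  using c(1,2) c(3)[of 0] xc(4) by (auto simp: path_def path_image_def pathfinish_def pathstart_def intro: continuous_on_subset)
 then have "represents F x (pr o c)" by (rule represents_pr[OF xc(1)])
 then show ?thesis using ax D(4) by (intro exI[of _ "pr o c"]) simp
qed

text \<open>Conjugate elements have matrices that are conjugate up to sign; equal non-zero traces
  exclude the minus sign.\<close>

lemma same_class:
 assumes x: "rep N x M" and y: "rep N y M'" and eq: "conjugacy_class \<pi>1 x = conjugacy_class \<pi>1 y" and tr: "tr2 M = tr2 M'" "tr2 M \<noteq> 0"
 shows "\<exists>c\<in>deck_group N. c * M = M' * c"
proof -
 have N: "det2 N = 1" and d: "det2 M = 1" "det2 M' = 1" using x y by (simp_all add: rep_def)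
 obtain C where C: "C \<in> deck" "rho y = C o rho x o finv C" using conjugacy_class_rho[OF _ _ eq] x y by (auto simp: rep_def)
 obtain c where c: "c \<in> deck_group N" "C = act (cj N c)" using deck_groupI[OF C(1) N] .
 then have dc: "det2 c = 1" by (simp add: deck_group_def)
 have "act (cj N M') = act (cj N (c * M * inv2 c))" using C(2) x y c(2) dc d N by (simp add: rep_def cj_simps cj_inv2 act_comp act_inv det2_inv2_1)
 then have "cj N M' = cj N (c * M * inv2 c) \<or> cj N M' = - cj N (c * M * inv2 c)" using d dc N by (intro act_eqD) (simp_all add: cj_simps det2_inv2_1)
 then consider "M' = c * M * inv2 c" | "M' = - (c * M * inv2 c)" using cj_inj[OF N] cj_simps(5)[OF N] by metis
 then show ?thesis
 proof cases
  case 1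
  then have "M' * c = c * M" using inv2_left[of c] dc by (simp add: mult.assoc)
  then show ?thesis using c(1) by metis
 next
  case 2
  then have "tr2 M' = - tr2 M" using tr2_conj[of c M] dc by simp
  then show ?thesis using tr by simp
 qed
qed

end

section \<open>Conjugates of \<open>b\<close> off the axis of \<open>a\<close>; exclusion of
  puncture loops\<close>

context marked
begin

text \<open>
 If all conjugates of \<open>b\<close> fix an end of the axis of \<open>a\<close>, then the whole deck group preserves this
 axis, and \<open>\<alpha>\<close> and \<open>\<beta>\<close> can be made disjoint: one on the axis, the other one at constant distance.
\<close>

lemma nonelementary:
 assumes c: "closed_curve F \<alpha>" "closed_curve F \<beta>" "transversal_double_points F \<alpha> \<beta>" "intersect_minimally F \<alpha> \<beta>"
   "P \<in> intersection_points \<alpha> \<beta>"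
  and a: "rep N a (dg \<mu>)" "represents F a \<alpha>" and b: "rep N b B" "represents F b \<beta>" and \<mu>: "1 < \<mu>"
 obtains g S where "rep N g S" "m12 (S * B * inv2 S) \<noteq> 0"
proof -
 have N: "det2 N = 1" using a by (simp add: rep_def)
 interpret discrete_sl2 "deck_group N" \<mu> using rep_group[OF a(1)] \<mu> by (intro deck_group_discrete[OF N]) (simp_all add: dg_def)
 have hol: "hol \<alpha> (rho a)" "hol \<beta> (rho b)" using represents_hol[OF _ a(2)] represents_hol[OF _ b(2)] a(1) b(1) unfolding rep_def by blast+
 have rep_S: "\<exists>g. rep N g S" if "S \<in> deck_group N" for S using rho_surj[of "act (cj N S)"] that N by (force simp: rep_def deck_group_def)
 have False if all: "\<And>S. S \<in> deck_group N \<Longrightarrow> m12 (S * B * inv2 S) = 0"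
 proof -
  have BG: "B \<in> deck_group N" by (rule rep_group[OF b(1)])
  have "inv2 1 = 1" by (simp add: inv2_det1 mat2_eq_iff)
  then have B0: "m12 B = 0" "m21 B = 0" using all[OF one] upper_right_0[OF BG] by auto
  have Bd: "m11 B * m22 B = 1" using det[OF BG] B0 by (simp add: det2_def)
  have ne: "m11 B \<noteq> m22 B"
  proof
   assume e: "m11 B = m22 B"
   then have "m11 B = 1 \<or> m11 B = - 1" using Bd by (metis power2_eq_1_iff power2_eq_square)
   then have "B = 1 \<or> B = - 1" using e B0 by (auto simp: mat2_eq_iff)
   then have "act (cj N B) = id" using N by (auto simp: cj_simps)
   then show False using essential(1)[OF c hol(2)] b(1) by (simp add: rep_def)
  qed
  have diagonal: "m12 S = 0" "m21 S = 0" if S: "S \<in> deck_group N" for S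
  proof -
   have "m12 (S * B * inv2 S) = m11 S * m12 S * (m22 B - m11 B)" unfolding inv2_det1[OF det[OF S]] by (simp add: B0 algebra_simps)
   then show "m12 S = 0" using all[OF S] ne diagonal_entry_nonzero(1)[OF S] by simp
   then show "m21 S = 0" by (rule upper_right_0[OF S])
  qed
  \<comment> \<open>\<open>hq\<close> is real part over imaginary part, a measure of the signed
    distance from the imaginary axis, so diagonal matrices preserve it.\<close>
  have hq_diag: "hq (act S v) = hq v" if S: "S \<in> deck_group N" and v: "0 < Im v" for S v
  proof -
   have "m11 S * m22 S = 1" using det[OF S] diagonal[OF S] by (simp add: det2_def)
   then show ?thesis using act_h(3)[OF v, of S] det[OF S] diagonal[OF S] by simp
  qed
  let ?Y = "act N ` X"
  have Y: "hconvex ?Y" "?Y \<noteq> {}" using hconvex_image[OF hconvex_X] act_isoms N X_ne by auto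
  have up: "0 < Im v" if "v \<in> ?Y" for v using hconvex_upper[OF Y(1) that] .
  have YX: "act (inv2 N) v \<in> X" if "v \<in> ?Y" for v using that N by auto
  have GY: "act S v \<in> ?Y" if S: "S \<in> deck_group N" and v: "v \<in> ?Y" for S v using deck_conj_invariant(1)[of "cj N S" N v] S v N by (simp add: deck_group_def cj_simps)
  have \<mu>0: "\<mu> \<noteq> 0" "1 < \<mu>\<^sup>2" using \<mu> by (simp_all add: one_less_power)
  have "of_real (\<mu>\<^sup>2) * v \<in> ?Y" "of_real (1 / \<mu>\<^sup>2) * v \<in> ?Y" if v: "v \<in> ?Y" for v
   using GY[OF diag v] GY[OF inverse[OF diag] v] act_diag[OF \<mu>0(1) up[OF v]] act_diag[of "1 / \<mu>", OF _ up[OF v]] \<mu>0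
   by (simp_all add: inv2_det1[OF det[OF diag]] power_divide)
  then have axis: "Complex 0 y \<in> ?Y" if "0 < y" for y using hconvex_axis[OF Y \<mu>0(2) _ _ that] by blast
  have "open (act N ` interior X)" "act N ` interior X \<noteq> {}" using N act_isoms interior_X_ne interior_subset[of X] X_sub_upper by (auto intro!: open_isom_image)
  then obtain w where "w \<in> act N ` interior X" "Re w \<noteq> 0" using open_off_axis by blast
  then have w: "w \<in> ?Y" "Re w \<noteq> 0" using interior_subset[of X] by blast+
  then have w: "w \<in> ?Y" "hq w \<noteq> 0" using up[OF w(1)] by (simp_all add: hq_def)
  define k where "k v v' = act (inv2 N) o cvx v v'" for v v'
  have loop: "homotopic_loops F \<gamma> (pr o k v (act S v))" "path_image (k v (act S v)) = (\<lambda>s. act (inv2 N) (cvx v (act S v) s)) ` {0..1}"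
   if S: "rep N x S" and v: "v \<in> ?Y" and \<gamma>: "hol \<gamma> (rho x)" for x S v \<gamma>
  proof -
   have SG: "S \<in> deck_group N" by (rule rep_group[OF S])
   have Sv: "act S v \<in> ?Y" by (rule GY[OF SG v])
   have ki: "cvx v (act S v) s \<in> ?Y" if "s \<in> {0..1}" for s using hconvex_cvx[OF Y(1) v Sv that] .
   show im: "path_image (k v (act S v)) = (\<lambda>s. act (inv2 N) (cvx v (act S v) s)) ` {0..1}" by (simp add: path_image_def k_def)
   have "path (cvx v (act S v))" unfolding path_def using up[OF v] up[OF Sv] by (intro continuous_on_cvx continuous_intros) auto
   moreover have "path_image (cvx v (act S v)) \<subseteq> upper" using ki up by (auto simp: path_image_def)
   ultimately have pk: "path (k v (act S v))" unfolding k_def using N by (intro path_continuous_image continuous_on_subset[OF continuous_on_act]) (auto simp: det2_inv2_1)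
   have kX: "path_image (k v (act S v)) \<subseteq> X" unfolding im using ki YX by blast
   have "act (inv2 N) (act S v) = rho x (act (inv2 N) v)" using S N by (simp add: rep_def cj_def act_mult det2_inv2_1)
   then have "pathfinish (k v (act S v)) = rho x (pathstart (k v (act S v)))" using up[OF v] up[OF Sv] by (simp add: k_def pathfinish_def pathstart_def)
   then show "homotopic_loops F \<gamma> (pr o k v (act S v))" by (rule hol_homotopicI[OF \<gamma> pk kX])
  qed
  let ?z = "Complex 0 1"
  note la = loop[OF a(1) axis[OF zero_less_one] hol(1)] and lb = loop[OF b(1) w(1) hol(2)]
  \<comment> \<open>The first loop comes from a segment on the axis, where \<open>hq = 0\<close>.
    The second comes from the segment from \<open>w\<close> to its image under \<open>B\<close>;
    both ends have the same non-zero \<open>hq\<close>, so \<open>hq\<close> never vanishes on it. A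
    common point would give a group element that changes \<open>hq\<close>.\<close>
  have "path_image (pr o k ?z (act (dg \<mu>) ?z)) \<inter> path_image (pr o k w (act B w)) \<noteq> {}" using la lb by (intro not_disjoint[OF c]) auto
  then obtain s t where st: "s \<in> {0..1}" "t \<in> {0..1}"
    "pr (act (inv2 N) (cvx ?z (act (dg \<mu>) ?z) s)) = pr (act (inv2 N) (cvx w (act B w) t))" unfolding path_image_compose la(2) lb(2) image_image by blast
  have zY: "?z \<in> ?Y" "act (dg \<mu>) ?z \<in> ?Y" "act B w \<in> ?Y" using axis[of 1] GY rep_group a b w by auto
  define v v' where "v = cvx ?z (act (dg \<mu>) ?z) s" and "v' = cvx w (act B w) t"
  have vY: "v \<in> ?Y" "v' \<in> ?Y" using hconvex_cvx[OF Y(1)] zY w st by (auto simp: v_def v'_def)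
  have z0: "hq ?z = 0" by (simp add: hq_def)
  have "hq v = 0" using cvx_h(3)[OF up up st(1), OF zY(1,2)] hq_diag[OF rep_group[OF a(1)], of ?z] by (simp add: v_def z0)
  moreover have "hq v' = hq w / cvx_norm w (act B w) t" using cvx_h(3)[OF up up st(2), OF w(1) zY(3)] hq_diag[OF BG up[OF w(1)]] by (simp add: v'_def algebra_simps)
  then have "hq v' \<noteq> 0" using w(2) cvx_norm_ge1[OF up[OF w(1)] up[OF zY(3)] st(2)] by simp
  moreover obtain T where T: "T \<in> deck" "T (act (inv2 N) v) = act (inv2 N) v'" using deck_transitive[OF YX YX, OF vY] st(3) by (auto simp: v_def v'_def)
  obtain S where S: "S \<in> deck_group N" "T = act (cj N S)" using deck_groupI[OF T(1) N] .
  have "act N (T (act (inv2 N) v)) = act S v" using S N by (simp add: deck_group_def cj_def act_mult det2_inv2_1)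
  then have "act S v = v'" using T(2) N by simp
  ultimately show False using hq_diag[OF S(1) up[OF vY(1)]] by simp
 qed
 then show ?thesis using that rep_S by blast
qed

text \<open>\<open>T\<close> is the holonomy of a multiple of a puncture loop and commutes with
  \<open>S\<close>. After conjugation \<open>M\<close> commutes up to sign with a conjugate
  \<open>D\<close> of \<open>s\<close>; the minus sign is excluded by the non-zero trace of
  \<open>M\<close>. As \<open>D\<close> has the trace of \<open>s\<close>, it is trivial by
  assumption, and so are \<open>S\<close>, \<open>T\<close> and finally the element itself.\<close>

lemma not_core:
 assumes x: "rep N x M" "M \<noteq> 1" "M \<noteq> - 1" "tr2 M \<noteq> 0"
  and S: "s \<in> deck_group N" "act (cj N s) = S" "T o S = S o T" "S = id \<Longrightarrow> T = id"
  and e: "hol e (rho x)" "hol e T"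
  and triv: "\<And>D. D \<in> deck_group N \<Longrightarrow> abs (tr2 D) \<le> abs (tr2 s) \<Longrightarrow> D * M = M * D \<Longrightarrow> D = 1 \<or> D = - 1"
 shows False
proof -
 have N: "det2 N = 1" "det2 M = 1" "rho x = act (cj N M)" using x by (simp_all add: rep_def)
 note cjN = cj_simps[OF N(1)]
 obtain C where C: "C \<in> deck" "rho x = C o T o finv C" using hol_conj[OF e] by blast
 obtain c where c: "c \<in> deck_group N" "C = act (cj N c)" using deck_groupI[OF C(1) N(1)] .
 have ds: "det2 s = 1" "S \<in> deck" using S by (auto simp: deck_group_def)
 have dc: "det2 c = 1" using c by (simp add: deck_group_def)
 note iC = isoms_inv(4)[OF deck_isoms[OF C(1)]]
 define D where "D = c * s * inv2 c"
 have dD: "det2 D = 1" using ds dc by (simp add: D_def det2_inv2_1)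
 have aD: "act (cj N D) = C o S o finv C" using ds dc N c(2) S(2) by (simp add: D_def cjN cj_inv2 act_comp act_inv det2_inv2_1)
 have DG: "D \<in> deck_group N" using dD aD deck_comp deck_inv C(1) ds(2) by (simp add: deck_group_def)
 have "act (cj N D) o rho x = C o (S o T) o finv C" "rho x o act (cj N D) = C o (T o S) o finv C" unfolding aD C(2) using iC by (metis comp_assoc comp_id)+
 then have "act (cj N (D * M)) = act (cj N (M * D))" using S(3) N dD by (simp add: cjN act_comp)
 then have "cj N (D * M) = cj N (M * D) \<or> cj N (D * M) = - cj N (M * D)" using N dD by (intro act_eqD) (simp_all add: cjN)
 then have "D * M = M * D \<or> D * M = - (M * D)" using cj_inj[OF N(1)] cjN(5) by metis
 moreover have "D * M \<noteq> - (M * D)"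
 proof
  assume "D * M = - (M * D)"
  then have "D * M * inv2 D = - M" using inv2_right[of D] dD by (simp add: mult.assoc)
  then have "tr2 M = - tr2 M" using tr2_conj[of D M] dD by (metis tr2_minus zero_neq_one)
  then show False using x(4) by simp
 qed
 moreover have "tr2 D = tr2 s" using tr2_conj[of c s] dc by (simp add: D_def)
 ultimately have "D = 1 \<or> D = - 1" using triv[OF DG] by simp
 then have "C o S o finv C = id" using aD by (auto simp: cjN)
 then have "S = id" using iC isoms_inv(5)[OF deck_isoms[OF C(1)]] by (metis comp_assoc comp_id id_comp)
 then have "rho x = id" using C(2) S(4) isoms_inv(5)[OF deck_isoms[OF C(1)]] by simp
 then have "cj N M = 1 \<or> cj N M = - 1" using N by (intro act_eq_id) (simp_all add: cjN)
 then show False using x(2,3) cj_inj[OF N(1)] cjN(4,5) by metis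
qed

end

theorem mainTheorem1:
  fixes F :: "'a::topological_space set"
    and d :: "'a \<Rightarrow> 'a \<Rightarrow> real"
    and \<alpha> \<beta> :: "real \<Rightarrow> 'a"
    and P1 P2 p :: 'a
    and a b :: "(real \<Rightarrow> 'a) set"
  assumes "hyperbolic_surface F d"
    and "closed_curve F \<alpha>" and "closed_curve F \<beta>"
    and "transversal_double_points F \<alpha> \<beta>"
    and "intersect_minimally F \<alpha> \<beta>"
    and "P1 \<in> intersection_points \<alpha> \<beta>" and "P2 \<in> intersection_points \<alpha> \<beta>" and "P1 \<noteq> P2"
    and "free_homotopy_class F (loop_product \<alpha> P1 \<beta>) = free_homotopy_class F (loop_product \<alpha> P2 \<beta>)"
    and "p \<in> F"
    and "a \<in> carrier (fundamental_group F p)" and "represents F a \<alpha>"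
    and "b \<in> carrier (fundamental_group F p)" and "represents F b \<beta>"
  shows "\<exists>g\<in>carrier (fundamental_group F p). \<exists>h\<in>carrier (fundamental_group F p).
           \<exists>N::nat. 0 < N \<and> (\<forall>n>N.
             length_equivalent F p
               (a [^]\<^bsub>fundamental_group F p\<^esub> n \<otimes>\<^bsub>fundamental_group F p\<^esub>
                  conjugate_by (fundamental_group F p) b g)
               (a [^]\<^bsub>fundamental_group F p\<^esub> n \<otimes>\<^bsub>fundamental_group F p\<^esub>
                  conjugate_by (fundamental_group F p) b h))"
proof -
 obtain m where surf: "surface F" "orientable F" "has_punctures F m" and hyp: "hyperbolic_metric F d" using assms(1) by (auto simp: hyperbolic_surface_def finite_type_surface_def)
 \<comment> \<open>Every hyperbolic metric on \<open>F\<close> has its own developing map and its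
   own representation of the same fundamental group.\<close>
 have marked: "marked F d' p" if "hyperbolic_metric F d'" for d' using that surf(1,2) assms(10) by unfold_locales (auto simp: surface_def)
 interpret marked F d p by (rule marked[OF hyp])
 obtain \<phi> :: "nat \<Rightarrow> complex \<Rightarrow> 'a" where \<phi>: "\<And>i. i < m \<Longrightarrow> openin (top_of_set F) (\<phi> i ` (ball 0 1 - {0}))"
   "\<And>i. i < m \<Longrightarrow> \<exists>\<psi>. homeomorphism (cball 0 1 - {0}) (\<phi> i ` (cball 0 1 - {0})) (\<phi> i) \<psi>"
   "\<And>i j. i < m \<Longrightarrow> j < m \<Longrightarrow> i \<noteq> j \<Longrightarrow> \<phi> i ` (cball 0 1 - {0}) \<inter> \<phi> j ` (cball 0 1 - {0}) = {}"
   "compact (F - (\<Union>i<m. \<phi> i ` (ball 0 1 - {0})))" by (rule exE[OF surf(3)[unfolded has_punctures_def]], elim conjE, rule that[rotated 3], assumption) (blast | simp)+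
 note curves = assms(2-6)
 have ab: "a \<in> carrier \<pi>1" "b \<in> carrier \<pi>1" using assms by simp_all
 obtain A where A: "det2 A = 1" "rho a = act A" using deck_matrix[OF rho(1)[OF ab(1)]] .
 have "2 < abs (tr2 A)" using essential(2)[OF curves _ A(1)] represents_hol[OF ab(1) assms(12)] A(2) by simp
 then obtain N l where N: "det2 N = 1" and l: "1 < abs l" "N * A * inv2 N = Mat l 0 0 (1 / l)" using hyperbolic_form[OF A(1)] by blast
 define \<mu> where "\<mu> = abs l"
 have \<mu>: "1 < \<mu>" using l(1) by (simp add: \<mu>_def)
 \<comment> \<open>Passing to the negative matrix makes the eigenvalue positive without changing the
   isometry.\<close>
 have "dg \<mu> = N * A * inv2 N \<or> dg \<mu> = - (N * A * inv2 N)" unfolding l(2) by (auto simp: \<mu>_def dg_def mat2_eq_iff abs_if)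
 then have "act (cj N (dg \<mu>)) = act A" using cj_simps[OF N] by (metis act_minus)
 moreover have "det2 (dg \<mu>) = 1" using \<mu> by (simp add: dg_def det2_def)
 ultimately have ra: "rep N a (dg \<mu>)" using ab N A(2) by (simp add: rep_def)
 obtain B where rb: "rep N b B" using rep_ex[OF ab(2) N] .
 obtain g0 S where rg: "rep N g0 S" and B1: "m12 (S * B * inv2 S) \<noteq> 0" using nonelementary[OF curves ra assms(12) rb assms(14) \<mu>] .
 interpret discrete_sl2 "deck_group N" \<mu> using rep_group[OF ra] \<mu> by (intro deck_group_discrete[OF N]) (simp_all add: dg_def)
 define B' where "B' = S * B * inv2 S"
 have B': "B' \<in> deck_group N" "m12 B' \<noteq> 0" using rep_group[OF rep_conj[OF rb rg]] B1 by (simp_all add: B'_def)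
 \<comment> \<open>From here on \<open>l\<close> is the exponent in the words and no longer the
   eigenvalue; it is fixed before \<open>n\<close> grows.\<close>
 obtain l where w: "m12 (word1 (dg (\<mu> ^ l)) B') \<noteq> 0" "m12 (word2 (dg (\<mu> ^ l)) B') \<noteq> 0"
  "\<And>m. Mat m 0 0 (1 / m) \<in> deck_group N \<Longrightarrow> m * m * m12 (word1 (dg (\<mu> ^ l)) B') \<noteq> m12 (word2 (dg (\<mu> ^ l)) B')"
  by (rule words_not_conjugate[OF B']) (rule that; assumption)
 define W V where "W = word1 (dg (\<mu> ^ l)) B'" and "V = word2 (dg (\<mu> ^ l)) B'"
 have pw: "dg \<mu> ^ n = Mat (\<mu> ^ n) 0 0 (1 / \<mu> ^ n)" "dg (\<mu> ^ n) = Mat (\<mu> ^ n) 0 0 (1 / \<mu> ^ n)" for n by (simp_all add: dg_def diag_power)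
 have WV: "W \<in> deck_group N" "V \<in> deck_group N" "m11 V = m11 W" "m22 V = m22 W"
 proof -
  show "W \<in> deck_group N" "V \<in> deck_group N" unfolding W_def V_def by (intro word_G dg_G B')+
  have "\<mu> ^ l \<noteq> 0" using \<mu> by simp
  then show "m11 V = m11 W" "m22 V = m22 W" using word_entries(3,4)[OF _ det[OF B'(1)]] unfolding W_def V_def by (metis mat2.collapse)+
 qed
 define x y where "x n = a [^]\<^bsub>\<pi>1\<^esub> n \<otimes>\<^bsub>\<pi>1\<^esub> conjugate_by \<pi>1 b (twist1 a b g0 l)"
  and "y n = a [^]\<^bsub>\<pi>1\<^esub> n \<otimes>\<^bsub>\<pi>1\<^esub> conjugate_by \<pi>1 b (twist2 a b g0 l)" for n :: nat
 let ?A = "\<lambda>n. Mat (\<mu> ^ n) 0 0 (1 / \<mu> ^ n)"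
 have rx: "rep N (x n) (?A n * W)" and ry: "rep N (y n) (?A n * V)" for n using rep_twist(1,2)[OF ra rb rg, of n l] unfolding x_def y_def W_def V_def B'_def pw by simp_all
 have tr: "tr2 (?A n * W) = tr2 (?A n * V)" "tr2 (?A n * W) \<noteq> 0" for n using WV(3,4) trace[OF rep_group[OF rx[of n]]] by (auto simp: tr2_def)
 \<comment> \<open>One matrix for each puncture, formed in the metric \<open>d\<close>, controls all
   multiples of the loop around it.\<close>
 have "\<exists>s. s \<in> deck_group N \<and> (\<forall>j. \<exists>T. hol (\<lambda>t. core_line (\<phi> i) (of_int j * t)) T \<and>
   T o act (cj N s) = act (cj N s) o T \<and> (act (cj N s) = id \<longrightarrow> T = id))" if i: "i < m" for i
 proof -
  have e: "exp (of_real (ln (1 / 2)) + of_real t * (2 * of_real pi * \<i>)) \<in> ball 0 1 - {0}" for t using core_line_norm[of t] by simp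
  obtain \<psi> where h: "homeomorphism (cball 0 1 - {0}) (\<phi> i ` (cball 0 1 - {0})) (\<phi> i) \<psi>" using \<phi>(2)[OF i] by blast
  have "continuous_on UNIV (core_line (\<phi> i))" unfolding core_line_def
  proof (rule continuous_on_compose2[OF homeomorphism_cont1[OF h]])
   show "(\<lambda>t::real. 0 + exp (of_real (ln (1 / 2)) + of_real t * (2 * of_real pi * \<i>))) ` UNIV \<subseteq> cball 0 1 - {0}" using e by (auto simp: less_imp_le)
  qed (intro continuous_intros)
  moreover have "range (core_line (\<phi> i)) \<subseteq> F" using openin_imp_subset[OF \<phi>(1)[OF i]] e by (auto simp: core_line_def)
  ultimately obtain S where S: "S \<in> deck" "\<And>j. \<exists>T. hol (\<lambda>t. core_line (\<phi> i) (of_int j * t)) T \<and> T o S = S o T \<and> (S = id \<longrightarrow> T = id)"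
   using periodic_holonomy core_line_period by metis
  then show ?thesis using deck_groupI[OF S(1) N] by metis
 qed
 then obtain s where s: "\<And>i. i < m \<Longrightarrow> s i \<in> deck_group N"
  "\<And>i j. i < m \<Longrightarrow> \<exists>T. hol (\<lambda>t. core_line (\<phi> i) (of_int j * t)) T \<and> T o act (cj N (s i)) = act (cj N (s i)) o T \<and> (act (cj N (s i)) = id \<longrightarrow> T = id)"
  by metis
 \<comment> \<open>The number 0 is inserted because there may be no punctures.\<close>
 define t where "t = Max (insert 0 ((\<lambda>i. abs (tr2 (s i))) ` {..<m}))"
 have t: "abs (tr2 (s i)) \<le> t" if "i < m" for i using that by (auto simp: t_def intro!: Max_ge)
 note nc = not_conjugate[OF WV(1) w(1)[folded W_def] WV(2) w(2)[folded V_def] WV(3,4) w(3)[folded W_def V_def]]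
 obtain N1 where N1: "\<And>n c. N1 < n \<Longrightarrow> c \<in> deck_group N \<Longrightarrow> c * (?A n * W) \<noteq> (?A n * V) * c" using nc(1) by blast
 obtain N2 where N2: "\<And>n c. N2 < n \<Longrightarrow> c \<in> deck_group N \<Longrightarrow> c * inv2 (?A n * W) \<noteq> (?A n * V) * c" using nc(2) by blast
 obtain N3 where N3: "\<And>n D. N3 < n \<Longrightarrow> D \<in> deck_group N \<Longrightarrow> abs (tr2 D) \<le> t \<Longrightarrow> D * (?A n * W) = (?A n * W) * D \<Longrightarrow> D = 1 \<or> D = - 1"
  using commuting_trivial[OF WV(1) w(1)[folded W_def], of t] by blast
 have "length_equivalent F p (x n) (y n)" if n: "N1 < n" "N2 < n" "N3 < n" for n unfolding length_equivalent_def
 proof (intro conjI allI impI)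
  show "conjugacy_class \<pi>1 (x n) \<noteq> conjugacy_class \<pi>1 (y n)" using same_class[OF rx ry _ tr] N1[OF n(1)] by blast
  have "det2 (?A n * W) = 1" using rx[of n] by (simp add: rep_def)
  then have "tr2 (inv2 (?A n * W)) = tr2 (?A n * W)" by (simp add: inv2_det1 tr2_def)
  then show "conjugacy_class \<pi>1 (y n) \<noteq> conjugacy_class \<pi>1 (inv\<^bsub>\<pi>1\<^esub> (x n))"
   using same_class[OF rep_inv[OF rx[of n]] ry[of n]] tr[of n] N2[OF n(2)] by metis
  fix d' assume d': "hyperbolic_metric F d'"
  interpret D: marked F d' p by (rule marked[OF d'])
  \<comment> \<open>In the second metric no normal form is needed for the matrices, since the trace
    identity holds for all of them; hence the coordinates \<open>N = 1\<close>.\<close>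
  have one: "det2 1 = 1" by simp
  have gc: "g0 \<in> carrier \<pi>1" using rg by (simp add: rep_def)
  obtain A' B0' S' where r: "D.rep 1 a A'" "D.rep 1 b B0'" "D.rep 1 g0 S'" using D.rep_ex[OF ab(1) one] D.rep_ex[OF ab(2) one] D.rep_ex[OF gc one] by metis
  define Q where "Q = S' * B0' * inv2 S'"
  define X' Y' where "X' = A' ^ n * word1 (A' ^ l) Q" and "Y' = A' ^ n * word2 (A' ^ l) Q"
  have rX: "D.rep 1 (x n) X'" and rY: "D.rep 1 (y n) Y'"
   using D.rep_twist(1,2)[OF r, of n l] by (simp_all add: x_def y_def X'_def Y'_def Q_def D.twist1_def D.twist2_def twist1_def twist2_def)
  have tr': "tr2 X' = tr2 Y'" unfolding X'_def Y'_def using r by (intro trace_words) (simp_all add: D.rep_def Q_def det2_inv2_1)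
  have xc: "x n \<in> carrier \<pi>1" using rx[of n] by (simp add: rep_def)
  have M1: "?A n * W \<noteq> 1" "?A n * W \<noteq> - 1" using w(1) \<mu> by (auto simp: W_def mat2_eq_iff)
  have "2 < abs (tr2 X')"
  proof -
   have i1: "inv2 1 = 1" by (simp add: inv2_det1 mat2_eq_iff)
   have cX: "det2 X' = 1" "D.rho (x n) = act X'" using rX by (simp_all add: D.rep_def cj_def i1)
   have nid: "act X' \<noteq> id"
   proof
    assume "act X' = id"
    then have "x n = \<one>\<^bsub>\<pi>1\<^esub>" using D.rho_inj[OF xc D.rho_one(1)] D.rho_one(2) cX by simp
    then have "act (cj N (?A n * W)) = id" using rx[of n] rho_one(2) by (simp add: rep_def)
    moreover have "det2 (cj N (?A n * W)) = 1" using rx[of n] by (simp add: rep_def cj_simps)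
    ultimately have "cj N (?A n * W) = 1 \<or> cj N (?A n * W) = - 1" by (intro act_eq_id)
    then show False using M1 cj_inj[OF N] cj_simps(4,5)[OF N] by metis
   qed
   have XD: "act X' \<in> D.deck" using D.rho(1)[OF xc] cX by simp
   have "abs (tr2 X') \<noteq> 2"
   proof
    assume par: "abs (tr2 X') = 2"
    obtain g where g: "g \<in> x n" using carrier_ne[OF xc] by blast
    \<comment> \<open>The loop is parabolic for \<open>d'\<close>, which yields a homotopy into a
      punctured disc; the contradiction is then found with the holonomies for
      \<open>d\<close>.\<close>
    have "D.hol g (act X')" using D.rho_hol[OF xc g] cX by simp
    from D.parabolic_core[OF \<phi> this cX(1) par nid] obtain i j
     where i: "i < m" and h: "homotopic_loops F g (\<lambda>t. core_line (\<phi> i) (of_int j * t))" by blast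
    obtain T where T: "hol (\<lambda>t. core_line (\<phi> i) (of_int j * t)) T" "T o act (cj N (s i)) = act (cj N (s i)) o T"
     "act (cj N (s i)) = id \<Longrightarrow> T = id" using s(2)[OF i] by blast
    show False
    proof (rule not_core[OF rx[of n] M1 tr(2) s(1)[OF i] HOL.refl T(2,3) hol_homotopic[OF h rho_hol[OF xc g]] T(1)])
     show "D = 1 \<or> D = - 1" if "D \<in> deck_group N" "abs (tr2 D) \<le> abs (tr2 (s i))" "D * (?A n * W) = ?A n * W * D" for D
      using N3[OF n(3) that(1) order_trans[OF that(2) t[OF i]] that(3)] .
    qed
   qed
   then show ?thesis using D.deck_trace[OF XD cX(1) nid] by simp
  qed
  then show "\<exists>\<gamma> \<delta>. closed_geodesic F d' \<gamma> \<and> represents F (x n) \<gamma> \<and> closed_geodesic F d' \<delta> \<and> represents F (y n) \<delta> \<and>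
    curve_length d' \<gamma> = curve_length d' \<delta>" using D.geodesic_rep[OF rX] D.geodesic_rep[OF rY] tr' by metis
 qed
 \<comment> \<open>The sum dominates all three bounds, and the additional 1 makes it
   positive.\<close>
 then have "\<exists>N>0. \<forall>n>N. length_equivalent F p (x n) (y n)" by (intro exI[of _ "N1 + N2 + N3 + 1"]) simp
 then show ?thesis unfolding x_def y_def using rep_twist(3,4)[OF ra rb rg, of l] by blast
qed

end
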